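(* Let $B:L_1\to L_2$ be a factor between two line bundles $L_1\to Q_1$, $L_2\to Q_2$, covering a smooth map $b:Q_1\to Q_2$. Then its jet lift $J^1B\subset J^1L_1\underline{\times}J^1L_2$ is a Legendrian submanifold with respect to the product Jacobi structure on $L_{J^1L_1}\overline{\times}(L_{J^1L_2})^{\mathrm{op}}$, where $L_{J^1L_1}$ and $L_{J^1L_2}$ carry their canonical Jacobi structures.
   Context: A line bundle is a real vector bundle of rank 1. A factor $B:L_1\to L_2$ is a vector bundle morphism covering a smooth map that is a linear isomorphism $B_x$ on each fibre; sections pull back by $(B^*s)(x)=B_x^{-1}(s(b(x)))$. Line product: for line bundles $L_i\to M_i$, the base product $M_1\underline{\times}M_2$ is the manifold of all linear isomorphisms $C_{x_1x_2}:(L_1)_{x_1}\to(L_2)_{x_2}$, with projections $p_i$ to $M_i$; $L_1\overline{\times}L_2:=p_1^*L_1$ is the line product, with projection factors $P_1(C,l)=l$, $P_2(C,l)=C(l)$. Der and jet bundles: for $L\to Q$, $D_xL$ is the space of $\mathbb{R}$-linear $a_x:\Gamma(L)\to L_x$ with $a_x(fs)=f(x)a_x(s)+\delta(a_x)[f]s(x)$ for some $\delta(a_x)\in T_xQ$; sections of $DL$ are derivations of $\Gamma(L)$ with the commutator bracket. $\pi:J^1L=(DL)^*\otimes L\to Q$, so $J^1_xL=\mathrm{Hom}(D_xL,L_x)$ and $j^1_xs(a)=a(s)$; $L_{J^1L}:=\pi^*L\to J^1L$. For a factor $B$, $D_xB:D_xL_1\to D_{b(x)}L_2$ is $(D_xB\,a)(s)=B_x(a(B^*s))$.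 Jet lift: $J^1B$ is the set of all $C_{\alpha\beta}\in J^1L_1\underline{\times}J^1L_2$ (a linear isomorphism from the fibre of $L_{J^1L_1}$ at $\alpha\in J^1_{q_1}L_1$, i.e. $(L_1)_{q_1}$, to that of $L_{J^1L_2}$ at $\beta\in J^1_{q_2}L_2$, i.e. $(L_2)_{q_2}$) such that $q_2=b(q_1)$, $\alpha=B_{q_1}^{-1}\circ\beta\circ D_{q_1}B$, and $C_{\alpha\beta}=B_{q_1}$. Jacobi structures: a Jacobi structure on a line bundle $L\to M$ is a Lie bracket on $\Gamma(L)$ that is a first-order differential operator in each argument; then $\{s,fr\}=f\{s,r\}+X_s[f]r$ for a vector field $X_s$; $\Pi^\sharp:J^1L\to DL$ is defined by $\Pi^\sharp(j^1s)=\{s,\cdot\}$ and $\Lambda^\sharp:T^*M\otimes L\to TM$ by $\Lambda^\sharp(df\otimes s)=X_{fs}-fX_s$. $L^{\mathrm{op}}$ is $L$ with bracket $-\{\cdot,\cdot\}$. The canonical Jacobi structure on $L_{J^1L}$ is the unique one with $\{l_a,l_b\}=l_{[a,b]}$, $\{l_a,\pi^*s\}=\pi^*(a[s])$, $\{\pi^*s,\pi^*r\}=0$, where $l_a(\alpha_q)=\alpha_q(a(q))$ for $a\in\Gamma(DL)$. The product Jacobi structure on $L_1\overline{\times}L_2$ is the unique one with $\{P_i^*s_i,P_i^*s_i'\}=P_i^*\{s_i,s_i'\}_i$ and $\{P_1^*s_1,P_2^*s_2\}=0$. When the Jacobi structure is non-degenerate ($\Pi^\sharp$ an isomorphism), $H=\Lambda^\sharp(T^*M\otimes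 L)\subset TM$ is the associated contact hyperplane distribution. A submanifold $S\subset M$ is isotropic if $TS\subset H$; coisotropic if for every $x\in S$, $\Pi^\sharp_x$ maps $\{\alpha\in J^1_xL:\alpha|_{D_x(L|_S)}=0\}$ into $D_x(L|_S)\subset D_xL$. It is Legendrian if it is both isotropic and coisotropic. *)

theory Defs
  imports "HOL-Analysis.Analysis"
begin

section \<open>Model spaces and smooth functions between them\<close>

text \<open>
  Manifolds are modelled on finite-dimensional real inner product spaces. In contrast to
  \<^class>\<open>euclidean_space\<close> the space 0 is allowed, so that zero-dimensional manifolds (in
  particular line bundles over a point) are covered; the dimension is that of the model type.
\<close>

class finite_dim_inner = real_inner +
  assumes finite_spanning_set: "\<exists>B. finite B \<and> (\<forall>x. \<exists>c. x = (\<Sum>b\<in>B. c b *\<^sub>R b))"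

subclass (in euclidean_space) finite_dim_inner
proof
  show "\<exists>B. finite B \<and> (\<forall>x. \<exists>c. x = (\<Sum>b\<in>B. c b *\<^sub>R b))"
    by (metis euclidean_representation finite_Basis)
qed

lemma finite_dim_inner_span:
  "\<exists>B :: 'a::finite_dim_inner set. finite B \<and> span B = UNIV"
proof -
  obtain B :: "'a set" where B: "finite B" "\<forall>x. \<exists>c. x = (\<Sum>b\<in>B. c b *\<^sub>R b)"
    using finite_spanning_set by blast
  have "x \<in> span B" for x
  proof -
    obtain c where "x = (\<Sum>b\<in>B. c b *\<^sub>R b)" using B(2) by blast
    moreover have "(\<Sum>b\<in>B. c b *\<^sub>R b) \<in> span B"
      by (intro span_sum span_scale span_base)
    ultimately show ?thesis by simp
  qed
  with B(1) show ?thesis by blast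
qed

instance prod :: (finite_dim_inner, finite_dim_inner) finite_dim_inner
proof
  obtain A :: "'a set" where A: "finite A" "span A = UNIV"
    using finite_dim_inner_span by blast
  obtain B :: "'b set" where B: "finite B" "span B = UNIV"
    using finite_dim_inner_span by blast
  define C where "C = (\<lambda>a. (a, 0::'b)) ` A \<union> (\<lambda>b. (0::'a, b)) ` B"
  have C: "finite C" using A B by (simp add: C_def)
  have lin1: "linear (\<lambda>a. (a, 0::'b))" and lin2: "linear (\<lambda>b. (0::'a, b))"
    by (auto intro!: linearI)
  have "(x, y) \<in> span C" for x y
  proof -
    have "(x, 0) \<in> span ((\<lambda>a. (a, 0::'b)) ` A)" "(0, y) \<in> span ((\<lambda>b. (0::'a, b)) ` B)"
      using A B by (auto simp: linear_span_image[OF lin1] linear_span_image[OF lin2])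
    then have "(x, 0) \<in> span C" "(0, y) \<in> span C"
      unfolding C_def by (meson Un_upper1 Un_upper2 span_mono subsetD)+
    then have "(x, 0) + (0, y) \<in> span C" by (rule span_add)
    then show ?thesis by simp
  qed
  then have "\<forall>z. z \<in> range (\<lambda>c. \<Sum>v\<in>C. c v *\<^sub>R v)"
    by (metis span_finite[OF C] surj_pair)
  then show "\<exists>C :: ('a \<times> 'b) set. finite C \<and> (\<forall>x. \<exists>c. x = (\<Sum>b\<in>C. c b *\<^sub>R b))"
    using C by blast
qed

primrec Ck_on :: "nat \<Rightarrow> 'a::real_normed_vector set \<Rightarrow> ('a \<Rightarrow> 'b::real_normed_vector) \<Rightarrow> bool"
  where
    "Ck_on 0 S f \<longleftrightarrow> continuous_on S f"
  | "Ck_on (Suc k) S f \<longleftrightarrow> (\<forall>x\<in>S. f differentiable (at x)) \<and>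
       (\<forall>v. Ck_on k S (\<lambda>x. frechet_derivative f (at x) v))"

text \<open>Only used for open \<open>S\<close>.\<close>

definition smooth_on :: "'a::real_normed_vector set \<Rightarrow> ('a \<Rightarrow> 'b::real_normed_vector) \<Rightarrow> bool"
  where "smooth_on S f \<longleftrightarrow> (\<forall>k. Ck_on k S f)"

section \<open>Manifolds\<close>

text \<open>
  An atlas is a set of charts \<open>(U, \<phi>)\<close>; the point set of the manifold is the union of the chart
  domains and its topology is generated by the charts. Atlases need not be maximal.
\<close>

type_synonym ('m, 'e) atlas = "('m set \<times> ('m \<Rightarrow> 'e)) set"

definition points :: "('m, 'e) atlas \<Rightarrow> 'm set"
  where "points A = (\<Union>(U, \<phi>)\<in>A. U)"

definition atlas_topology :: "('m, 'e::topological_space) atlas \<Rightarrow> 'm topology"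
  where "atlas_topology A = topology_generated_by {U \<inter> \<phi> -` V |U \<phi> V. (U, \<phi>) \<in> A \<and> open V}"

definition manifold :: "('m, 'e::finite_dim_inner) atlas \<Rightarrow> bool"
  where "manifold A \<longleftrightarrow>
    (\<forall>(U, \<phi>)\<in>A. inj_on \<phi> U \<and> open (\<phi> ` U)) \<and>
    (\<forall>(U, \<phi>)\<in>A. \<forall>(V, \<psi>)\<in>A. open (\<phi> ` (U \<inter> V)) \<and>
       smooth_on (\<phi> ` (U \<inter> V)) (\<psi> \<circ> inv_into U \<phi>)) \<and>
    Hausdorff_space (atlas_topology A) \<and> second_countable (atlas_topology A)"

definition smooth_map ::
    "('m, 'e::finite_dim_inner) atlas \<Rightarrow> ('n, 'f::finite_dim_inner) atlas \<Rightarrow> ('m \<Rightarrow> 'n) \<Rightarrow> bool"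
  where "smooth_map A A' f \<longleftrightarrow>
    (\<forall>x\<in>points A. f x \<in> points A') \<and>
    (\<forall>(U, \<phi>)\<in>A. \<forall>(V, \<psi>)\<in>A'. open (\<phi> ` (U \<inter> f -` V)) \<and>
       smooth_on (\<phi> ` (U \<inter> f -` V)) (\<psi> \<circ> f \<circ> inv_into U \<phi>))"

text \<open>
  Throughout, a map defined on a subset of a type is represented by its extension by 0, so that
  equality of the represented maps is equality in the logic.
\<close>

definition smooth_functions :: "('m, 'e::finite_dim_inner) atlas \<Rightarrow> ('m \<Rightarrow> real) set"
  where "smooth_functions A =
    {f. (\<forall>(U, \<phi>)\<in>A. smooth_on (\<phi> ` U) (f \<circ> inv_into U \<phi>)) \<and> (\<forall>x. x \<notin> points A \<longrightarrow> f x = 0)}"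

text \<open>
  \<open>Hom V W\<close>: the linear maps from a space \<open>V\<close> of vector-valued functions to a subspace \<open>W\<close>.
  It is applied to sections, to derivations and to tangent vectors, all of which are functions.
\<close>

definition Hom :: "('a \<Rightarrow> 'v::real_vector) set \<Rightarrow> 'w::real_vector set \<Rightarrow> (('a \<Rightarrow> 'v) \<Rightarrow> 'w) set"
  where "Hom V W = {h. (\<forall>s\<in>V. h s \<in> W) \<and> (\<forall>s. s \<notin> V \<longrightarrow> h s = 0) \<and>
    (\<forall>s\<in>V. \<forall>r\<in>V. h (\<lambda>x. s x + r x) = h s + h r) \<and>
    (\<forall>c. \<forall>s\<in>V. h (\<lambda>x. c *\<^sub>R s x) = c *\<^sub>R h s)}"

definition tangent_space ::
    "('m, 'e::finite_dim_inner) atlas \<Rightarrow> 'm \<Rightarrow> (('m \<Rightarrow> real) \<Rightarrow> real) set"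
  where "tangent_space A x = {X \<in> Hom (smooth_functions A) UNIV.
    \<forall>f\<in>smooth_functions A. \<forall>g\<in>smooth_functions A.
      X (\<lambda>y. f y * g y) = f x * X g + X f * g x}"

definition tangent_map :: "('m, 'e::finite_dim_inner) atlas \<Rightarrow> ('n, 'f::finite_dim_inner) atlas \<Rightarrow>
    ('m \<Rightarrow> 'n) \<Rightarrow> (('m \<Rightarrow> real) \<Rightarrow> real) \<Rightarrow> (('n \<Rightarrow> real) \<Rightarrow> real)"
  where "tangent_map A A' f X = (\<lambda>g.
    if g \<in> smooth_functions A' then X (\<lambda>x. if x \<in> points A then g (f x) else 0) else 0)"

text \<open>\<open>S\<close> is an atlas on a subset of the points of \<open>A\<close>.\<close>

definition embedded_submanifold ::
    "('m, 'e::finite_dim_inner) atlas \<Rightarrow> ('m, 'k::finite_dim_inner) atlas \<Rightarrow> bool"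
  where "embedded_submanifold A S \<longleftrightarrow>
    manifold S \<and> smooth_map S A (\<lambda>x. x) \<and>
    (\<forall>x\<in>points S. inj_on (tangent_map S A (\<lambda>x. x)) (tangent_space S x)) \<and>
    atlas_topology S = subtopology (atlas_topology A) (points S)"

section \<open>Line bundles and factors\<close>

text \<open>
  The fibres are one-dimensional subspaces of an ambient real vector space, which serves only as
  a type to hold them: the smooth structure comes from the local trivialisations \<open>(W, \<tau>)\<close>, where
  \<open>\<tau> x\<close> maps the fibre over \<open>x \<in> W\<close> isomorphically to the real line. Points of the total space
  are pairs \<open>(x, v)\<close> with \<open>v\<close> in the fibre over \<open>x\<close>.
\<close>

record ('m, 'e, 'v) line_bundle =
  base :: "('m, 'e) atlas"
  fibre :: "'m \<Rightarrow> 'v set"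
  trivs :: "('m set \<times> ('m \<Rightarrow> 'v \<Rightarrow> real)) set"

definition linear_iso :: "'v::real_vector set \<Rightarrow> 'w::real_vector set \<Rightarrow> ('v \<Rightarrow> 'w) \<Rightarrow> bool"
  where "linear_iso V W h \<longleftrightarrow> bij_betw h V W \<and>
    (\<forall>u\<in>V. \<forall>v\<in>V. h (u + v) = h u + h v) \<and> (\<forall>c. \<forall>v\<in>V. h (c *\<^sub>R v) = c *\<^sub>R h v)"

definition line_bundle :: "('m, 'e::finite_dim_inner, 'v::real_vector) line_bundle \<Rightarrow> bool"
  where "line_bundle L \<longleftrightarrow>
    manifold (base L) \<and>
    (\<forall>x\<in>points (base L). subspace (fibre L x)) \<and>
    (\<Union>(W, \<tau>)\<in>trivs L. W) = points (base L) \<and>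
    (\<forall>(W, \<tau>)\<in>trivs L. openin (atlas_topology (base L)) W \<and>
       (\<forall>x\<in>W. linear_iso (fibre L x) UNIV (\<tau> x))) \<and>
    (\<forall>(W, \<tau>)\<in>trivs L. \<forall>(W', \<tau>')\<in>trivs L. \<forall>(U, \<phi>)\<in>base L.
       smooth_on (\<phi> ` (U \<inter> W \<inter> W'))
         ((\<lambda>x. \<tau>' x (inv_into (fibre L x) (\<tau> x) 1)) \<circ> inv_into U \<phi>))"

definition total_space ::
    "('m, 'e::finite_dim_inner, 'v::real_vector) line_bundle \<Rightarrow> ('m \<times> 'v, 'e \<times> real) atlas"
  where "total_space L =
    {({(x, v). x \<in> U \<inter> W \<and> v \<in> fibre L x}, \<lambda>(x, v). (\<phi> x, \<tau> x v)) |U \<phi> W \<tau>.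
       (U, \<phi>) \<in> base L \<and> (W, \<tau>) \<in> trivs L}"

definition sections :: "('m, 'e::finite_dim_inner, 'v::real_vector) line_bundle \<Rightarrow> ('m \<Rightarrow> 'v) set"
  where "sections L =
    {s. smooth_map (base L) (total_space L) (\<lambda>x. (x, s x)) \<and> (\<forall>x. x \<notin> points (base L) \<longrightarrow> s x = 0)}"

definition factor :: "('m, 'e::finite_dim_inner, 'v::real_vector) line_bundle \<Rightarrow>
    ('n, 'f::finite_dim_inner, 'w::real_vector) line_bundle \<Rightarrow> ('m \<Rightarrow> 'n) \<Rightarrow> ('m \<Rightarrow> 'v \<Rightarrow> 'w) \<Rightarrow> bool"
  where "factor L1 L2 b B \<longleftrightarrow>
    smooth_map (base L1) (base L2) b \<and>
    smooth_map (total_space L1) (total_space L2) (\<lambda>(x, v). (b x, B x v)) \<and>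
    (\<forall>x\<in>points (base L1). linear_iso (fibre L1 x) (fibre L2 (b x)) (B x))"

definition section_pullback :: "('m, 'e::finite_dim_inner, 'v::real_vector) line_bundle \<Rightarrow>
    ('m \<Rightarrow> 'n) \<Rightarrow> ('m \<Rightarrow> 'v \<Rightarrow> 'w) \<Rightarrow> ('n \<Rightarrow> 'w) \<Rightarrow> ('m \<Rightarrow> 'v)"
  where "section_pullback L1 b B s =
    (\<lambda>x. if x \<in> points (base L1) then inv_into (fibre L1 x) (B x) (s (b x)) else 0)"

text \<open>
  The pullback of \<open>L\<close> along \<open>f\<close>, whose domain is the manifold \<open>A\<close>. Its fibre over \<open>x\<close> is the
  fibre of \<open>L\<close> over \<open>f x\<close> itself, so the canonical factor to \<open>L\<close> is \<open>\<lambda>_ v. v\<close>, covering \<open>f\<close>.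
\<close>

definition pullback_bundle :: "('n, 'f) atlas \<Rightarrow> ('n \<Rightarrow> 'm) \<Rightarrow>
    ('m, 'e, 'v) line_bundle \<Rightarrow> ('n, 'f, 'v) line_bundle"
  where "pullback_bundle A f L =
    \<lparr>base = A, fibre = (\<lambda>x. fibre L (f x)),
     trivs = {(points A \<inter> f -` W, \<lambda>x. \<tau> (f x)) |W \<tau>. (W, \<tau>) \<in> trivs L}\<rparr>"

section \<open>The line product\<close>

text \<open>
  A point \<open>(x1, x2, C)\<close> is a linear isomorphism \<open>C\<close> from the fibre over \<open>x1\<close> to that over \<open>x2\<close>.
  The third coordinate in a chart is the factor by which \<open>C\<close> multiplies in the trivialisations.
\<close>

definition base_product :: "('m1, 'e1::finite_dim_inner, 'v1::real_vector) line_bundle \<Rightarrow>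
    ('m2, 'e2::finite_dim_inner, 'v2::real_vector) line_bundle \<Rightarrow>
    ('m1 \<times> 'm2 \<times> ('v1 \<Rightarrow> 'v2), 'e1 \<times> 'e2 \<times> real) atlas"
  where "base_product L1 L2 =
    {({(x1, x2, C). x1 \<in> U1 \<inter> W1 \<and> x2 \<in> U2 \<inter> W2 \<and>
         linear_iso (fibre L1 x1) (fibre L2 x2) C \<and> (\<forall>l. l \<notin> fibre L1 x1 \<longrightarrow> C l = 0)},
      \<lambda>(x1, x2, C). (\<phi>1 x1, \<phi>2 x2, \<tau>2 x2 (C (inv_into (fibre L1 x1) (\<tau>1 x1) 1))))
     |U1 \<phi>1 W1 \<tau>1 U2 \<phi>2 W2 \<tau>2.
       (U1, \<phi>1) \<in> base L1 \<and> (W1, \<tau>1) \<in> trivs L1 \<and> (U2, \<phi>2) \<in> base L2 \<and> (W2, \<tau>2) \<in> trivs L2}"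

definition line_product :: "('m1, 'e1::finite_dim_inner, 'v1::real_vector) line_bundle \<Rightarrow>
    ('m2, 'e2::finite_dim_inner, 'v2::real_vector) line_bundle \<Rightarrow>
    ('m1 \<times> 'm2 \<times> ('v1 \<Rightarrow> 'v2), 'e1 \<times> 'e2 \<times> real, 'v1) line_bundle"
  where "line_product L1 L2 = pullback_bundle (base_product L1 L2) fst L1"

definition P1_pullback :: "('m1, 'e1::finite_dim_inner, 'v1::real_vector) line_bundle \<Rightarrow>
    ('m2, 'e2::finite_dim_inner, 'v2::real_vector) line_bundle \<Rightarrow>
    ('m1 \<Rightarrow> 'v1) \<Rightarrow> ('m1 \<times> 'm2 \<times> ('v1 \<Rightarrow> 'v2) \<Rightarrow> 'v1)"
  where "P1_pullback L1 L2 = section_pullback (line_product L1 L2) (\<lambda>(x1, x2, C). x1) (\<lambda>_ l. l)"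

definition P2_pullback :: "('m1, 'e1::finite_dim_inner, 'v1::real_vector) line_bundle \<Rightarrow>
    ('m2, 'e2::finite_dim_inner, 'v2::real_vector) line_bundle \<Rightarrow>
    ('m2 \<Rightarrow> 'v2) \<Rightarrow> ('m1 \<times> 'm2 \<times> ('v1 \<Rightarrow> 'v2) \<Rightarrow> 'v1)"
  where "P2_pullback L1 L2 =
    section_pullback (line_product L1 L2) (\<lambda>(x1, x2, C). x2) (\<lambda>(x1, x2, C) l. C l)"

section \<open>Der and jet bundles\<close>

text \<open>\<open>derivations_at L x\<close> is the fibre \<open>D\<^sub>x L\<close>.\<close>

definition derivations_at ::
    "('m, 'e::finite_dim_inner, 'v::real_vector) line_bundle \<Rightarrow> 'm \<Rightarrow> (('m \<Rightarrow> 'v) \<Rightarrow> 'v) set"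
  where "derivations_at L x = {a \<in> Hom (sections L) (fibre L x).
    \<exists>X\<in>tangent_space (base L) x. \<forall>f\<in>smooth_functions (base L). \<forall>s\<in>sections L.
      a (\<lambda>y. f y *\<^sub>R s y) = f x *\<^sub>R a s + X f *\<^sub>R s x}"

definition symbol :: "('m, 'e::finite_dim_inner, 'v::real_vector) line_bundle \<Rightarrow> 'm \<Rightarrow>
    (('m \<Rightarrow> 'v) \<Rightarrow> 'v) \<Rightarrow> (('m \<Rightarrow> real) \<Rightarrow> real)"
  where "symbol L x a = (THE X. X \<in> tangent_space (base L) x \<and>
    (\<forall>f\<in>smooth_functions (base L). \<forall>s\<in>sections L.
      a (\<lambda>y. f y *\<^sub>R s y) = f x *\<^sub>R a s + X f *\<^sub>R s x))"

text \<open>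
  The smooth sections of \<open>DL\<close>, as derivations of the module of sections of \<open>L\<close>. Smoothness is
  the condition that sections are mapped to sections.
\<close>

definition derivations ::
    "('m, 'e::finite_dim_inner, 'v::real_vector) line_bundle \<Rightarrow> (('m \<Rightarrow> 'v) \<Rightarrow> ('m \<Rightarrow> 'v)) set"
  where "derivations L = {a. (\<forall>s\<in>sections L. a s \<in> sections L) \<and>
    (\<forall>s. s \<notin> sections L \<longrightarrow> a s = (\<lambda>_. 0)) \<and>
    (\<forall>x\<in>points (base L). (\<lambda>s. a s x) \<in> derivations_at L x)}"

definition commutator ::
    "(('m \<Rightarrow> 'v) \<Rightarrow> ('m \<Rightarrow> 'v)) \<Rightarrow> (('m \<Rightarrow> 'v) \<Rightarrow> ('m \<Rightarrow> 'v)) \<Rightarrow> ('m \<Rightarrow> 'v::real_vector) \<Rightarrow> ('m \<Rightarrow> 'v)"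
  where "commutator a b = (\<lambda>s x. a (b s) x - b (a s) x)"

definition der_map :: "('m, 'e::finite_dim_inner, 'v::real_vector) line_bundle \<Rightarrow>
    ('n, 'f::finite_dim_inner, 'w::real_vector) line_bundle \<Rightarrow> ('m \<Rightarrow> 'n) \<Rightarrow> ('m \<Rightarrow> 'v \<Rightarrow> 'w) \<Rightarrow>
    'm \<Rightarrow> (('m \<Rightarrow> 'v) \<Rightarrow> 'v) \<Rightarrow> (('n \<Rightarrow> 'w) \<Rightarrow> 'w)"
  where "der_map L1 L2 b B x a =
    (\<lambda>s. if s \<in> sections L2 then B x (a (section_pullback L1 b B s)) else 0)"

definition jets_at :: "('m, 'e::finite_dim_inner, 'v::real_vector) line_bundle \<Rightarrow> 'm \<Rightarrow>
    ((('m \<Rightarrow> 'v) \<Rightarrow> 'v) \<Rightarrow> 'v) set"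
  where "jets_at L x = Hom (derivations_at L x) (fibre L x)"

definition jet :: "('m, 'e::finite_dim_inner, 'v::real_vector) line_bundle \<Rightarrow> ('m \<Rightarrow> 'v) \<Rightarrow> 'm \<Rightarrow>
    ((('m \<Rightarrow> 'v) \<Rightarrow> 'v) \<Rightarrow> 'v)"
  where "jet L s x = (\<lambda>a. if a \<in> derivations_at L x then a s else 0)"

text \<open>
  For a chart \<open>(U, \<phi>)\<close> and a trivialisation \<open>(W, \<tau>)\<close>, the smooth structure of \<open>DL\<close> over
  \<open>U \<inter> W\<close> is given by the local frame consisting of the evaluation \<open>s \<mapsto> s(x)\<close>, i.e. the identity
  derivation, and of the derivatives in the directions \<open>v\<close> of the model space below.
\<close>

definition eval_der :: "('m, 'e::finite_dim_inner, 'v::real_vector) line_bundle \<Rightarrow> 'm \<Rightarrow>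
    (('m \<Rightarrow> 'v) \<Rightarrow> 'v)"
  where "eval_der L x = (\<lambda>s. if s \<in> sections L then s x else 0)"

definition partial_der :: "('m, 'e::finite_dim_inner, 'v::real_vector) line_bundle \<Rightarrow>
    'm set \<Rightarrow> ('m \<Rightarrow> 'e) \<Rightarrow> ('m \<Rightarrow> 'v \<Rightarrow> real) \<Rightarrow> 'm \<Rightarrow> 'e \<Rightarrow> (('m \<Rightarrow> 'v) \<Rightarrow> 'v)"
  where "partial_der L U \<phi> \<tau> x v = (\<lambda>s. if s \<in> sections L then
      inv_into (fibre L x) (\<tau> x)
        (frechet_derivative ((\<lambda>y. \<tau> y (s y)) \<circ> inv_into U \<phi>) (at (\<phi> x)) v)
    else 0)"

text \<open>
  Dual coordinates on \<open>J\<^sup>1L = Hom(DL, L)\<close>: the momentum \<open>p\<close>, where the dual of the model space is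
  identified with the model space by the inner product, and the value on the identity derivation.
\<close>

definition jet_manifold :: "('m, 'e::finite_dim_inner, 'v::real_vector) line_bundle \<Rightarrow>
    ('m \<times> ((('m \<Rightarrow> 'v) \<Rightarrow> 'v) \<Rightarrow> 'v), 'e \<times> 'e \<times> real) atlas"
  where "jet_manifold L =
    {({(x, \<alpha>). x \<in> U \<inter> W \<and> \<alpha> \<in> jets_at L x},
      \<lambda>(x, \<alpha>). (\<phi> x, THE p. \<forall>v. p \<bullet> v = \<tau> x (\<alpha> (partial_der L U \<phi> \<tau> x v)),
                 \<tau> x (\<alpha> (eval_der L x))))
     |U \<phi> W \<tau>. (U, \<phi>) \<in> base L \<and> (W, \<tau>) \<in> trivs L}"

definition jet_line_bundle :: "('m, 'e::finite_dim_inner, 'v::real_vector) line_bundle \<Rightarrow>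
    ('m \<times> ((('m \<Rightarrow> 'v) \<Rightarrow> 'v) \<Rightarrow> 'v), 'e \<times> 'e \<times> real, 'v) line_bundle"
  where "jet_line_bundle L = pullback_bundle (jet_manifold L) fst L"

definition jet_lift :: "('m1, 'e1::finite_dim_inner, 'v1::real_vector) line_bundle \<Rightarrow>
    ('m2, 'e2::finite_dim_inner, 'v2::real_vector) line_bundle \<Rightarrow>
    ('m1 \<Rightarrow> 'm2) \<Rightarrow> ('m1 \<Rightarrow> 'v1 \<Rightarrow> 'v2) \<Rightarrow>
    (('m1 \<times> ((('m1 \<Rightarrow> 'v1) \<Rightarrow> 'v1) \<Rightarrow> 'v1)) \<times> ('m2 \<times> ((('m2 \<Rightarrow> 'v2) \<Rightarrow> 'v2) \<Rightarrow> 'v2)) \<times>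
     ('v1 \<Rightarrow> 'v2)) set"
  where "jet_lift L1 L2 b B =
    {((q1, \<alpha>), (q2, \<beta>), C) |q1 \<alpha> q2 \<beta> C.
       ((q1, \<alpha>), (q2, \<beta>), C) \<in> points (base_product (jet_line_bundle L1) (jet_line_bundle L2)) \<and>
       q2 = b q1 \<and>
       (\<forall>a\<in>derivations_at L1 q1. \<alpha> a = inv_into (fibre L1 q1) (B q1) (\<beta> (der_map L1 L2 b B q1 a))) \<and>
       (\<forall>l\<in>fibre L1 q1. C l = B q1 l)}"

section \<open>Jacobi structures\<close>

text \<open>
  Differential operators of order at most 1 on the module of sections, in the algebraic sense:
  the iterated commutators \<open>[[P, f], g]\<close> with multiplication operators vanish.
\<close>

definition first_order_operator :: "('m, 'e::finite_dim_inner, 'v::real_vector) line_bundle \<Rightarrow>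
    (('m \<Rightarrow> 'v) \<Rightarrow> ('m \<Rightarrow> 'v)) \<Rightarrow> bool"
  where "first_order_operator L P \<longleftrightarrow>
    (\<forall>s\<in>sections L. P s \<in> sections L) \<and>
    (\<forall>s\<in>sections L. \<forall>r\<in>sections L. P (\<lambda>x. s x + r x) = (\<lambda>x. P s x + P r x)) \<and>
    (\<forall>c. \<forall>s\<in>sections L. P (\<lambda>x. c *\<^sub>R s x) = (\<lambda>x. c *\<^sub>R P s x)) \<and>
    (\<forall>f\<in>smooth_functions (base L). \<forall>g\<in>smooth_functions (base L). \<forall>s\<in>sections L. \<forall>x.
       P (\<lambda>y. (f y * g y) *\<^sub>R s y) x - f x *\<^sub>R P (\<lambda>y. g y *\<^sub>R s y) x
       - g x *\<^sub>R P (\<lambda>y. f y *\<^sub>R s y) x + (f x * g x) *\<^sub>R P s x = 0)"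

text \<open>\<open>R\<close>-bilinearity of the bracket is part of \<^const>\<open>first_order_operator\<close>.\<close>

definition jacobi_structure :: "('m, 'e::finite_dim_inner, 'v::real_vector) line_bundle \<Rightarrow>
    (('m \<Rightarrow> 'v) \<Rightarrow> ('m \<Rightarrow> 'v) \<Rightarrow> ('m \<Rightarrow> 'v)) \<Rightarrow> bool"
  where "jacobi_structure L br \<longleftrightarrow>
    (\<forall>s\<in>sections L. first_order_operator L (\<lambda>r. br s r)) \<and>
    (\<forall>r\<in>sections L. first_order_operator L (\<lambda>s. br s r)) \<and>
    (\<forall>s\<in>sections L. br s s = (\<lambda>_. 0)) \<and>
    (\<forall>s\<in>sections L. \<forall>r\<in>sections L. \<forall>t\<in>sections L.
       (\<lambda>x. br s (br r t) x + br r (br t s) x + br t (br s r) x) = (\<lambda>_. 0))"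

definition op_bracket :: "(('m \<Rightarrow> 'v) \<Rightarrow> ('m \<Rightarrow> 'v) \<Rightarrow> ('m \<Rightarrow> 'v::real_vector)) \<Rightarrow>
    (('m \<Rightarrow> 'v) \<Rightarrow> ('m \<Rightarrow> 'v) \<Rightarrow> ('m \<Rightarrow> 'v))"
  where "op_bracket br = (\<lambda>s r x. - br s r x)"

text \<open>\<open>ham_der L br s x\<close> is \<open>{s, \<cdot>}\<close> at \<open>x\<close>, and \<open>ham_vec L br s x\<close> is \<open>X\<^sub>s\<close> at \<open>x\<close>.\<close>

definition ham_der :: "('m, 'e::finite_dim_inner, 'v::real_vector) line_bundle \<Rightarrow>
    (('m \<Rightarrow> 'v) \<Rightarrow> ('m \<Rightarrow> 'v) \<Rightarrow> ('m \<Rightarrow> 'v)) \<Rightarrow> ('m \<Rightarrow> 'v) \<Rightarrow> 'm \<Rightarrow> (('m \<Rightarrow> 'v) \<Rightarrow> 'v)"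
  where "ham_der L br s x = (\<lambda>r. if r \<in> sections L then br s r x else 0)"

definition ham_vec :: "('m, 'e::finite_dim_inner, 'v::real_vector) line_bundle \<Rightarrow>
    (('m \<Rightarrow> 'v) \<Rightarrow> ('m \<Rightarrow> 'v) \<Rightarrow> ('m \<Rightarrow> 'v)) \<Rightarrow> ('m \<Rightarrow> 'v) \<Rightarrow> 'm \<Rightarrow> (('m \<Rightarrow> real) \<Rightarrow> real)"
  where "ham_vec L br s x = symbol L x (ham_der L br s x)"

definition Pi_sharp :: "('m, 'e::finite_dim_inner, 'v::real_vector) line_bundle \<Rightarrow>
    (('m \<Rightarrow> 'v) \<Rightarrow> ('m \<Rightarrow> 'v) \<Rightarrow> ('m \<Rightarrow> 'v)) \<Rightarrow> 'm \<Rightarrow> ((('m \<Rightarrow> 'v) \<Rightarrow> 'v) \<Rightarrow> 'v) \<Rightarrow> (('m \<Rightarrow> 'v) \<Rightarrow> 'v)"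
  where "Pi_sharp L br x \<alpha> =
    (THE a. \<forall>s\<in>sections L. jet L s x = \<alpha> \<longrightarrow> a = ham_der L br s x)"

text \<open>
  The fibre of \<open>T\<^sup>*M \<otimes> L\<close> at \<open>x\<close> is the space of linear maps from the tangent space to the fibre
  of \<open>L\<close>; the following is its element \<open>df \<otimes> s\<close>.
\<close>

definition df_tensor :: "('m, 'e::finite_dim_inner, 'v::real_vector) line_bundle \<Rightarrow> 'm \<Rightarrow>
    ('m \<Rightarrow> real) \<Rightarrow> ('m \<Rightarrow> 'v) \<Rightarrow> ((('m \<Rightarrow> real) \<Rightarrow> real) \<Rightarrow> 'v)"
  where "df_tensor L x f s = (\<lambda>X. if X \<in> tangent_space (base L) x then X f *\<^sub>R s x else 0)"

definition Lambda_sharp :: "('m, 'e::finite_dim_inner, 'v::real_vector) line_bundle \<Rightarrow>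
    (('m \<Rightarrow> 'v) \<Rightarrow> ('m \<Rightarrow> 'v) \<Rightarrow> ('m \<Rightarrow> 'v)) \<Rightarrow> 'm \<Rightarrow> ((('m \<Rightarrow> real) \<Rightarrow> real) \<Rightarrow> 'v) \<Rightarrow>
    (('m \<Rightarrow> real) \<Rightarrow> real)"
  where "Lambda_sharp L br x \<eta> =
    (THE X. \<forall>f\<in>smooth_functions (base L). \<forall>s\<in>sections L. df_tensor L x f s = \<eta> \<longrightarrow>
      X = (\<lambda>g. ham_vec L br (\<lambda>y. f y *\<^sub>R s y) x g - f x * ham_vec L br s x g))"

definition nondegenerate :: "('m, 'e::finite_dim_inner, 'v::real_vector) line_bundle \<Rightarrow>
    (('m \<Rightarrow> 'v) \<Rightarrow> ('m \<Rightarrow> 'v) \<Rightarrow> ('m \<Rightarrow> 'v)) \<Rightarrow> bool"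
  where "nondegenerate L br \<longleftrightarrow>
    (\<forall>x\<in>points (base L). bij_betw (Pi_sharp L br x) (jets_at L x) (derivations_at L x))"

definition contact_hyperplane :: "('m, 'e::finite_dim_inner, 'v::real_vector) line_bundle \<Rightarrow>
    (('m \<Rightarrow> 'v) \<Rightarrow> ('m \<Rightarrow> 'v) \<Rightarrow> ('m \<Rightarrow> 'v)) \<Rightarrow> 'm \<Rightarrow> (('m \<Rightarrow> real) \<Rightarrow> real) set"
  where "contact_hyperplane L br x =
    Lambda_sharp L br x ` Hom (tangent_space (base L) x) (fibre L x)"

section \<open>Isotropic, coisotropic and Legendrian submanifolds\<close>

definition isotropic :: "('m, 'e::finite_dim_inner, 'v::real_vector) line_bundle \<Rightarrow>
    (('m \<Rightarrow> 'v) \<Rightarrow> ('m \<Rightarrow> 'v) \<Rightarrow> ('m \<Rightarrow> 'v)) \<Rightarrow> ('m, 'k::finite_dim_inner) atlas \<Rightarrow> bool"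
  where "isotropic L br S \<longleftrightarrow> (\<forall>x\<in>points S.
    tangent_map S (base L) (\<lambda>x. x) ` tangent_space S x \<subseteq> contact_hyperplane L br x)"

text \<open>
  The image of the derivations at \<open>x\<close> of the restriction of \<open>L\<close> to \<open>S\<close> under the injection
  induced by the inclusion factor.
\<close>

definition restricted_derivations_at :: "('m, 'e::finite_dim_inner, 'v::real_vector) line_bundle \<Rightarrow>
    ('m, 'k::finite_dim_inner) atlas \<Rightarrow> 'm \<Rightarrow> (('m \<Rightarrow> 'v) \<Rightarrow> 'v) set"
  where "restricted_derivations_at L S x =
    (let L_S = pullback_bundle S (\<lambda>x. x) L
     in der_map L_S L (\<lambda>x. x) (\<lambda>_ l. l) x ` derivations_at L_S x)"

definition coisotropic :: "('m, 'e::finite_dim_inner, 'v::real_vector) line_bundle \<Rightarrow>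
    (('m \<Rightarrow> 'v) \<Rightarrow> ('m \<Rightarrow> 'v) \<Rightarrow> ('m \<Rightarrow> 'v)) \<Rightarrow> ('m, 'k::finite_dim_inner) atlas \<Rightarrow> bool"
  where "coisotropic L br S \<longleftrightarrow> (\<forall>x\<in>points S.
    Pi_sharp L br x ` {\<alpha> \<in> jets_at L x. \<forall>a\<in>restricted_derivations_at L S x. \<alpha> a = 0}
      \<subseteq> restricted_derivations_at L S x)"

text \<open>The notion presupposes that the Jacobi structure is non-degenerate.\<close>

definition legendrian_submanifold :: "('m, 'e::finite_dim_inner, 'v::real_vector) line_bundle \<Rightarrow>
    (('m \<Rightarrow> 'v) \<Rightarrow> ('m \<Rightarrow> 'v) \<Rightarrow> ('m \<Rightarrow> 'v)) \<Rightarrow> ('m, 'k::finite_dim_inner) atlas \<Rightarrow> bool"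
  where "legendrian_submanifold L br S \<longleftrightarrow>
    nondegenerate L br \<and> embedded_submanifold (base L) S \<and> isotropic L br S \<and> coisotropic L br S"

section \<open>The canonical and the product Jacobi structures\<close>

definition base_section :: "('m, 'e::finite_dim_inner, 'v::real_vector) line_bundle \<Rightarrow> ('m \<Rightarrow> 'v) \<Rightarrow>
    ('m \<times> ((('m \<Rightarrow> 'v) \<Rightarrow> 'v) \<Rightarrow> 'v) \<Rightarrow> 'v)"
  where "base_section L = section_pullback (jet_line_bundle L) fst (\<lambda>_ l. l)"

definition linear_section :: "('m, 'e::finite_dim_inner, 'v::real_vector) line_bundle \<Rightarrow>
    (('m \<Rightarrow> 'v) \<Rightarrow> ('m \<Rightarrow> 'v)) \<Rightarrow> ('m \<times> ((('m \<Rightarrow> 'v) \<Rightarrow> 'v) \<Rightarrow> 'v) \<Rightarrow> 'v)"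
  where "linear_section L a =
    (\<lambda>(q, \<alpha>). if (q, \<alpha>) \<in> points (jet_manifold L) then \<alpha> (\<lambda>s. a s q) else 0)"

definition canonical_jacobi_structure :: "('m, 'e::finite_dim_inner, 'v::real_vector) line_bundle \<Rightarrow>
    (('m \<times> ((('m \<Rightarrow> 'v) \<Rightarrow> 'v) \<Rightarrow> 'v) \<Rightarrow> 'v) \<Rightarrow> ('m \<times> ((('m \<Rightarrow> 'v) \<Rightarrow> 'v) \<Rightarrow> 'v) \<Rightarrow> 'v) \<Rightarrow>
     ('m \<times> ((('m \<Rightarrow> 'v) \<Rightarrow> 'v) \<Rightarrow> 'v) \<Rightarrow> 'v)) \<Rightarrow> bool"
  where "canonical_jacobi_structure L br \<longleftrightarrow>
    jacobi_structure (jet_line_bundle L) br \<and>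
    (\<forall>a\<in>derivations L. \<forall>b\<in>derivations L.
       br (linear_section L a) (linear_section L b) = linear_section L (commutator a b)) \<and>
    (\<forall>a\<in>derivations L. \<forall>s\<in>sections L.
       br (linear_section L a) (base_section L s) = base_section L (a s)) \<and>
    (\<forall>s\<in>sections L. \<forall>r\<in>sections L. br (base_section L s) (base_section L r) = (\<lambda>_. 0))"

definition product_jacobi_structure :: "('m1, 'e1::finite_dim_inner, 'v1::real_vector) line_bundle \<Rightarrow>
    (('m1 \<Rightarrow> 'v1) \<Rightarrow> ('m1 \<Rightarrow> 'v1) \<Rightarrow> ('m1 \<Rightarrow> 'v1)) \<Rightarrow>
    ('m2, 'e2::finite_dim_inner, 'v2::real_vector) line_bundle \<Rightarrow>
    (('m2 \<Rightarrow> 'v2) \<Rightarrow> ('m2 \<Rightarrow> 'v2) \<Rightarrow> ('m2 \<Rightarrow> 'v2)) \<Rightarrow>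
    (('m1 \<times> 'm2 \<times> ('v1 \<Rightarrow> 'v2) \<Rightarrow> 'v1) \<Rightarrow> ('m1 \<times> 'm2 \<times> ('v1 \<Rightarrow> 'v2) \<Rightarrow> 'v1) \<Rightarrow>
     ('m1 \<times> 'm2 \<times> ('v1 \<Rightarrow> 'v2) \<Rightarrow> 'v1)) \<Rightarrow> bool"
  where "product_jacobi_structure L1 br1 L2 br2 br \<longleftrightarrow>
    jacobi_structure (line_product L1 L2) br \<and>
    (\<forall>s\<in>sections L1. \<forall>s'\<in>sections L1.
       br (P1_pullback L1 L2 s) (P1_pullback L1 L2 s') = P1_pullback L1 L2 (br1 s s')) \<and>
    (\<forall>s\<in>sections L2. \<forall>s'\<in>sections L2.
       br (P2_pullback L1 L2 s) (P2_pullback L1 L2 s') = P2_pullback L1 L2 (br2 s s')) \<and>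
    (\<forall>s1\<in>sections L1. \<forall>s2\<in>sections L2.
       br (P1_pullback L1 L2 s1) (P2_pullback L1 L2 s2) = (\<lambda>_. 0))"

end

theory Submission
  imports Defs
begin

text \<open>
  At a point \<open>z\<close> of the jet lift over \<open>q\<close>, with jets \<open>\<alpha>\<close> and \<open>\<beta>\<close>, choose a section \<open>s\<close> of \<open>L2\<close> whose
  jet at \<open>b q\<close> is \<open>\<beta>\<close>; then \<open>\<alpha>\<close> is the jet of \<open>B\<^sup>* s\<close>. Up to first order at \<open>z\<close> the jet lift is the zero set
  of the sections \<open>P1\<^sup>* \<pi>\<^sup>* B\<^sup>* t - P2\<^sup>* \<pi>\<^sup>* t\<close> and \<open>P1\<^sup>* (l\<^sub>A - \<pi>\<^sup>* (A B\<^sup>* s)) - P2\<^sup>* (l\<^sub>Z - \<pi>\<^sup>* (Z s))\<close>,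
  where the derivation \<open>Z\<close> is at \<open>b q\<close> the image of \<open>A\<close> at \<open>q\<close>: the space \<open>K\<close> of derivations at \<open>z\<close> that are
  tangent to the jet lift consists of those that annihilate these sections. The defining relations of the
  brackets show that the bracket of any two of the sections vanishes at \<open>z\<close>, so their Hamiltonian derivations
  lie in \<open>K\<close>. If a jet \<open>\<eta>\<close> annihilates \<open>K\<close>, antisymmetry gives that the derivation associated with \<open>\<eta>\<close>
  annihilates the sections, hence lies in \<open>K\<close>. Isotropy uses the section \<open>V\<close> given by \<open>A = Z = id\<close>, whose
  Hamiltonian derivation at \<open>z\<close> is the evaluation: if \<open>{r, \<cdot>}\<close> is in \<open>K\<close>, then \<open>r(z) = {V, r}(z) = 0\<close>.
\<close>

section \<open>Smooth calculus\<close>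

text \<open>The map \<open>b\<close> is arbitrary, so a field \<open>Z\<close> that is related to
  \<open>A\<close> along \<open>b\<close> need not exist; it can only be prescribed at
  \<open>b q\<close>. Hence the linear sections of the overview vanish on the jet lift merely to
  first order. In coordinates the error is a sum of products of two factors: one measures how far
  \<open>\<beta>\<close> is from the jet of \<open>s\<close>, the other how far \<open>Z\<close> is
  from the image of \<open>A\<close>, and both vanish at the point. To make this factorisation
  explicit, \<open>s\<close> is affine in a chart and \<open>Z\<close> has constant coefficients
  near \<open>b q\<close>. The brackets are known only on base sections, linear sections and
  pullbacks. Statements about them therefore rest on the fact that a derivation at a point which
  annihilates these sections is zero. The same fact shows that every derivation at a point is
  Hamiltonian, which together with antisymmetry is non-degeneracy, and it replaces a dimension count
  when tangency to the jet lift is characterised. Derivations are abstract functionals; Hadamard's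
  lemma gives them finitely many coordinates.\<close>

lemma frechet_derivative_eqI:
  "(f has_derivative f') (at x) \<Longrightarrow> frechet_derivative f (at x) = f'"
  by (metis frechet_derivative_at)

lemma frechet_derivative_worksI:
  "f differentiable (at x) \<Longrightarrow> (f has_derivative frechet_derivative f (at x)) (at x)"
  by (simp add: frechet_derivative_works)

lemma Ck_on_subset: "Ck_on k S f \<Longrightarrow> T \<subseteq> S \<Longrightarrow> Ck_on k T f"
  by (induction k arbitrary: f) (auto intro: continuous_on_subset)

lemma frechet_derivative_cong_open:
  assumes "open S" "x \<in> S" "\<And>y. y \<in> S \<Longrightarrow> f y = g y"
  shows "frechet_derivative f (at x) = frechet_derivative g (at x)"
    and "f differentiable (at x) \<Longrightarrow> g differentiable (at x)"
proof -
  have "(f has_derivative D) (at x) \<longleftrightarrow> (g has_derivative D) (at x)" for D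
    using has_derivative_transform_within_open[of f D x UNIV S g]
      has_derivative_transform_within_open[of g D x UNIV S f] assms by metis
  then show "frechet_derivative f (at x) = frechet_derivative g (at x)"
    "f differentiable (at x) \<Longrightarrow> g differentiable (at x)"
    by (auto simp: frechet_derivative_def differentiable_def)
qed

lemma Ck_on_cong:
  assumes "open S" "\<And>x. x \<in> S \<Longrightarrow> f x = g x" "Ck_on k S f"
  shows "Ck_on k S g"
  using assms(2,3)
proof (induction k arbitrary: f g)
  case 0
  then show ?case by (simp cong: continuous_on_cong)
next
  case (Suc k)
  have "Ck_on k S (\<lambda>x. frechet_derivative g (at x) v)" for v
  proof (rule Suc.IH)
    show "Ck_on k S (\<lambda>x. frechet_derivative f (at x) v)" using Suc.prems by simp
    show "\<And>x. x \<in> S \<Longrightarrow> frechet_derivative f (at x) v = frechet_derivative g (at x) v"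
      by (rule fun_cong[OF frechet_derivative_cong_open(1)[OF assms(1) _ Suc.prems(1)]])
  qed
  then show ?case
    using Suc.prems frechet_derivative_cong_open(2)[OF assms(1) _ Suc.prems(1)] by auto
qed

lemma Ck_on_SucD: "Ck_on (Suc k) S f \<Longrightarrow> Ck_on k S f"
proof (induction k arbitrary: f)
  case 0
  then show ?case
    by (auto intro!: continuous_at_imp_continuous_on differentiable_imp_continuous_within)
next
  case (Suc k)
  then show ?case by (metis Ck_on.simps(2))
qed

lemma Ck_on_local:
  assumes "\<And>x. x \<in> S \<Longrightarrow> \<exists>T. open T \<and> x \<in> T \<and> Ck_on k T f"
  shows "Ck_on k S f"
  using assms
proof (induction k arbitrary: f)
  case 0
  have "continuous (at x) f" if x: "x \<in> S" for x
  proof -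
    obtain T where "open T" "x \<in> T" "continuous_on T f" using 0[OF x] by auto
    then show ?thesis by (simp add: continuous_on_eq_continuous_at)
  qed
  then show ?case by (simp add: continuous_at_imp_continuous_on)
next
  case (Suc k)
  have "f differentiable (at x)" if "x \<in> S" for x
    using Suc.prems[OF that] by auto
  moreover have "Ck_on k S (\<lambda>x. frechet_derivative f (at x) v)" for v
  proof (rule Suc.IH)
    fix x assume "x \<in> S"
    then obtain T where "open T" "x \<in> T" "Ck_on (Suc k) T f" using Suc.prems by blast
    then show "\<exists>T. open T \<and> x \<in> T \<and> Ck_on k T (\<lambda>x. frechet_derivative f (at x) v)"
      by auto
  qed
  ultimately show ?case by simp
qed

lemma Ck_on_imp_smooth_on: "(\<And>k. Ck_on k S f) \<Longrightarrow> smooth_on S f"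
  by (simp add: smooth_on_def)

lemma smooth_on_Ck: "smooth_on S f \<Longrightarrow> Ck_on k S f"
  by (simp add: smooth_on_def)

lemma smooth_on_subset: "smooth_on S f \<Longrightarrow> T \<subseteq> S \<Longrightarrow> smooth_on T f"
  by (auto simp: smooth_on_def intro: Ck_on_subset)

lemma smooth_on_cong:
  "open S \<Longrightarrow> smooth_on S f \<Longrightarrow> (\<And>x. x \<in> S \<Longrightarrow> f x = g x) \<Longrightarrow> smooth_on S g"
  by (auto simp: smooth_on_def intro: Ck_on_cong)

lemma smooth_on_local:
  "(\<And>x. x \<in> S \<Longrightarrow> \<exists>T. open T \<and> x \<in> T \<and> smooth_on T f) \<Longrightarrow> smooth_on S f"
  unfolding smooth_on_def by (metis Ck_on_local)

lemma smooth_on_imp_continuous_on: "smooth_on S f \<Longrightarrow> continuous_on S f"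
  using smooth_on_Ck[of S f 0] by simp

lemma smooth_on_differentiable: "smooth_on S f \<Longrightarrow> x \<in> S \<Longrightarrow> f differentiable (at x)"
  using smooth_on_Ck[of S f "Suc 0"] by simp

lemma smooth_on_has_derivative:
  "smooth_on S f \<Longrightarrow> x \<in> S \<Longrightarrow> (f has_derivative frechet_derivative f (at x)) (at x)"
  using smooth_on_differentiable frechet_derivative_works by blast

lemma smooth_on_frechet_derivative:
  "smooth_on S f \<Longrightarrow> smooth_on S (\<lambda>x. frechet_derivative f (at x) v)"
  unfolding smooth_on_def by (metis Ck_on.simps(2))

lemma Ck_on_const: "Ck_on k S (\<lambda>_. c)"
  by (induction k arbitrary: c) simp_all

lemma smooth_on_const [simp]: "smooth_on S (\<lambda>_. c)"
  by (simp add: smooth_on_def Ck_on_const)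

lemma Ck_on_bounded_linear: "bounded_linear f \<Longrightarrow> Ck_on k S f"
proof (cases k)
  case 0
  assume "bounded_linear f"
  then show ?thesis using 0 by (simp add: linear_continuous_on)
next
  case (Suc m)
  assume f: "bounded_linear f"
  then have D: "(f has_derivative f) (at x)" for x by (rule bounded_linear_imp_has_derivative)
  then show ?thesis
    using Suc by (auto simp: frechet_derivative_eqI[OF D] Ck_on_const differentiable_def)
qed

lemma smooth_on_bounded_linear: "bounded_linear f \<Longrightarrow> smooth_on S f"
  by (simp add: smooth_on_def Ck_on_bounded_linear)

lemma Ck_on_bounded_linear_comp:
  assumes "open S" "bounded_linear L" "Ck_on k S f"
  shows "Ck_on k S (\<lambda>x. L (f x))"
  using assms(3)
proof (induction k arbitrary: f)
  case 0
  then show ?case using assms(2) by (simp add: bounded_linear.continuous_on)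
next
  case (Suc k)
  have D: "((\<lambda>x. L (f x)) has_derivative (\<lambda>v. L (frechet_derivative f (at x) v))) (at x)" if "x \<in> S" for x
    using Suc.prems that
    by (intro bounded_linear.has_derivative[OF assms(2) frechet_derivative_worksI]) simp
  have "Ck_on k S (\<lambda>x. frechet_derivative (\<lambda>x. L (f x)) (at x) v)" for v
    by (rule Ck_on_cong[OF assms(1) _ Suc.IH[of "\<lambda>x. frechet_derivative f (at x) v"]])
      (use Suc.prems in \<open>simp_all add: frechet_derivative_eqI[OF D]\<close>)
  then show ?case using D by (auto simp: differentiable_def)
qed

lemma Ck_on_add:
  assumes "open S" "Ck_on k S f" "Ck_on k S g"
  shows "Ck_on k S (\<lambda>x. f x + g x)"
  using assms(2,3)
proof (induction k arbitrary: f g)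
  case 0
  then show ?case by (simp add: continuous_on_add)
next
  case (Suc k)
  have D: "((\<lambda>x. f x + g x) has_derivative
      (\<lambda>v. frechet_derivative f (at x) v + frechet_derivative g (at x) v)) (at x)" if "x \<in> S" for x
    using Suc.prems that
    by (intro has_derivative_add[OF frechet_derivative_worksI frechet_derivative_worksI]) simp_all
  have "Ck_on k S (\<lambda>x. frechet_derivative (\<lambda>x. f x + g x) (at x) v)" for v
    by (rule Ck_on_cong[OF assms(1) _ Suc.IH[of "\<lambda>x. frechet_derivative f (at x) v"
          "\<lambda>x. frechet_derivative g (at x) v"]])
      (use Suc.prems in \<open>simp_all add: frechet_derivative_eqI[OF D]\<close>)
  then show ?case using D by (auto simp: differentiable_def)
qed

text \<open>The product rule writes the derivative as two values of the same bilinear map, so the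
  induction hypothesis applies to both. Scalar multiples, products of reals and inner products are
  the instances used later.\<close>

lemma Ck_on_bilinear:
  assumes "open S" "bounded_bilinear p" "Ck_on k S f" "Ck_on k S g"
  shows "Ck_on k S (\<lambda>x. p (f x) (g x))"
  using assms(3,4)
proof (induction k arbitrary: f g)
  case 0
  then show ?case using assms(2) by (simp add: bounded_bilinear.continuous_on)
next
  case (Suc k)
  have D: "((\<lambda>x. p (f x) (g x)) has_derivative
      (\<lambda>v. p (f x) (frechet_derivative g (at x) v) + p (frechet_derivative f (at x) v) (g x))) (at x)"
    if "x \<in> S" for x
    using Suc.prems that
    by (intro bounded_bilinear.FDERIV[OF assms(2) frechet_derivative_worksI frechet_derivative_worksI])
      simp_all
  have "Ck_on k S (\<lambda>x. frechet_derivative (\<lambda>x. p (f x) (g x)) (at x) v)" for v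
  proof (rule Ck_on_cong[OF assms(1)])
    show "Ck_on k S (\<lambda>x. p (f x) (frechet_derivative g (at x) v) + p (frechet_derivative f (at x) v) (g x))"
      using Suc.prems by (intro Ck_on_add assms(1) Suc.IH) (simp_all add: Ck_on_SucD del: Ck_on.simps, simp_all)
  qed (use Suc.prems in \<open>simp add: frechet_derivative_eqI[OF D]\<close>)
  then show ?case using D by (auto simp: differentiable_def)
qed

lemma Ck_on_sum:
  assumes "open S" "\<And>i. i \<in> I \<Longrightarrow> Ck_on k S (f i)"
  shows "Ck_on k S (\<lambda>x. \<Sum>i\<in>I. f i x)"
  using assms(2)
  by (induction I rule: infinite_finite_induct) (simp_all add: Ck_on_const Ck_on_add assms(1))

lemma smooth_on_bounded_linear_comp:
  "open S \<Longrightarrow> bounded_linear L \<Longrightarrow> smooth_on S f \<Longrightarrow> smooth_on S (\<lambda>x. L (f x))"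
  by (simp add: smooth_on_def Ck_on_bounded_linear_comp)

lemma smooth_on_add: "open S \<Longrightarrow> smooth_on S f \<Longrightarrow> smooth_on S g \<Longrightarrow> smooth_on S (\<lambda>x. f x + g x)"
  by (simp add: smooth_on_def Ck_on_add)

lemma smooth_on_bilinear:
  "open S \<Longrightarrow> bounded_bilinear p \<Longrightarrow> smooth_on S f \<Longrightarrow> smooth_on S g \<Longrightarrow>
    smooth_on S (\<lambda>x. p (f x) (g x))"
  by (simp add: smooth_on_def Ck_on_bilinear)

lemma smooth_on_sum:
  "open S \<Longrightarrow> (\<And>i. i \<in> I \<Longrightarrow> smooth_on S (f i)) \<Longrightarrow> smooth_on S (\<lambda>x. \<Sum>i\<in>I. f i x)"
  by (simp add: smooth_on_def Ck_on_sum)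

lemmas smooth_on_scaleR = smooth_on_bilinear[OF _ bounded_bilinear_scaleR]
lemmas smooth_on_mult = smooth_on_bilinear[OF _ bounded_bilinear_mult]
lemmas smooth_on_inner = smooth_on_bilinear[OF _ bounded_bilinear_inner]
lemmas smooth_on_minus = smooth_on_bounded_linear_comp[OF _ bounded_linear_minus[OF bounded_linear_ident]]

lemma smooth_on_diff: "open S \<Longrightarrow> smooth_on S f \<Longrightarrow> smooth_on S g \<Longrightarrow> smooth_on S (\<lambda>x. f x - g x)"
  using smooth_on_add[OF _ _ smooth_on_minus, of S f g] by simp

lemma smooth_on_fst: "open S \<Longrightarrow> smooth_on S f \<Longrightarrow> smooth_on S (\<lambda>x. fst (f x))"
  by (rule smooth_on_bounded_linear_comp[OF _ bounded_linear_fst])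

lemma smooth_on_snd: "open S \<Longrightarrow> smooth_on S f \<Longrightarrow> smooth_on S (\<lambda>x. snd (f x))"
  by (rule smooth_on_bounded_linear_comp[OF _ bounded_linear_snd])

lemma smooth_on_ident [simp]: "smooth_on S (\<lambda>x. x)"
  by (rule smooth_on_bounded_linear[OF bounded_linear_ident])

lemma smooth_on_Pair:
  assumes "open S" "smooth_on S f" "smooth_on S g"
  shows "smooth_on S (\<lambda>x. (f x, g x))"
proof -
  have "bounded_linear (\<lambda>x. (x, 0))" "bounded_linear (\<lambda>x. (0, x))"
    by (auto intro!: bounded_linear_Pair bounded_linear_ident bounded_linear_zero)
  then have "smooth_on S (\<lambda>x. (f x, 0) + (0, g x))"
    using assms by (intro smooth_on_add) (auto dest: smooth_on_bounded_linear_comp)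
  then show ?thesis by simp
qed

text \<open>The derivative of \<open>1/f\<close> is a product of \<open>1/f\<close>, taken twice,
  with a derivative of \<open>f\<close>. So the order of \<open>1/f\<close> rises one step at a time
  while \<open>f\<close> stays fixed.\<close>

lemma Ck_on_inverse:
  fixes f :: "'a::real_normed_vector \<Rightarrow> real"
  assumes "open S" "\<And>x. x \<in> S \<Longrightarrow> f x \<noteq> 0" "Ck_on k S f"
  shows "Ck_on k S (\<lambda>x. inverse (f x))"
  using assms(3)
proof (induction k)
  case 0
  then show ?case using assms(2) by (auto intro!: continuous_on_inverse)
next
  case (Suc k)
  have D: "((\<lambda>x. inverse (f x)) has_derivative
      (\<lambda>v. - (inverse (f x) * frechet_derivative f (at x) v * inverse (f x)))) (at x)" if "x \<in> S" for x
    using Suc.prems that assms(2)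
    by (intro Deriv.has_derivative_inverse[OF _ frechet_derivative_worksI]) simp_all
  have "Ck_on k S (\<lambda>x. frechet_derivative (\<lambda>x. inverse (f x)) (at x) v)" for v
  proof (rule Ck_on_cong[OF assms(1)])
    have "Ck_on k S (\<lambda>x. inverse (f x))" using Suc by (simp add: Ck_on_SucD del: Ck_on.simps)
    then show "Ck_on k S (\<lambda>x. - (inverse (f x) * frechet_derivative f (at x) v * inverse (f x)))"
      using Suc.prems
      by (intro Ck_on_bounded_linear_comp[OF assms(1) bounded_linear_minus[OF bounded_linear_ident]]
          Ck_on_bilinear[OF assms(1) bounded_bilinear_mult]) simp_all
  qed (simp add: frechet_derivative_eqI[OF D])
  then show ?case using D by (auto simp: differentiable_def)
qed

lemma smooth_on_inverse:
  fixes f :: "'a::real_normed_vector \<Rightarrow> real"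
  shows "open S \<Longrightarrow> smooth_on S f \<Longrightarrow> (\<And>x. x \<in> S \<Longrightarrow> f x \<noteq> 0) \<Longrightarrow> smooth_on S (\<lambda>x. inverse (f x))"
  by (simp add: smooth_on_def Ck_on_inverse)

lemma smooth_on_divide:
  fixes f :: "'a::real_normed_vector \<Rightarrow> real"
  shows "open S \<Longrightarrow> smooth_on S f \<Longrightarrow> smooth_on S g \<Longrightarrow> (\<And>x. x \<in> S \<Longrightarrow> g x \<noteq> 0) \<Longrightarrow>
    smooth_on S (\<lambda>x. f x / g x)"
  by (simp add: divide_inverse smooth_on_mult smooth_on_inverse)

section \<open>Finite-dimensional inner product spaces\<close>

text \<open>The model spaces carry no distinguished basis, so one orthonormal basis is fixed by
  choice; on the zero space it is empty.\<close>

definition onb :: "'a::finite_dim_inner set"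
  where "onb = (SOME B. finite B \<and> (\<forall>b\<in>B. \<forall>c\<in>B. b \<bullet> c = (if b = c then 1 else 0)) \<and>
    (\<forall>x. x = (\<Sum>b\<in>B. (x \<bullet> b) *\<^sub>R b)))"

text \<open>Orthogonalise a finite spanning set. This may produce the zero vector, which is removed
  before normalising; orthonormality then identifies the expansion coefficients with inner
  products.\<close>

lemma onb_exists:
  "\<exists>B :: 'a::finite_dim_inner set. finite B \<and> (\<forall>b\<in>B. \<forall>c\<in>B. b \<bullet> c = (if b = c then 1 else 0)) \<and>
    (\<forall>x. x = (\<Sum>b\<in>B. (x \<bullet> b) *\<^sub>R b))"
proof -
  obtain A :: "'a set" where A: "finite A" "span A = UNIV" using finite_dim_inner_span by blast
  obtain C where C: "finite C" "span C = span A" "pairwise orthogonal C"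
    using basis_orthogonal[OF A(1)] by blast
  define B where "B = (\<lambda>c. c /\<^sub>R norm c) ` (C - {0})"
  have fin: "finite B" using C by (simp add: B_def)
  have on: "b \<bullet> c = (if b = c then 1 else 0)" if bB: "b \<in> B" and cB: "c \<in> B" for b c
  proof -
    obtain b' where b': "b' \<in> C - {0}" "b = b' /\<^sub>R norm b'" using bB unfolding B_def by blast
    obtain c' where c': "c' \<in> C - {0}" "c = c' /\<^sub>R norm c'" using cB unfolding B_def by blast
    have bc: "b' \<in> C" "b' \<noteq> 0" "b = b' /\<^sub>R norm b'" "c' \<in> C" "c' \<noteq> 0" "c = c' /\<^sub>R norm c'"
      using b' c' by auto
    show ?thesis
    proof (cases "b' = c'")
      case True
      then show ?thesis using bc by (simp add: power2_norm_eq_inner[symmetric] power2_eq_square)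
    next
      case False
      then have 0: "b' \<bullet> c' = 0" using C(3) bc by (auto simp: pairwise_def orthogonal_def)
      then have "b \<bullet> c = 0" using bc by simp
      moreover have "b \<noteq> c"
      proof
        assume "b = c"
        then have "b \<bullet> b = 0" using calculation by simp
        then show False using bc by simp
      qed
      ultimately show ?thesis by simp
    qed
  qed
  have "c \<in> span B" if "c \<in> C" for c
  proof (cases "c = 0")
    case False
    then have "c /\<^sub>R norm c \<in> span B" using that by (auto simp: B_def intro!: span_base)
    then have "norm c *\<^sub>R (c /\<^sub>R norm c) \<in> span B" by (rule span_scale)
    then show ?thesis using False by simp
  qed (simp add: span_zero)
  then have "span C \<subseteq> span B" by (meson span_minimal subspace_span subsetI)
  then have "span B = UNIV" using A C by auto
  then have x: "\<exists>u. x = (\<Sum>b\<in>B. u b *\<^sub>R b)" for x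
    using span_finite[OF fin] by (metis (no_types, lifting) UNIV_I imageE)
  have "x = (\<Sum>b\<in>B. (x \<bullet> b) *\<^sub>R b)" for x
  proof -
    obtain u where u: "x = (\<Sum>b\<in>B. u b *\<^sub>R b)" using x by blast
    have "x \<bullet> c = u c" if "c \<in> B" for c
    proof -
      have "x \<bullet> c = (\<Sum>b\<in>B. u b * (b \<bullet> c))" by (simp add: u inner_sum_left)
      also have "\<dots> = (\<Sum>b\<in>B. if b = c then u b else 0)" using on that by (intro sum.cong) auto
      finally show ?thesis using fin that by simp
    qed
    then show ?thesis using u by simp
  qed
  then show ?thesis using fin on by blast
qed

lemma finite_onb [simp]: "finite (onb :: 'a::finite_dim_inner set)"
  and onb_orthonormal: "b \<in> onb \<Longrightarrow> c \<in> onb \<Longrightarrow> b \<bullet> (c :: 'a) = (if b = c then 1 else 0)"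
  and onb_expansion: "(x :: 'a) = (\<Sum>b\<in>onb. (x \<bullet> b) *\<^sub>R b)"
  using someI_ex[OF onb_exists[where 'a='a], folded onb_def] by blast+

lemma linear_onb_expansion:
  fixes h :: "'a::finite_dim_inner \<Rightarrow> 'b::real_vector"
  assumes "linear h"
  shows "h x = (\<Sum>b\<in>onb. (x \<bullet> b) *\<^sub>R h b)"
  by (subst onb_expansion[of x]) (simp only: linear_sum[OF assms] linear_scale[OF assms])

text \<open>This makes the definite description of the momentum in the jet charts meaningful. Later
  it also turns a linear functional on frame directions into the differential of a section.\<close>

lemma riesz_ex1:
  fixes h :: "'a::finite_dim_inner \<Rightarrow> real"
  assumes "linear h"
  shows "\<exists>!p. \<forall>v. p \<bullet> v = h v"
proof
  show "\<forall>v. (\<Sum>b\<in>onb. h b *\<^sub>R b) \<bullet> v = h v"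
  proof
    fix v
    have "(\<Sum>b\<in>onb. h b *\<^sub>R b) \<bullet> v = (\<Sum>b\<in>onb. (v \<bullet> b) *\<^sub>R h b)"
      unfolding inner_sum_left by (intro sum.cong) (simp_all add: inner_commute)
    then show "(\<Sum>b\<in>onb. h b *\<^sub>R b) \<bullet> v = h v"
      by (metis linear_onb_expansion[OF assms, of v])
  qed
  show "p = (\<Sum>b\<in>onb. h b *\<^sub>R b)" if "\<forall>v. p \<bullet> v = h v" for p
  proof -
    have "p = (\<Sum>b\<in>onb. (p \<bullet> b) *\<^sub>R b)" by (rule onb_expansion)
    then show ?thesis using that by simp
  qed
qed

text \<open>The chain rule evaluates the derivative of \<open>g\<close> in a direction that moves
  with \<open>x\<close>, while \<open>Ck_on\<close> controls derivatives in fixed directions only.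
  Expanding the direction in \<open>onb\<close> leaves a finite sum of products, to which the
  induction hypothesis applies; this is the reason for the finite-dimensional space in the
  middle.\<close>

lemma Ck_on_compose:
  fixes f :: "'a::real_normed_vector \<Rightarrow> 'b::finite_dim_inner" and g :: "'b \<Rightarrow> 'c::real_normed_vector"
  assumes "open S" "open T" "f ` S \<subseteq> T" "Ck_on k S f" "Ck_on k T g"
  shows "Ck_on k S (\<lambda>x. g (f x))"
  using assms(4,5)
proof (induction k arbitrary: g)
  case 0
  then show ?case using assms(3) by (auto intro: continuous_on_compose2)
next
  case (Suc k)
  have D: "((\<lambda>x. g (f x)) has_derivative
      (\<lambda>v. frechet_derivative g (at (f x)) (frechet_derivative f (at x) v))) (at x)" if "x \<in> S" for x
    using Suc.prems that assms(3)
    by (intro has_derivative_compose[OF frechet_derivative_worksI frechet_derivative_worksI]) auto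
  have "Ck_on k S (\<lambda>x. frechet_derivative (\<lambda>x. g (f x)) (at x) v)" for v
  proof (rule Ck_on_cong[OF assms(1)])
    show "Ck_on k S (\<lambda>x. \<Sum>b\<in>onb. (frechet_derivative f (at x) v \<bullet> b) *\<^sub>R frechet_derivative g (at (f x)) b)"
    proof (intro Ck_on_sum assms(1) Ck_on_bilinear[OF _ bounded_bilinear_scaleR])
      show "Ck_on k S (\<lambda>x. frechet_derivative f (at x) v \<bullet> b)" for b
        using Suc.prems by (intro Ck_on_bounded_linear_comp[OF assms(1) bounded_linear_inner_left]) simp
      show "Ck_on k S (\<lambda>x. frechet_derivative g (at (f x)) b)" for b
        using Suc.prems by (intro Suc.IH) (simp_all add: Ck_on_SucD del: Ck_on.simps, simp_all)
    qed
    fix x assume x: "x \<in> S"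
    have "linear (frechet_derivative g (at (f x)))"
      using Suc.prems x assms(3) by (intro linear_frechet_derivative) auto
    then show "(\<Sum>b\<in>onb. (frechet_derivative f (at x) v \<bullet> b) *\<^sub>R frechet_derivative g (at (f x)) b)
        = frechet_derivative (\<lambda>x. g (f x)) (at x) v"
      by (simp add: frechet_derivative_eqI[OF D[OF x]] linear_onb_expansion[symmetric])
  qed
  then show ?case using D by (auto simp: differentiable_def)
qed

lemma smooth_on_compose:
  fixes f :: "'a::real_normed_vector \<Rightarrow> 'b::finite_dim_inner" and g :: "'b \<Rightarrow> 'c::real_normed_vector"
  assumes "open S" "open T" "f ` S \<subseteq> T" "smooth_on S f" "smooth_on T g"
  shows "smooth_on S (\<lambda>x. g (f x))"
  using assms by (simp add: smooth_on_def Ck_on_compose[OF assms(1-3)])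

lemma smooth_on_innerI:
  fixes f :: "'a::real_normed_vector \<Rightarrow> 'b::finite_dim_inner"
  assumes "open S" "\<And>w. smooth_on S (\<lambda>x. f x \<bullet> w)"
  shows "smooth_on S f"
proof -
  have "smooth_on S (\<lambda>x. \<Sum>b\<in>onb. (f x \<bullet> b) *\<^sub>R b)"
    using assms by (intro smooth_on_sum smooth_on_scaleR) simp_all
  then show ?thesis by (simp add: onb_expansion[symmetric])
qed

text \<open>Compactness of closed balls yields cut-off functions on manifolds; completeness, which
  follows from it, is needed to differentiate under an integral.\<close>

instance finite_dim_inner \<subseteq> heine_borel
proof
  fix f :: "nat \<Rightarrow> 'a"
  assume "bounded (range f)"
  then have b: "bounded ((\<lambda>x. x \<bullet> k) ` range f)" for k
    by (rule bounded_linear_image) (rule bounded_linear_inner_left)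
  have "\<forall>d\<subseteq>onb::'a set. \<exists>l::'a. \<exists>r::nat\<Rightarrow>nat. strict_mono r \<and>
      (\<forall>e>0. eventually (\<lambda>n. \<forall>i\<in>d. dist (f (r n) \<bullet> i) (l \<bullet> i) < e) sequentially)"
  proof (rule compact_lemma_general[where unproj="\<lambda>u. \<Sum>b\<in>onb. u b *\<^sub>R b"])
    show "(\<Sum>b\<in>onb. u b *\<^sub>R b) \<bullet> k = u k" if "k \<in> onb" for k :: 'a and u
    proof -
      have "(\<Sum>b\<in>onb. u b *\<^sub>R b) \<bullet> k = (\<Sum>b\<in>onb. if b = k then u b else 0)"
        unfolding inner_sum_left using that by (intro sum.cong) (simp_all add: onb_orthonormal)
      then show ?thesis using that by simp
    qed
    show "(\<Sum>b\<in>onb. (x \<bullet> b) *\<^sub>R b) = x" for x :: 'a by (rule onb_expansion[symmetric])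
  qed (use b in auto)
  then obtain l r where r: "strict_mono (r::nat\<Rightarrow>nat)"
    and ev: "\<And>e. e > 0 \<Longrightarrow> eventually (\<lambda>n. \<forall>i\<in>onb. dist (f (r n) \<bullet> i) (l \<bullet> i) < e) sequentially"
    by blast
  have "(\<lambda>n. f (r n)) \<longlonglongrightarrow> l"
  proof -
    have "(\<lambda>n. f (r n) \<bullet> b) \<longlonglongrightarrow> l \<bullet> b" if "b \<in> onb" for b
      unfolding tendsto_iff
    proof (intro allI impI)
      fix e :: real assume "e > 0"
      from ev[OF this] show "\<forall>\<^sub>F n in sequentially. dist (f (r n) \<bullet> b) (l \<bullet> b) < e"
        by (rule eventually_mono) (use that in blast)
    qed
    then have "(\<lambda>n. \<Sum>b\<in>onb. (f (r n) \<bullet> b) *\<^sub>R b) \<longlonglongrightarrow> (\<Sum>b\<in>onb. (l \<bullet> b) *\<^sub>R b)"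
      by (intro tendsto_sum tendsto_scaleR tendsto_const)
    then show ?thesis by (simp add: onb_expansion[symmetric])
  qed
  then show "\<exists>l r. strict_mono (r::nat\<Rightarrow>nat) \<and> (f \<circ> r) \<longlonglongrightarrow> l"
    using r by (auto simp: o_def)
qed

instance finite_dim_inner \<subseteq> banach ..

text \<open>The base consists of the boxes with rational corners in orthonormal coordinates.\<close>

lemma countable_open_base:
  "\<exists>\<B> :: 'a::finite_dim_inner set set. countable \<B> \<and> (\<forall>V\<in>\<B>. open V) \<and>
    (\<forall>U x. open U \<and> x \<in> U \<longrightarrow> (\<exists>V\<in>\<B>. x \<in> V \<and> V \<subseteq> U))"
proof -
  define F where "F = (\<lambda>(p, q). {x :: 'a. \<forall>b\<in>onb. p b < x \<bullet> b \<and> x \<bullet> b < q b})"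
  define Q :: "('a \<Rightarrow> real) set" where "Q = (\<Pi>\<^sub>E b\<in>onb. \<rat>)"
  have cQ: "countable Q" unfolding Q_def by (intro countable_PiE) (auto simp: countable_rat)
  have op: "open (F (p, q))" for p q
  proof -
    have "F (p, q) = (\<Inter>b\<in>onb. {x. p b < x \<bullet> b} \<inter> {x. x \<bullet> b < q b})" by (auto simp: F_def)
    then show ?thesis by (auto intro!: open_INT open_Int open_Collect_less continuous_intros)
  qed
  have "\<exists>V\<in>F ` (Q \<times> Q). x \<in> V \<and> V \<subseteq> U" if U: "open U" "x \<in> U" for U and x :: 'a
  proof -
    obtain e where e: "e > 0" "ball x e \<subseteq> U" using U openE by blast
    \<comment> \<open>The additional 1 keeps the denominator positive and the sum of
      \<open>card onb\<close> copies of \<open>d\<close> strictly below \<open>e\<close>, also on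
      the zero space.\<close>
    define d where "d = e / (card (onb :: 'a set) + 1)"
    have d: "d > 0" using e by (simp add: d_def)
    have "\<forall>b. \<exists>r\<in>\<rat>. x \<bullet> b - d < r \<and> r < x \<bullet> b" using d by (auto intro: Rats_dense_in_real)
    then obtain p where p: "\<And>b. p b \<in> \<rat> \<and> x \<bullet> b - d < p b \<and> p b < x \<bullet> b" by metis
    have "\<forall>b. \<exists>r\<in>\<rat>. x \<bullet> b < r \<and> r < x \<bullet> b + d" using d by (auto intro: Rats_dense_in_real)
    then obtain q where q: "\<And>b. q b \<in> \<rat> \<and> x \<bullet> b < q b \<and> q b < x \<bullet> b + d" by metis
    have "y \<in> ball x e" if y: "y \<in> F (p, q)" for y
    proof -
      have l: "\<bar>(y - x) \<bullet> b\<bar> \<le> d" if "b \<in> onb" for b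
      proof -
        have "p b < y \<bullet> b" "y \<bullet> b < q b" using y that by (auto simp: F_def)
        then show ?thesis using p[of b] q[of b] by (simp add: inner_diff_left abs_le_iff)
      qed
      have "y - x = (\<Sum>b\<in>onb. ((y - x) \<bullet> b) *\<^sub>R b)" by (rule onb_expansion)
      then have "norm (y - x) \<le> (\<Sum>b\<in>onb. norm (((y - x) \<bullet> b) *\<^sub>R b))" by (metis norm_sum)
      also have "\<dots> \<le> (\<Sum>b\<in>(onb :: 'a set). d)"
        by (intro sum_mono) (simp add: norm_eq_sqrt_inner[of "_ :: 'a"] onb_orthonormal l)
      also have "\<dots> = card (onb :: 'a set) * d" by simp
      also have "\<dots> < e"
        using e by (simp add: d_def field_simps)
      finally show ?thesis by (simp add: dist_norm norm_minus_commute)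
    qed
    moreover have "x \<in> F (p, q)" using p q by (auto simp: F_def)
    \<comment> \<open>Restriction to \<open>onb\<close> turns the corners into elements of the
      countable function space \<open>Q\<close>.\<close>
    moreover have "F (p, q) = F (restrict p onb, restrict q onb)" by (auto simp: F_def)
    moreover have "(restrict p onb, restrict q onb) \<in> Q \<times> Q" using p q by (auto simp: Q_def)
    ultimately show ?thesis using e by (metis (no_types, lifting) imageI subset_iff)
  qed
  moreover have "countable (F ` (Q \<times> Q))" using cQ by auto
  moreover have "\<forall>V\<in>F ` (Q \<times> Q). open V" using op by auto
  ultimately show ?thesis by metis
qed

text \<open>\<open>flat 0\<close> is the classical function \<open>exp (- 1/t)\<close> extended by
  0. Its derivatives produce powers of \<open>1/t\<close>, so the family is closed under
  differentiation up to linear combinations.\<close>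

definition flat :: "nat \<Rightarrow> real \<Rightarrow> real"
  where "flat n t = (if t > 0 then inverse t ^ n * exp (- inverse t) else 0)"

text \<open>From the right this is, with \<open>u = 1/t\<close>, the decay of
  \<open>u ^ n / exp u\<close> at infinity.\<close>

lemma tendsto_flat_0: "(flat n \<longlongrightarrow> 0) (at 0)"
proof -
  have "((\<lambda>t. inverse t ^ n / exp (inverse t)) \<longlongrightarrow> 0) (at_right (0::real))"
    by (rule filterlim_compose[OF tendsto_power_div_exp_0 filterlim_inverse_at_top_right])
  moreover have "\<forall>\<^sub>F t in at_right 0. inverse t ^ n / exp (inverse t) = flat n t"
    by (auto simp: eventually_at_right_field flat_def exp_minus divide_inverse intro!: exI[of _ 1])
  ultimately have "(flat n \<longlongrightarrow> 0) (at_right 0)" using tendsto_cong by fast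
  moreover have "\<forall>\<^sub>F t in at_left 0. 0 = flat n t"
    by (auto simp: eventually_at_left_field flat_def intro!: exI[of _ "-1"])
  then have "(flat n \<longlongrightarrow> 0) (at_left 0)" using tendsto_cong[of "\<lambda>_. 0" "flat n" "at_left 0" 0] by simp
  ultimately show ?thesis by (simp add: filterlim_split_at)
qed

lemma DERIV_flat: "(flat n has_real_derivative (flat (n + 2) t - n * flat (n + 1) t)) (at t)"
proof (cases t "0::real" rule: linorder_cases)
  case less
  have "((\<lambda>_. 0) has_real_derivative 0) (at t)" by simp
  then have "(flat n has_real_derivative 0) (at t)"
    by (rule has_field_derivative_transform_within_open[of _ _ _ "{..<0}"]) (use less in \<open>auto simp: flat_def\<close>)
  then show ?thesis using less by (simp add: flat_def)
next
  case equal
  \<comment> \<open>Since \<open>flat n 0 = 0\<close>, the difference quotient at 0 is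
    \<open>flat (Suc n)\<close> itself, which tends to 0.\<close>
  have "((\<lambda>h. (flat n (0 + h) - flat n 0) / h) \<longlongrightarrow> 0) (at 0)"
  proof (rule Lim_transform_eventually[OF tendsto_flat_0[of "Suc n"]])
    show "\<forall>\<^sub>F h in at 0. flat (Suc n) h = (flat n (0 + h) - flat n 0) / h"
      by (rule always_eventually) (auto simp: flat_def divide_inverse)
  qed
  then show ?thesis using equal by (simp add: DERIV_def flat_def)
next
  case greater
  have "((\<lambda>t. inverse t ^ n * exp (- inverse t)) has_real_derivative
      (flat (n + 2) t - n * flat (n + 1) t)) (at t)"
    using greater
    by (auto intro!: derivative_eq_intros simp: flat_def field_simps power2_eq_square)
      (cases n; simp add: field_simps power2_eq_square)
  then show ?thesis
    by (rule has_field_derivative_transform_within_open[of _ _ _ "{0<..}"]) (use greater in \<open>auto simp: flat_def\<close>)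
qed

lemma Ck_on_flat: "Ck_on k UNIV (flat n)"
proof (induction k arbitrary: n)
  case 0
  then show ?case using DERIV_flat by (auto intro!: DERIV_atLeastAtMost_imp_continuous_on continuous_at_imp_continuous_on DERIV_isCont)
next
  case (Suc k)
  have D: "(flat n has_derivative (\<lambda>v. (flat (n + 2) t - n * flat (n + 1) t) * v)) (at t)" for t
    using DERIV_flat[of n t] by (simp add: has_field_derivative_def)
  have "Ck_on k UNIV (\<lambda>t. (flat (n + 2) t + (- real n) * flat (n + 1) t) * v)" for v
    by (intro Ck_on_add Ck_on_bilinear[OF _ bounded_bilinear_mult] Ck_on_const Suc.IH open_UNIV)
  then show ?case using D by (auto simp: frechet_derivative_eqI[OF D] differentiable_def)
qed

text \<open>\<open>N\<close> is positive exactly inside the ball of radius \<open>e\<close> and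
  \<open>M\<close> exactly outside the closed ball of radius \<open>e / 2\<close>. So
  \<open>N + M\<close> never vanishes, and \<open>N / (N + M)\<close> interpolates between 1 and 0.
  Squared distances keep both functions smooth at the centre.\<close>

lemma smooth_bump:
  fixes a :: "'a::finite_dim_inner"
  assumes "e > 0"
  obtains \<rho> :: "'a \<Rightarrow> real" where "smooth_on UNIV \<rho>" "\<And>y. dist a y < e / 2 \<Longrightarrow> \<rho> y = 1"
    "\<And>y. dist a y \<ge> e \<Longrightarrow> \<rho> y = 0"
proof
  define N where "N = (\<lambda>y. flat 0 (e\<^sup>2 - (y - a) \<bullet> (y - a)))"
  define M where "M = (\<lambda>y. flat 0 ((y - a) \<bullet> (y - a) - (e/2)\<^sup>2))"
  have *: "smooth_on UNIV (\<lambda>y. flat 0 (g y))" if "smooth_on UNIV g" for g :: "'a \<Rightarrow> real"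
    by (rule smooth_on_compose[OF _ _ _ that, of UNIV]) (auto intro: Ck_on_imp_smooth_on Ck_on_flat)
  have s: "smooth_on UNIV (\<lambda>y. (y - a) \<bullet> (y - a))"
    by (intro smooth_on_inner smooth_on_diff) simp_all
  have sm: "smooth_on UNIV N" "smooth_on UNIV M"
    unfolding N_def M_def by (intro * smooth_on_diff s smooth_on_const open_UNIV)+
  have q: "(y - a) \<bullet> (y - a) = (dist a y)\<^sup>2" for y
    by (metis dist_norm dist_commute power2_norm_eq_inner)
  have lt: "(e/2)\<^sup>2 < e\<^sup>2" using assms by (intro power_strict_mono) auto
  have nn: "N y \<ge> 0" "M y \<ge> 0" for y by (auto simp: N_def M_def flat_def)
  have pos: "N y + M y > 0" for y
  proof (cases "(y - a) \<bullet> (y - a) < e\<^sup>2")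
    case True
    then have "N y > 0" by (simp add: N_def flat_def)
    then show ?thesis using nn(2)[of y] by linarith
  next
    case False
    then have "M y > 0" using lt by (simp add: M_def flat_def)
    then show ?thesis using nn(1)[of y] by linarith
  qed
  show "smooth_on UNIV (\<lambda>y. N y / (N y + M y))"
    using pos by (intro smooth_on_divide smooth_on_add sm open_UNIV) (metis less_irrefl)
  show "N y / (N y + M y) = 1" if "dist a y < e / 2" for y
  proof -
    have "(dist a y)\<^sup>2 \<le> (e/2)\<^sup>2" using that by (intro power_mono) auto
    then have "M y = 0" by (simp add: M_def flat_def q)
    then show ?thesis using pos[of y] by simp
  qed
  show "N y / (N y + M y) = 0" if "e \<le> dist a y" for y
  proof -
    have "e\<^sup>2 \<le> (dist a y)\<^sup>2" using that assms by (intro power_mono) auto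
    then show ?thesis by (simp add: N_def flat_def q)
  qed
qed

section \<open>Hadamard's lemma\<close>

text \<open>Weighted means of \<open>h\<close> along the segment from \<open>a\<close> to
  \<open>y\<close>. Differentiating in \<open>y\<close> brings out one factor \<open>t\<close>,
  hence the family over \<open>k\<close>; the case \<open>k = 0\<close> gives the coefficients in
  Hadamard's lemma.\<close>

definition ray_moment :: "'a \<Rightarrow> nat \<Rightarrow> ('a::real_normed_vector \<Rightarrow> real) \<Rightarrow> 'a \<Rightarrow> real"
  where "ray_moment a k h y = integral (cbox 0 1) (\<lambda>t. t ^ k * h (a + t *\<^sub>R (y - a)))"

lemma ray_in_ball:
  fixes a :: "'a::real_normed_vector"
  assumes "y \<in> ball a r" "t \<in> cbox 0 (1::real)"
  shows "a + t *\<^sub>R (y - a) \<in> ball a r"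
proof -
  have "dist a (a + t *\<^sub>R (y - a)) = t * dist a y"
    using assms(2) norm_minus_commute[of a y] by (simp add: dist_norm)
  also have "\<dots> \<le> 1 * dist a y" using assms(2) by (intro mult_right_mono) auto
  finally show ?thesis using assms(1) by simp
qed

lemma has_derivative_ray_moment:
  fixes a :: "'a::finite_dim_inner"
  assumes h: "smooth_on (ball a r) h" and y: "y \<in> ball a r"
  shows "(ray_moment a k h has_derivative
    (\<lambda>v. ray_moment a (Suc k) (\<lambda>z. frechet_derivative h (at z) v) y)) (at y)"
proof -
  let ?D = "\<lambda>z b. frechet_derivative h (at z) b"
  \<comment> \<open>The Leibniz rule for integrals asks for the derivative as a bounded linear map
    that is jointly continuous in \<open>y\<close> and \<open>t\<close>. Written in the basis, this
    is continuity of finitely many directional derivatives.\<close>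
  define fx where "fx = (\<lambda>y (t::real). \<Sum>b\<in>onb. (t ^ Suc k * ?D (a + t *\<^sub>R (y - a)) b) *\<^sub>R blinfun_inner_left b)"
  have lin: "linear (?D z)" if "z \<in> ball a r" for z
    using smooth_on_differentiable[OF h that] by (rule linear_frechet_derivative)
  have fx: "blinfun_apply (fx y t) v = t ^ Suc k * ?D (a + t *\<^sub>R (y - a)) v"
    if "y \<in> ball a r" "t \<in> cbox 0 1" for y t v
  proof -
    have "?D (a + t *\<^sub>R (y - a)) v = (\<Sum>b\<in>onb. (v \<bullet> b) *\<^sub>R ?D (a + t *\<^sub>R (y - a)) b)"
      by (rule linear_onb_expansion[OF lin[OF ray_in_ball[OF that]]])
    then show ?thesis
      by (simp add: fx_def blinfun.sum_left blinfun.scaleR_left sum_distrib_left inner_commute mult.assoc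
          mult.left_commute mult.commute)
  qed
  have cD: "continuous_on (ball a r) (\<lambda>z. ?D z b)" for b
    by (intro smooth_on_imp_continuous_on smooth_on_frechet_derivative h)
  have ch: "continuous_on (ball a r) h" by (rule smooth_on_imp_continuous_on[OF h])
  have "((\<lambda>y. integral (cbox 0 1) (\<lambda>t. t ^ k * h (a + t *\<^sub>R (y - a)))) has_derivative
      blinfun_apply (integral (cbox 0 1) (fx y))) (at y within ball a r)"
  proof (rule leibniz_rule[OF _ _ _ y convex_ball])
    fix y t assume *: "y \<in> ball a r" "t \<in> cbox 0 (1::real)"
    have 1: "((\<lambda>y. a + t *\<^sub>R (y - a)) has_derivative (\<lambda>v. t *\<^sub>R v)) (at y)"
      by (auto intro!: derivative_eq_intros)
    have "((\<lambda>y. t ^ k * h (a + t *\<^sub>R (y - a))) has_derivative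
        (\<lambda>v. t ^ k * ?D (a + t *\<^sub>R (y - a)) (t *\<^sub>R v))) (at y)"
      using has_derivative_compose[OF 1 smooth_on_has_derivative[OF h ray_in_ball[OF *]]]
      by (rule has_derivative_mult_right)
    moreover have "t ^ k * ?D (a + t *\<^sub>R (y - a)) (t *\<^sub>R v) = blinfun_apply (fx y t) v" for v
      using linear_scale[OF lin[OF ray_in_ball[OF *]]] by (simp add: fx[OF *])
    ultimately show "((\<lambda>y. t ^ k * h (a + t *\<^sub>R (y - a))) has_derivative blinfun_apply (fx y t)) (at y within ball a r)"
      by (simp add: has_derivative_at_withinI)
  next
    fix y assume "y \<in> ball a r"
    then show "(\<lambda>t. t ^ k * h (a + t *\<^sub>R (y - a))) integrable_on cbox 0 1"
      by (intro integrable_continuous continuous_intros continuous_on_compose2[OF ch])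
        (auto simp del: cbox_interval mem_ball intro: ray_in_ball)
  next
    show "continuous_on (ball a r \<times> cbox 0 1) (\<lambda>(x, t). fx x t)"
      unfolding fx_def split_beta
      by (intro continuous_intros continuous_on_compose2[OF cD])
        (auto simp del: cbox_interval mem_ball intro: ray_in_ball)
  qed
  moreover have "blinfun_apply (integral (cbox 0 1) (fx y)) = (\<lambda>v. ray_moment a (Suc k) (\<lambda>z. ?D z v) y)"
  proof
    fix v
    have "fx y integrable_on cbox 0 1"
      unfolding fx_def
      by (intro integrable_continuous continuous_intros continuous_on_compose2[OF cD])
        (use y in \<open>auto simp del: cbox_interval mem_ball intro: ray_in_ball\<close>)
    then have "blinfun_apply (integral (cbox 0 1) (fx y)) v = integral (cbox 0 1) (\<lambda>t. blinfun_apply (fx y t) v)"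
      by (rule blinfun_apply_integral)
    also have "\<dots> = ray_moment a (Suc k) (\<lambda>z. ?D z v) y"
      unfolding ray_moment_def using fx[OF y] by (intro integral_cong) auto
    finally show "blinfun_apply (integral (cbox 0 1) (fx y)) v = ray_moment a (Suc k) (\<lambda>z. ?D z v) y" .
  qed
  ultimately show ?thesis
    using at_within_open[OF y open_ball] unfolding ray_moment_def by simp
qed

lemma smooth_on_ray_moment:
  fixes a :: "'a::finite_dim_inner"
  assumes "smooth_on (ball a r) h"
  shows "smooth_on (ball a r) (ray_moment a k h)"
proof -
  have "Ck_on m (ball a r) (ray_moment a k h)" if "smooth_on (ball a r) h" for m k h
    using that
  proof (induction m arbitrary: k h)
    case 0
    then show ?case
      by (auto intro!: continuous_at_imp_continuous_on has_derivative_continuous has_derivative_ray_moment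
          simp del: mem_ball)
  next
    case (Suc m)
    note D = has_derivative_ray_moment[OF Suc.prems]
    have "Ck_on m (ball a r) (\<lambda>x. frechet_derivative (ray_moment a k h) (at x) v)" for v
      by (rule Ck_on_cong[OF open_ball _ Suc.IH[OF smooth_on_frechet_derivative[OF Suc.prems]]])
        (simp only: frechet_derivative_eqI[OF D])
    then show ?case using D by (auto simp: differentiable_def simp del: mem_ball)
  qed
  then show ?thesis using assms by (simp add: Ck_on_imp_smooth_on)
qed

text \<open>Integrate the derivative of \<open>f\<close> along the segment from \<open>a\<close> to
  \<open>y\<close> and expand \<open>y - a\<close> in the basis. At \<open>a\<close> the coefficient
  functions are the directional derivatives, which is all that a tangent vector at \<open>a\<close>
  sees of them.\<close>

lemma hadamard:
  fixes a :: "'a::finite_dim_inner" and f :: "'a \<Rightarrow> real"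
  assumes f: "smooth_on (ball a r) f" and r: "r > 0"
  shows "\<exists>G. (\<forall>b. smooth_on (ball a r) (G b)) \<and> (\<forall>b. G b a = frechet_derivative f (at a) b) \<and>
    (\<forall>y\<in>ball a r. f y = f a + (\<Sum>b\<in>onb. ((y - a) \<bullet> b) * G b y))"
proof -
  let ?D = "\<lambda>z b. frechet_derivative f (at z) b"
  define G where "G = (\<lambda>b. ray_moment a 0 (\<lambda>z. ?D z b))"
  have G: "smooth_on (ball a r) (G b)" for b
    unfolding G_def by (intro smooth_on_ray_moment smooth_on_frechet_derivative f)
  have Ga: "G b a = ?D a b" for b by (simp add: G_def ray_moment_def)
  have "f y = f a + (\<Sum>b\<in>onb. ((y - a) \<bullet> b) * G b y)" if y: "y \<in> ball a r" for y
  proof -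
    have cD: "continuous_on (ball a r) (\<lambda>z. ?D z b)" for b
      by (intro smooth_on_imp_continuous_on smooth_on_frechet_derivative f)
    have "((\<lambda>t. ?D (a + t *\<^sub>R (y - a)) (y - a)) has_integral
        (f (a + 1 *\<^sub>R (y - a)) - f (a + 0 *\<^sub>R (y - a)))) {0..1}"
    proof (rule fundamental_theorem_of_calculus)
      fix t :: real assume t: "t \<in> {0..1}"
      have z: "a + t *\<^sub>R (y - a) \<in> ball a r" using ray_in_ball[OF y] t by simp
      have 1: "((\<lambda>t. a + t *\<^sub>R (y - a)) has_derivative (\<lambda>s. s *\<^sub>R (y - a))) (at t)"
        by (auto intro!: derivative_eq_intros)
      have lin: "linear (?D (a + t *\<^sub>R (y - a)))"
        using smooth_on_differentiable[OF f z] by (rule linear_frechet_derivative)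
      have "((\<lambda>t. f (a + t *\<^sub>R (y - a))) has_derivative (\<lambda>s. ?D (a + t *\<^sub>R (y - a)) (s *\<^sub>R (y - a)))) (at t)"
        using has_derivative_compose[OF 1 smooth_on_has_derivative[OF f z]] .
      then show "((\<lambda>t. f (a + t *\<^sub>R (y - a))) has_vector_derivative ?D (a + t *\<^sub>R (y - a)) (y - a)) (at t within {0..1})"
        by (simp add: has_vector_derivative_def linear_scale[OF lin] has_derivative_at_withinI)
    qed simp
    then have "integral (cbox 0 1) (\<lambda>t. ?D (a + t *\<^sub>R (y - a)) (y - a)) = f y - f a"
      by (simp add: integral_unique)
    moreover have "integral (cbox 0 1) (\<lambda>t. ?D (a + t *\<^sub>R (y - a)) (y - a))
        = integral (cbox 0 1) (\<lambda>t. \<Sum>b\<in>onb. ((y - a) \<bullet> b) * ?D (a + t *\<^sub>R (y - a)) b)"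
    proof (rule integral_cong)
      fix t :: real assume "t \<in> cbox 0 1"
      then have "linear (?D (a + t *\<^sub>R (y - a)))"
        using smooth_on_differentiable[OF f ray_in_ball[OF y]] by (intro linear_frechet_derivative)
      from linear_onb_expansion[OF this, of "y - a"]
      show "?D (a + t *\<^sub>R (y - a)) (y - a) = (\<Sum>b\<in>onb. ((y - a) \<bullet> b) * ?D (a + t *\<^sub>R (y - a)) b)"
        by (simp only: real_scaleR_def)
    qed
    moreover have "\<dots> = (\<Sum>b\<in>onb. ((y - a) \<bullet> b) * integral (cbox 0 1) (\<lambda>t. ?D (a + t *\<^sub>R (y - a)) b))"
    proof -
      have "(\<lambda>t. ((y - a) \<bullet> b) * ?D (a + t *\<^sub>R (y - a)) b) integrable_on cbox 0 1" for b
        by (intro integrable_continuous continuous_intros continuous_on_compose2[OF cD])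
          (use y in \<open>auto simp del: cbox_interval mem_ball intro: ray_in_ball\<close>)
      then show ?thesis by (simp only: integral_sum[OF finite_onb] integral_mult_right)
    qed
    ultimately show ?thesis by (simp add: G_def ray_moment_def)
  qed
  with G Ga show ?thesis by (intro exI[of _ G]) blast
qed

section \<open>Smooth maps on manifolds\<close>

text \<open>The chart conditions are separated from the topological ones because the Hausdorff
  property of the jet and product atlases is deduced from continuity of their projections, which
  already relies on the charts.\<close>

definition charted :: "('m, 'e::finite_dim_inner) atlas \<Rightarrow> bool"
  where "charted A \<longleftrightarrow>
    (\<forall>(U, \<phi>)\<in>A. inj_on \<phi> U \<and> open (\<phi> ` U)) \<and>
    (\<forall>(U, \<phi>)\<in>A. \<forall>(V, \<psi>)\<in>A. open (\<phi> ` (U \<inter> V)) \<and>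
       smooth_on (\<phi> ` (U \<inter> V)) (\<psi> \<circ> inv_into U \<phi>))"

text \<open>Second countability is dropped: it is needed only for the submanifold, not for the auxiliary manifolds.\<close>

definition hmanifold :: "('m, 'e::finite_dim_inner) atlas \<Rightarrow> bool"
  where "hmanifold A \<longleftrightarrow> charted A \<and> Hausdorff_space (atlas_topology A)"

definition smooth_in :: "('m, 'e::finite_dim_inner) atlas \<Rightarrow> 'm set \<Rightarrow> ('m \<Rightarrow> 'b::real_normed_vector) \<Rightarrow> bool"
  where "smooth_in A S f \<longleftrightarrow> (\<forall>(U, \<phi>)\<in>A. smooth_on (\<phi> ` (U \<inter> S)) (\<lambda>y. f (inv_into U \<phi> y)))"

abbreviation aopen :: "('m, 'e::finite_dim_inner) atlas \<Rightarrow> 'm set \<Rightarrow> bool"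
  where "aopen A \<equiv> openin (atlas_topology A)"

lemma manifold_iff: "manifold A \<longleftrightarrow> hmanifold A \<and> second_countable (atlas_topology A)"
  by (auto simp: manifold_def hmanifold_def charted_def)

lemma chartedD:
  assumes "charted A" "(U, \<phi>) \<in> A"
  shows "inj_on \<phi> U" "open (\<phi> ` U)"
    and "(V, \<psi>) \<in> A \<Longrightarrow> open (\<phi> ` (U \<inter> V))"
    and "(V, \<psi>) \<in> A \<Longrightarrow> smooth_on (\<phi> ` (U \<inter> V)) (\<lambda>y. \<psi> (inv_into U \<phi> y))"
  using assms unfolding charted_def by (fastforce simp: o_def)+

lemma hmanifold_charted: "hmanifold A \<Longrightarrow> charted A"
  by (simp add: hmanifold_def)

lemma topspace_atlas [simp]: "topspace (atlas_topology A) = points A"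
proof -
  have "\<Union>{U \<inter> \<phi> -` V |U \<phi> V. (U, \<phi>) \<in> A \<and> open V} = points A"
  proof
    show "points A \<subseteq> \<Union>{U \<inter> \<phi> -` V |U \<phi> V. (U, \<phi>) \<in> A \<and> open V}"
    proof
      fix x assume "x \<in> points A"
      then obtain U \<phi> where "(U, \<phi>) \<in> A" "x \<in> U" by (auto simp: points_def)
      then have "U \<inter> \<phi> -` UNIV \<in> {U \<inter> \<phi> -` V |U \<phi> V. (U, \<phi>) \<in> A \<and> open V}" "x \<in> U \<inter> \<phi> -` UNIV"
        by blast+
      then show "x \<in> \<Union>{U \<inter> \<phi> -` V |U \<phi> V. (U, \<phi>) \<in> A \<and> open V}" by blast
    qed
  qed (auto simp: points_def)
  then show ?thesis by (simp add: atlas_topology_def topology_generated_by_topspace)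
qed

lemma chart_subset_points: "(U, \<phi>) \<in> A \<Longrightarrow> U \<subseteq> points A"
  by (auto simp: points_def)

lemma pointsE:
  assumes "x \<in> points A" obtains U \<phi> where "(U, \<phi>) \<in> A" "x \<in> U"
  using assms by (auto simp: points_def)

lemma aopen_imp_subset: "aopen A S \<Longrightarrow> S \<subseteq> points A"
  using openin_subset by fastforce

lemma aopenE:
  assumes "aopen A S" "x \<in> S" obtains U \<phi> where "(U, \<phi>) \<in> A" "x \<in> U"
  using pointsE[OF subsetD[OF aopen_imp_subset[OF assms(1)] assms(2)]] .

lemma aopen_chart_vimage:
  "(U, \<phi>) \<in> A \<Longrightarrow> open T \<Longrightarrow> aopen A (U \<inter> \<phi> -` T)"
  unfolding atlas_topology_def by (intro topology_generated_by_Basis) blast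

lemma inv_chart: "charted A \<Longrightarrow> (U, \<phi>) \<in> A \<Longrightarrow> x \<in> U \<Longrightarrow> inv_into U \<phi> (\<phi> x) = x"
  by (rule inv_into_f_f[OF chartedD(1)])

lemma chart_image_vimage:
  assumes "charted A" "(U, \<phi>) \<in> A" "S \<subseteq> U"
  shows "\<phi> ` (S \<inter> g -` T) = \<phi> ` S \<inter> (\<lambda>y. g (inv_into U \<phi> y)) -` T"
  using assms inv_chart[OF assms(1,2)] by (auto simp: subset_iff image_iff)

text \<open>Transition maps are continuous, so the generating sets have open images in every chart;
  injectivity of the charts carries this through intersections. Conversely a set that passes the
  test is a union of chart preimages.\<close>

lemma aopen_iff:
  assumes A: "charted A"
  shows "aopen A S \<longleftrightarrow> S \<subseteq> points A \<and> (\<forall>(U, \<phi>)\<in>A. open (\<phi> ` (U \<inter> S)))"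
proof
  assume S: "aopen A S"
  have "open (\<phi> ` (U \<inter> S))" if U: "(U, \<phi>) \<in> A" for U \<phi>
    using S unfolding atlas_topology_def openin_topology_generated_by_iff
  proof (induction rule: generate_topology_on.induct)
    case Empty
    then show ?case by simp
  next
    case (Int a b)
    have "\<phi> ` (U \<inter> (a \<inter> b)) = \<phi> ` (U \<inter> a) \<inter> \<phi> ` (U \<inter> b)"
      using chartedD(1)[OF A U] by (auto simp: inj_on_def)
    then show ?case using Int by (simp add: open_Int)
  next
    case (UN K)
    have "\<phi> ` (U \<inter> \<Union>K) = (\<Union>k\<in>K. \<phi> ` (U \<inter> k))" by auto
    then show ?case using UN by auto
  next
    case (Basis s)
    then obtain V \<psi> T where s: "s = V \<inter> \<psi> -` T" "(V, \<psi>) \<in> A" "open T" by auto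
    have "\<phi> ` (U \<inter> s) = \<phi> ` (U \<inter> V) \<inter> (\<lambda>y. \<psi> (inv_into U \<phi> y)) -` T"
      using chart_image_vimage[OF A U, of "U \<inter> V" \<psi> T] s(1) by (simp add: Int_assoc)
    moreover have "continuous_on (\<phi> ` (U \<inter> V)) (\<lambda>y. \<psi> (inv_into U \<phi> y))"
      using chartedD(4)[OF A U s(2)] by (rule smooth_on_imp_continuous_on)
    ultimately show ?case
      using continuous_open_preimage[OF _ chartedD(3)[OF A U s(2)] s(3)] by simp
  qed
  then show "S \<subseteq> points A \<and> (\<forall>(U, \<phi>)\<in>A. open (\<phi> ` (U \<inter> S)))"
    using aopen_imp_subset[OF S] by auto
next
  assume S: "S \<subseteq> points A \<and> (\<forall>(U, \<phi>)\<in>A. open (\<phi> ` (U \<inter> S)))"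
  have "\<exists>T. aopen A T \<and> x \<in> T \<and> T \<subseteq> S" if x: "x \<in> S" for x
  proof -
    obtain U \<phi> where U: "(U, \<phi>) \<in> A" "x \<in> U" by (rule pointsE[OF subsetD[OF conjunct1[OF S] x]])
    have "open (\<phi> ` (U \<inter> S))" using bspec[OF conjunct2[OF S] U(1)] by simp
    then have "aopen A (U \<inter> \<phi> -` (\<phi> ` (U \<inter> S)))"
      by (rule aopen_chart_vimage[OF U(1)])
    moreover have "U \<inter> \<phi> -` (\<phi> ` (U \<inter> S)) = U \<inter> S"
      using chartedD(1)[OF A U(1)] by (auto simp: inj_on_def)
    ultimately show ?thesis using x U by auto
  qed
  then show "aopen A S" by (subst openin_subopen) blast
qed

lemma aopen_chart: "charted A \<Longrightarrow> (U, \<phi>) \<in> A \<Longrightarrow> aopen A U"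
  unfolding aopen_iff using chartedD(3) by (fastforce simp: points_def Int_commute)

lemma aopen_image: "charted A \<Longrightarrow> (U, \<phi>) \<in> A \<Longrightarrow> aopen A S \<Longrightarrow> open (\<phi> ` (U \<inter> S))"
  by (auto simp: aopen_iff)

lemma aopen_points [simp]: "aopen A (points A)"
  by (metis openin_topspace topspace_atlas)

lemma smooth_inD: "smooth_in A S f \<Longrightarrow> (U, \<phi>) \<in> A \<Longrightarrow> smooth_on (\<phi> ` (U \<inter> S)) (\<lambda>y. f (inv_into U \<phi> y))"
  by (auto simp: smooth_in_def)

lemma smooth_inI:
  "(\<And>U \<phi>. (U, \<phi>) \<in> A \<Longrightarrow> smooth_on (\<phi> ` (U \<inter> S)) (\<lambda>y. f (inv_into U \<phi> y))) \<Longrightarrow> smooth_in A S f"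
  by (auto simp: smooth_in_def)

lemma smooth_in_subset: "smooth_in A S f \<Longrightarrow> T \<subseteq> S \<Longrightarrow> smooth_in A T f"
  unfolding smooth_in_def by (fastforce intro: smooth_on_subset)

lemma smooth_in_cong:
  assumes "charted A" "aopen A S" "smooth_in A S f" "\<And>x. x \<in> S \<Longrightarrow> f x = g x"
  shows "smooth_in A S g"
proof (rule smooth_inI)
  fix U \<phi> assume U: "(U, \<phi>) \<in> A"
  show "smooth_on (\<phi> ` (U \<inter> S)) (\<lambda>y. g (inv_into U \<phi> y))"
    by (rule smooth_on_cong[OF aopen_image[OF assms(1) U assms(2)] smooth_inD[OF assms(3) U]])
      (auto simp: inv_chart[OF assms(1) U] assms(4))
qed

lemma smooth_in_local:
  assumes A: "charted A" and "\<And>x. x \<in> S \<Longrightarrow> \<exists>T. aopen A T \<and> x \<in> T \<and> smooth_in A T f"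
  shows "smooth_in A S f"
proof (rule smooth_inI, rule smooth_on_local)
  fix U \<phi> y assume U: "(U, \<phi>) \<in> A" and "y \<in> \<phi> ` (U \<inter> S)"
  then obtain x where x: "x \<in> U" "x \<in> S" "y = \<phi> x" by auto
  then obtain T where "aopen A T" "x \<in> T" "smooth_in A T f" using assms by blast
  then show "\<exists>T. open T \<and> y \<in> T \<and> smooth_on T (\<lambda>y. f (inv_into U \<phi> y))"
    using x by (intro exI[of _ "\<phi> ` (U \<inter> T)"]) (auto intro: aopen_image[OF A U] smooth_inD[OF _ U])
qed

lemma smooth_in_chartI:
  assumes A: "charted A" and U: "(U, \<phi>) \<in> A" and S: "aopen A S" "S \<subseteq> U"
    and f: "smooth_on (\<phi> ` S) (\<lambda>y. f (inv_into U \<phi> y))"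
  shows "smooth_in A S f"
proof (rule smooth_inI)
  fix V \<psi> assume V: "(V, \<psi>) \<in> A"
  have o: "open (\<psi> ` (V \<inter> S))" "open (\<phi> ` S)"
    using aopen_image[OF A V S(1)] aopen_image[OF A U S(1)] S(2) by (simp_all add: Int_absorb1)
  have sm: "smooth_on (\<psi> ` (V \<inter> S)) (\<lambda>y. \<phi> (inv_into V \<psi> y))"
    using chartedD(4)[OF A V U] by (rule smooth_on_subset) (use S in auto)
  have "smooth_on (\<psi> ` (V \<inter> S)) (\<lambda>y. f (inv_into U \<phi> (\<phi> (inv_into V \<psi> y))))"
    by (rule smooth_on_compose[OF o _ sm f]) (auto simp: inv_chart[OF A V])
  then show "smooth_on (\<psi> ` (V \<inter> S)) (\<lambda>y. f (inv_into V \<psi> y))"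
    by (rule smooth_on_cong[OF o(1)]) (use S in \<open>auto simp: inv_chart[OF A V] inv_chart[OF A U]\<close>)
qed

lemma smooth_in_chart: "charted A \<Longrightarrow> (U, \<phi>) \<in> A \<Longrightarrow> smooth_in A U \<phi>"
  by (rule smooth_inI) (rule chartedD(4))

lemma smooth_in_compose:
  fixes f :: "'m \<Rightarrow> 'b::finite_dim_inner"
  assumes A: "charted A" and S: "aopen A S" and f: "smooth_in A S f"
    and T: "open T" "f ` S \<subseteq> T" and g: "smooth_on T g"
  shows "smooth_in A S (\<lambda>x. g (f x))"
proof (rule smooth_inI)
  fix U \<phi> assume U: "(U, \<phi>) \<in> A"
  show "smooth_on (\<phi> ` (U \<inter> S)) (\<lambda>y. g (f (inv_into U \<phi> y)))"
    by (rule smooth_on_compose[OF aopen_image[OF A U S] T(1) _ smooth_inD[OF f U] g])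
      (use T(2) in \<open>auto simp: inv_chart[OF A U]\<close>)
qed

lemma smooth_in_const [simp]: "smooth_in A S (\<lambda>_. c)"
  by (simp add: smooth_in_def)

context
  fixes A :: "('m, 'e::finite_dim_inner) atlas" and S
  assumes A: "charted A" and S: "aopen A S"
begin

lemma smooth_in_bounded_linear: "bounded_linear L \<Longrightarrow> smooth_in A S f \<Longrightarrow> smooth_in A S (\<lambda>x. L (f x))"
  using smooth_on_bounded_linear_comp[OF aopen_image[OF A _ S]] by (fastforce simp: smooth_in_def)

lemma smooth_in_bilinear:
  "bounded_bilinear p \<Longrightarrow> smooth_in A S f \<Longrightarrow> smooth_in A S g \<Longrightarrow> smooth_in A S (\<lambda>x. p (f x) (g x))"
  using smooth_on_bilinear[OF aopen_image[OF A _ S]] by (fastforce simp: smooth_in_def)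

lemmas smooth_in_mult = smooth_in_bilinear[OF bounded_bilinear_mult]
lemmas smooth_in_scaleR = smooth_in_bilinear[OF bounded_bilinear_scaleR]
lemmas smooth_in_inner = smooth_in_bilinear[OF bounded_bilinear_inner]
lemma smooth_in_add: "smooth_in A S f \<Longrightarrow> smooth_in A S g \<Longrightarrow> smooth_in A S (\<lambda>x. f x + g x)"
  by (intro smooth_inI smooth_on_add aopen_image[OF A _ S]) (auto dest: smooth_inD)

lemma smooth_in_diff: "smooth_in A S f \<Longrightarrow> smooth_in A S g \<Longrightarrow> smooth_in A S (\<lambda>x. f x - g x)"
  by (intro smooth_inI smooth_on_diff aopen_image[OF A _ S]) (auto dest: smooth_inD)

lemma smooth_in_Pair: "smooth_in A S f \<Longrightarrow> smooth_in A S g \<Longrightarrow> smooth_in A S (\<lambda>x. (f x, g x))"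
  by (intro smooth_inI smooth_on_Pair aopen_image[OF A _ S]) (auto dest: smooth_inD)

lemma smooth_in_sum:
  "(\<And>i. i \<in> I \<Longrightarrow> smooth_in A S (f i)) \<Longrightarrow> smooth_in A S (\<lambda>x. \<Sum>i\<in>I. f i x)"
  by (intro smooth_inI smooth_on_sum aopen_image[OF A _ S]) (auto dest: smooth_inD)

lemma smooth_in_divide:
  fixes f :: "'m \<Rightarrow> real"
  assumes "smooth_in A S f" "smooth_in A S g" "\<And>x. x \<in> S \<Longrightarrow> g x \<noteq> 0"
  shows "smooth_in A S (\<lambda>x. f x / g x)"
  by (intro smooth_inI smooth_on_divide aopen_image[OF A _ S])
    (use assms in \<open>auto dest: smooth_inD simp: inv_chart[OF A]\<close>)

lemma smooth_in_vimage_open: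
  assumes f: "smooth_in A S f" and T: "open T"
  shows "aopen A (S \<inter> f -` T)"
  unfolding aopen_iff[OF A]
proof (intro conjI ballI)
  show "S \<inter> f -` T \<subseteq> points A" using aopen_imp_subset[OF S] by auto
  fix c assume "c \<in> A"
  then obtain U \<phi> where U: "(U, \<phi>) \<in> A" "c = (U, \<phi>)" by (cases c) auto
  have "open (\<phi> ` (U \<inter> S) \<inter> (\<lambda>y. f (inv_into U \<phi> y)) -` T)"
    by (rule continuous_open_preimage[OF smooth_on_imp_continuous_on[OF smooth_inD[OF f U(1)]]
          aopen_image[OF A U(1) S] T])
  then have "open (\<phi> ` (U \<inter> S \<inter> f -` T))"
    by (simp add: chart_image_vimage[OF A U(1), of "U \<inter> S"])
  then show "case c of (U, \<phi>) \<Rightarrow> open (\<phi> ` (U \<inter> (S \<inter> f -` T)))"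
    by (simp add: U Int_assoc)
qed

end

section \<open>Smooth maps between manifolds and pullback of functions\<close>

lemma smooth_map_points: "smooth_map A A' g \<Longrightarrow> x \<in> points A \<Longrightarrow> g x \<in> points A'"
  by (auto simp: smooth_map_def)

lemma smooth_mapD:
  assumes "smooth_map A A' g" and A: "charted A" and V: "(V, \<psi>) \<in> A'"
  shows "aopen A (points A \<inter> g -` V)" "smooth_in A (points A \<inter> g -` V) (\<lambda>x. \<psi> (g x))"
proof -
  have *: "U \<inter> (points A \<inter> g -` V) = U \<inter> g -` V" if "(U, \<phi>) \<in> A" for U \<phi>
    using chart_subset_points[OF that] by auto
  have "open (\<phi> ` (U \<inter> g -` V)) \<and> smooth_on (\<phi> ` (U \<inter> g -` V)) (\<lambda>y. \<psi> (g (inv_into U \<phi> y)))"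
    if "(U, \<phi>) \<in> A" for U \<phi>
    using assms(1) that V unfolding smooth_map_def by (fastforce simp: o_def)
  then show "aopen A (points A \<inter> g -` V)" "smooth_in A (points A \<inter> g -` V) (\<lambda>x. \<psi> (g x))"
    by (auto simp: aopen_iff[OF A] smooth_in_def *)
qed

lemma smooth_mapI':
  assumes A: "charted A" and "\<And>x. x \<in> points A \<Longrightarrow> g x \<in> points A'"
    and "\<And>V \<psi>. (V, \<psi>) \<in> A' \<Longrightarrow> aopen A (points A \<inter> g -` V)"
    and "\<And>V \<psi>. (V, \<psi>) \<in> A' \<Longrightarrow> smooth_in A (points A \<inter> g -` V) (\<lambda>x. \<psi> (g x))"
  shows "smooth_map A A' g"
proof -
  have *: "U \<inter> (points A \<inter> g -` V) = U \<inter> g -` V" if "(U, \<phi>) \<in> A" for U \<phi> V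
    using chart_subset_points[OF that] by auto
  have "open (\<phi> ` (U \<inter> g -` V)) \<and> smooth_on (\<phi> ` (U \<inter> g -` V)) (\<psi> \<circ> g \<circ> inv_into U \<phi>)"
    if U: "(U, \<phi>) \<in> A" and V: "(V, \<psi>) \<in> A'" for U \<phi> V \<psi>
    using aopen_image[OF A U assms(3)[OF V]] smooth_inD[OF assms(4)[OF V] U] by (simp add: *[OF U] o_def)
  then show ?thesis using assms(2) by (auto simp: smooth_map_def)
qed

text \<open>Coordinates in another target chart \<open>V\<close> arise by a smooth transition on the
  set \<open>N\<close> of points whose images lie in both charts. Injectivity of
  \<open>\<psi>'\<close> allows \<open>N\<close> to be cut out by coordinates alone, as an open set,
  so one target chart around each image point decides.\<close>

lemma smooth_mapI:
  assumes A: "charted A" and A': "charted A'"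
    and loc: "\<And>x. x \<in> points A \<Longrightarrow> \<exists>V \<psi> T. (V, \<psi>) \<in> A' \<and> aopen A T \<and> x \<in> T \<and> g ` T \<subseteq> V \<and>
      smooth_in A T (\<lambda>x. \<psi> (g x))"
  shows "smooth_map A A' g"
proof (rule smooth_mapI'[OF A])
  show "g x \<in> points A'" if "x \<in> points A" for x
    using loc[OF that] chart_subset_points by fast
  fix V \<psi> assume V: "(V, \<psi>) \<in> A'"
  have *: "\<exists>T. aopen A T \<and> x \<in> T \<and> T \<subseteq> points A \<inter> g -` V \<and> smooth_in A T (\<lambda>x. \<psi> (g x))"
    if x: "x \<in> points A \<inter> g -` V" for x
  proof -
    obtain V' \<psi>' T where T: "(V', \<psi>') \<in> A'" "aopen A T" "x \<in> T" "g ` T \<subseteq> V'"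
      "smooth_in A T (\<lambda>x. \<psi>' (g x))"
      using loc[of x] x by blast
    define N where "N = T \<inter> (\<lambda>x. \<psi>' (g x)) -` (\<psi>' ` (V' \<inter> V))"
    have oV: "open (\<psi>' ` (V' \<inter> V))" by (rule chartedD(3)[OF A' T(1) V])
    have N: "aopen A N"
      unfolding N_def by (rule smooth_in_vimage_open[OF A T(2,5) oV])
    have gN: "g y \<in> V' \<inter> V" if y: "y \<in> N" for y
    proof -
      obtain z where z: "z \<in> V' \<inter> V" "\<psi>' (g y) = \<psi>' z" using y by (auto simp: N_def)
      have "g y \<in> V'" using y T(4) by (auto simp: N_def)
      then have "g y = z" using chartedD(1)[OF A' T(1)] z by (auto simp: inj_on_def)
      then show ?thesis using z by simp
    qed
    have "smooth_in A N (\<lambda>x. \<psi> (inv_into V' \<psi>' (\<psi>' (g x))))"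
      by (rule smooth_in_compose[OF A N smooth_in_subset[OF T(5)] oV _ chartedD(4)[OF A' T(1) V]])
        (auto simp: N_def)
    then have "smooth_in A N (\<lambda>x. \<psi> (g x))"
      by (rule smooth_in_cong[OF A N]) (use gN inv_chart[OF A' T(1)] in auto)
    moreover have "x \<in> N" using x T by (auto simp: N_def)
    moreover have "N \<subseteq> points A \<inter> g -` V" using gN aopen_imp_subset[OF N] by auto
    ultimately show ?thesis using N by blast
  qed
  show "aopen A (points A \<inter> g -` V)" by (subst openin_subopen) (use * in blast)
  show "smooth_in A (points A \<inter> g -` V) (\<lambda>x. \<psi> (g x))" by (rule smooth_in_local[OF A]) (use * in blast)
qed

lemma smooth_map_aopen_vimage:
  assumes g: "smooth_map A A' g" and A: "charted A" "charted A'" and T: "aopen A' T"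
  shows "aopen A (points A \<inter> g -` T)"
proof (subst openin_subopen, intro ballI)
  fix x assume x: "x \<in> points A \<inter> g -` T"
  then have "g x \<in> T" by simp
  then obtain V \<psi> where V: "(V, \<psi>) \<in> A'" "g x \<in> V" by (rule aopenE[OF T])
  let ?W = "points A \<inter> g -` V"
  have "aopen A (?W \<inter> (\<lambda>x. \<psi> (g x)) -` (\<psi> ` (V \<inter> T)))"
    by (rule smooth_in_vimage_open[OF A(1) smooth_mapD[OF g A(1) V(1)] aopen_image[OF A(2) V(1) T]])
  moreover have "?W \<inter> (\<lambda>x. \<psi> (g x)) -` (\<psi> ` (V \<inter> T)) \<subseteq> points A \<inter> g -` T"
    using chartedD(1)[OF A(2) V(1)] by (auto simp: inj_on_def)
  ultimately show "\<exists>N. aopen A N \<and> x \<in> N \<and> N \<subseteq> points A \<inter> g -` T"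
    using x V(2) by (intro exI[of _ "?W \<inter> (\<lambda>x. \<psi> (g x)) -` (\<psi> ` (V \<inter> T))"]) auto
qed

lemma smooth_in_pullback:
  assumes g: "smooth_map A A' g" and A: "charted A" "charted A'" and S: "aopen A S"
    and T: "aopen A' T" "g ` S \<subseteq> T" and f: "smooth_in A' T f"
  shows "smooth_in A S (\<lambda>x. f (g x))"
proof (rule smooth_in_local[OF A(1)])
  fix x assume x: "x \<in> S"
  then have "g x \<in> T" using T(2) by auto
  then obtain V \<psi> where V: "(V, \<psi>) \<in> A'" "g x \<in> V" by (rule aopenE[OF T(1)])
  let ?N = "S \<inter> (points A \<inter> g -` V)"
  have N: "aopen A ?N" using S smooth_mapD(1)[OF g A(1) V(1)] by (rule openin_Int)
  have "smooth_in A ?N (\<lambda>x. f (inv_into V \<psi> (\<psi> (g x))))"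
    by (rule smooth_in_compose[OF A(1) N smooth_in_subset[OF smooth_mapD(2)[OF g A(1) V(1)]]
          aopen_image[OF A(2) V(1) T(1)] _ smooth_inD[OF f V(1)]]) (use T(2) in auto)
  then have "smooth_in A ?N (\<lambda>x. f (g x))"
    by (rule smooth_in_cong[OF A(1) N]) (auto simp: inv_chart[OF A(2) V(1)])
  then show "\<exists>T. aopen A T \<and> x \<in> T \<and> smooth_in A T (\<lambda>x. f (g x))"
    using N x V(2) aopen_imp_subset[OF S] by blast
qed

lemma smooth_functions_iff:
  "f \<in> smooth_functions A \<longleftrightarrow> smooth_in A (points A) f \<and> (\<forall>x. x \<notin> points A \<longrightarrow> f x = 0)"
proof -
  have "U \<inter> points A = U" if "(U, \<phi>) \<in> A" for U \<phi> using chart_subset_points[OF that] by auto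
  then show ?thesis by (fastforce simp: smooth_functions_def smooth_in_def o_def)
qed

lemma smooth_functionsD: "f \<in> smooth_functions A \<Longrightarrow> smooth_in A (points A) f"
  "f \<in> smooth_functions A \<Longrightarrow> x \<notin> points A \<Longrightarrow> f x = 0"
  by (auto simp: smooth_functions_iff)

lemma smooth_functions_mult: "charted A \<Longrightarrow> f \<in> smooth_functions A \<Longrightarrow> g \<in> smooth_functions A \<Longrightarrow>
    (\<lambda>x. f x * g x) \<in> smooth_functions A"
  by (auto simp: smooth_functions_iff intro!: smooth_in_mult)

lemma smooth_functions_add: "charted A \<Longrightarrow> f \<in> smooth_functions A \<Longrightarrow> g \<in> smooth_functions A \<Longrightarrow>
    (\<lambda>x. f x + g x) \<in> smooth_functions A"
  by (auto simp: smooth_functions_iff intro!: smooth_in_add)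

lemma smooth_functions_diff: "charted A \<Longrightarrow> f \<in> smooth_functions A \<Longrightarrow> g \<in> smooth_functions A \<Longrightarrow>
    (\<lambda>x. f x - g x) \<in> smooth_functions A"
  by (auto simp: smooth_functions_iff intro!: smooth_in_diff)

lemma smooth_functions_scaleR: "charted A \<Longrightarrow> f \<in> smooth_functions A \<Longrightarrow> (\<lambda>x. c *\<^sub>R f x) \<in> smooth_functions A"
  by (auto simp: smooth_functions_iff intro!: smooth_in_mult)

definition const_fun :: "('m, 'e) atlas \<Rightarrow> real \<Rightarrow> 'm \<Rightarrow> real"
  where "const_fun A c = (\<lambda>x. if x \<in> points A then c else 0)"

lemma const_fun_smooth: "charted A \<Longrightarrow> const_fun A c \<in> smooth_functions A"
  by (auto simp: smooth_functions_iff const_fun_def intro: smooth_in_cong[OF _ aopen_points smooth_in_const[of _ _ c]])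

section \<open>Bump functions and tangent vectors\<close>

text \<open>The closed set \<open>C\<close> plays the part of the support: on its complement a
  product with \<rho> is zero, so objects given on \<open>S\<close> extend to the whole
  manifold.\<close>

definition bump :: "('m, 'e::finite_dim_inner) atlas \<Rightarrow> 'm \<Rightarrow> 'm set \<Rightarrow> ('m \<Rightarrow> real) \<Rightarrow> bool"
  where "bump A x S \<rho> \<longleftrightarrow> \<rho> \<in> smooth_functions A \<and>
    (\<exists>N. aopen A N \<and> x \<in> N \<and> N \<subseteq> S \<and> (\<forall>y\<in>N. \<rho> y = 1)) \<and>
    (\<exists>C. closedin (atlas_topology A) C \<and> C \<subseteq> S \<and> (\<forall>y. y \<notin> C \<longrightarrow> \<rho> y = 0))"

lemma continuous_map_inv_chart:
  assumes A: "charted A" and U: "(U, \<phi>) \<in> A"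
  shows "continuous_map (top_of_set (\<phi> ` U)) (atlas_topology A) (inv_into U \<phi>)"
  unfolding continuous_map
proof (intro conjI allI impI)
  show "inv_into U \<phi> ` topspace (top_of_set (\<phi> ` U)) \<subseteq> topspace (atlas_topology A)"
    using inv_chart[OF A U] chart_subset_points[OF U] by auto
  fix S assume S: "aopen A S"
  have "{x \<in> \<phi> ` U. inv_into U \<phi> x \<in> S} = \<phi> ` (U \<inter> S)"
    using inv_chart[OF A U] by auto
  then show "openin (top_of_set (\<phi> ` U)) {x \<in> topspace (top_of_set (\<phi> ` U)). inv_into U \<phi> x \<in> S}"
    using open_subset[OF _ aopen_image[OF A U S], of "\<phi> ` U"] by auto
qed

text \<open>Here the Hausdorff property enters: the part of the chart over a compact ball is
  compact, hence closed, so that extension by 0 is smooth.\<close>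

lemma bump_exists:
  assumes A: "hmanifold A" and S: "aopen A S" "x \<in> S"
  obtains \<rho> where "bump A x S \<rho>"
proof -
  note ch = hmanifold_charted[OF A]
  obtain U \<phi> where U: "(U, \<phi>) \<in> A" "x \<in> U" by (rule aopenE[OF S])
  obtain e where e: "e > 0" "ball (\<phi> x) e \<subseteq> \<phi> ` (U \<inter> S)"
    using aopen_image[OF ch U(1) S(1)] S(2) U(2) by (metis IntI imageI openE)
  \<comment> \<open>The radius is \<open>e / 2\<close> in order that even the closed ball stays
    inside the chart image of \<open>U \<inter> S\<close>.\<close>
  obtain h where h: "smooth_on UNIV h" "\<And>y. dist (\<phi> x) y < e / 2 / 2 \<Longrightarrow> h y = 1"
    "\<And>y. dist (\<phi> x) y \<ge> e / 2 \<Longrightarrow> h y = (0::real)"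
    using smooth_bump[of "e / 2" "\<phi> x"] e(1) by auto
  define \<rho> where "\<rho> = (\<lambda>y. if y \<in> U then h (\<phi> y) else 0)"
  define C where "C = inv_into U \<phi> ` cball (\<phi> x) (e / 2)"
  have sub: "cball (\<phi> x) (e / 2) \<subseteq> \<phi> ` (U \<inter> S)" using e by (auto simp: subset_iff)
  have "compactin (atlas_topology A) C"
    unfolding C_def
    by (rule image_compactin[OF _ continuous_map_inv_chart[OF ch U(1)]])
      (use sub in \<open>auto simp: compactin_subtopology\<close>)
  then have C: "closedin (atlas_topology A) C"
    using A by (simp add: compactin_imp_closedin hmanifold_def)
  have CS: "C \<subseteq> U \<inter> S"
  proof
    fix y assume "y \<in> C"
    then obtain z where z: "z \<in> cball (\<phi> x) (e / 2)" "y = inv_into U \<phi> z" by (auto simp: C_def)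
    then obtain w where "w \<in> U \<inter> S" "z = \<phi> w" using sub by blast
    then show "y \<in> U \<inter> S" using z inv_chart[OF ch U(1)] by auto
  qed
  have off: "\<rho> y = 0" if "y \<notin> C" for y
  proof (cases "y \<in> U")
    case True
    then have "\<phi> y \<notin> cball (\<phi> x) (e / 2)" using that inv_chart[OF ch U(1)] by (force simp: C_def)
    then show ?thesis using h(3) by (simp add: \<rho>_def)
  qed (simp add: \<rho>_def)
  have "smooth_in A (points A) \<rho>"
  proof (rule smooth_in_local[OF ch])
    fix y assume y: "y \<in> points A"
    show "\<exists>T. aopen A T \<and> y \<in> T \<and> smooth_in A T \<rho>"
    proof (cases "y \<in> C")
      case True
      have "smooth_in A U (\<lambda>y. h (\<phi> y))"
        by (rule smooth_in_compose[OF ch aopen_chart[OF ch U(1)] smooth_in_chart[OF ch U(1)] open_UNIV _ h(1)]) simp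
      then have "smooth_in A U \<rho>" by (rule smooth_in_cong[OF ch aopen_chart[OF ch U(1)]]) (simp add: \<rho>_def)
      then show ?thesis using True CS aopen_chart[OF ch U(1)] by blast
    next
      case False
      have o: "aopen A (points A - C)" using C openin_diff[OF aopen_points C] by simp
      have "smooth_in A (points A - C) \<rho>"
        by (rule smooth_in_cong[OF ch o smooth_in_const[of _ _ 0]]) (simp add: off)
      then show ?thesis using False y o by blast
    qed
  qed
  moreover have "\<rho> y = 0" if "y \<notin> points A" for y
    using that chart_subset_points[OF U(1)] by (auto simp: \<rho>_def)
  moreover define N where "N = U \<inter> \<phi> -` ball (\<phi> x) (e / 4)"
  have "aopen A N" unfolding N_def by (rule aopen_chart_vimage[OF U(1) open_ball])
  moreover have "x \<in> N" "\<forall>y\<in>N. \<rho> y = 1" using U(2) e(1) h(2) by (auto simp: N_def \<rho>_def)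
  moreover have "N \<subseteq> S"
  proof
    fix y assume y: "y \<in> N"
    then have "\<phi> y \<in> \<phi> ` (U \<inter> S)" using e by (auto simp: N_def subset_iff)
    then show "y \<in> S" using y chartedD(1)[OF ch U(1)] by (auto simp: N_def inj_on_def)
  qed
  ultimately have "bump A x S \<rho>"
    using C CS off unfolding bump_def smooth_functions_iff by blast
  then show thesis by (rule that)
qed

lemma bump_smooth: "bump A x S \<rho> \<Longrightarrow> \<rho> \<in> smooth_functions A"
  by (simp add: bump_def)

lemma bumpE:
  assumes "bump A x S \<rho>"
  obtains N where "aopen A N" "x \<in> N" "N \<subseteq> S" "\<And>y. y \<in> N \<Longrightarrow> \<rho> y = 1"
  using assms by (auto simp: bump_def)

lemma bump_off: "bump A x S \<rho> \<Longrightarrow> y \<notin> S \<Longrightarrow> \<rho> y = 0"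
  by (auto simp: bump_def)

lemma bump_at: "bump A x S \<rho> \<Longrightarrow> \<rho> x = 1"
  by (auto simp: bump_def)

text \<open>The product is smooth on \<open>S\<close> and zero on the complement of
  \<open>C\<close>; these two open sets cover the manifold.\<close>

lemma bump_scaleR_smooth:
  fixes f :: "'m \<Rightarrow> 'b::real_normed_vector"
  assumes A: "charted A" and b: "bump A x S \<rho>" and S: "aopen A S" and f: "smooth_in A S f"
  shows "smooth_in A (points A) (\<lambda>y. \<rho> y *\<^sub>R f y)"
proof (rule smooth_in_local[OF A])
  fix y assume y: "y \<in> points A"
  obtain C where C: "closedin (atlas_topology A) C" "C \<subseteq> S" "\<And>y. y \<notin> C \<Longrightarrow> \<rho> y = 0"
    using b by (auto simp: bump_def)
  show "\<exists>T. aopen A T \<and> y \<in> T \<and> smooth_in A T (\<lambda>y. \<rho> y *\<^sub>R f y)"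
  proof (cases "y \<in> C")
    case True
    have "smooth_in A S (\<lambda>y. \<rho> y *\<^sub>R f y)"
      using smooth_functionsD(1)[OF bump_smooth[OF b]] aopen_imp_subset[OF S]
      by (intro smooth_in_scaleR[OF A S _ f]) (rule smooth_in_subset)
    then show ?thesis using True C S by blast
  next
    case False
    have o: "aopen A (points A - C)" using openin_diff[OF aopen_points C(1)] by simp
    have "smooth_in A (points A - C) (\<lambda>y. \<rho> y *\<^sub>R f y)"
      by (rule smooth_in_cong[OF A o smooth_in_const[of _ _ 0]]) (simp add: C)
    then show ?thesis using False y o by blast
  qed
qed

lemma bump_mult_smooth:
  assumes "charted A" "bump A x S \<rho>" "aopen A S" "smooth_in A S f"
  shows "(\<lambda>y. \<rho> y * f y) \<in> smooth_functions A"
  using bump_scaleR_smooth[OF assms] smooth_functionsD(2)[OF bump_smooth[OF assms(2)]]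
  by (simp add: smooth_functions_iff)

section \<open>Locality of tangent vectors and their coordinates\<close>

lemma tangentD:
  assumes "X \<in> tangent_space A x"
  shows "f \<in> smooth_functions A \<Longrightarrow> g \<in> smooth_functions A \<Longrightarrow> X (\<lambda>y. f y * g y) = f x * X g + X f * g x"
    and "f \<in> smooth_functions A \<Longrightarrow> g \<in> smooth_functions A \<Longrightarrow> X (\<lambda>y. f y + g y) = X f + X g"
    and "f \<in> smooth_functions A \<Longrightarrow> X (\<lambda>y. c * f y) = c * X f"
    and "f \<notin> smooth_functions A \<Longrightarrow> X f = 0"
  using assms by (auto simp: tangent_space_def Hom_def)

text \<open>For a bump function \<rho> in \<open>S\<close> one has
  \<open>f = (1 - \<rho>) f\<close>, and both factors vanish at \<open>x\<close>, so both terms of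
  the Leibniz rule vanish.\<close>

lemma tangent_local_zero:
  assumes A: "hmanifold A" and X: "X \<in> tangent_space A x"
    and S: "aopen A S" "x \<in> S" and f: "f \<in> smooth_functions A" "\<And>y. y \<in> S \<Longrightarrow> f y = 0"
  shows "X f = 0"
proof -
  note ch = hmanifold_charted[OF A]
  obtain \<rho> where b: "bump A x S \<rho>" using bump_exists[OF A S] .
  have 1: "(\<lambda>y. const_fun A 1 y - \<rho> y) \<in> smooth_functions A"
    by (intro smooth_functions_diff ch const_fun_smooth bump_smooth[OF b])
  have "f = (\<lambda>y. (const_fun A 1 y - \<rho> y) * f y)"
  proof
    fix y show "f y = (const_fun A 1 y - \<rho> y) * f y"
      using f(2) bump_off[OF b] smooth_functionsD(2)[OF f(1), of y] by (cases "y \<in> S") (auto simp: const_fun_def)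
  qed
  then have "X f = (const_fun A 1 x - \<rho> x) * X f + X (\<lambda>y. const_fun A 1 y - \<rho> y) * f x"
    using tangentD(1)[OF X 1 f(1)] by metis
  moreover have "const_fun A 1 x = 1" using S aopen_imp_subset by (auto simp: const_fun_def)
  ultimately show ?thesis using f(2)[OF S(2)] bump_at[OF b] by simp
qed

lemma tangent_local:
  assumes A: "hmanifold A" and X: "X \<in> tangent_space A x"
    and S: "aopen A S" "x \<in> S" and f: "f \<in> smooth_functions A" "g \<in> smooth_functions A" "\<And>y. y \<in> S \<Longrightarrow> f y = g y"
  shows "X f = X g"
proof -
  note ch = hmanifold_charted[OF A]
  have g': "(\<lambda>y. (-1) * g y) \<in> smooth_functions A"
    using smooth_functions_scaleR[OF ch f(2), of "-1"] by simp
  have "X (\<lambda>y. f y + (-1) * g y) = 0"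
    by (rule tangent_local_zero[OF A X S smooth_functions_add[OF ch f(1) g']]) (simp add: f(3))
  then show ?thesis using tangentD(2)[OF X f(1) g'] tangentD(3)[OF X f(2), of "-1"] by simp
qed

text \<open>Hadamard's lemma makes the algebraic tangent vectors directional derivatives.\<close>

lemma tangent_coords:
  fixes A :: "('m, 'e::finite_dim_inner) atlas"
  assumes A: "hmanifold A" and X: "X \<in> tangent_space A x" and U: "(U, \<phi>) \<in> A" "x \<in> U"
  obtains v where "\<And>f. f \<in> smooth_functions A \<Longrightarrow>
    X f = frechet_derivative (\<lambda>y. f (inv_into U \<phi> y)) (at (\<phi> x)) v"
proof -
  note ch = hmanifold_charted[OF A]
  have xp: "x \<in> points A" using U chart_subset_points by blast
  obtain r where r: "r > 0" "ball (\<phi> x) r \<subseteq> \<phi> ` U"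
    using chartedD(2)[OF ch U(1)] U(2) by (metis imageI openE)
  define S where "S = U \<inter> \<phi> -` ball (\<phi> x) r"
  have S: "aopen A S" "x \<in> S" "S \<subseteq> U"
    using r(1) U(2) aopen_chart_vimage[OF U(1)] by (auto simp: S_def)
  obtain \<rho> where b: "bump A x S \<rho>" using bump_exists[OF A S(1,2)] .
  \<comment> \<open>Coordinate functions centred at \<open>x\<close> and cut off. The values of
    \<open>X\<close> on them become the components of \<open>v\<close>.\<close>
  define p where "p = (\<lambda>b y. \<rho> y * ((\<phi> y - \<phi> x) \<bullet> b))"
  have p: "p b \<in> smooth_functions A" for b
    unfolding p_def
    by (intro bump_mult_smooth[OF ch b S(1)] smooth_in_inner[OF ch S(1)] smooth_in_diff[OF ch S(1)]
        smooth_in_subset[OF smooth_in_chart[OF ch U(1)] S(3)] smooth_in_const)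
  define v where "v = (\<Sum>b\<in>onb. X (p b) *\<^sub>R b)"
  have "X f = frechet_derivative (\<lambda>y. f (inv_into U \<phi> y)) (at (\<phi> x)) v" if f: "f \<in> smooth_functions A" for f
  proof -
    let ?f = "\<lambda>y. f (inv_into U \<phi> y)"
    have sf: "smooth_on (\<phi> ` U) ?f"
      using smooth_inD[OF smooth_functionsD(1)[OF f] U(1)] chart_subset_points[OF U(1)]
      by (simp add: Int_absorb2)
    obtain G where "(\<forall>b. smooth_on (ball (\<phi> x) r) (G b)) \<and>
      (\<forall>b. G b (\<phi> x) = frechet_derivative ?f (at (\<phi> x)) b) \<and>
      (\<forall>y\<in>ball (\<phi> x) r. ?f y = ?f (\<phi> x) + (\<Sum>b\<in>onb. ((y - \<phi> x) \<bullet> b) * G b y))"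
      using hadamard[OF smooth_on_subset[OF sf r(2)] r(1)] ..
    then have G: "\<And>b. smooth_on (ball (\<phi> x) r) (G b)"
      "\<And>b. G b (\<phi> x) = frechet_derivative ?f (at (\<phi> x)) b"
      "\<And>y. y \<in> ball (\<phi> x) r \<Longrightarrow> ?f y = ?f (\<phi> x) + (\<Sum>b\<in>onb. ((y - \<phi> x) \<bullet> b) * G b y)"
      by blast+
    define g where "g = (\<lambda>b y. \<rho> y * G b (\<phi> y))"
    have g: "g b \<in> smooth_functions A" for b
      unfolding g_def
      by (intro bump_mult_smooth[OF ch b S(1)] smooth_in_compose[OF ch S(1) _ open_ball _ G(1)]
          smooth_in_subset[OF smooth_in_chart[OF ch U(1)] S(3)]) (auto simp: S_def)
    have pg: "(\<lambda>y. p b y * g b y) \<in> smooth_functions A" for b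
      by (rule smooth_functions_mult[OF ch p g])
    have sum_smooth: "(\<lambda>y. \<Sum>b\<in>B. p b y * g b y) \<in> smooth_functions A" for B :: "'e set"
      using pg by (auto simp: smooth_functions_iff intro!: smooth_in_sum[OF ch] sum.neutral)
    have X_sum: "X (\<lambda>y. \<Sum>b\<in>B. p b y * g b y) = (\<Sum>b\<in>B. X (\<lambda>y. p b y * g b y))" if "finite B" for B
      using that
    proof induction
      case empty
      then show ?case using tangentD(3)[OF X const_fun_smooth[OF ch], of 0] by simp
    next
      case (insert b B)
      then show ?case using tangentD(2)[OF X pg sum_smooth] by simp
    qed
    have c: "(\<lambda>y. f x * const_fun A 1 y) \<in> smooth_functions A"
      using smooth_functions_scaleR[OF ch const_fun_smooth[OF ch]] by simp
    obtain N where N: "aopen A N" "x \<in> N" "N \<subseteq> S" "\<And>y. y \<in> N \<Longrightarrow> \<rho> y = 1" using bumpE[OF b] by blast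
    \<comment> \<open>By Hadamard's formula \<open>f\<close> agrees near \<open>x\<close> with a
      constant plus products of \<open>p b\<close> and \<open>g b\<close>. As \<open>p b\<close>
      vanishes at \<open>x\<close>, the Leibniz rule leaves \<open>X (p b)\<close> times a
      directional derivative of \<open>f\<close>.\<close>
    have "X f = X (\<lambda>y. f x * const_fun A 1 y + (\<Sum>b\<in>onb. p b y * g b y))"
    proof (rule tangent_local[OF A X N(1,2) f])
      show "(\<lambda>y. f x * const_fun A 1 y + (\<Sum>b\<in>onb. p b y * g b y)) \<in> smooth_functions A"
        by (rule smooth_functions_add[OF ch c sum_smooth])
      fix y assume y: "y \<in> N"
      then have yU: "y \<in> U" "\<phi> y \<in> ball (\<phi> x) r" "y \<in> points A"
        using N(3) S(3) chart_subset_points[OF U(1)] by (auto simp: S_def)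
      show "f y = f x * const_fun A 1 y + (\<Sum>b\<in>onb. p b y * g b y)"
        using G(3)[OF yU(2)] inv_chart[OF ch U(1)] yU U(2) N(4)[OF y] by (simp add: const_fun_def p_def g_def)
    qed
    also have "\<dots> = f x * X (const_fun A 1) + (\<Sum>b\<in>onb. X (\<lambda>y. p b y * g b y))"
      using tangentD(2)[OF X c sum_smooth] tangentD(3)[OF X const_fun_smooth[OF ch]] X_sum[OF finite_onb] by simp
    also have "X (const_fun A 1) = 0"
    proof -
      have "(\<lambda>y. const_fun A 1 y * const_fun A 1 y) = const_fun A 1" by (auto simp: const_fun_def)
      then show ?thesis
        using tangentD(1)[OF X const_fun_smooth[OF ch] const_fun_smooth[OF ch], of 1 1] xp
        by (simp add: const_fun_def)
    qed
    also have "(\<Sum>b\<in>onb. X (\<lambda>y. p b y * g b y)) = (\<Sum>b\<in>onb. X (p b) * frechet_derivative ?f (at (\<phi> x)) b)"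
      using bump_at[OF b] by (simp add: tangentD(1)[OF X p g]) (simp add: G(2)[symmetric] p_def g_def)
    also have "(\<Sum>b\<in>onb. X (p b) * frechet_derivative ?f (at (\<phi> x)) b) = frechet_derivative ?f (at (\<phi> x)) v"
    proof -
      have "linear (frechet_derivative ?f (at (\<phi> x)))"
        using smooth_on_differentiable[OF sf] U(2) by (intro linear_frechet_derivative) auto
      then show ?thesis by (simp add: v_def linear_sum linear_scale)
    qed
    finally show ?thesis by simp
  qed
  then show thesis by (rule that)
qed

section \<open>Line bundles, sections and derivations\<close>

text \<open>The bundles over the jet manifolds, the base product and the jet lift are all used in
  this form; their transition functions are smooth in the sense of \<open>smooth_in\<close>.\<close>

definition hline_bundle :: "('m, 'e::finite_dim_inner, 'v::real_vector) line_bundle \<Rightarrow> bool"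
  where "hline_bundle L \<longleftrightarrow> hmanifold (base L) \<and>
    (\<forall>x\<in>points (base L). subspace (fibre L x)) \<and>
    (\<Union>(W, \<tau>)\<in>trivs L. W) = points (base L) \<and>
    (\<forall>(W, \<tau>)\<in>trivs L. aopen (base L) W \<and> (\<forall>x\<in>W. linear_iso (fibre L x) UNIV (\<tau> x))) \<and>
    (\<forall>(W, \<tau>)\<in>trivs L. \<forall>(W', \<tau>')\<in>trivs L.
       smooth_in (base L) (W \<inter> W') (\<lambda>x. \<tau>' x (inv_into (fibre L x) (\<tau> x) 1)))"

lemma line_bundle_imp_hline_bundle: "line_bundle L \<Longrightarrow> hline_bundle L"
  unfolding line_bundle_def hline_bundle_def manifold_iff smooth_in_def
  by (simp add: o_def Int_assoc case_prod_beta)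

lemma linear_iso_inv:
  assumes "linear_iso V W h"
  shows "w \<in> W \<Longrightarrow> h (inv_into V h w) = w" "w \<in> W \<Longrightarrow> inv_into V h w \<in> V"
    "v \<in> V \<Longrightarrow> inv_into V h (h v) = v" "v \<in> V \<Longrightarrow> h v \<in> W"
  using assms unfolding linear_iso_def bij_betw_def
  by (auto simp: f_inv_into_f inv_into_into)

lemma linear_isoD:
  assumes "linear_iso V W h"
  shows "u \<in> V \<Longrightarrow> v \<in> V \<Longrightarrow> h (u + v) = h u + h v" "v \<in> V \<Longrightarrow> h (c *\<^sub>R v) = c *\<^sub>R h v"
  using assms unfolding linear_iso_def by auto

lemma linear_iso_inv_into: "linear_iso V W h \<Longrightarrow> subspace V \<Longrightarrow> linear_iso W V (inv_into V h)"
  unfolding linear_iso_def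
proof (intro conjI ballI allI)
  assume *: "bij_betw h V W \<and> (\<forall>u\<in>V. \<forall>v\<in>V. h (u + v) = h u + h v) \<and> (\<forall>c. \<forall>v\<in>V. h (c *\<^sub>R v) = c *\<^sub>R h v)"
    and V: "subspace V"
  then have iso: "linear_iso V W h" by (simp add: linear_iso_def)
  note inv = linear_iso_inv[OF iso]
  show "bij_betw (inv_into V h) W V" using * bij_betw_inv_into by blast
  show "inv_into V h (u + v) = inv_into V h u + inv_into V h v" if "u \<in> W" "v \<in> W" for u v
    using inv(3)[of "inv_into V h u + inv_into V h v"] linear_isoD(1)[OF iso inv(2) inv(2)] that inv(1,2)
      subspace_add[OF V] by metis
  show "inv_into V h (c *\<^sub>R v) = c *\<^sub>R inv_into V h v" if "v \<in> W" for c v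
    using inv(3)[of "c *\<^sub>R inv_into V h v"] linear_isoD(2)[OF iso inv(2)] that inv(1,2)
      subspace_scale[OF V] by metis
qed

lemma linear_iso_0:
  assumes "linear_iso V W h" "subspace V" shows "h 0 = 0"
  using linear_isoD(2)[OF assms(1) subspace_0[OF assms(2)], of 0] by simp

lemma linear_iso_ident: "linear_iso V V (\<lambda>v. v)"
  by (simp add: linear_iso_def bij_betw_def)

abbreviation (input) section_deriv :: "'m set \<Rightarrow> ('m \<Rightarrow> 'e::real_normed_vector) \<Rightarrow> ('m \<Rightarrow> 'v \<Rightarrow> real) \<Rightarrow> ('m \<Rightarrow> 'v) \<Rightarrow> 'm \<Rightarrow> 'e \<Rightarrow> real"
  where "section_deriv U \<phi> \<tau> s x \<equiv> frechet_derivative ((\<lambda>y. \<tau> y (s y)) \<circ> inv_into U \<phi>) (at (\<phi> x))"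

text \<open>The local frame that belongs to a trivialisation.\<close>

definition unit_vec :: "('m, 'e, 'v::real_vector) line_bundle \<Rightarrow> ('m \<Rightarrow> 'v \<Rightarrow> real) \<Rightarrow> 'm \<Rightarrow> 'v"
  where "unit_vec L \<tau> x = inv_into (fibre L x) (\<tau> x) 1"

locale hbundle =
  fixes L :: "('m, 'e::finite_dim_inner, 'v::real_vector) line_bundle"
  assumes hline_bundle: "hline_bundle L"
begin

lemma hmfd: "hmanifold (base L)"
  and fibre_subspace: "x \<in> points (base L) \<Longrightarrow> subspace (fibre L x)"
  and triv_cover: "(\<Union>(W, \<tau>)\<in>trivs L. W) = points (base L)"
  and triv_open: "(W, \<tau>) \<in> trivs L \<Longrightarrow> aopen (base L) W"
  and triv_iso: "(W, \<tau>) \<in> trivs L \<Longrightarrow> x \<in> W \<Longrightarrow> linear_iso (fibre L x) UNIV (\<tau> x)"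
  and triv_transition: "(W, \<tau>) \<in> trivs L \<Longrightarrow> (W', \<tau>') \<in> trivs L \<Longrightarrow>
    smooth_in (base L) (W \<inter> W') (\<lambda>x. \<tau>' x (unit_vec L \<tau> x))"
  using hline_bundle unfolding hline_bundle_def unit_vec_def by (fastforce)+

lemmas ch = hmanifold_charted[OF hmfd]

lemma trivE:
  assumes "x \<in> points (base L)" obtains W \<tau> where "(W, \<tau>) \<in> trivs L" "x \<in> W"
  using assms triv_cover by blast

lemma triv_subset: "(W, \<tau>) \<in> trivs L \<Longrightarrow> W \<subseteq> points (base L)"
  using triv_cover by blast

context
  fixes W \<tau> x
  assumes W: "(W, \<tau>) \<in> trivs L" and x: "x \<in> W"
begin

lemma triv_inv: "\<tau> x (inv_into (fibre L x) (\<tau> x) t) = t"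
  and triv_inv_in: "inv_into (fibre L x) (\<tau> x) t \<in> fibre L x"
  and triv_inv': "v \<in> fibre L x \<Longrightarrow> inv_into (fibre L x) (\<tau> x) (\<tau> x v) = v"
  using linear_iso_inv[OF triv_iso[OF W x]] by auto

lemma triv_add: "u \<in> fibre L x \<Longrightarrow> v \<in> fibre L x \<Longrightarrow> \<tau> x (u + v) = \<tau> x u + \<tau> x v"
  and triv_scale: "v \<in> fibre L x \<Longrightarrow> \<tau> x (c *\<^sub>R v) = c * \<tau> x v"
  using linear_isoD[OF triv_iso[OF W x]] by auto

lemma triv_subspace: "subspace (fibre L x)"
  using fibre_subspace triv_subset[OF W] x by blast

lemma triv_zero: "\<tau> x 0 = 0"
  using linear_iso_0[OF triv_iso[OF W x] triv_subspace] .

lemma triv_diff: "u \<in> fibre L x \<Longrightarrow> v \<in> fibre L x \<Longrightarrow> \<tau> x (u - v) = \<tau> x u - \<tau> x v"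
  using triv_add[of u "(-1) *\<^sub>R v"] triv_scale[of v "-1"] subspace_scale[OF triv_subspace, of v "-1"] by simp

lemma triv_unit: "\<tau> x (unit_vec L \<tau> x) = 1" and unit_in: "unit_vec L \<tau> x \<in> fibre L x"
  using triv_inv triv_inv_in by (auto simp: unit_vec_def)

lemma triv_inj: "u \<in> fibre L x \<Longrightarrow> v \<in> fibre L x \<Longrightarrow> \<tau> x u = \<tau> x v \<Longrightarrow> u = v"
  using triv_inv' by metis

lemma triv_expand: "v \<in> fibre L x \<Longrightarrow> v = \<tau> x v *\<^sub>R unit_vec L \<tau> x"
  by (rule triv_inj) (auto simp: triv_scale unit_in triv_unit subspace_scale[OF triv_subspace])

lemma triv_inv_eq: "inv_into (fibre L x) (\<tau> x) t = t *\<^sub>R unit_vec L \<tau> x"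
  using triv_expand[OF triv_inv_in, of t] triv_inv by simp

end

lemma total_space_chart:
  "c \<in> total_space L \<longleftrightarrow> (\<exists>U \<phi> W \<tau>. (U, \<phi>) \<in> base L \<and> (W, \<tau>) \<in> trivs L \<and>
    c = ({(x, v). x \<in> U \<inter> W \<and> v \<in> fibre L x}, \<lambda>(x, v). (\<phi> x, \<tau> x v)))"
  by (auto simp: total_space_def)

lemma points_total_space: "points (total_space L) = {(x, v). x \<in> points (base L) \<and> v \<in> fibre L x}"
proof (intro equalityI subsetI)
  fix z assume "z \<in> points (total_space L)"
  then obtain V \<Phi> where V: "(V, \<Phi>) \<in> total_space L" "z \<in> V" by (rule pointsE)
  from V(1) obtain U \<phi> W \<tau> where U: "(U, \<phi>) \<in> base L" "V = {(x, v). x \<in> U \<inter> W \<and> v \<in> fibre L x}"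
    unfolding total_space_chart prod.inject by (elim exE conjE) (rule that)
  obtain x v where z: "z = (x, v)" by (cases z)
  have "x \<in> U" "v \<in> fibre L x" using V(2) unfolding U(2) z by simp_all
  then show "z \<in> {(x, v). x \<in> points (base L) \<and> v \<in> fibre L x}"
    using chart_subset_points[OF U(1)] unfolding z by blast
next
  fix z assume "z \<in> {(x, v). x \<in> points (base L) \<and> v \<in> fibre L x}"
  then obtain x v where z: "z = (x, v)" "x \<in> points (base L)" "v \<in> fibre L x" by auto
  obtain U \<phi> where U: "(U, \<phi>) \<in> base L" "x \<in> U" by (rule pointsE[OF z(2)])
  obtain W \<tau> where W: "(W, \<tau>) \<in> trivs L" "x \<in> W" by (rule trivE[OF z(2)])
  have "({(x, v). x \<in> U \<inter> W \<and> v \<in> fibre L x}, \<lambda>(x, v). (\<phi> x, \<tau> x v)) \<in> total_space L"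
    using U W unfolding total_space_chart by blast
  from chart_subset_points[OF this] show "z \<in> points (total_space L)" using z U W by auto
qed

lemma sections_iff:
  "s \<in> sections L \<longleftrightarrow> (\<forall>x\<in>points (base L). s x \<in> fibre L x) \<and>
    (\<forall>(W, \<tau>)\<in>trivs L. smooth_in (base L) W (\<lambda>x. \<tau> x (s x))) \<and> (\<forall>x. x \<notin> points (base L) \<longrightarrow> s x = 0)"
  (is "_ \<longleftrightarrow> ?fib \<and> ?sm \<and> ?zero")
proof
  assume s: "s \<in> sections L"
  then have sm: "smooth_map (base L) (total_space L) (\<lambda>x. (x, s x))" by (simp add: sections_def)
  have fib: ?fib using smooth_map_points[OF sm] by (auto simp: points_total_space)
  moreover have "smooth_in (base L) W (\<lambda>x. \<tau> x (s x))" if W: "(W, \<tau>) \<in> trivs L" for W \<tau>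
  proof (rule smooth_in_local[OF ch])
    fix x assume x: "x \<in> W"
    obtain U \<phi> where U: "(U, \<phi>) \<in> base L" "x \<in> U" by (rule pointsE[OF subsetD[OF triv_subset[OF W] x]])
    let ?V = "{(x, v). x \<in> U \<inter> W \<and> v \<in> fibre L x}" and ?\<Phi> = "\<lambda>(x, v). (\<phi> x, \<tau> x v)"
    have V: "(?V, ?\<Phi>) \<in> total_space L" using U W unfolding total_space_chart by blast
    have eq: "points (base L) \<inter> (\<lambda>x. (x, s x)) -` ?V = U \<inter> W"
      using fib chart_subset_points[OF U(1)] by auto
    have o: "aopen (base L) (U \<inter> W)" by (intro openin_Int aopen_chart[OF ch U(1)] triv_open[OF W])
    have "smooth_in (base L) (U \<inter> W) (\<lambda>x. (\<phi> x, \<tau> x (s x)))"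
      using smooth_mapD(2)[OF sm ch V] unfolding eq by simp
    from smooth_in_bounded_linear[OF ch o bounded_linear_snd this]
    have "smooth_in (base L) (U \<inter> W) (\<lambda>x. \<tau> x (s x))" by simp
    then show "\<exists>T. aopen (base L) T \<and> x \<in> T \<and> smooth_in (base L) T (\<lambda>x. \<tau> x (s x))"
      using o x U by blast
  qed
  ultimately show "?fib \<and> ?sm \<and> ?zero" using s by (auto simp: sections_def)
next
  assume *: "?fib \<and> ?sm \<and> ?zero"
  have "smooth_map (base L) (total_space L) (\<lambda>x. (x, s x))"
  proof (rule smooth_mapI'[OF ch])
    show "(x, s x) \<in> points (total_space L)" if "x \<in> points (base L)" for x
      using that * by (auto simp: points_total_space)
    fix V \<Phi> assume "(V, \<Phi>) \<in> total_space L"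
    then obtain U \<phi> W \<tau> where c: "(U, \<phi>) \<in> base L" "(W, \<tau>) \<in> trivs L"
      "V = {(x, v). x \<in> U \<inter> W \<and> v \<in> fibre L x}" "\<Phi> = (\<lambda>(x, v). (\<phi> x, \<tau> x v))"
      unfolding total_space_chart prod.inject by (elim exE conjE) (rule that)
    have eq: "points (base L) \<inter> (\<lambda>x. (x, s x)) -` V = U \<inter> W"
      using * chart_subset_points[OF c(1)] by (auto simp: c)
    have o: "aopen (base L) (U \<inter> W)" by (intro openin_Int aopen_chart[OF ch c(1)] triv_open[OF c(2)])
    show "aopen (base L) (points (base L) \<inter> (\<lambda>x. (x, s x)) -` V)" unfolding eq by (rule o)
    have "smooth_in (base L) W (\<lambda>x. \<tau> x (s x))" using * c(2) by auto
    then have "smooth_in (base L) (U \<inter> W) (\<lambda>x. (\<phi> x, \<tau> x (s x)))"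
      using smooth_in_chart[OF ch c(1)] by (intro smooth_in_Pair[OF ch o]; auto elim: smooth_in_subset)
    then show "smooth_in (base L) (points (base L) \<inter> (\<lambda>x. (x, s x)) -` V) (\<lambda>x. \<Phi> (x, s x))"
      unfolding eq by (simp add: c)
  qed
  then show "s \<in> sections L" using * by (simp add: sections_def)
qed

lemma sectionsD:
  assumes "s \<in> sections L"
  shows "x \<in> points (base L) \<Longrightarrow> s x \<in> fibre L x" "x \<notin> points (base L) \<Longrightarrow> s x = 0"
    "(W, \<tau>) \<in> trivs L \<Longrightarrow> smooth_in (base L) W (\<lambda>x. \<tau> x (s x))"
    "(W, \<tau>) \<in> trivs L \<Longrightarrow> x \<in> W \<Longrightarrow> s x \<in> fibre L x"
  using assms triv_subset unfolding sections_iff by blast+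

text \<open>In another trivialisation the coordinate of \<open>s\<close> is multiplied by a smooth
  transition function, so one trivialisation near each point decides.\<close>

lemma sectionsI:
  assumes fib: "\<And>x. x \<in> points (base L) \<Longrightarrow> s x \<in> fibre L x" and zero: "\<And>x. x \<notin> points (base L) \<Longrightarrow> s x = 0"
    and loc: "\<And>x. x \<in> points (base L) \<Longrightarrow> \<exists>W \<tau> T. (W, \<tau>) \<in> trivs L \<and> aopen (base L) T \<and> x \<in> T \<and> T \<subseteq> W \<and>
      smooth_in (base L) T (\<lambda>x. \<tau> x (s x))"
  shows "s \<in> sections L"
  unfolding sections_iff
proof (intro conjI allI impI ballI)
  fix c assume "c \<in> trivs L"
  then obtain W \<tau> where W: "(W, \<tau>) \<in> trivs L" "c = (W, \<tau>)" by (cases c) auto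
  have "smooth_in (base L) W (\<lambda>x. \<tau> x (s x))"
  proof (rule smooth_in_local[OF ch])
    fix x assume x: "x \<in> W"
    then obtain W' \<tau>' T where T: "(W', \<tau>') \<in> trivs L" "aopen (base L) T" "x \<in> T" "T \<subseteq> W'"
      "smooth_in (base L) T (\<lambda>x. \<tau>' x (s x))"
      using loc triv_subset[OF W(1)] by blast
    have o: "aopen (base L) (T \<inter> W)" by (intro openin_Int T(2) triv_open[OF W(1)])
    have "smooth_in (base L) (T \<inter> W) (\<lambda>x. \<tau>' x (s x) * \<tau> x (unit_vec L \<tau>' x))"
      using triv_transition[OF T(1) W(1)] T(4,5)
      by (intro smooth_in_mult[OF ch o]; auto elim: smooth_in_subset)
    moreover have "\<tau>' x (s x) * \<tau> x (unit_vec L \<tau>' x) = \<tau> x (s x)" if "x \<in> T \<inter> W" for x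
    proof -
      have xW: "x \<in> W" "x \<in> W'" using that T(4) by auto
      then have sx: "s x \<in> fibre L x" using fib triv_subset[OF W(1)] by auto
      show ?thesis
        using triv_expand[OF T(1) xW(2) sx] triv_scale[OF W(1) xW(1) unit_in[OF T(1) xW(2)]] by metis
    qed
    ultimately have "smooth_in (base L) (T \<inter> W) (\<lambda>x. \<tau> x (s x))"
      by (rule smooth_in_cong[OF ch o])
    then show "\<exists>T. aopen (base L) T \<and> x \<in> T \<and> smooth_in (base L) T (\<lambda>x. \<tau> x (s x))"
      using o T(3) x by blast
  qed
  then show "case c of (W, \<tau>) \<Rightarrow> smooth_in (base L) W (\<lambda>x. \<tau> x (s x))" by (simp add: W)
qed (use fib zero in auto)

lemma sections_add:
  assumes s: "s \<in> sections L" and r: "r \<in> sections L" shows "(\<lambda>x. s x + r x) \<in> sections L"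
proof (rule sectionsI)
  fix x assume x: "x \<in> points (base L)"
  then obtain W \<tau> where W: "(W, \<tau>) \<in> trivs L" "x \<in> W" by (rule trivE)
  have "smooth_in (base L) W (\<lambda>x. \<tau> x (s x + r x))"
    by (rule smooth_in_cong[OF ch triv_open[OF W(1)] smooth_in_add[OF ch triv_open[OF W(1)]
          sectionsD(3)[OF s W(1)] sectionsD(3)[OF r W(1)]]])
      (simp add: triv_add[OF W(1)] sectionsD(4)[OF s W(1)] sectionsD(4)[OF r W(1)])
  then show "\<exists>W \<tau> T. (W, \<tau>) \<in> trivs L \<and> aopen (base L) T \<and> x \<in> T \<and> T \<subseteq> W \<and>
      smooth_in (base L) T (\<lambda>x. \<tau> x (s x + r x))"
    using W triv_open[OF W(1)] by blast
qed (use sectionsD(1,2)[OF s] sectionsD(1,2)[OF r] in \<open>auto intro: subspace_add[OF fibre_subspace]\<close>)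

lemma sections_mult:
  assumes f: "f \<in> smooth_functions (base L)" and s: "s \<in> sections L" shows "(\<lambda>x. f x *\<^sub>R s x) \<in> sections L"
proof (rule sectionsI)
  fix x assume x: "x \<in> points (base L)"
  then obtain W \<tau> where W: "(W, \<tau>) \<in> trivs L" "x \<in> W" by (rule trivE)
  have "smooth_in (base L) W (\<lambda>x. \<tau> x (f x *\<^sub>R s x))"
    by (rule smooth_in_cong[OF ch triv_open[OF W(1)] smooth_in_mult[OF ch triv_open[OF W(1)]
          smooth_in_subset[OF smooth_functionsD(1)[OF f] triv_subset[OF W(1)]] sectionsD(3)[OF s W(1)]]])
      (simp add: triv_scale[OF W(1)] sectionsD(4)[OF s W(1)])
  then show "\<exists>W \<tau> T. (W, \<tau>) \<in> trivs L \<and> aopen (base L) T \<and> x \<in> T \<and> T \<subseteq> W \<and>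
      smooth_in (base L) T (\<lambda>x. \<tau> x (f x *\<^sub>R s x))"
    using W triv_open[OF W(1)] by blast
qed (use sectionsD(1,2)[OF s] in \<open>auto intro: subspace_scale[OF fibre_subspace]\<close>)

lemma sections_scale:
  assumes s: "s \<in> sections L" shows "(\<lambda>x. c *\<^sub>R s x) \<in> sections L"
proof -
  have "(\<lambda>x. const_fun (base L) c x *\<^sub>R s x) = (\<lambda>x. c *\<^sub>R s x)"
    using sectionsD(2)[OF s] by (auto simp: const_fun_def)
  then show ?thesis using sections_mult[OF const_fun_smooth[OF ch] s, of c] by simp
qed

lemma sections_minus: "s \<in> sections L \<Longrightarrow> (\<lambda>x. - s x) \<in> sections L"
  using sections_scale[of s "-1"] by simp

lemma sections_diff: "s \<in> sections L \<Longrightarrow> r \<in> sections L \<Longrightarrow> (\<lambda>x. s x - r x) \<in> sections L"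
  using sections_add[OF _ sections_minus, of s r] by simp

lemma sections_zero: "(\<lambda>_. 0) \<in> sections L"
proof (rule sectionsI)
  fix x assume x: "x \<in> points (base L)"
  show "0 \<in> fibre L x" by (rule subspace_0[OF fibre_subspace[OF x]])
  obtain W \<tau> where W: "(W, \<tau>) \<in> trivs L" "x \<in> W" using trivE[OF x] .
  have "smooth_in (base L) W (\<lambda>x. \<tau> x 0)"
    by (rule smooth_in_cong[OF ch triv_open[OF W(1)] smooth_in_const[of _ _ 0]]) (simp add: triv_zero[OF W(1)])
  then show "\<exists>W \<tau> T. (W, \<tau>) \<in> trivs L \<and> aopen (base L) T \<and> x \<in> T \<and> T \<subseteq> W \<and>
      smooth_in (base L) T (\<lambda>x. \<tau> x 0)"
    using W triv_open[OF W(1)] by blast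
qed simp

text \<open>Take \<open>\<rho> h\<close> times the local frame. This is smooth across the boundary
  of \<open>T\<close> because \<rho> vanishes off a closed subset of \<open>T\<close>. All sections
  with prescribed local behaviour come from here.\<close>

lemma local_section:
  assumes W: "(W, \<tau>) \<in> trivs L" and T: "aopen (base L) T" "x \<in> T" "T \<subseteq> W" and h: "smooth_in (base L) T h"
  obtains s N where "s \<in> sections L" "aopen (base L) N" "x \<in> N" "N \<subseteq> T"
    "\<And>y. y \<in> N \<Longrightarrow> \<tau> y (s y) = h y"
proof -
  obtain \<rho> where b: "bump (base L) x T \<rho>" using bump_exists[OF hmfd T(1,2)] .
  obtain N where N: "aopen (base L) N" "x \<in> N" "N \<subseteq> T" "\<And>y. y \<in> N \<Longrightarrow> \<rho> y = 1" using bumpE[OF b] by blast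
  define s where "s = (\<lambda>y. if y \<in> T then (\<rho> y * h y) *\<^sub>R unit_vec L \<tau> y else 0)"
  have \<tau>s: "\<tau> y (s y) = \<rho> y * h y" if "y \<in> W" for y
    using that T(3) triv_scale[OF W _ unit_in[OF W]] triv_unit[OF W] triv_zero[OF W] bump_off[OF b]
    by (cases "y \<in> T") (auto simp: s_def)
  have sS: "s \<in> sections L"
  proof (rule sectionsI)
    show "s y \<in> fibre L y" if "y \<in> points (base L)" for y
    proof (cases "y \<in> T")
      case True
      then have "unit_vec L \<tau> y \<in> fibre L y" using unit_in[OF W] T(3) by auto
      then show ?thesis using True subspace_scale[OF fibre_subspace[OF that]] by (simp add: s_def)
    qed (simp add: s_def subspace_0[OF fibre_subspace[OF that]])
    show "s y = 0" if "y \<notin> points (base L)" for y using that aopen_imp_subset[OF T(1)] by (auto simp: s_def)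
    fix y assume y: "y \<in> points (base L)"
    obtain C where C: "closedin (atlas_topology (base L)) C" "C \<subseteq> T" "\<And>y. y \<notin> C \<Longrightarrow> \<rho> y = 0"
      using b by (auto simp: bump_def)
    show "\<exists>W \<tau> T. (W, \<tau>) \<in> trivs L \<and> aopen (base L) T \<and> y \<in> T \<and> T \<subseteq> W \<and>
      smooth_in (base L) T (\<lambda>x. \<tau> x (s x))"
    proof (cases "y \<in> W")
      case True
      have "smooth_in (base L) (points (base L)) (\<lambda>y. \<rho> y * h y)"
        using bump_mult_smooth[OF ch b T(1) h] by (rule smooth_functionsD)
      then have "smooth_in (base L) W (\<lambda>y. \<rho> y * h y)" by (rule smooth_in_subset) (rule triv_subset[OF W])
      then have "smooth_in (base L) W (\<lambda>x. \<tau> x (s x))"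
        by (rule smooth_in_cong[OF ch triv_open[OF W]]) (simp add: \<tau>s)
      then show ?thesis using W True triv_open[OF W] by blast
    next
      case False
      obtain W' \<tau>' where W': "(W', \<tau>') \<in> trivs L" "y \<in> W'" using trivE[OF y] .
      have o: "aopen (base L) (W' - C)" using triv_open[OF W'(1)] C(1) by (rule openin_diff)
      have "s z = 0" if "z \<notin> C" for z using C(3)[OF that] by (simp add: s_def)
      then have "smooth_in (base L) (W' - C) (\<lambda>x. \<tau>' x (s x))"
        by (intro smooth_in_cong[OF ch o smooth_in_const[of _ _ 0]]) (auto simp: triv_zero[OF W'(1)])
      then show ?thesis using W' o C(2) T(3) False by blast
    qed
  qed
  show thesis
    by (rule that[OF sS N(1-3)]) (use N(3,4) \<tau>s T(3) in auto)
qed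

section \<open>Derivations at a point, their symbols and their coordinates\<close>

lemma derivationsD:
  assumes "a \<in> derivations_at L x"
  shows "s \<in> sections L \<Longrightarrow> a s \<in> fibre L x" "s \<notin> sections L \<Longrightarrow> a s = 0"
    "s \<in> sections L \<Longrightarrow> r \<in> sections L \<Longrightarrow> a (\<lambda>y. s y + r y) = a s + a r"
    "s \<in> sections L \<Longrightarrow> a (\<lambda>y. c *\<^sub>R s y) = c *\<^sub>R a s"
  using assms by (auto simp: derivations_at_def Hom_def)

lemma derivations_minus:
  assumes "a \<in> derivations_at L x"
  shows "s \<in> sections L \<Longrightarrow> a (\<lambda>y. - s y) = - a s"
    "s \<in> sections L \<Longrightarrow> r \<in> sections L \<Longrightarrow> a (\<lambda>y. s y - r y) = a s - a r"
  using derivationsD(4)[OF assms, of s "-1"] derivationsD(3)[OF assms _ sections_minus, of s r]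
    derivationsD(4)[OF assms, of r "-1"] by auto

text \<open>The body of the definite description \<open>symbol\<close> as a relation, so that
  uniqueness can be stated for arbitrary candidates.\<close>

definition is_symbol :: "'m \<Rightarrow> (('m \<Rightarrow> 'v) \<Rightarrow> 'v) \<Rightarrow> (('m \<Rightarrow> real) \<Rightarrow> real) \<Rightarrow> bool"
  where "is_symbol x a X \<longleftrightarrow> X \<in> tangent_space (base L) x \<and>
    (\<forall>f\<in>smooth_functions (base L). \<forall>s\<in>sections L. a (\<lambda>y. f y *\<^sub>R s y) = f x *\<^sub>R a s + X f *\<^sub>R s x)"

lemma derivations_at_iff: "a \<in> derivations_at L x \<longleftrightarrow> a \<in> Hom (sections L) (fibre L x) \<and> (\<exists>X. is_symbol x a X)"
  by (auto simp: derivations_at_def is_symbol_def)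

lemma nonzero_section:
  assumes "(W, \<tau>) \<in> trivs L" "x \<in> W"
  obtains e N where "e \<in> sections L" "aopen (base L) N" "x \<in> N" "N \<subseteq> W" "\<And>y. y \<in> N \<Longrightarrow> \<tau> y (e y) = 1"
  using local_section[OF assms(1) triv_open[OF assms(1)] assms(2) subset_refl smooth_in_const[of _ _ 1]] by metis

text \<open>On a section that does not vanish at \<open>x\<close> the Leibniz rule is an equation
  that determines the value of the symbol on \<open>f\<close>.\<close>

lemma symbol_unique:
  assumes x: "x \<in> points (base L)" and X: "is_symbol x a X" and Y: "is_symbol x a Y"
  shows "X = Y"
proof
  fix f
  obtain W \<tau> where W: "(W, \<tau>) \<in> trivs L" "x \<in> W" using trivE[OF x] .
  obtain e N where e: "e \<in> sections L" "x \<in> N" "\<And>y. y \<in> N \<Longrightarrow> \<tau> y (e y) = 1" using nonzero_section[OF W] by metis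
  have ne: "e x \<noteq> 0" using e triv_zero[OF W] by force
  show "X f = Y f"
  proof (cases "f \<in> smooth_functions (base L)")
    case True
    then have "a (\<lambda>y. f y *\<^sub>R e y) = f x *\<^sub>R a e + X f *\<^sub>R e x" "a (\<lambda>y. f y *\<^sub>R e y) = f x *\<^sub>R a e + Y f *\<^sub>R e x"
      using X Y e(1) by (auto simp: is_symbol_def)
    then show ?thesis using ne by simp
  next
    case False
    then show ?thesis using tangentD(4)[of X "base L" x f] tangentD(4)[of Y "base L" x f] X Y
      by (simp add: is_symbol_def)
  qed
qed

lemma symbol_eq: "x \<in> points (base L) \<Longrightarrow> is_symbol x a X \<Longrightarrow> symbol L x a = X"
  unfolding symbol_def is_symbol_def[symmetric] by (rule the_equality) (auto intro: symbol_unique)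

lemma derivation_symbol: "x \<in> points (base L) \<Longrightarrow> a \<in> derivations_at L x \<Longrightarrow> is_symbol x a (symbol L x a)"
  using symbol_eq by (auto simp: derivations_at_iff)

text \<open>The difference of the two sections equals \<open>1 - \<rho>\<close> times itself, for a
  bump function \<rho> in \<open>S\<close>. Both factors vanish at \<open>x\<close>, and the Leibniz
  rule does the rest.\<close>

lemma derivation_local:
  assumes a: "a \<in> derivations_at L x" and S: "aopen (base L) S" "x \<in> S"
    and s: "s \<in> sections L" "r \<in> sections L" "\<And>y. y \<in> S \<Longrightarrow> s y = r y"
  shows "a s = a r"
proof -
  obtain X where X: "is_symbol x a X" using a by (auto simp: derivations_at_iff)
  obtain \<rho> where b: "bump (base L) x S \<rho>" using bump_exists[OF hmfd S] .
  have 1: "(\<lambda>y. const_fun (base L) 1 y - \<rho> y) \<in> smooth_functions (base L)"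
    by (intro smooth_functions_diff ch const_fun_smooth bump_smooth[OF b])
  have d: "(\<lambda>y. s y - r y) \<in> sections L" by (rule sections_diff[OF s(1,2)])
  have "(\<lambda>y. s y - r y) = (\<lambda>y. (const_fun (base L) 1 y - \<rho> y) *\<^sub>R (s y - r y))"
  proof
    fix y show "s y - r y = (const_fun (base L) 1 y - \<rho> y) *\<^sub>R (s y - r y)"
      using s(3) bump_off[OF b] sectionsD(2)[OF d, of y] by (cases "y \<in> S") (auto simp: const_fun_def)
  qed
  then have "a (\<lambda>y. s y - r y) = (const_fun (base L) 1 x - \<rho> x) *\<^sub>R a (\<lambda>y. s y - r y)
      + X (\<lambda>y. const_fun (base L) 1 y - \<rho> y) *\<^sub>R (s x - r x)"
    using X 1 d unfolding is_symbol_def by metis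
  moreover have "const_fun (base L) 1 x = 1" using S aopen_imp_subset by (auto simp: const_fun_def)
  ultimately have "a (\<lambda>y. s y - r y) = 0" using s(3)[OF S(2)] bump_at[OF b] by simp
  then show ?thesis using derivations_minus(2)[OF a s(1,2)] by simp
qed

text \<open>\<open>v\<close> is the coordinate vector of the symbol and \<open>c\<close> the
  multiple of the identity derivation; the pair \<open>(v, c)\<close> serves as linear coordinates
  on \<open>D_x L\<close>.\<close>

definition coord_der :: "'m set \<Rightarrow> ('m \<Rightarrow> 'e) \<Rightarrow> ('m \<Rightarrow> 'v \<Rightarrow> real) \<Rightarrow> 'm \<Rightarrow> 'e \<Rightarrow> real \<Rightarrow> ('m \<Rightarrow> 'v) \<Rightarrow> 'v"
  where "coord_der U \<phi> \<tau> x v c = (\<lambda>s. if s \<in> sections L then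
    (section_deriv U \<phi> \<tau> s x v + c * \<tau> x (s x)) *\<^sub>R unit_vec L \<tau> x else 0)"

context
  fixes U \<phi> W \<tau> x
  assumes U: "(U, \<phi>) \<in> base L" "x \<in> U" and W: "(W, \<tau>) \<in> trivs L" "x \<in> W"
begin

lemma coord_open: "aopen (base L) (U \<inter> W)"
  by (intro openin_Int aopen_chart[OF ch U(1)] triv_open[OF W(1)])

lemma image_coord_open: "open (\<phi> ` (U \<inter> W))"
  using aopen_image[OF ch U(1) triv_open[OF W(1)]] .

lemma section_rep_smooth:
  assumes "s \<in> sections L" shows "smooth_on (\<phi> ` (U \<inter> W)) ((\<lambda>y. \<tau> y (s y)) \<circ> inv_into U \<phi>)"
  using smooth_inD[OF sectionsD(3)[OF assms W(1)] U(1)] by (simp add: o_def)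

lemma section_rep_has_derivative:
  assumes "s \<in> sections L"
  shows "(((\<lambda>y. \<tau> y (s y)) \<circ> inv_into U \<phi>) has_derivative
    section_deriv U \<phi> \<tau> s x) (at (\<phi> x))"
  by (rule smooth_on_has_derivative[OF section_rep_smooth[OF assms]]) (use U W in auto)

lemma section_rep_linear:
  "s \<in> sections L \<Longrightarrow> linear (section_deriv U \<phi> \<tau> s x)"
  using section_rep_has_derivative by (blast intro: has_derivative_linear)

text \<open>The rule by which derivatives of concrete sections are computed: a coordinate formula
  that is valid near the point is enough.\<close>

lemma section_rep_eqI:
  assumes N: "aopen (base L) N" "x \<in> N" and g: "(g has_derivative g') (at (\<phi> x))"
    and eq: "\<And>y. y \<in> N \<Longrightarrow> y \<in> U \<Longrightarrow> \<tau> y (s y) = g (\<phi> y)"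
  shows "section_deriv U \<phi> \<tau> s x = g'"
proof -
  have "(((\<lambda>y. \<tau> y (s y)) \<circ> inv_into U \<phi>) has_derivative g') (at (\<phi> x))"
    by (rule has_derivative_transform_within_open[OF g aopen_image[OF ch U(1) N(1)]])
      (use U N in \<open>auto simp: inv_chart[OF ch U(1)] eq\<close>)
  then show ?thesis by (rule frechet_derivative_eqI)
qed

lemma rep_add:
  assumes "s \<in> sections L" "r \<in> sections L"
  shows "frechet_derivative ((\<lambda>y. \<tau> y (s y + r y)) \<circ> inv_into U \<phi>) (at (\<phi> x)) v =
    section_deriv U \<phi> \<tau> s x v +
    section_deriv U \<phi> \<tau> r x v"
proof -
  have "frechet_derivative ((\<lambda>y. \<tau> y (s y + r y)) \<circ> inv_into U \<phi>) (at (\<phi> x)) =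
    (\<lambda>v. section_deriv U \<phi> \<tau> s x v +
    section_deriv U \<phi> \<tau> r x v)"
    by (rule section_rep_eqI[OF triv_open[OF W(1)] W(2) has_derivative_add[OF section_rep_has_derivative[OF assms(1)]
        section_rep_has_derivative[OF assms(2)]]])
      (simp add: inv_chart[OF ch U(1)] triv_add[OF W(1)] sectionsD(4)[OF _ W(1)] assms)
  then show ?thesis by simp
qed

lemma chart_function_has_derivative:
  assumes "f \<in> smooth_functions (base L)"
  shows "((\<lambda>y. f (inv_into U \<phi> y)) has_derivative
    frechet_derivative (\<lambda>y. f (inv_into U \<phi> y)) (at (\<phi> x))) (at (\<phi> x))"
proof -
  have "smooth_on (\<phi> ` (U \<inter> points (base L))) (\<lambda>y. f (inv_into U \<phi> y))"
    by (rule smooth_inD[OF smooth_functionsD(1)[OF assms] U(1)])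
  then show ?thesis using U chart_subset_points[OF U(1)] by (intro smooth_on_has_derivative) auto
qed

lemma rep_mult:
  assumes f: "f \<in> smooth_functions (base L)" and s: "s \<in> sections L"
  shows "frechet_derivative ((\<lambda>y. \<tau> y (f y *\<^sub>R s y)) \<circ> inv_into U \<phi>) (at (\<phi> x)) v =
    f x * section_deriv U \<phi> \<tau> s x v +
    frechet_derivative (\<lambda>y. f (inv_into U \<phi> y)) (at (\<phi> x)) v * \<tau> x (s x)"
proof -
  have "frechet_derivative ((\<lambda>y. \<tau> y (f y *\<^sub>R s y)) \<circ> inv_into U \<phi>) (at (\<phi> x)) =
    (\<lambda>v. f (inv_into U \<phi> (\<phi> x)) * section_deriv U \<phi> \<tau> s x v +
    frechet_derivative (\<lambda>y. f (inv_into U \<phi> y)) (at (\<phi> x)) v * ((\<lambda>y. \<tau> y (s y)) \<circ> inv_into U \<phi>) (\<phi> x))"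
    by (rule section_rep_eqI[OF triv_open[OF W(1)] W(2) has_derivative_mult[OF chart_function_has_derivative[OF f]
        section_rep_has_derivative[OF s]]])
      (simp add: inv_chart[OF ch U(1)] triv_scale[OF W(1)] sectionsD(4)[OF s W(1)])
  then show ?thesis by (simp add: inv_chart[OF ch U])
qed

lemma rep_scale:
  assumes s: "s \<in> sections L"
  shows "frechet_derivative ((\<lambda>y. \<tau> y (c *\<^sub>R s y)) \<circ> inv_into U \<phi>) (at (\<phi> x)) v =
    c * section_deriv U \<phi> \<tau> s x v"
proof -
  have "frechet_derivative ((\<lambda>y. \<tau> y (c *\<^sub>R s y)) \<circ> inv_into U \<phi>) (at (\<phi> x)) =
    (\<lambda>v. c * section_deriv U \<phi> \<tau> s x v)"
    by (rule section_rep_eqI[OF triv_open[OF W(1)] W(2) has_derivative_mult_right[OF section_rep_has_derivative[OF s]]])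
      (simp add: inv_chart[OF ch U(1)] triv_scale[OF W(1)] sectionsD(4)[OF s W(1)])
  then show ?thesis by simp
qed

lemma chart_tangent:
  "(\<lambda>f. if f \<in> smooth_functions (base L) then frechet_derivative (\<lambda>y. f (inv_into U \<phi> y)) (at (\<phi> x)) v else 0)
    \<in> tangent_space (base L) x"
proof -
  let ?i = "inv_into U \<phi>"
  have add: "frechet_derivative (\<lambda>y. f (?i y) + g (?i y)) (at (\<phi> x)) v =
      frechet_derivative (\<lambda>y. f (?i y)) (at (\<phi> x)) v + frechet_derivative (\<lambda>y. g (?i y)) (at (\<phi> x)) v"
    if "f \<in> smooth_functions (base L)" "g \<in> smooth_functions (base L)" for f g
    by (simp add: frechet_derivative_eqI[OF has_derivative_add[OF chart_function_has_derivative[OF that(1)]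
          chart_function_has_derivative[OF that(2)]]])
  have mult: "frechet_derivative (\<lambda>y. f (?i y) * g (?i y)) (at (\<phi> x)) v =
      f x * frechet_derivative (\<lambda>y. g (?i y)) (at (\<phi> x)) v + frechet_derivative (\<lambda>y. f (?i y)) (at (\<phi> x)) v * g x"
    if "f \<in> smooth_functions (base L)" "g \<in> smooth_functions (base L)" for f g
    by (simp add: inv_chart[OF ch U] frechet_derivative_eqI[OF has_derivative_mult[OF chart_function_has_derivative[OF that(1)]
          chart_function_has_derivative[OF that(2)]]])
  have scale: "frechet_derivative (\<lambda>y. c * f (?i y)) (at (\<phi> x)) v = c * frechet_derivative (\<lambda>y. f (?i y)) (at (\<phi> x)) v"
    if "f \<in> smooth_functions (base L)" for c f
    by (simp add: frechet_derivative_eqI[OF has_derivative_mult_right[OF chart_function_has_derivative[OF that]]])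
  show ?thesis
    unfolding tangent_space_def Hom_def
    using smooth_functions_add[OF ch] smooth_functions_mult[OF ch] smooth_functions_scaleR[OF ch]
    by (auto simp: add mult scale)
qed

lemma coord_der_triv: "s \<in> sections L \<Longrightarrow> \<tau> x (coord_der U \<phi> \<tau> x v c s) =
    section_deriv U \<phi> \<tau> s x v + c * \<tau> x (s x)"
  by (simp add: coord_der_def triv_scale[OF W unit_in[OF W]] triv_unit[OF W])

lemma coord_der_fibre: "s \<in> sections L \<Longrightarrow> coord_der U \<phi> \<tau> x v c s \<in> fibre L x"
  by (simp add: coord_der_def subspace_scale[OF triv_subspace[OF W]] unit_in[OF W])

lemma coord_der_derivation: "coord_der U \<phi> \<tau> x v c \<in> derivations_at L x"
proof -
  let ?a = "coord_der U \<phi> \<tau> x v c"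
  note fibI = sectionsD(4)[OF _ W] coord_der_fibre subspace_scale[OF triv_subspace[OF W]] subspace_add[OF triv_subspace[OF W]]
  have "?a \<in> Hom (sections L) (fibre L x)"
    unfolding Hom_def
  proof (intro CollectI conjI ballI allI impI)
    fix s assume s: "s \<in> sections L"
    show "?a s \<in> fibre L x" by (rule coord_der_fibre[OF s])
    show "?a (\<lambda>x. s x + r x) = ?a s + ?a r" if r: "r \<in> sections L" for r
    proof (rule triv_inj[OF W])
      show "?a (\<lambda>x. s x + r x) \<in> fibre L x" by (rule coord_der_fibre[OF sections_add[OF s r]])
      show "?a s + ?a r \<in> fibre L x" using s r by (intro fibI)
      show "\<tau> x (?a (\<lambda>x. s x + r x)) = \<tau> x (?a s + ?a r)"
        using s r by (simp add: coord_der_triv sections_add rep_add triv_add[OF W] fibI) (simp add: algebra_simps)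
    qed
    show "?a (\<lambda>x. c *\<^sub>R s x) = c *\<^sub>R ?a s" for c
      using s by (simp add: coord_der_def sections_scale rep_scale triv_scale[OF W] sectionsD(4)[OF _ W]
          algebra_simps)
  qed (simp add: coord_der_def)
  moreover have "is_symbol x ?a (\<lambda>f. if f \<in> smooth_functions (base L) then
      frechet_derivative (\<lambda>y. f (inv_into U \<phi> y)) (at (\<phi> x)) v else 0)"
    unfolding is_symbol_def
  proof (intro conjI ballI chart_tangent)
    fix f s assume f: "f \<in> smooth_functions (base L)" and s: "s \<in> sections L"
    have "?a (\<lambda>y. f y *\<^sub>R s y) \<in> fibre L x" using f s by (intro coord_der_fibre sections_mult)
    moreover have "f x *\<^sub>R ?a s + (frechet_derivative (\<lambda>y. f (inv_into U \<phi> y)) (at (\<phi> x)) v) *\<^sub>R s x \<in> fibre L x"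
      using s by (intro fibI)
    moreover have "\<tau> x (?a (\<lambda>y. f y *\<^sub>R s y)) =
        \<tau> x (f x *\<^sub>R ?a s + (frechet_derivative (\<lambda>y. f (inv_into U \<phi> y)) (at (\<phi> x)) v) *\<^sub>R s x)"
      using f s by (simp add: triv_add[OF W] triv_scale[OF W] fibI coord_der_triv sections_mult rep_mult algebra_simps)
    ultimately have "?a (\<lambda>y. f y *\<^sub>R s y) =
        f x *\<^sub>R ?a s + (frechet_derivative (\<lambda>y. f (inv_into U \<phi> y)) (at (\<phi> x)) v) *\<^sub>R s x"
      by (rule triv_inj[OF W])
    then show "?a (\<lambda>y. f y *\<^sub>R s y) = f x *\<^sub>R ?a s + (if f \<in> smooth_functions (base L) then
      frechet_derivative (\<lambda>y. f (inv_into U \<phi> y)) (at (\<phi> x)) v else 0) *\<^sub>R s x"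
      using f by simp
  qed
  ultimately show ?thesis by (auto simp: derivations_at_iff)
qed

text \<open>Near \<open>x\<close> a section is its coordinate function times the local frame
  \<open>e\<close>, so by the Leibniz rule \<open>a s\<close> is determined by \<open>a e\<close>
  and the symbol. The symbol is a directional derivative by \<open>tangent_coords\<close>, and
  \<open>c\<close> is the coordinate of \<open>a e\<close>.\<close>

lemma derivation_coords:
  assumes a: "a \<in> derivations_at L x"
  obtains v c where "a = coord_der U \<phi> \<tau> x v c"
proof -
  obtain X where X: "is_symbol x a X" using a by (auto simp: derivations_at_iff)
  obtain v where v: "\<And>f. f \<in> smooth_functions (base L) \<Longrightarrow>
      X f = frechet_derivative (\<lambda>y. f (inv_into U \<phi> y)) (at (\<phi> x)) v"
    using tangent_coords[OF hmfd _ U, of X] X by (auto simp: is_symbol_def)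
  obtain e N where e: "e \<in> sections L" "aopen (base L) N" "x \<in> N" "N \<subseteq> W" "\<And>y. y \<in> N \<Longrightarrow> \<tau> y (e y) = 1"
    using nonzero_section[OF W] by blast
  obtain \<rho> where b: "bump (base L) x N \<rho>" using bump_exists[OF hmfd e(2,3)] .
  obtain N' where N': "aopen (base L) N'" "x \<in> N'" "N' \<subseteq> N" "\<And>y. y \<in> N' \<Longrightarrow> \<rho> y = 1" using bumpE[OF b] by blast
  have ex: "e x = unit_vec L \<tau> x" using triv_expand[OF W sectionsD(4)[OF e(1) W]] e by simp
  have "a s = coord_der U \<phi> \<tau> x v (\<tau> x (a e)) s" for s
  proof (cases "s \<in> sections L")
    case s: True
    let ?f = "\<lambda>y. \<rho> y * \<tau> y (s y)"
    have f: "?f \<in> smooth_functions (base L)"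
      by (rule bump_mult_smooth[OF ch b e(2) smooth_in_subset[OF sectionsD(3)[OF s W(1)] e(4)]])
    have "a s = a (\<lambda>y. ?f y *\<^sub>R e y)"
    proof (rule derivation_local[OF a N'(1,2) s sections_mult[OF f e(1)]])
      fix y assume y: "y \<in> N'"
      then have yW: "y \<in> W" using N'(3) e(4) by auto
      have "e y = unit_vec L \<tau> y" using triv_expand[OF W(1) yW sectionsD(4)[OF e(1) W(1) yW]] e(5) y N'(3) by auto
      then show "s y = ?f y *\<^sub>R e y" using triv_expand[OF W(1) yW sectionsD(4)[OF s W(1) yW]] N'(4)[OF y] by simp
    qed
    also have "\<dots> = ?f x *\<^sub>R a e + X ?f *\<^sub>R e x" using X f e(1) by (auto simp: is_symbol_def)
    also have "X ?f = section_deriv U \<phi> \<tau> s x v"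
    proof -
      have "((\<lambda>y. ?f (inv_into U \<phi> y)) has_derivative section_deriv U \<phi> \<tau> s x) (at (\<phi> x))"
        by (rule has_derivative_transform_within_open[OF section_rep_has_derivative[OF s] aopen_image[OF ch U(1) N'(1)]])
          (use U N' in \<open>auto simp: inv_chart[OF ch U(1)]\<close>)
      then show ?thesis unfolding v[OF f] by (simp only: frechet_derivative_eqI)
    qed
    also have "a e = \<tau> x (a e) *\<^sub>R unit_vec L \<tau> x" by (rule triv_expand[OF W derivationsD(1)[OF a e(1)]])
    finally have "a s = ?f x *\<^sub>R (\<tau> x (a e) *\<^sub>R unit_vec L \<tau> x) +
        section_deriv U \<phi> \<tau> s x v *\<^sub>R unit_vec L \<tau> x"
      unfolding ex .
    then show ?thesis
      unfolding coord_der_def using s bump_at[OF b] by (simp only: if_True) (simp add: scaleR_add_left mult.commute)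
  qed (simp add: coord_der_def derivationsD(2)[OF a])
  then show thesis using that by blast
qed

lemma partial_der_eq: "partial_der L U \<phi> \<tau> x v = coord_der U \<phi> \<tau> x v 0"
  by (auto simp: partial_der_def coord_der_def triv_inv_eq[OF W])

lemma eval_der_eq: "eval_der L x = coord_der U \<phi> \<tau> x 0 1"
proof
  fix s show "eval_der L x s = coord_der U \<phi> \<tau> x 0 1 s"
    using linear_0[OF section_rep_linear] triv_expand[OF W sectionsD(4)[OF _ W]]
    by (auto simp: eval_der_def coord_der_def)
qed

lemma coord_der_linear:
  "coord_der U \<phi> \<tau> x (v + v') (c + c') = (\<lambda>s. coord_der U \<phi> \<tau> x v c s + coord_der U \<phi> \<tau> x v' c' s)"
  "coord_der U \<phi> \<tau> x (k *\<^sub>R v) (k * c) = (\<lambda>s. k *\<^sub>R coord_der U \<phi> \<tau> x v c s)"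
  using linear_add[OF section_rep_linear] linear_scale[OF section_rep_linear]
  by (auto simp: coord_der_def fun_eq_iff algebra_simps)

lemma jetsD:
  assumes "\<alpha> \<in> jets_at L x"
  shows "a \<in> derivations_at L x \<Longrightarrow> \<alpha> a \<in> fibre L x" "a \<notin> derivations_at L x \<Longrightarrow> \<alpha> a = 0"
    "a \<in> derivations_at L x \<Longrightarrow> a' \<in> derivations_at L x \<Longrightarrow> \<alpha> (\<lambda>s. a s + a' s) = \<alpha> a + \<alpha> a'"
    "a \<in> derivations_at L x \<Longrightarrow> \<alpha> (\<lambda>s. k *\<^sub>R a s) = k *\<^sub>R \<alpha> a"
  using assms by (auto simp: jets_at_def Hom_def)

text \<open>A jet is linear in the coordinates \<open>(v, c)\<close> of a derivation. The part in
  \<open>v\<close> has a Riesz vector, the momentum, and the part in \<open>c\<close> is the value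
  on the identity derivation.\<close>

lemma jet_momentum:
  assumes \<alpha>: "\<alpha> \<in> jets_at L x"
  shows "\<exists>!p. \<forall>v. p \<bullet> v = \<tau> x (\<alpha> (partial_der L U \<phi> \<tau> x v))"
    "\<tau> x (\<alpha> (coord_der U \<phi> \<tau> x v c)) =
      (THE p. \<forall>v. p \<bullet> v = \<tau> x (\<alpha> (partial_der L U \<phi> \<tau> x v))) \<bullet> v + c * \<tau> x (\<alpha> (eval_der L x))"
proof -
  let ?h = "\<lambda>v. \<tau> x (\<alpha> (coord_der U \<phi> \<tau> x v 0))"
  note j = jetsD[OF \<alpha>] and d = coord_der_derivation and t = triv_add[OF W] triv_scale[OF W]
  have "linear ?h"
  proof (rule linearI)
    show "?h (v + v') = ?h v + ?h v'" for v v'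
      using coord_der_linear(1)[of v v' 0 0] j(3)[OF d d] j(1)[OF d] by (simp add: t)
    show "?h (k *\<^sub>R v) = k *\<^sub>R ?h v" for k v
      using coord_der_linear(2)[of k v 0] j(4)[OF d] j(1)[OF d] by (simp add: t)
  qed
  from riesz_ex1[OF this] show ex: "\<exists>!p. \<forall>v. p \<bullet> v = \<tau> x (\<alpha> (partial_der L U \<phi> \<tau> x v))"
    by (simp add: partial_der_eq)
  have "coord_der U \<phi> \<tau> x v c = (\<lambda>s. coord_der U \<phi> \<tau> x v 0 s + c *\<^sub>R coord_der U \<phi> \<tau> x 0 1 s)"
    using coord_der_linear(1)[of v 0 0 c] coord_der_linear(2)[of c 0 1] by simp
  moreover have "\<alpha> (\<lambda>s. coord_der U \<phi> \<tau> x v 0 s + c *\<^sub>R coord_der U \<phi> \<tau> x 0 1 s) =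
      \<alpha> (coord_der U \<phi> \<tau> x v 0) + c *\<^sub>R \<alpha> (coord_der U \<phi> \<tau> x 0 1)"
    using j(3)[OF d d, of v 0 "c *\<^sub>R 0" "c * 1"] j(4)[OF d, of c 0 1] by (simp add: coord_der_linear(2)[of c 0 1, simplified])
  moreover have "\<alpha> (coord_der U \<phi> \<tau> x v 0) \<in> fibre L x" "\<alpha> (coord_der U \<phi> \<tau> x 0 1) \<in> fibre L x"
    using j(1)[OF d] by auto
  ultimately show "\<tau> x (\<alpha> (coord_der U \<phi> \<tau> x v c)) =
      (THE p. \<forall>v. p \<bullet> v = \<tau> x (\<alpha> (partial_der L U \<phi> \<tau> x v))) \<bullet> v + c * \<tau> x (\<alpha> (eval_der L x))"
    using theI'[OF ex] by (simp add: t subspace_scale[OF triv_subspace[OF W]] partial_der_eq eval_der_eq)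
qed

text \<open>The section is locally an affine function of the coordinates. The formula on a whole
  neighbourhood, and not only the jet, is needed later to compute how the generators behave along
  the jet lift.\<close>

lemma section_with_jet:
  obtains s N where "s \<in> sections L" "aopen (base L) N" "x \<in> N" "N \<subseteq> U \<inter> W"
    "\<And>y. y \<in> N \<Longrightarrow> \<tau> y (s y) = u + p \<bullet> (\<phi> y - \<phi> x)"
    "\<tau> x (s x) = u" "\<And>v. section_deriv U \<phi> \<tau> s x v = p \<bullet> v"
proof -
  have h: "smooth_in (base L) (U \<inter> W) (\<lambda>y. u + p \<bullet> (\<phi> y - \<phi> x))"
    by (intro smooth_in_add[OF ch coord_open] smooth_in_inner[OF ch coord_open] smooth_in_diff[OF ch coord_open]
        smooth_in_const smooth_in_subset[OF smooth_in_chart[OF ch U(1)]]) auto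
  obtain s N where s: "s \<in> sections L" "aopen (base L) N" "x \<in> N" "N \<subseteq> U \<inter> W"
    "\<And>y. y \<in> N \<Longrightarrow> \<tau> y (s y) = u + p \<bullet> (\<phi> y - \<phi> x)"
    using local_section[OF W(1) coord_open _ _ h, of x] U W by auto
  have D: "((\<lambda>y. u + p \<bullet> (y - \<phi> x)) has_derivative (\<lambda>v. p \<bullet> v)) (at (\<phi> x))"
    by (auto intro!: derivative_eq_intros)
  have "section_deriv U \<phi> \<tau> s x = (\<lambda>v. p \<bullet> v)"
    by (rule section_rep_eqI[OF s(2,3) D]) (simp add: s(5))
  then show thesis using that[OF s] s(5)[OF s(3)] by simp
qed

text \<open>A section with the value and the momentum of \<alpha> has jet \<alpha>. Since
  \<open>Pi_sharp\<close> is described through jets of sections, this determines it on every jet at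
  the point.\<close>

lemma jet_surj:
  assumes \<alpha>: "\<alpha> \<in> jets_at L x"
  obtains s where "s \<in> sections L" "jet L s x = \<alpha>"
proof -
  define p where "p = (THE p. \<forall>v. p \<bullet> v = \<tau> x (\<alpha> (partial_der L U \<phi> \<tau> x v)))"
  obtain s where s: "s \<in> sections L" "\<tau> x (s x) = \<tau> x (\<alpha> (eval_der L x))"
    "\<And>v. section_deriv U \<phi> \<tau> s x v = p \<bullet> v"
    using section_with_jet[of "\<tau> x (\<alpha> (eval_der L x))" p] by metis
  have "jet L s x a = \<alpha> a" for a
  proof (cases "a \<in> derivations_at L x")
    case True
    then obtain v c where a: "a = coord_der U \<phi> \<tau> x v c" by (rule derivation_coords)
    have "\<tau> x (a s) = \<tau> x (\<alpha> a)"
      unfolding a by (simp add: coord_der_triv[OF s(1)] s jet_momentum(2)[OF \<alpha>] p_def)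
    then have "a s = \<alpha> a" by (rule triv_inj[OF W derivationsD(1)[OF True s(1)] jetsD(1)[OF \<alpha> True]])
    then show ?thesis using True by (simp add: jet_def)
  qed (simp add: jet_def jetsD(2)[OF \<alpha>])
  then show thesis using that s(1) by blast
qed

end

lemma derivations_at_add:
  assumes x: "x \<in> points (base L)" and a: "a \<in> derivations_at L x" "a' \<in> derivations_at L x"
  shows "(\<lambda>s. a s + k *\<^sub>R a' s) \<in> derivations_at L x"
proof -
  obtain U \<phi> where U: "(U, \<phi>) \<in> base L" "x \<in> U" using pointsE[OF x] .
  obtain W \<tau> where W: "(W, \<tau>) \<in> trivs L" "x \<in> W" using trivE[OF x] .
  note UW = U W
  obtain v c where v: "a = coord_der U \<phi> \<tau> x v c" using derivation_coords[OF UW a(1)] .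
  obtain v' c' where v': "a' = coord_der U \<phi> \<tau> x v' c'" using derivation_coords[OF UW a(2)] .
  have "(\<lambda>s. a s + k *\<^sub>R a' s) = coord_der U \<phi> \<tau> x (v + k *\<^sub>R v') (c + k * c')"
    unfolding v v' by (simp add: coord_der_linear[OF UW])
  then show ?thesis using coord_der_derivation[OF UW] by simp
qed

lemma derivations_at_diff:
  "x \<in> points (base L) \<Longrightarrow> a \<in> derivations_at L x \<Longrightarrow> a' \<in> derivations_at L x \<Longrightarrow>
    (\<lambda>s. a s - a' s) \<in> derivations_at L x"
  using derivations_at_add[of x a a' "-1"] by simp

lemma jet_surj':
  assumes "x \<in> points (base L)" "\<alpha> \<in> jets_at L x"
  obtains s where "s \<in> sections L" "jet L s x = \<alpha>"
  using assms by (meson jet_surj pointsE trivE)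

lemma jet_in_jets:
  assumes x: "x \<in> points (base L)" and s: "s \<in> sections L" shows "jet L s x \<in> jets_at L x"
proof -
  have "(\<lambda>s. a s + a' s) \<in> derivations_at L x" "(\<lambda>s. k *\<^sub>R a s) \<in> derivations_at L x"
    if "a \<in> derivations_at L x" "a' \<in> derivations_at L x" for a a' k
    using derivations_at_add[OF x that, of 1] derivations_at_add[OF x that(1) that(1), of "k - 1"]
    by (simp_all add: algebra_simps)
  then show ?thesis
    unfolding jets_at_def Hom_def jet_def using derivationsD(1)[OF _ s] by auto
qed

lemma eval_der_derivation: "x \<in> points (base L) \<Longrightarrow> eval_der L x \<in> derivations_at L x"
  by (metis coord_der_derivation eval_der_eq pointsE trivE)

end

section \<open>Factors and pullbacks\<close>

text \<open>On one-dimensional fibres a factor is, in trivialisations, multiplication by a function.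
  Smoothness of the map of total spaces is replaced by smoothness of this multiplier.\<close>

definition hfactor :: "('m, 'e::finite_dim_inner, 'v::real_vector) line_bundle \<Rightarrow>
    ('n, 'f::finite_dim_inner, 'w::real_vector) line_bundle \<Rightarrow> ('m \<Rightarrow> 'n) \<Rightarrow> ('m \<Rightarrow> 'v \<Rightarrow> 'w) \<Rightarrow> bool"
  where "hfactor L1 L2 b B \<longleftrightarrow> smooth_map (base L1) (base L2) b \<and>
    (\<forall>x\<in>points (base L1). linear_iso (fibre L1 x) (fibre L2 (b x)) (B x)) \<and>
    (\<forall>(W1, \<tau>1)\<in>trivs L1. \<forall>(W2, \<tau>2)\<in>trivs L2.
      smooth_in (base L1) (W1 \<inter> b -` W2) (\<lambda>x. \<tau>2 (b x) (B x (unit_vec L1 \<tau>1 x))))"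

text \<open>The multiplier is the fibre coordinate of the image of the unit vector: restrict the
  coordinate form of the map of total spaces to the slice where the fibre coordinate is 1.\<close>

lemma factor_imp_hfactor:
  assumes "hline_bundle L1" "hline_bundle L2" and f: "factor L1 L2 b B"
  shows "hfactor L1 L2 b B"
proof -
  interpret L1: hbundle L1 by (rule hbundle.intro) fact
  interpret L2: hbundle L2 by (rule hbundle.intro) fact
  have b: "smooth_map (base L1) (base L2) b"
    and g: "smooth_map (total_space L1) (total_space L2) (\<lambda>(x, v). (b x, B x v))"
    and iso: "\<And>x. x \<in> points (base L1) \<Longrightarrow> linear_iso (fibre L1 x) (fibre L2 (b x)) (B x)"
    using f by (auto simp: factor_def)
  have "smooth_in (base L1) (W1 \<inter> b -` W2) (\<lambda>x. \<tau>2 (b x) (B x (unit_vec L1 \<tau>1 x)))"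
    if W1: "(W1, \<tau>1) \<in> trivs L1" and W2: "(W2, \<tau>2) \<in> trivs L2" for W1 \<tau>1 W2 \<tau>2
  proof (rule smooth_in_local[OF L1.ch])
    fix x assume x: "x \<in> W1 \<inter> b -` W2"
    have xp: "x \<in> points (base L1)" using x L1.triv_subset[OF W1] by auto
    obtain U1 \<phi>1 where U1: "(U1, \<phi>1) \<in> base L1" "x \<in> U1" using pointsE[OF xp] .
    obtain U2 \<phi>2 where U2: "(U2, \<phi>2) \<in> base L2" "b x \<in> U2" using pointsE[OF smooth_map_points[OF b xp]] .
    let ?T = "(U1 \<inter> W1) \<inter> (points (base L1) \<inter> b -` (U2 \<inter> W2))"
    have T: "aopen (base L1) ?T"
      by (intro openin_Int L1.coord_open[OF U1 W1] smooth_map_aopen_vimage[OF b L1.ch L2.ch]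
          L2.coord_open[OF U2 W2]) (use x in auto)
    let ?V1 = "{(x, v). x \<in> U1 \<inter> W1 \<and> v \<in> fibre L1 x}" and ?\<Phi>1 = "\<lambda>(x, v). (\<phi>1 x, \<tau>1 x v)"
    let ?V2 = "{(x, v). x \<in> U2 \<inter> W2 \<and> v \<in> fibre L2 x}" and ?\<Phi>2 = "\<lambda>(x, v). (\<phi>2 x, \<tau>2 x v)"
    let ?g = "\<lambda>(x, v). (b x, B x v)"
    have V: "(?V1, ?\<Phi>1) \<in> total_space L1" "(?V2, ?\<Phi>2) \<in> total_space L2"
      using U1 U2 W1 W2 unfolding L1.total_space_chart L2.total_space_chart by blast+
    have op: "open (?\<Phi>1 ` (?V1 \<inter> ?g -` ?V2))"
      and sm: "smooth_on (?\<Phi>1 ` (?V1 \<inter> ?g -` ?V2)) (?\<Phi>2 \<circ> ?g \<circ> inv_into ?V1 ?\<Phi>1)"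
      using g V unfolding smooth_map_def by blast+
    have inj: "inj_on ?\<Phi>1 ?V1"
    proof (rule inj_onI, clarify)
      fix a v a' v'
      assume *: "a \<in> U1" "a \<in> W1" "v \<in> fibre L1 a" "a' \<in> U1" "a' \<in> W1" "v' \<in> fibre L1 a'"
        "\<phi>1 a = \<phi>1 a'" "\<tau>1 a v = \<tau>1 a' v'"
      then have "a = a'" using chartedD(1)[OF L1.ch U1(1)] by (auto simp: inj_on_def)
      then show "a = a' \<and> v = v'" using L1.triv_inj[OF W1 *(2,3)] * by auto
    qed
    have in_dom: "(y, unit_vec L1 \<tau>1 y) \<in> ?V1 \<inter> ?g -` ?V2" if "y \<in> ?T" for y
      using that L1.unit_in[OF W1] linear_iso_inv(4)[OF iso] by auto
    have "smooth_on (\<phi>1 ` ?T) (\<lambda>y. snd ((?\<Phi>2 \<circ> ?g \<circ> inv_into ?V1 ?\<Phi>1) (y, 1)))"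
    proof (rule smooth_on_compose[of _ "?\<Phi>1 ` (?V1 \<inter> ?g -` ?V2)" "\<lambda>y. (y, 1)" "\<lambda>z. snd ((?\<Phi>2 \<circ> ?g \<circ> inv_into ?V1 ?\<Phi>1) z)"])
      show "open (\<phi>1 ` ?T)" using aopen_image[OF L1.ch U1(1) T] by (metis Int_assoc Int_absorb)
      show "(\<lambda>y. (y, 1)) ` \<phi>1 ` ?T \<subseteq> ?\<Phi>1 ` (?V1 \<inter> ?g -` ?V2)"
      proof clarify
        fix y assume "y \<in> U1" "y \<in> W1" "y \<in> points (base L1)" "b y \<in> U2" "b y \<in> W2"
        then have "?\<Phi>1 (y, unit_vec L1 \<tau>1 y) \<in> ?\<Phi>1 ` (?V1 \<inter> ?g -` ?V2)" using in_dom[of y] by blast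
        then show "(\<phi>1 y, 1) \<in> ?\<Phi>1 ` (?V1 \<inter> ?g -` ?V2)" using L1.triv_unit[OF W1 \<open>y \<in> W1\<close>] by simp
      qed
      show "smooth_on (\<phi>1 ` ?T) (\<lambda>y. (y, 1::real))"
        using aopen_image[OF L1.ch U1(1) T] by (intro smooth_on_Pair) (simp_all add: Int_assoc[symmetric])
      show "smooth_on (?\<Phi>1 ` (?V1 \<inter> ?g -` ?V2)) (\<lambda>z. snd ((?\<Phi>2 \<circ> ?g \<circ> inv_into ?V1 ?\<Phi>1) z))"
        by (rule smooth_on_snd[OF op sm])
    qed (rule op)
    then have "smooth_on (\<phi>1 ` ?T) (\<lambda>y. \<tau>2 (b (inv_into U1 \<phi>1 y)) (B (inv_into U1 \<phi>1 y) (unit_vec L1 \<tau>1 (inv_into U1 \<phi>1 y))))"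
    proof (rule smooth_on_cong[rotated])
      show "open (\<phi>1 ` ?T)" using aopen_image[OF L1.ch U1(1) T] by (metis Int_assoc Int_absorb)
      fix z assume "z \<in> \<phi>1 ` ?T"
      then obtain y where y: "y \<in> ?T" "z = \<phi>1 y" by auto
      then have "inv_into ?V1 ?\<Phi>1 (z, 1) = (y, unit_vec L1 \<tau>1 y)"
        using inv_into_f_f[OF inj, of "(y, unit_vec L1 \<tau>1 y)"] in_dom[OF y(1)] L1.triv_unit[OF W1] by auto
      then show "snd ((?\<Phi>2 \<circ> ?g \<circ> inv_into ?V1 ?\<Phi>1) (z, 1)) =
        \<tau>2 (b (inv_into U1 \<phi>1 z)) (B (inv_into U1 \<phi>1 z) (unit_vec L1 \<tau>1 (inv_into U1 \<phi>1 z)))"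
        using y inv_chart[OF L1.ch U1(1)] by simp
    qed
    then have "smooth_in (base L1) ?T (\<lambda>x. \<tau>2 (b x) (B x (unit_vec L1 \<tau>1 x)))"
      by (intro smooth_in_chartI[OF L1.ch U1(1) T]) auto
    then show "\<exists>T. aopen (base L1) T \<and> x \<in> T \<and> smooth_in (base L1) T (\<lambda>x. \<tau>2 (b x) (B x (unit_vec L1 \<tau>1 x)))"
      using T x xp U1 U2 by blast
  qed
  then show ?thesis using b iso by (auto simp: hfactor_def)
qed

locale bundle_factor = L1: hbundle L1 + L2: hbundle L2
  for L1 :: "('m, 'e::finite_dim_inner, 'v::real_vector) line_bundle"
    and L2 :: "('n, 'f::finite_dim_inner, 'w::real_vector) line_bundle" +
  fixes b :: "'m \<Rightarrow> 'n" and B :: "'m \<Rightarrow> 'v \<Rightarrow> 'w"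
  assumes hfactor: "hfactor L1 L2 b B"
begin

abbreviation "pull \<equiv> section_pullback L1 b B"

lemma b_smooth: "smooth_map (base L1) (base L2) b"
  and B_iso: "x \<in> points (base L1) \<Longrightarrow> linear_iso (fibre L1 x) (fibre L2 (b x)) (B x)"
  and B_smooth: "(W1, \<tau>1) \<in> trivs L1 \<Longrightarrow> (W2, \<tau>2) \<in> trivs L2 \<Longrightarrow>
      smooth_in (base L1) (W1 \<inter> b -` W2) (\<lambda>x. \<tau>2 (b x) (B x (unit_vec L1 \<tau>1 x)))"
  using hfactor unfolding hfactor_def by fastforce+

lemmas b_points = smooth_map_points[OF b_smooth]
lemmas B_inv = linear_iso_inv[OF B_iso]
lemmas B_lin = linear_isoD[OF B_iso]

lemma B_0: "x \<in> points (base L1) \<Longrightarrow> B x 0 = 0"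
  using linear_iso_0[OF B_iso L1.fibre_subspace] .

lemma B_minus: "x \<in> points (base L1) \<Longrightarrow> v \<in> fibre L1 x \<Longrightarrow> B x (- v) = - B x v"
  using B_lin(2)[of x v "-1"] by simp

lemma B_inj: "x \<in> points (base L1) \<Longrightarrow> u \<in> fibre L1 x \<Longrightarrow> v \<in> fibre L1 x \<Longrightarrow> B x u = B x v \<Longrightarrow> u = v"
  using B_inv(3) by metis

lemma B_triv:
  assumes "(W1, \<tau>1) \<in> trivs L1" "x \<in> W1" "(W2, \<tau>2) \<in> trivs L2" "b x \<in> W2" "v \<in> fibre L1 x"
  shows "\<tau>2 (b x) (B x v) = \<tau>1 x v * \<tau>2 (b x) (B x (unit_vec L1 \<tau>1 x))"
proof -
  have x: "x \<in> points (base L1)" using assms L1.triv_subset by blast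
  have "B x v = \<tau>1 x v *\<^sub>R B x (unit_vec L1 \<tau>1 x)"
    using L1.triv_expand[OF assms(1,2,5)] B_lin(2)[OF x L1.unit_in[OF assms(1,2)]] by metis
  then show ?thesis
    using L2.triv_scale[OF assms(3,4)] B_inv(4)[OF x L1.unit_in[OF assms(1,2)]] by simp
qed

lemma B_unit_nonzero:
  assumes "(W1, \<tau>1) \<in> trivs L1" "x \<in> W1" "(W2, \<tau>2) \<in> trivs L2" "b x \<in> W2"
  shows "\<tau>2 (b x) (B x (unit_vec L1 \<tau>1 x)) \<noteq> 0"
proof
  assume 0: "\<tau>2 (b x) (B x (unit_vec L1 \<tau>1 x)) = 0"
  have x: "x \<in> points (base L1)" using assms L1.triv_subset by blast
  let ?v = "inv_into (fibre L1 x) (B x) (unit_vec L2 \<tau>2 (b x))"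
  have "?v \<in> fibre L1 x" "B x ?v = unit_vec L2 \<tau>2 (b x)"
    using B_inv[OF x] L2.unit_in[OF assms(3,4)] by auto
  then show False using B_triv[OF assms] L2.triv_unit[OF assms(3,4)] 0 by force
qed

lemma pull_at: "x \<in> points (base L1) \<Longrightarrow> pull s x = inv_into (fibre L1 x) (B x) (s (b x))"
  by (simp add: section_pullback_def)

lemma pull_fibre: "x \<in> points (base L1) \<Longrightarrow> s \<in> sections L2 \<Longrightarrow> pull s x \<in> fibre L1 x"
  by (simp add: pull_at B_inv(2) L2.sectionsD(1) b_points)

lemma B_pull: "x \<in> points (base L1) \<Longrightarrow> s \<in> sections L2 \<Longrightarrow> B x (pull s x) = s (b x)"
  by (simp add: pull_at B_inv(1) L2.sectionsD(1) b_points)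

lemma pull_triv:
  assumes "(W1, \<tau>1) \<in> trivs L1" "x \<in> W1" "(W2, \<tau>2) \<in> trivs L2" "b x \<in> W2" "s \<in> sections L2"
  shows "\<tau>1 x (pull s x) = \<tau>2 (b x) (s (b x)) / \<tau>2 (b x) (B x (unit_vec L1 \<tau>1 x))"
proof -
  have x: "x \<in> points (base L1)" using assms L1.triv_subset by blast
  show ?thesis
    using B_triv[OF assms(1-4) pull_fibre[OF x assms(5)]] B_unit_nonzero[OF assms(1-4)]
    by (simp add: B_pull[OF x assms(5)] field_simps)
qed

lemma pull_section:
  assumes s: "s \<in> sections L2" shows "pull s \<in> sections L1"
proof (rule L1.sectionsI)
  fix x assume x: "x \<in> points (base L1)"
  obtain W1 \<tau>1 where W1: "(W1, \<tau>1) \<in> trivs L1" "x \<in> W1" using L1.trivE[OF x] .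
  obtain W2 \<tau>2 where W2: "(W2, \<tau>2) \<in> trivs L2" "b x \<in> W2" using L2.trivE[OF b_points[OF x]] .
  let ?T = "W1 \<inter> (points (base L1) \<inter> b -` W2)"
  have T: "aopen (base L1) ?T"
    by (intro openin_Int L1.triv_open[OF W1(1)] smooth_map_aopen_vimage[OF b_smooth L1.ch L2.ch] L2.triv_open[OF W2(1)])
  have "smooth_in (base L1) ?T (\<lambda>x. \<tau>2 (b x) (s (b x)) / \<tau>2 (b x) (B x (unit_vec L1 \<tau>1 x)))"
  proof (rule smooth_in_divide[OF L1.ch T])
    show "smooth_in (base L1) ?T (\<lambda>x. \<tau>2 (b x) (s (b x)))"
      by (rule smooth_in_pullback[OF b_smooth L1.ch L2.ch T L2.triv_open[OF W2(1)] _ L2.sectionsD(3)[OF s W2(1)]]) auto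
    show "smooth_in (base L1) ?T (\<lambda>x. \<tau>2 (b x) (B x (unit_vec L1 \<tau>1 x)))"
      by (rule smooth_in_subset[OF B_smooth[OF W1(1) W2(1)]]) auto
  qed (use B_unit_nonzero[OF W1(1) _ W2(1)] in auto)
  then have "smooth_in (base L1) ?T (\<lambda>x. \<tau>1 x (pull s x))"
    by (rule smooth_in_cong[OF L1.ch T]) (simp add: pull_triv[OF W1(1) _ W2(1) _ s])
  then show "\<exists>W \<tau> T. (W, \<tau>) \<in> trivs L1 \<and> aopen (base L1) T \<and> x \<in> T \<and> T \<subseteq> W \<and> smooth_in (base L1) T (\<lambda>x. \<tau> x (pull s x))"
    using W1 W2 x T by blast
qed (auto simp: s section_pullback_def intro: B_inv(2) L2.sectionsD(1)[OF s] b_points)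

lemma pull_add:
  assumes "s \<in> sections L2" "r \<in> sections L2"
  shows "pull (\<lambda>x. s x + r x) = (\<lambda>x. pull s x + pull r x)"
proof
  fix x show "pull (\<lambda>x. s x + r x) x = pull s x + pull r x"
  proof (cases "x \<in> points (base L1)")
    case True
    show ?thesis
      by (rule B_inj[OF True])
        (simp_all add: True B_lin B_pull pull_fibre assms L2.sections_add subspace_add[OF L1.fibre_subspace])
  qed (simp add: section_pullback_def)
qed

lemma pull_scale:
  assumes "s \<in> sections L2"
  shows "pull (\<lambda>x. c *\<^sub>R s x) = (\<lambda>x. c *\<^sub>R pull s x)"
proof
  fix x show "pull (\<lambda>x. c *\<^sub>R s x) x = c *\<^sub>R pull s x"
  proof (cases "x \<in> points (base L1)")
    case True
    show ?thesis
      by (rule B_inj[OF True])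
        (simp_all add: True B_lin B_pull pull_fibre assms L2.sections_scale subspace_scale[OF L1.fibre_subspace])
  qed (simp add: section_pullback_def)
qed

lemma pull_minus: "s \<in> sections L2 \<Longrightarrow> pull (\<lambda>x. - s x) = (\<lambda>x. - pull s x)"
  using pull_scale[of s "-1"] by simp

lemma pull_diff: "s \<in> sections L2 \<Longrightarrow> r \<in> sections L2 \<Longrightarrow> pull (\<lambda>x. s x - r x) = (\<lambda>x. pull s x - pull r x)"
  using pull_add[OF _ L2.sections_minus, of s r] pull_minus[of r] by simp

definition pull_fun :: "('n \<Rightarrow> real) \<Rightarrow> 'm \<Rightarrow> real"
  where "pull_fun f = (\<lambda>x. if x \<in> points (base L1) then f (b x) else 0)"

lemma pull_fun_smooth:
  assumes "f \<in> smooth_functions (base L2)" shows "pull_fun f \<in> smooth_functions (base L1)"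
proof -
  have "smooth_in (base L1) (points (base L1)) (\<lambda>x. f (b x))"
    by (rule smooth_in_pullback[OF b_smooth L1.ch L2.ch aopen_points aopen_points _ smooth_functionsD(1)[OF assms]])
      (use b_points in auto)
  then have "smooth_in (base L1) (points (base L1)) (pull_fun f)"
    by (rule smooth_in_cong[OF L1.ch aopen_points]) (simp add: pull_fun_def)
  then show ?thesis by (simp add: smooth_functions_iff pull_fun_def)
qed

lemma pull_mult:
  assumes "f \<in> smooth_functions (base L2)" "s \<in> sections L2"
  shows "pull (\<lambda>x. f x *\<^sub>R s x) = (\<lambda>x. pull_fun f x *\<^sub>R pull s x)"
proof
  fix x show "pull (\<lambda>x. f x *\<^sub>R s x) x = pull_fun f x *\<^sub>R pull s x"
  proof (cases "x \<in> points (base L1)")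
    case True
    show ?thesis
      by (rule B_inj[OF True])
        (simp_all add: True B_lin B_pull pull_fibre pull_fun_def assms L2.sections_mult subspace_scale[OF L1.fibre_subspace])
  qed (simp add: section_pullback_def)
qed

abbreviation "dmap \<equiv> der_map L1 L2 b B"

lemma tangent_map_eq: "g \<in> smooth_functions (base L2) \<Longrightarrow> tangent_map (base L1) (base L2) b X g = X (pull_fun g)"
  by (simp add: tangent_map_def pull_fun_def)

lemma tangent_map_tangent:
  assumes x: "x \<in> points (base L1)" and X: "X \<in> tangent_space (base L1) x"
  shows "tangent_map (base L1) (base L2) b X \<in> tangent_space (base L2) (b x)"
proof -
  note sm = smooth_functions_add[OF L2.ch] smooth_functions_mult[OF L2.ch] smooth_functions_scaleR[OF L2.ch]
    and t = tangentD[OF X]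
  have add: "pull_fun (\<lambda>x. f x + g x) = (\<lambda>x. pull_fun f x + pull_fun g x)"
    and mult: "pull_fun (\<lambda>x. f x * g x) = (\<lambda>x. pull_fun f x * pull_fun g x)"
    and scale: "pull_fun (\<lambda>x. c * f x) = (\<lambda>x. c * pull_fun f x)" for f g c
    by (auto simp: pull_fun_def)
  have at: "pull_fun f x = f (b x)" for f using x by (simp add: pull_fun_def)
  show ?thesis
    unfolding tangent_space_def Hom_def
  proof (intro CollectI conjI ballI allI impI)
    fix f g assume f: "f \<in> smooth_functions (base L2)" and g: "g \<in> smooth_functions (base L2)"
    show "tangent_map (base L1) (base L2) b X (\<lambda>x. f x + g x) =
        tangent_map (base L1) (base L2) b X f + tangent_map (base L1) (base L2) b X g"
      by (simp add: tangent_map_eq f g sm add t pull_fun_smooth)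
    show "tangent_map (base L1) (base L2) b X (\<lambda>x. f x * g x) =
        f (b x) * tangent_map (base L1) (base L2) b X g + tangent_map (base L1) (base L2) b X f * g (b x)"
      by (simp add: tangent_map_eq f g sm mult t pull_fun_smooth at)
  next
    fix f and c :: real assume f: "f \<in> smooth_functions (base L2)"
    show "tangent_map (base L1) (base L2) b X (\<lambda>x. c *\<^sub>R f x) = c *\<^sub>R tangent_map (base L1) (base L2) b X f"
      using sm(3)[OF f, of c] by (simp add: tangent_map_eq f scale t pull_fun_smooth)
  qed (simp_all add: tangent_map_def)
qed

text \<open>The Leibniz rule is pulled back along the factor. This permits a tangent vector of the
  jet lift to be studied through a derivation that has it as symbol.\<close>

lemma dmap_symbol:
  assumes x: "x \<in> points (base L1)" and X: "L1.is_symbol x a X" and a: "a \<in> derivations_at L1 x"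
  shows "L2.is_symbol (b x) (dmap x a) (tangent_map (base L1) (base L2) b X)"
  unfolding L2.is_symbol_def
proof (intro conjI ballI)
  show "tangent_map (base L1) (base L2) b X \<in> tangent_space (base L2) (b x)"
    using X by (intro tangent_map_tangent x) (simp add: L1.is_symbol_def)
  fix f s assume f: "f \<in> smooth_functions (base L2)" and s: "s \<in> sections L2"
  have "a (pull (\<lambda>y. f y *\<^sub>R s y)) = pull_fun f x *\<^sub>R a (pull s) + X (pull_fun f) *\<^sub>R pull s x"
    using X f s by (simp add: pull_mult L1.is_symbol_def pull_fun_smooth pull_section)
  then show "dmap x a (\<lambda>y. f y *\<^sub>R s y) = f (b x) *\<^sub>R dmap x a s + tangent_map (base L1) (base L2) b X f *\<^sub>R s (b x)"
    using f s x by (simp add: der_map_def L2.sections_mult tangent_map_eq B_lin B_pull pull_fibre pull_section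
        L1.derivationsD(1)[OF a] subspace_scale[OF L1.fibre_subspace] pull_fun_def)
qed

lemma dmap_derivation:
  assumes x: "x \<in> points (base L1)" and a: "a \<in> derivations_at L1 x"
  shows "dmap x a \<in> derivations_at L2 (b x)"
proof -
  have "dmap x a \<in> Hom (sections L2) (fibre L2 (b x))"
    unfolding Hom_def der_map_def
    using x L1.derivationsD[OF a]
    by (auto simp: L2.sections_add L2.sections_scale pull_add pull_scale pull_section B_inv(4) B_lin)
  then show ?thesis
    using dmap_symbol[OF x L1.derivation_symbol[OF x a] a] by (auto simp: L2.derivations_at_iff)
qed

lemma dmap_at: "s \<in> sections L2 \<Longrightarrow> dmap x a s = B x (a (pull s))"
  by (simp add: der_map_def)

lemma dmap_eval: "x \<in> points (base L1) \<Longrightarrow> dmap x (eval_der L1 x) = eval_der L2 (b x)"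
  by (auto simp: der_map_def eval_der_def pull_section B_pull)

end

lemma hline_bundle_pullback:
  assumes L: "hline_bundle L" and A: "hmanifold A" and f: "smooth_map A (base L) f"
  shows "hline_bundle (pullback_bundle A f L)"
    and "hfactor (pullback_bundle A f L) L f (\<lambda>_ l. l)"
proof -
  interpret L: hbundle L by (rule hbundle.intro) fact
  note ch = hmanifold_charted[OF A]
  let ?P = "pullback_bundle A f L"
  have simps [simp]: "base ?P = A" "fibre ?P x = fibre L (f x)" for x
    by (simp_all add: pullback_bundle_def)
  have trivs: "c \<in> trivs ?P \<longleftrightarrow> (\<exists>W \<tau>. (W, \<tau>) \<in> trivs L \<and> c = (points A \<inter> f -` W, \<lambda>x. \<tau> (f x)))" for c
    by (auto simp: pullback_bundle_def)
  have sm: "smooth_in A ((points A \<inter> f -` W) \<inter> f -` W') (\<lambda>x. \<tau>' (f x) (unit_vec L \<tau> (f x)))"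
    if "(W, \<tau>) \<in> trivs L" "(W', \<tau>') \<in> trivs L" for W \<tau> W' \<tau>'
  proof (rule smooth_in_pullback[OF f ch L.ch])
    have W: "aopen (base L) (W \<inter> W')" using that by (intro openin_Int L.triv_open)
    have eq: "points A \<inter> f -` W \<inter> f -` W' = points A \<inter> f -` (W \<inter> W')" by auto
    show "aopen A (points A \<inter> f -` W \<inter> f -` W')"
      unfolding eq by (rule smooth_map_aopen_vimage[OF f ch L.ch W])
    show "aopen (base L) (W \<inter> W')" by (rule W)
    show "smooth_in (base L) (W \<inter> W') (\<lambda>x. \<tau>' x (unit_vec L \<tau> x))" by (rule L.triv_transition[OF that])
  qed auto
  show P: "hline_bundle ?P"
    unfolding hline_bundle_def
  proof (intro conjI ballI)
    show "(\<Union>(W, \<tau>)\<in>trivs ?P. W) = points (base ?P)"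
    proof (intro equalityI subsetI)
      fix x assume x: "x \<in> points (base ?P)"
      then obtain W \<tau> where "(W, \<tau>) \<in> trivs L" "f x \<in> W" using L.trivE smooth_map_points[OF f] by (metis simps(1))
      then have "(points A \<inter> f -` W, \<lambda>x. \<tau> (f x)) \<in> trivs ?P" "x \<in> points A \<inter> f -` W" using x unfolding trivs by auto
      then show "x \<in> (\<Union>(W, \<tau>)\<in>trivs ?P. W)" by blast
    qed (auto simp: trivs)
    fix c assume "c \<in> trivs ?P"
    then obtain W \<tau> where c: "(W, \<tau>) \<in> trivs L" "c = (points A \<inter> f -` W, \<lambda>x. \<tau> (f x))" unfolding trivs by blast
    show "case c of (W, \<tau>) \<Rightarrow> aopen (base ?P) W \<and> (\<forall>x\<in>W. linear_iso (fibre ?P x) UNIV (\<tau> x))"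
      using smooth_map_aopen_vimage[OF f ch L.ch L.triv_open[OF c(1)]] L.triv_iso[OF c(1)] by (simp add: c)
    have "smooth_in (base ?P) (points A \<inter> f -` W \<inter> W') (\<lambda>x. \<tau>' x (inv_into (fibre ?P x) (\<tau> (f x)) 1))"
      if "(W', \<tau>') \<in> trivs ?P" for W' \<tau>'
    proof -
      obtain V \<sigma> where d: "(V, \<sigma>) \<in> trivs L" "W' = points A \<inter> f -` V" "\<tau>' = (\<lambda>x. \<sigma> (f x))" using \<open>(W', \<tau>') \<in> trivs ?P\<close> unfolding trivs by blast
      have eq: "points A \<inter> f -` W \<inter> W' = points A \<inter> f -` W \<inter> f -` V" unfolding d(2) by auto
      show ?thesis unfolding eq using sm[OF c(1) d(1)] by (simp add: d(3) unit_vec_def)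
    qed
    then show "case c of (W, \<tau>) \<Rightarrow> \<forall>(W', \<tau>')\<in>trivs ?P. smooth_in (base ?P) (W \<inter> W')
        (\<lambda>x. \<tau>' x (inv_into (fibre ?P x) (\<tau> x) 1))"
      by (auto simp: c)
  qed (use A smooth_map_points[OF f] L.fibre_subspace in auto)
  show "hfactor ?P L f (\<lambda>_ l. l)"
    unfolding hfactor_def
  proof (intro conjI ballI)
    fix c assume "c \<in> trivs ?P"
    then obtain W \<tau> where c: "(W, \<tau>) \<in> trivs L" "c = (points A \<inter> f -` W, \<lambda>x. \<tau> (f x))"
      unfolding trivs by blast
    show "case c of (W1, \<tau>1) \<Rightarrow> \<forall>(W2, \<tau>2)\<in>trivs L.
      smooth_in (base ?P) (W1 \<inter> f -` W2) (\<lambda>x. \<tau>2 (f x) (unit_vec ?P \<tau>1 x))"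
      using sm[OF c(1)] by (auto simp: c unit_vec_def)
  qed (use f in \<open>auto simp: linear_iso_ident\<close>)
qed

context hbundle
begin

section \<open>Derivation fields\<close>

text \<open>Coordinate derivations made global by cutting off the direction vector. Near the centre
  of the bump function they span the derivations together with the identity field.\<close>

definition frame_field :: "'m set \<Rightarrow> ('m \<Rightarrow> 'e) \<Rightarrow> 'm set \<Rightarrow> ('m \<Rightarrow> 'v \<Rightarrow> real) \<Rightarrow> ('m \<Rightarrow> real) \<Rightarrow> 'e \<Rightarrow> ('m \<Rightarrow> 'v) \<Rightarrow> 'm \<Rightarrow> 'v"
  where "frame_field U \<phi> W \<tau> \<rho> w = (\<lambda>s y. if y \<in> U \<inter> W then coord_der U \<phi> \<tau> y (\<rho> y *\<^sub>R w) 0 s else 0)"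

text \<open>Its linear section is the tautological value coordinate on the jet bundle: at the jet of
  \<open>s\<close> it returns the value of \<open>s\<close>.\<close>

definition ident_field :: "('m \<Rightarrow> 'v) \<Rightarrow> 'm \<Rightarrow> 'v"
  where "ident_field = (\<lambda>s. if s \<in> sections L then s else (\<lambda>_. 0))"

lemma derivationsI:
  assumes "\<And>s. s \<in> sections L \<Longrightarrow> a s \<in> sections L" "\<And>s x. s \<notin> sections L \<Longrightarrow> a s x = 0"
    "\<And>x. x \<in> points (base L) \<Longrightarrow> (\<lambda>s. a s x) \<in> derivations_at L x"
  shows "a \<in> derivations L"
  using assms by (auto simp: derivations_def)

lemma derivations_fieldD:
  assumes "a \<in> derivations L"
  shows "s \<in> sections L \<Longrightarrow> a s \<in> sections L" "s \<notin> sections L \<Longrightarrow> a s = (\<lambda>_. 0)"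
    "x \<in> points (base L) \<Longrightarrow> (\<lambda>s. a s x) \<in> derivations_at L x"
  using assms by (auto simp: derivations_def)

lemma zero_derivation: "x \<in> points (base L) \<Longrightarrow> (\<lambda>_. 0) \<in> derivations_at L x"
  using derivations_at_add[of x "eval_der L x" "eval_der L x" "-1"] eval_der_derivation by simp

lemma frame_field_derivation:
  assumes U: "(U, \<phi>) \<in> base L" "x \<in> U" and W: "(W, \<tau>) \<in> trivs L" "x \<in> W" and b: "bump (base L) x (U \<inter> W) \<rho>"
  shows "frame_field U \<phi> W \<tau> \<rho> w \<in> derivations L"
proof (rule derivationsI)
  let ?A = "frame_field U \<phi> W \<tau> \<rho> w"
  note o = coord_open[OF U W]
  show "?A s \<in> sections L" if s: "s \<in> sections L" for s
  proof (rule sectionsI)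
    show "?A s y \<in> fibre L y" if "y \<in> points (base L)" for y
      using coord_der_fibre[OF U(1) _ W(1) _ s] subspace_0[OF fibre_subspace[OF that]] by (simp add: frame_field_def)
    show "?A s y = 0" if "y \<notin> points (base L)" for y
      using that chart_subset_points[OF U(1)] by (auto simp: frame_field_def)
    fix y assume y: "y \<in> points (base L)"
    obtain C where C: "closedin (atlas_topology (base L)) C" "C \<subseteq> U \<inter> W" "\<And>y. y \<notin> C \<Longrightarrow> \<rho> y = 0"
      using b by (auto simp: bump_def)
    show "\<exists>W \<tau> T. (W, \<tau>) \<in> trivs L \<and> aopen (base L) T \<and> y \<in> T \<and> T \<subseteq> W \<and>
      smooth_in (base L) T (\<lambda>x. \<tau> x (?A s x))"
    proof (cases "y \<in> C")
      case True
      let ?D = "\<lambda>z. frechet_derivative ((\<lambda>y. \<tau> y (s y)) \<circ> inv_into U \<phi>) (at z) w"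
      have "smooth_in (base L) (U \<inter> W) (\<lambda>y. ?D (\<phi> y))"
        by (rule smooth_in_compose[OF ch o smooth_in_subset[OF smooth_in_chart[OF ch U(1)]]
              image_coord_open[OF U W] _ smooth_on_frechet_derivative[OF section_rep_smooth[OF U W s]]]) auto
      then have "smooth_in (base L) (U \<inter> W) (\<lambda>y. \<rho> y * ?D (\<phi> y))"
        using smooth_functionsD(1)[OF bump_smooth[OF b]] aopen_imp_subset[OF o]
        by (intro smooth_in_mult[OF ch o]) (rule smooth_in_subset)
      then have "smooth_in (base L) (U \<inter> W) (\<lambda>x. \<tau> x (?A s x))"
        by (rule smooth_in_cong[OF ch o])
          (use s in \<open>auto simp: frame_field_def coord_der_triv[OF U(1) _ W(1)] linear_scale[OF section_rep_linear[OF U(1) _ W(1)]]\<close>)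
      then show ?thesis using W(1) o True C(2) by blast
    next
      case False
      obtain W' \<tau>' where W': "(W', \<tau>') \<in> trivs L" "y \<in> W'" using trivE[OF y] .
      have o: "aopen (base L) (W' - C)" using triv_open[OF W'(1)] C(1) by (rule openin_diff)
      have "?A s z = 0" if "z \<notin> C" for z
        using C(3)[OF that] linear_0[OF section_rep_linear[OF U(1) _ W(1) _ s]]
        by (auto simp: frame_field_def coord_der_def)
      then have "smooth_in (base L) (W' - C) (\<lambda>x. \<tau>' x (?A s x))"
        by (intro smooth_in_cong[OF ch o smooth_in_const[of _ _ 0]]) (auto simp: triv_zero[OF W'(1)])
      then show ?thesis using W' o False by blast
    qed
  qed
  show "?A s x = 0" if "s \<notin> sections L" for s x using that by (simp add: frame_field_def coord_der_def)
  show "(\<lambda>s. ?A s y) \<in> derivations_at L y" if "y \<in> points (base L)" for y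
    using coord_der_derivation[OF U(1) _ W(1), of y "\<rho> y *\<^sub>R w" 0] zero_derivation[OF that]
    by (cases "y \<in> U \<inter> W") (simp_all only: frame_field_def if_True if_False Int_iff simp_thms)
qed

lemma ident_field_at: "(\<lambda>s. ident_field s x) = eval_der L x"
  by (auto simp: ident_field_def eval_der_def)

lemma ident_field_derivation: "ident_field \<in> derivations L"
  by (rule derivationsI) (simp_all add: ident_field_at eval_der_derivation, simp_all add: ident_field_def)

lemma derivations_field_add:
  assumes "a \<in> derivations L" "a' \<in> derivations L"
  shows "(\<lambda>s x. a s x + k *\<^sub>R a' s x) \<in> derivations L"
  using assms derivations_fieldD[OF assms(1)] derivations_fieldD[OF assms(2)]
  by (intro derivationsI derivations_at_add sections_add sections_scale) auto

text \<open>Applied to a local section with coordinate 1, the Leibniz rule displays the symbol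
  acting on \<open>f\<close> as the coordinate of a section, hence as a smooth function. A second
  derivation can then be applied to the resulting products, as commutators require.\<close>

lemma derivation_field_function:
  assumes a: "a \<in> derivations L" and f: "f \<in> smooth_functions (base L)"
  obtains g where "g \<in> smooth_functions (base L)"
    "\<forall>s\<in>sections L. a (\<lambda>y. f y *\<^sub>R s y) = (\<lambda>y. f y *\<^sub>R a s y + g y *\<^sub>R s y)"
proof -
  define g where "g = (\<lambda>y. if y \<in> points (base L) then symbol L y (\<lambda>s. a s y) f else 0)"
  have eq: "a (\<lambda>y. f y *\<^sub>R s y) y = f y *\<^sub>R a s y + g y *\<^sub>R s y" if s: "s \<in> sections L" for s y
  proof (cases "y \<in> points (base L)")
    case True
    then show ?thesis
      using derivation_symbol[OF True derivations_fieldD(3)[OF a True]] f s by (simp add: is_symbol_def g_def)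
  next
    case False
    then show ?thesis
      using sectionsD(2)[OF derivations_fieldD(1)[OF a sections_mult[OF f s]]]
        sectionsD(2)[OF derivations_fieldD(1)[OF a s]] sectionsD(2)[OF s] by simp
  qed
  have "smooth_in (base L) (points (base L)) g"
  proof (rule smooth_in_local[OF ch])
    fix y assume y: "y \<in> points (base L)"
    obtain W \<tau> where W: "(W, \<tau>) \<in> trivs L" "y \<in> W" using trivE[OF y] .
    obtain e N where e: "e \<in> sections L" "aopen (base L) N" "y \<in> N" "N \<subseteq> W" "\<And>y. y \<in> N \<Longrightarrow> \<tau> y (e y) = 1"
      using nonzero_section[OF W] by blast
    define t where "t = (\<lambda>y. a (\<lambda>y. f y *\<^sub>R e y) y - f y *\<^sub>R a e y)"
    have t: "t \<in> sections L"
      unfolding t_def by (intro sections_diff derivations_fieldD(1)[OF a] sections_mult f e(1))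
    have "smooth_in (base L) N (\<lambda>y. \<tau> y (t y))" by (rule smooth_in_subset[OF sectionsD(3)[OF t W(1)] e(4)])
    then have "smooth_in (base L) N g"
    proof (rule smooth_in_cong[OF ch e(2)])
      fix z assume z: "z \<in> N"
      have "t z = g z *\<^sub>R e z" using eq[OF e(1), of z] by (simp add: t_def)
      then show "\<tau> z (t z) = g z" using z e(4,5) triv_scale[OF W(1) _ sectionsD(4)[OF e(1) W(1)]] by auto
    qed
    then show "\<exists>T. aopen (base L) T \<and> y \<in> T \<and> smooth_in (base L) T g" using e by blast
  qed
  then have "g \<in> smooth_functions (base L)" by (simp add: smooth_functions_iff g_def)
  then show thesis using that eq by blast
qed

text \<open>The mixed terms \<open>g b s\<close> and \<open>h a s\<close> cancel in the commutator,
  and a Leibniz rule remains. Jets are 0 by convention off the derivations, so this membership is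
  what allows a jet to be evaluated on a commutator.\<close>

lemma commutator_derivation:
  assumes a: "a \<in> derivations L" and b: "b \<in> derivations L" and x: "x \<in> points (base L)"
  shows "(\<lambda>s. commutator a b s x) \<in> derivations_at L x"
proof -
  let ?c = "\<lambda>s. commutator a b s x"
  note fa = derivations_fieldD[OF a] and fb = derivations_fieldD[OF b]
  note da = derivationsD[OF fa(3)] and db = derivationsD[OF fb(3)]
  have add: "a (\<lambda>y. s y + r y) = (\<lambda>y. a s y + a r y)" "b (\<lambda>y. s y + r y) = (\<lambda>y. b s y + b r y)"
    if "s \<in> sections L" "r \<in> sections L" for s r
    using da(3)[OF _ that] db(3)[OF _ that] sectionsD(2)[OF fa(1)[OF sections_add[OF that]]]
      sectionsD(2)[OF fb(1)[OF sections_add[OF that]]] sectionsD(2)[OF fa(1)] sectionsD(2)[OF fb(1)] that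
    by (auto simp: fun_eq_iff) (metis add.left_neutral)+
  have scale: "a (\<lambda>y. c *\<^sub>R s y) = (\<lambda>y. c *\<^sub>R a s y)" "b (\<lambda>y. c *\<^sub>R s y) = (\<lambda>y. c *\<^sub>R b s y)"
    if "s \<in> sections L" for s c
    using da(4)[OF _ that] db(4)[OF _ that] sectionsD(2)[OF fa(1)[OF sections_scale[OF that]]]
      sectionsD(2)[OF fb(1)[OF sections_scale[OF that]]] sectionsD(2)[OF fa(1)] sectionsD(2)[OF fb(1)] that
    by (auto simp: fun_eq_iff) (metis scaleR_zero_right)+
  have "?c \<in> Hom (sections L) (fibre L x)"
    unfolding Hom_def
  proof (intro CollectI conjI ballI allI impI)
    show "?c s \<in> fibre L x" if "s \<in> sections L" for s
      using sectionsD(1)[OF sections_diff[OF fa(1)[OF fb(1)[OF that]] fb(1)[OF fa(1)[OF that]]] x]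
      by (simp add: commutator_def)
    show "?c s = 0" if "s \<notin> sections L" for s
      using fa(2)[OF that] fb(2)[OF that] scale[OF sections_zero, of 0] by (simp add: commutator_def)
    show "?c (\<lambda>x. s x + r x) = ?c s + ?c r" if "s \<in> sections L" "r \<in> sections L" for s r
      using that by (simp add: commutator_def add fa(1) fb(1))
    show "?c (\<lambda>x. c *\<^sub>R s x) = c *\<^sub>R ?c s" if "s \<in> sections L" for c s
      using that by (simp add: commutator_def scale fa(1) fb(1) scaleR_diff_right)
  qed
  moreover
  define X where "X = symbol L x (\<lambda>s. a s x)"
  define Y where "Y = symbol L x (\<lambda>s. b s x)"
  have X: "is_symbol x (\<lambda>s. a s x) X" unfolding X_def by (rule derivation_symbol[OF x fa(3)[OF x]])
  have Y: "is_symbol x (\<lambda>s. b s x) Y" unfolding Y_def by (rule derivation_symbol[OF x fb(3)[OF x]])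
  obtain W \<tau> where W: "(W, \<tau>) \<in> trivs L" "x \<in> W" using trivE[OF x] .
  obtain e N where e: "e \<in> sections L" "x \<in> N" "\<And>y. y \<in> N \<Longrightarrow> \<tau> y (e y) = 1" using nonzero_section[OF W] by metis
  have leib: "\<exists>h. \<forall>s\<in>sections L. ?c (\<lambda>y. f y *\<^sub>R s y) = f x *\<^sub>R ?c s + h *\<^sub>R s x" if f: "f \<in> smooth_functions (base L)" for f
  proof -
    obtain g where g: "g \<in> smooth_functions (base L)" "\<forall>s\<in>sections L. a (\<lambda>y. f y *\<^sub>R s y) = (\<lambda>y. f y *\<^sub>R a s y + g y *\<^sub>R s y)"
      using derivation_field_function[OF a f] .
    obtain h where h: "h \<in> smooth_functions (base L)" "\<forall>s\<in>sections L. b (\<lambda>y. f y *\<^sub>R s y) = (\<lambda>y. f y *\<^sub>R b s y + h y *\<^sub>R s y)"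
      using derivation_field_function[OF b f] .
    have Xh: "a (\<lambda>y. h y *\<^sub>R s y) x = h x *\<^sub>R a s x + X h *\<^sub>R s x" if "s \<in> sections L" for s
      using X h(1) that by (simp add: is_symbol_def)
    have Yg: "b (\<lambda>y. g y *\<^sub>R s y) x = g x *\<^sub>R b s x + Y g *\<^sub>R s x" if "s \<in> sections L" for s
      using Y g(1) that by (simp add: is_symbol_def)
    have "?c (\<lambda>y. f y *\<^sub>R s y) = f x *\<^sub>R ?c s + (X h - Y g) *\<^sub>R s x" if s: "s \<in> sections L" for s
    proof -
      note m = sections_mult[OF f] sections_mult[OF g(1)] sections_mult[OF h(1)] fa(1) fb(1)
      have "a (b (\<lambda>y. f y *\<^sub>R s y)) x = f x *\<^sub>R a (b s) x + g x *\<^sub>R b s x + h x *\<^sub>R a s x + X h *\<^sub>R s x"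
        using h(2) g(2) s by (simp add: add m Xh)
      moreover have "b (a (\<lambda>y. f y *\<^sub>R s y)) x = f x *\<^sub>R b (a s) x + h x *\<^sub>R a s x + g x *\<^sub>R b s x + Y g *\<^sub>R s x"
        using h(2) g(2) s by (simp add: add m Yg)
      ultimately show ?thesis by (simp add: commutator_def algebra_simps)
    qed
    then show ?thesis by blast
  qed
  \<comment> \<open>The symbol is read off from \<open>e\<close>, whose coordinate at
    \<open>x\<close> is 1. Its own product rule follows from the Leibniz rule applied to
    \<open>f\<close> times the section \<open>g e\<close>.\<close>
  define Z where "Z = (\<lambda>f. if f \<in> smooth_functions (base L) then \<tau> x (?c (\<lambda>y. f y *\<^sub>R e y) - f x *\<^sub>R ?c e) else 0)"
  have ex: "\<tau> x (e x) = 1" using e by simp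
  have Z: "?c (\<lambda>y. f y *\<^sub>R s y) = f x *\<^sub>R ?c s + Z f *\<^sub>R s x" if f: "f \<in> smooth_functions (base L)" and s: "s \<in> sections L" for f s
  proof -
    obtain k where k: "\<forall>s\<in>sections L. ?c (\<lambda>y. f y *\<^sub>R s y) = f x *\<^sub>R ?c s + k *\<^sub>R s x" using leib[OF f] by blast
    then have "Z f = \<tau> x (k *\<^sub>R e x)" using f e(1) by (simp add: Z_def)
    then have "Z f = k" using triv_scale[OF W sectionsD(4)[OF e(1) W]] ex by simp
    then show ?thesis using k s by simp
  qed
  have e0: "e x \<noteq> 0" using ex triv_zero[OF W] by auto
  note sm = smooth_functions_add[OF ch] smooth_functions_mult[OF ch] smooth_functions_scaleR[OF ch, unfolded real_scaleR_def]
  note Hc = \<open>?c \<in> Hom (sections L) (fibre L x)\<close>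
  have cadd: "?c (\<lambda>y. s y + r y) = ?c s + ?c r" if "s \<in> sections L" "r \<in> sections L" for s r
    using Hc that unfolding Hom_def by blast
  have csc: "?c (\<lambda>y. k *\<^sub>R s y) = k *\<^sub>R ?c s" if "s \<in> sections L" for s k
    using Hc that unfolding Hom_def by blast
  have "Z \<in> tangent_space (base L) x"
    unfolding tangent_space_def Hom_def
  proof (intro CollectI conjI ballI allI impI)
    fix f g assume f: "f \<in> smooth_functions (base L)" and g: "g \<in> smooth_functions (base L)"
    have "?c (\<lambda>y. (f y + g y) *\<^sub>R e y) = ?c (\<lambda>y. f y *\<^sub>R e y) + ?c (\<lambda>y. g y *\<^sub>R e y)"
      using cadd[OF sections_mult[OF f e(1)] sections_mult[OF g e(1)]] by (simp add: scaleR_add_left)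
    then have "(Z (\<lambda>x. f x + g x)) *\<^sub>R e x = (Z f + Z g) *\<^sub>R e x"
      unfolding Z[OF sm(1)[OF f g] e(1)] Z[OF f e(1)] Z[OF g e(1)] by (simp add: algebra_simps)
    then show "Z (\<lambda>x. f x + g x) = Z f + Z g" using e0 by simp
    have "?c (\<lambda>y. (f y * g y) *\<^sub>R e y) = f x *\<^sub>R ?c (\<lambda>y. g y *\<^sub>R e y) + Z f *\<^sub>R (g x *\<^sub>R e x)"
      using Z[OF f sections_mult[OF g e(1)]] by simp
    then have "(Z (\<lambda>x. f x * g x)) *\<^sub>R e x = (f x * Z g + Z f * g x) *\<^sub>R e x"
      by (simp add: Z[OF sm(2)[OF f g] e(1)] Z[OF g e(1)] algebra_simps)
    then show "Z (\<lambda>x. f x * g x) = f x * Z g + Z f * g x" using e0 by simp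
  next
    fix f and k :: real assume f: "f \<in> smooth_functions (base L)"
    have "?c (\<lambda>y. (k * f y) *\<^sub>R e y) = k *\<^sub>R ?c (\<lambda>y. f y *\<^sub>R e y)"
      using csc[OF sections_mult[OF f e(1)], of k] by simp
    then have "(Z (\<lambda>x. k * f x)) *\<^sub>R e x = (k * Z f) *\<^sub>R e x"
      by (simp add: Z[OF sm(3)[OF f] e(1)] Z[OF f e(1)] algebra_simps)
    then show "Z (\<lambda>x. k *\<^sub>R f x) = k *\<^sub>R Z f" using e0 by simp
  qed (simp_all add: Z_def)
  then have "is_symbol x ?c Z" using Z by (simp add: is_symbol_def)
  ultimately show ?thesis by (auto simp: derivations_at_iff)
qed

text \<open>The trivialisation is a flat connection near \<open>x\<close>, and the derivation
  differentiates coordinates along \<open>X\<close>. The bump function makes the coordinate of a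
  section a global function, on which \<open>X\<close> is defined.\<close>

lemma derivation_with_symbol:
  assumes x: "x \<in> points (base L)" and X: "X \<in> tangent_space (base L) x"
  obtains a where "a \<in> derivations_at L x" "is_symbol x a X"
proof -
  obtain W \<tau> where W: "(W, \<tau>) \<in> trivs L" "x \<in> W" using trivE[OF x] .
  obtain \<rho> where b: "bump (base L) x W \<rho>" using bump_exists[OF hmfd triv_open[OF W(1)] W(2)] .
  have f: "(\<lambda>y. \<rho> y * \<tau> y (s y)) \<in> smooth_functions (base L)" if "s \<in> sections L" for s
    by (rule bump_mult_smooth[OF ch b triv_open[OF W(1)] sectionsD(3)[OF that W(1)]])
  have off: "\<rho> y = 0" if "y \<notin> W" for y using bump_off[OF b that] .
  define a where "a = (\<lambda>s. if s \<in> sections L then X (\<lambda>y. \<rho> y * \<tau> y (s y)) *\<^sub>R unit_vec L \<tau> x else 0)"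
  note t = tangentD[OF X] and s4 = sectionsD(4)[OF _ W(1)]
  have 1: "(\<lambda>y. \<rho> y * \<tau> y (s y + r y)) = (\<lambda>y. \<rho> y * \<tau> y (s y) + \<rho> y * \<tau> y (r y))"
    if "s \<in> sections L" "r \<in> sections L" for s r
  proof
    fix y show "\<rho> y * \<tau> y (s y + r y) = \<rho> y * \<tau> y (s y) + \<rho> y * \<tau> y (r y)"
      by (cases "y \<in> W") (simp_all add: off triv_add[OF W(1)] s4 that algebra_simps)
  qed
  have 2: "(\<lambda>y. \<rho> y * \<tau> y (g y *\<^sub>R s y)) = (\<lambda>y. g y * (\<rho> y * \<tau> y (s y)))" if "s \<in> sections L" for s g
  proof
    fix y show "\<rho> y * \<tau> y (g y *\<^sub>R s y) = g y * (\<rho> y * \<tau> y (s y))"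
      by (cases "y \<in> W") (simp_all add: off triv_scale[OF W(1)] s4 that)
  qed
  have "a \<in> Hom (sections L) (fibre L x)"
    unfolding Hom_def a_def
    by (auto simp: sections_add sections_scale 1 2 t f scaleR_add_left subspace_scale[OF fibre_subspace[OF x]] unit_in[OF W])
  moreover have "is_symbol x a X"
    unfolding is_symbol_def a_def
  proof (intro conjI X ballI)
    fix g s assume g: "g \<in> smooth_functions (base L)" and s: "s \<in> sections L"
    have "s x = \<tau> x (s x) *\<^sub>R unit_vec L \<tau> x" by (rule triv_expand[OF W s4[OF s W(2)]])
    then have "X g *\<^sub>R s x = (X g * \<tau> x (s x)) *\<^sub>R unit_vec L \<tau> x" by (metis scaleR_scaleR)
    then show "(if (\<lambda>y. g y *\<^sub>R s y) \<in> sections L then X (\<lambda>y. \<rho> y * \<tau> y (g y *\<^sub>R s y)) *\<^sub>R unit_vec L \<tau> x else 0) =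
        g x *\<^sub>R (if s \<in> sections L then X (\<lambda>y. \<rho> y * \<tau> y (s y)) *\<^sub>R unit_vec L \<tau> x else 0) + X g *\<^sub>R s x"
      using g s bump_at[OF b] by (simp add: sections_mult 2 t(1)[OF g f[OF s]] scaleR_add_left)
  qed
  ultimately show thesis using that by (auto simp: derivations_at_iff)
qed

end

section \<open>Jacobi structures\<close>

lemma tangent_combination:
  assumes "charted A" "X \<in> tangent_space A x" "Y \<in> tangent_space A x"
  shows "(\<lambda>f. X f + k * Y f) \<in> tangent_space A x"
  unfolding tangent_space_def Hom_def
  using tangentD[OF assms(2)] tangentD[OF assms(3)]
  by (auto simp: algebra_simps)

context hbundle
begin

lemma is_symbol_combination:
  assumes "is_symbol x a X" "is_symbol x a' X'"
  shows "is_symbol x (\<lambda>s. a s + k *\<^sub>R a' s) (\<lambda>f. X f + k * X' f)"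
  using assms tangent_combination[OF ch] by (auto simp: is_symbol_def algebra_simps)

text \<open>The vanishing double commutator says that the commutator of \<open>P\<close> with
  \<open>f\<close>, evaluated at \<open>x\<close>, is linear over functions in the section. It is
  therefore a multiple \<open>X f\<close> of the value of the section, and \<open>X\<close> is the
  symbol.\<close>

lemma first_order_derivation:
  assumes P: "first_order_operator L P" and x: "x \<in> points (base L)"
  shows "(\<lambda>r. if r \<in> sections L then P r x else 0) \<in> derivations_at L x"
proof -
  have Psec: "\<And>s. s \<in> sections L \<Longrightarrow> P s \<in> sections L"
    and Padd: "\<And>s r. s \<in> sections L \<Longrightarrow> r \<in> sections L \<Longrightarrow> P (\<lambda>x. s x + r x) x = P s x + P r x"
    and Pscale: "\<And>c s. s \<in> sections L \<Longrightarrow> P (\<lambda>x. c *\<^sub>R s x) x = c *\<^sub>R P s x"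
    and P2: "\<And>f g s. f \<in> smooth_functions (base L) \<Longrightarrow> g \<in> smooth_functions (base L) \<Longrightarrow> s \<in> sections L \<Longrightarrow>
       P (\<lambda>y. (f y * g y) *\<^sub>R s y) x = f x *\<^sub>R P (\<lambda>y. g y *\<^sub>R s y) x
       + g x *\<^sub>R P (\<lambda>y. f y *\<^sub>R s y) x - (f x * g x) *\<^sub>R P s x"
    using P unfolding first_order_operator_def by (simp_all add: algebra_simps)
  obtain W \<tau> where W: "(W, \<tau>) \<in> trivs L" "x \<in> W" using trivE[OF x] .
  obtain e' N where e': "e' \<in> sections L" "aopen (base L) N" "x \<in> N" "N \<subseteq> W" "\<And>y. y \<in> N \<Longrightarrow> \<tau> y (e' y) = 1"
    using nonzero_section[OF W] by blast
  obtain \<rho> where b: "bump (base L) x N \<rho>" using bump_exists[OF hmfd e'(2,3)] .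
  define e where "e = (\<lambda>y. \<rho> y *\<^sub>R e' y)"
  have e: "e \<in> sections L" unfolding e_def by (rule sections_mult[OF bump_smooth[OF b] e'(1)])
  have \<tau>e: "\<tau> x (e x) = 1"
    using bump_at[OF b] e'(3,5) triv_scale[OF W sectionsD(4)[OF e'(1) W]] by (simp add: e_def)
  then have e0: "e x \<noteq> 0" using triv_zero[OF W] by auto
  define c where "c = (\<lambda>f r. P (\<lambda>y. f y *\<^sub>R r y) x - f x *\<^sub>R P r x)"
  have c_mult: "c f (\<lambda>y. g y *\<^sub>R r y) = g x *\<^sub>R c f r"
    if "f \<in> smooth_functions (base L)" "g \<in> smooth_functions (base L)" "r \<in> sections L" for f g r
    using P2[OF that] by (simp add: c_def algebra_simps)
  have c_eq: "c f r = \<tau> x (r x) *\<^sub>R c f e"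
    if f: "f \<in> smooth_functions (base L)" and r: "r \<in> sections L" for f r
  proof -
    have \<rho>r: "(\<lambda>y. \<rho> y * \<tau> y (r y)) \<in> smooth_functions (base L)"
      by (rule bump_mult_smooth[OF ch b e'(2) smooth_in_subset[OF sectionsD(3)[OF r W(1)] e'(4)]])
    \<comment> \<open>One factor \<rho> makes the coordinate function of \<open>r\<close> global,
      the other is contained in \<open>e\<close>; at \<open>x\<close> both are 1.\<close>
    have "(\<lambda>y. \<rho> y *\<^sub>R (\<rho> y *\<^sub>R r y)) = (\<lambda>y. (\<rho> y * \<tau> y (r y)) *\<^sub>R e y)"
    proof
      fix y show "\<rho> y *\<^sub>R (\<rho> y *\<^sub>R r y) = (\<rho> y * \<tau> y (r y)) *\<^sub>R e y"
      proof (cases "y \<in> N")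
        case True
        then have yW: "y \<in> W" using e'(4) by auto
        have "e' y = unit_vec L \<tau> y" using triv_expand[OF W(1) yW sectionsD(4)[OF e'(1) W(1) yW]] e'(5)[OF True] by simp
        then have "r y = \<tau> y (r y) *\<^sub>R e' y" using triv_expand[OF W(1) yW sectionsD(4)[OF r W(1) yW]] by simp
        then have "\<rho> y *\<^sub>R \<rho> y *\<^sub>R r y = \<rho> y *\<^sub>R \<rho> y *\<^sub>R \<tau> y (r y) *\<^sub>R e' y" by simp
        then show ?thesis by (simp add: e_def mult_ac)
      qed (simp add: bump_off[OF b])
    qed
    then have "c f (\<lambda>y. \<rho> y *\<^sub>R (\<rho> y *\<^sub>R r y)) = c f (\<lambda>y. (\<rho> y * \<tau> y (r y)) *\<^sub>R e y)" by simp
    then show ?thesis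
      using c_mult[OF f bump_smooth[OF b] sections_mult[OF bump_smooth[OF b] r]] c_mult[OF f bump_smooth[OF b] r]
        c_mult[OF f \<rho>r e] bump_at[OF b] by simp
  qed
  have cfib: "c f r \<in> fibre L x" if "f \<in> smooth_functions (base L)" "r \<in> sections L" for f r
    unfolding c_def using that
    by (intro subspace_diff subspace_scale fibre_subspace x sectionsD(1)[OF Psec] sections_mult)
  define X where "X = (\<lambda>f. if f \<in> smooth_functions (base L) then \<tau> x (c f e) else 0)"
  have Xe: "c f e = X f *\<^sub>R e x" if "f \<in> smooth_functions (base L)" for f
    by (rule triv_inj[OF W cfib[OF that e]])
      (simp_all add: that X_def triv_scale[OF W] sectionsD(4)[OF e W] \<tau>e subspace_scale[OF fibre_subspace[OF x]])
  have rx: "r x = \<tau> x (r x) *\<^sub>R e x" if "r \<in> sections L" for r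
    by (rule triv_inj[OF W])
      (simp_all add: that triv_scale[OF W] sectionsD(4)[OF _ W] e \<tau>e subspace_scale[OF fibre_subspace[OF x]])
  have cX: "c f r = X f *\<^sub>R r x" if "f \<in> smooth_functions (base L)" "r \<in> sections L" for f r
  proof -
    have "c f r = \<tau> x (r x) *\<^sub>R X f *\<^sub>R e x" using c_eq[OF that] Xe[OF that(1)] by simp
    also have "\<dots> = X f *\<^sub>R \<tau> x (r x) *\<^sub>R e x" by (simp add: mult.commute)
    finally show ?thesis using rx[OF that(2)] by simp
  qed
  note sm = smooth_functions_add[OF ch] smooth_functions_mult[OF ch] smooth_functions_scaleR[OF ch, unfolded real_scaleR_def]
  have "X \<in> tangent_space (base L) x"
    unfolding tangent_space_def Hom_def
  proof (intro CollectI conjI ballI allI impI)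
    fix f g assume f: "f \<in> smooth_functions (base L)" and g: "g \<in> smooth_functions (base L)"
    have "c (\<lambda>x. f x + g x) e = c f e + c g e"
      using Padd[OF sections_mult[OF f e] sections_mult[OF g e]] by (simp add: c_def algebra_simps)
    then have "X (\<lambda>x. f x + g x) *\<^sub>R e x = (X f + X g) *\<^sub>R e x"
      by (simp add: Xe f g sm algebra_simps)
    then show "X (\<lambda>x. f x + g x) = X f + X g" using e0 by simp
    have "c (\<lambda>x. f x * g x) e = f x *\<^sub>R c g e + g x *\<^sub>R c f e"
      using P2[OF f g e] by (simp add: c_def algebra_simps)
    then have "X (\<lambda>x. f x * g x) *\<^sub>R e x = (f x * X g + X f * g x) *\<^sub>R e x"
      by (simp add: Xe f g sm algebra_simps)
    then show "X (\<lambda>x. f x * g x) = f x * X g + X f * g x" using e0 by simp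
  next
    fix f and k :: real assume f: "f \<in> smooth_functions (base L)"
    have "c (\<lambda>x. k * f x) e = k *\<^sub>R c f e"
      using Pscale[OF sections_mult[OF f e], of k] by (simp add: c_def algebra_simps)
    then have "X (\<lambda>x. k * f x) *\<^sub>R e x = (k * X f) *\<^sub>R e x" by (simp add: Xe f sm)
    then show "X (\<lambda>x. k *\<^sub>R f x) = k *\<^sub>R X f" using e0 by simp
  qed (simp_all add: X_def)
  then have "is_symbol x (\<lambda>r. if r \<in> sections L then P r x else 0) X"
    using cX unfolding is_symbol_def c_def by (simp add: sections_mult algebra_simps)
  moreover have "(\<lambda>r. if r \<in> sections L then P r x else 0) \<in> Hom (sections L) (fibre L x)"
    unfolding Hom_def by (auto simp: sections_add sections_scale Padd Pscale sectionsD(1)[OF Psec x])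
  ultimately show ?thesis by (auto simp: derivations_at_iff)
qed

end

text \<open>Surjectivity of \<open>Pi_sharp\<close> at every point, phrased with sections; in this
  form it passes to opposite structures and to line products.\<close>

definition full_hamiltonian :: "('m, 'e::finite_dim_inner, 'v::real_vector) line_bundle \<Rightarrow>
    (('m \<Rightarrow> 'v) \<Rightarrow> ('m \<Rightarrow> 'v) \<Rightarrow> ('m \<Rightarrow> 'v)) \<Rightarrow> bool"
  where "full_hamiltonian L br \<longleftrightarrow>
    (\<forall>x\<in>points (base L). \<forall>a\<in>derivations_at L x. \<exists>r\<in>sections L. a = ham_der L br r x)"

lemma full_hamiltonian_op:
  assumes "hbundle L" "full_hamiltonian L br"
    and "\<And>s r x. s \<in> sections L \<Longrightarrow> r \<in> sections L \<Longrightarrow> br (\<lambda>y. - s y) r x = - br s r x"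
  shows "full_hamiltonian L (op_bracket br)"
  unfolding full_hamiltonian_def
proof (intro ballI)
  interpret hbundle L by fact
  fix x a assume "x \<in> points (base L)" "a \<in> derivations_at L x"
  then obtain r where r: "r \<in> sections L" "a = ham_der L br r x" using assms(2) unfolding full_hamiltonian_def by blast
  then have "a = ham_der L (op_bracket br) (\<lambda>y. - r y) x"
    using assms(3) by (auto simp: ham_der_def op_bracket_def)
  then show "\<exists>r\<in>sections L. a = ham_der L (op_bracket br) r x" using sections_minus[OF r(1)] by blast
qed

section \<open>Hamiltonian derivations, non-degeneracy and the contact hyperplane\<close>

locale jacobi_bundle = hbundle L for L :: "('m, 'e::finite_dim_inner, 'v::real_vector) line_bundle" +
  fixes br :: "('m \<Rightarrow> 'v) \<Rightarrow> ('m \<Rightarrow> 'v) \<Rightarrow> ('m \<Rightarrow> 'v)"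
  assumes jacobi: "jacobi_structure L br"
begin

lemma br_first_order: "s \<in> sections L \<Longrightarrow> first_order_operator L (\<lambda>r. br s r)"
  "r \<in> sections L \<Longrightarrow> first_order_operator L (\<lambda>s. br s r)"
  and br_alternating: "s \<in> sections L \<Longrightarrow> br s s = (\<lambda>_. 0)"
  using jacobi by (simp_all add: jacobi_structure_def)

lemma br_section: "s \<in> sections L \<Longrightarrow> r \<in> sections L \<Longrightarrow> br s r \<in> sections L"
  and br_add_right: "s \<in> sections L \<Longrightarrow> r \<in> sections L \<Longrightarrow> t \<in> sections L \<Longrightarrow>
    br s (\<lambda>x. r x + t x) = (\<lambda>x. br s r x + br s t x)"
  and br_scale_right: "s \<in> sections L \<Longrightarrow> r \<in> sections L \<Longrightarrow> br s (\<lambda>x. c *\<^sub>R r x) = (\<lambda>x. c *\<^sub>R br s r x)"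
  using br_first_order(1) unfolding first_order_operator_def by blast+

lemma br_add_left: "s \<in> sections L \<Longrightarrow> r \<in> sections L \<Longrightarrow> t \<in> sections L \<Longrightarrow>
    br (\<lambda>x. s x + r x) t = (\<lambda>x. br s t x + br r t x)"
  and br_scale_left: "s \<in> sections L \<Longrightarrow> r \<in> sections L \<Longrightarrow> br (\<lambda>x. c *\<^sub>R s x) r = (\<lambda>x. c *\<^sub>R br s r x)"
  using br_first_order(2) unfolding first_order_operator_def by blast+

lemma br_minus_left: "s \<in> sections L \<Longrightarrow> r \<in> sections L \<Longrightarrow> br (\<lambda>x. - s x) r = (\<lambda>x. - br s r x)"
  using br_scale_left[of s r "-1"] by simp

lemma br_minus_right: "s \<in> sections L \<Longrightarrow> r \<in> sections L \<Longrightarrow> br s (\<lambda>x. - r x) = (\<lambda>x. - br s r x)"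
  using br_scale_right[of s r "-1"] by simp

lemma br_diff_left: "s \<in> sections L \<Longrightarrow> r \<in> sections L \<Longrightarrow> t \<in> sections L \<Longrightarrow>
    br (\<lambda>x. s x - r x) t = (\<lambda>x. br s t x - br r t x)"
  using br_add_left[OF _ sections_minus, of s r t] br_minus_left[of r t] by simp

lemma br_diff_right: "s \<in> sections L \<Longrightarrow> r \<in> sections L \<Longrightarrow> t \<in> sections L \<Longrightarrow>
    br s (\<lambda>x. r x - t x) = (\<lambda>x. br s r x - br s t x)"
  using br_add_right[OF _ _ sections_minus, of s r t] br_minus_right[of s t] by simp

lemma br_antisym:
  assumes "s \<in> sections L" "r \<in> sections L" shows "br s r x = - br r s x"
proof -
  have "br (\<lambda>x. s x + r x) (\<lambda>x. s x + r x) x = 0"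
    using br_alternating[OF sections_add[OF assms]] by simp
  then have "br s r x + br r s x = 0"
    using br_alternating[OF assms(1)] br_alternating[OF assms(2)]
    by (simp add: br_add_left br_add_right sections_add assms)
  then show ?thesis by (rule eq_neg_iff_add_eq_0[THEN iffD2])
qed

lemma ham_der_derivation: "x \<in> points (base L) \<Longrightarrow> s \<in> sections L \<Longrightarrow> ham_der L br s x \<in> derivations_at L x"
  unfolding ham_der_def by (rule first_order_derivation[OF br_first_order(1)])

lemma br_left_derivation:
  "x \<in> points (base L) \<Longrightarrow> r \<in> sections L \<Longrightarrow> (\<lambda>s. if s \<in> sections L then br s r x else 0) \<in> derivations_at L x"
  by (rule first_order_derivation[OF br_first_order(2)])

lemma ham_der_at: "r \<in> sections L \<Longrightarrow> ham_der L br s x r = br s r x"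
  by (simp add: ham_der_def)

text \<open>For fixed \<open>r\<close> the bracket with \<open>r\<close> at \<open>x\<close> is a
  derivation in the first argument, so only the jet of \<open>s\<close> matters. This makes
  \<open>Pi_sharp\<close>, a definite description over all sections with a given jet, well
  defined.\<close>

lemma ham_der_cong:
  assumes x: "x \<in> points (base L)" and s: "s \<in> sections L" "s' \<in> sections L"
    and eq: "\<And>a. a \<in> derivations_at L x \<Longrightarrow> a s = a s'"
  shows "ham_der L br s x = ham_der L br s' x"
proof
  fix r show "ham_der L br s x r = ham_der L br s' x r"
    using eq[OF br_left_derivation[OF x]] s by (auto simp: ham_der_def)
qed

lemma Pi_sharp_jet:
  assumes x: "x \<in> points (base L)" and s: "s \<in> sections L"
  shows "Pi_sharp L br x (jet L s x) = ham_der L br s x"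
  unfolding Pi_sharp_def
proof (rule the_equality)
  show "\<forall>s'\<in>sections L. jet L s' x = jet L s x \<longrightarrow> ham_der L br s x = ham_der L br s' x"
  proof (intro ballI impI)
    fix s' assume s': "s' \<in> sections L" "jet L s' x = jet L s x"
    show "ham_der L br s x = ham_der L br s' x"
    proof (rule ham_der_cong[OF x s s'(1)])
      fix a assume "a \<in> derivations_at L x"
      then show "a s = a s'" using fun_cong[OF s'(2), of a] by (simp add: jet_def)
    qed
  qed
qed (use s in blast)

text \<open>Injectivity comes from surjectivity by antisymmetry. If \<open>s\<close> and
  \<open>r\<close> have the same Hamiltonian derivation, write an arbitrary derivation as that of
  some \<open>t\<close>; its values on \<open>s\<close> and \<open>r\<close> are minus the values of
  the common derivation on \<open>t\<close>.\<close>

lemma nondegenerateI: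
  assumes full: "full_hamiltonian L br" shows "nondegenerate L br"
  unfolding nondegenerate_def
proof
  fix x assume x: "x \<in> points (base L)"
  show "bij_betw (Pi_sharp L br x) (jets_at L x) (derivations_at L x)"
    unfolding bij_betw_def
  proof (intro conjI inj_onI equalityI subsetI)
    fix \<alpha> \<beta> assume *: "\<alpha> \<in> jets_at L x" "\<beta> \<in> jets_at L x" "Pi_sharp L br x \<alpha> = Pi_sharp L br x \<beta>"
    obtain s where s: "s \<in> sections L" "jet L s x = \<alpha>" using jet_surj'[OF x *(1)] .
    obtain r where r: "r \<in> sections L" "jet L r x = \<beta>" using jet_surj'[OF x *(2)] .
    have eq: "ham_der L br s x = ham_der L br r x"
      using *(3) Pi_sharp_jet[OF x s(1)] Pi_sharp_jet[OF x r(1)] s r by simp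
    have "a s = a r" if a: "a \<in> derivations_at L x" for a
    proof -
      obtain t where t: "t \<in> sections L" "a = ham_der L br t x" using full x a unfolding full_hamiltonian_def by blast
      then show ?thesis
        using br_antisym[OF t(1) s(1), of x] br_antisym[OF t(1) r(1), of x] fun_cong[OF eq, of t] s r
        by (simp add: ham_der_at)
    qed
    then show "\<alpha> = \<beta>" using s r by (auto simp: jet_def)
  next
    fix a assume "a \<in> Pi_sharp L br x ` jets_at L x"
    then obtain \<alpha> where \<alpha>: "\<alpha> \<in> jets_at L x" "a = Pi_sharp L br x \<alpha>" by blast
    obtain s where s: "s \<in> sections L" "jet L s x = \<alpha>" using jet_surj'[OF x \<alpha>(1)] .
    then show "a \<in> derivations_at L x" using \<alpha>(2) Pi_sharp_jet[OF x s(1)] ham_der_derivation[OF x s(1)] by simp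
  next
    fix a assume a: "a \<in> derivations_at L x"
    then obtain t where t: "t \<in> sections L" "a = ham_der L br t x" using full x unfolding full_hamiltonian_def by blast
    then show "a \<in> Pi_sharp L br x ` jets_at L x"
      using Pi_sharp_jet[OF x t(1)] jet_in_jets[OF x t(1)] by (metis imageI)
  qed
qed

text \<open>If \<open>r\<close> vanishes at \<open>x\<close>, its jet is of the form \<open>df \<otimes> e\<close> with \<open>f x = 0\<close>, and \<open>\<Lambda>\<close> maps it to \<open>X\<^sub>r\<close>.\<close>

lemma contact_hyperplaneI:
  assumes x: "x \<in> points (base L)" and r: "r \<in> sections L" "r x = 0"
  shows "symbol L x (ham_der L br r x) \<in> contact_hyperplane L br x"
proof -
  obtain W \<tau> where W: "(W, \<tau>) \<in> trivs L" "x \<in> W" using trivE[OF x] .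
  obtain e N where e: "e \<in> sections L" "aopen (base L) N" "x \<in> N" "N \<subseteq> W" "\<And>y. y \<in> N \<Longrightarrow> \<tau> y (e y) = 1"
    using nonzero_section[OF W] by blast
  obtain \<rho> where b: "bump (base L) x N \<rho>" using bump_exists[OF hmfd e(2,3)] .
  obtain N' where N': "aopen (base L) N'" "x \<in> N'" "N' \<subseteq> N" "\<And>y. y \<in> N' \<Longrightarrow> \<rho> y = 1" using bumpE[OF b] by blast
  define f where "f = (\<lambda>y. \<rho> y * \<tau> y (r y))"
  have f: "f \<in> smooth_functions (base L)"
    unfolding f_def by (rule bump_mult_smooth[OF ch b e(2) smooth_in_subset[OF sectionsD(3)[OF r(1) W(1)] e(4)]])
  have fx: "f x = 0" using r(2) triv_zero[OF W] by (simp add: f_def)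
  have fe: "(\<lambda>y. f y *\<^sub>R e y) \<in> sections L" by (rule sections_mult[OF f e(1)])
  have ham: "ham_der L br r x = ham_der L br (\<lambda>y. f y *\<^sub>R e y) x"
  proof (rule ham_der_cong[OF x r(1) fe], rule derivation_local[OF _ N'(1,2) r(1) fe])
    fix y assume y: "y \<in> N'"
    then have yW: "y \<in> W" using N'(3) e(4) by auto
    have "e y = unit_vec L \<tau> y" using triv_expand[OF W(1) yW sectionsD(4)[OF e(1) W(1) yW]] e(5) y N'(3) by auto
    then show "r y = f y *\<^sub>R e y" using triv_expand[OF W(1) yW sectionsD(4)[OF r(1) W(1) yW]] N'(4)[OF y] by (simp add: f_def)
  qed
  let ?X = "symbol L x (ham_der L br r x)"
  note hd = ham_der_derivation[OF x]
  \<comment> \<open>\<open>Lambda_sharp\<close> is a definite description over all representations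
    of the tensor, so the formula is checked for each of them. The Leibniz rule in the left argument
    of the bracket shows that only the tensor enters.\<close>
  have key: "?X = (\<lambda>g. ham_vec L br (\<lambda>y. f' y *\<^sub>R s y) x g - f' x * ham_vec L br s x g)"
    if f': "f' \<in> smooth_functions (base L)" and s: "s \<in> sections L" and eq: "df_tensor L x f' s = df_tensor L x f e" for f' s
  proof -
    let ?D = "\<lambda>t. ham_der L br (\<lambda>y. f' y *\<^sub>R s y) x t + (- f' x) *\<^sub>R ham_der L br s x t"
    have sym: "is_symbol x ?D (\<lambda>g. ham_vec L br (\<lambda>y. f' y *\<^sub>R s y) x g + (- f' x) * ham_vec L br s x g)"
      unfolding ham_vec_def
      by (intro is_symbol_combination derivation_symbol[OF x] hd sections_mult f' s)
    have "?D t = ham_der L br r x t" for t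
    proof (cases "t \<in> sections L")
      case t: True
      let ?a = "\<lambda>s. if s \<in> sections L then br s t x else 0"
      obtain Y where Y: "is_symbol x ?a Y" using br_left_derivation[OF x t] by (auto simp: derivations_at_iff)
      have Yt: "Y \<in> tangent_space (base L) x" using Y by (simp add: is_symbol_def)
      have "?a (\<lambda>y. f' y *\<^sub>R s y) = f' x *\<^sub>R ?a s + Y f' *\<^sub>R s x"
        "?a (\<lambda>y. f y *\<^sub>R e y) = f x *\<^sub>R ?a e + Y f *\<^sub>R e x"
        using Y f' s f e(1) unfolding is_symbol_def by blast+
      moreover have "Y f' *\<^sub>R s x = Y f *\<^sub>R e x" using fun_cong[OF eq, of Y] Yt by (simp add: df_tensor_def)
      ultimately show ?thesis
        unfolding ham using t s e(1) fe sections_mult[OF f' s] fx by (simp add: ham_der_at)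
    qed (simp add: ham_der_def)
    then have "?D = ham_der L br r x" by blast
    then show ?thesis using symbol_eq[OF x sym] by simp
  qed
  have "Lambda_sharp L br x (df_tensor L x f e) = ?X"
    unfolding Lambda_sharp_def
  proof (rule the_equality)
    show "\<forall>f'\<in>smooth_functions (base L). \<forall>s\<in>sections L. df_tensor L x f' s = df_tensor L x f e \<longrightarrow>
      ?X = (\<lambda>g. ham_vec L br (\<lambda>y. f' y *\<^sub>R s y) x g - f' x * ham_vec L br s x g)"
      using key by blast
    show "X = ?X" if "\<forall>f'\<in>smooth_functions (base L). \<forall>s\<in>sections L. df_tensor L x f' s = df_tensor L x f e \<longrightarrow>
      X = (\<lambda>g. ham_vec L br (\<lambda>y. f' y *\<^sub>R s y) x g - f' x * ham_vec L br s x g)" for X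
    proof -
      have "X = (\<lambda>g. ham_vec L br (\<lambda>y. f y *\<^sub>R e y) x g - f x * ham_vec L br e x g)" using that f e(1) by blast
      then show ?thesis using key[OF f e(1) refl] by simp
    qed
  qed
  moreover have "df_tensor L x f e \<in> Hom (tangent_space (base L) x) (fibre L x)"
  proof -
    have "(\<lambda>g. X g + Y g) \<in> tangent_space (base L) x"
      if "X \<in> tangent_space (base L) x" "Y \<in> tangent_space (base L) x" for X Y
      using tangent_combination[OF ch that, of 1] by simp
    moreover have "(\<lambda>g. k * X g) \<in> tangent_space (base L) x" if "X \<in> tangent_space (base L) x" for X k
      using tangent_combination[OF ch that that, of "k - 1"] by (simp add: algebra_simps)
    ultimately show ?thesis
      using subspace_scale[OF fibre_subspace[OF x] sectionsD(1)[OF e(1) x]]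
      unfolding Hom_def df_tensor_def by (auto simp: scaleR_add_left)
  qed
  ultimately show ?thesis unfolding contact_hyperplane_def by (metis imageI)
qed

end

section \<open>The line product\<close>

text \<open>Points with different projections are separated in the base; points with the same
  projection lie in a common chart and are separated there.\<close>

lemma Hausdorff_fibred:
  assumes A: "charted A" and p: "continuous_map (atlas_topology A) Z p" and Z: "Hausdorff_space Z"
    and common: "\<And>x y. x \<in> points A \<Longrightarrow> y \<in> points A \<Longrightarrow> p x = p y \<Longrightarrow> \<exists>(U, \<phi>)\<in>A. x \<in> U \<and> y \<in> U"
  shows "Hausdorff_space (atlas_topology A)"
  unfolding Hausdorff_space_def topspace_atlas
proof (intro allI impI)
  fix x y assume xy: "x \<in> points A \<and> y \<in> points A \<and> x \<noteq> y"
  show "\<exists>U V. aopen A U \<and> aopen A V \<and> x \<in> U \<and> y \<in> V \<and> disjnt U V"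
  proof (cases "p x = p y")
    case True
    then obtain U \<phi> where U: "(U, \<phi>) \<in> A" "x \<in> U" "y \<in> U" using common xy by blast
    then have "\<phi> x \<noteq> \<phi> y" using xy chartedD(1)[OF A U(1)] by (auto simp: inj_on_def)
    then obtain S T where "open S" "open T" "\<phi> x \<in> S" "\<phi> y \<in> T" "S \<inter> T = {}" using hausdorff by metis
    then show ?thesis
      using U aopen_chart_vimage[OF U(1)]
      by (intro exI[of _ "U \<inter> \<phi> -` S"] exI[of _ "U \<inter> \<phi> -` T"]) (auto simp: disjnt_def)
  next
    case False
    have top: "p x \<in> topspace Z" "p y \<in> topspace Z" using p xy continuous_map_image_subset_topspace by fastforce+
    then obtain S T where ST: "openin Z S" "openin Z T" "p x \<in> S" "p y \<in> T" "disjnt S T"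
      using Z False unfolding Hausdorff_space_def by meson
    have "aopen A {x \<in> points A. p x \<in> S}" "aopen A {x \<in> points A. p x \<in> T}"
      using openin_continuous_map_preimage[OF p ST(1)] openin_continuous_map_preimage[OF p ST(2)] by simp_all
    then show ?thesis using ST xy
      by (intro exI[of _ "{x \<in> points A. p x \<in> S}"] exI[of _ "{x \<in> points A. p x \<in> T}"]) (auto simp: disjnt_iff)
  qed
qed

lemma smooth_map_continuous:
  assumes "smooth_map A A' g" "charted A" "charted A'"
  shows "continuous_map (atlas_topology A) (atlas_topology A') g"
  unfolding continuous_map topspace_atlas
proof (intro conjI allI impI)
  show "g ` points A \<subseteq> points A'" using smooth_map_points[OF assms(1)] by auto
  show "aopen A {x \<in> points A. g x \<in> T}" if "aopen A' T" for T
    using smooth_map_aopen_vimage[OF assms that] by (simp add: vimage_def Int_def)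
qed

lemma smooth_on_fst_compose:
  assumes "open A" "open B" "smooth_on A g"
  shows "smooth_on (A \<times> B) (\<lambda>z. g (fst (z :: 'a::finite_dim_inner \<times> 'b::finite_dim_inner)))"
  by (rule smooth_on_compose[OF open_Times[OF assms(1,2)] assms(1) _ _ assms(3)])
    (auto intro: smooth_on_bounded_linear[OF bounded_linear_fst])

lemma smooth_on_snd_compose:
  assumes "open A" "open B" "smooth_on B g"
  shows "smooth_on (A \<times> B) (\<lambda>z. g (snd (z :: 'a::finite_dim_inner \<times> 'b::finite_dim_inner)))"
  by (rule smooth_on_compose[OF open_Times[OF assms(1,2)] assms(2) _ _ assms(3)])
    (auto intro: smooth_on_bounded_linear[OF bounded_linear_snd])

locale bundle_pair = L1: hbundle L1 + L2: hbundle L2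
  for L1 :: "('m1, 'e1::finite_dim_inner, 'v1::real_vector) line_bundle"
    and L2 :: "('m2, 'e2::finite_dim_inner, 'v2::real_vector) line_bundle"
begin

definition fibre_iso :: "'m1 \<Rightarrow> 'm2 \<Rightarrow> ('v1 \<Rightarrow> 'v2) \<Rightarrow> bool"
  where "fibre_iso x1 x2 C \<longleftrightarrow> linear_iso (fibre L1 x1) (fibre L2 x2) C \<and> (\<forall>l. l \<notin> fibre L1 x1 \<longrightarrow> C l = 0)"

definition pdom :: "'m1 set \<Rightarrow> 'm1 set \<Rightarrow> 'm2 set \<Rightarrow> 'm2 set \<Rightarrow> ('m1 \<times> 'm2 \<times> ('v1 \<Rightarrow> 'v2)) set"
  where "pdom U1 W1 U2 W2 = {(x1, x2, C). x1 \<in> U1 \<inter> W1 \<and> x2 \<in> U2 \<inter> W2 \<and> fibre_iso x1 x2 C}"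

definition pchart :: "('m1 \<Rightarrow> 'e1) \<Rightarrow> ('m1 \<Rightarrow> 'v1 \<Rightarrow> real) \<Rightarrow> ('m2 \<Rightarrow> 'e2) \<Rightarrow> ('m2 \<Rightarrow> 'v2 \<Rightarrow> real) \<Rightarrow>
    'm1 \<times> 'm2 \<times> ('v1 \<Rightarrow> 'v2) \<Rightarrow> 'e1 \<times> 'e2 \<times> real"
  where "pchart \<phi>1 \<tau>1 \<phi>2 \<tau>2 = (\<lambda>(x1, x2, C). (\<phi>1 x1, \<phi>2 x2, \<tau>2 x2 (C (unit_vec L1 \<tau>1 x1))))"

abbreviation "BP \<equiv> base_product L1 L2"

lemma BP_chart_iff: "c \<in> BP \<longleftrightarrow> (\<exists>U1 \<phi>1 W1 \<tau>1 U2 \<phi>2 W2 \<tau>2. (U1, \<phi>1) \<in> base L1 \<and> (W1, \<tau>1) \<in> trivs L1 \<and>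
    (U2, \<phi>2) \<in> base L2 \<and> (W2, \<tau>2) \<in> trivs L2 \<and> c = (pdom U1 W1 U2 W2, pchart \<phi>1 \<tau>1 \<phi>2 \<tau>2))"
  unfolding base_product_def pdom_def pchart_def fibre_iso_def unit_vec_def by (simp, blast)

lemma BP_chartE:
  assumes "(V, \<Phi>) \<in> BP"
  obtains U1 \<phi>1 W1 \<tau>1 U2 \<phi>2 W2 \<tau>2 where "(U1, \<phi>1) \<in> base L1" "(W1, \<tau>1) \<in> trivs L1"
    "(U2, \<phi>2) \<in> base L2" "(W2, \<tau>2) \<in> trivs L2" "V = pdom U1 W1 U2 W2" "\<Phi> = pchart \<phi>1 \<tau>1 \<phi>2 \<tau>2"
  using assms unfolding BP_chart_iff prod.inject by (elim exE conjE) (rule that)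

text \<open>The isomorphism of fibres with scale \<open>k\<close>, extended by 0 as the points of
  the base product require. It inverts \<open>pchart\<close> in the last coordinate.\<close>

definition plift :: "('m1 \<Rightarrow> 'v1 \<Rightarrow> real) \<Rightarrow> ('m2 \<Rightarrow> 'v2 \<Rightarrow> real) \<Rightarrow> 'm1 \<Rightarrow> 'm2 \<Rightarrow> real \<Rightarrow> 'v1 \<Rightarrow> 'v2"
  where "plift \<tau>1 \<tau>2 x1 x2 k = (\<lambda>l. if l \<in> fibre L1 x1 then (\<tau>1 x1 l * k) *\<^sub>R unit_vec L2 \<tau>2 x2 else 0)"

context
  fixes W1 \<tau>1 W2 \<tau>2 x1 x2
  assumes W1: "(W1, \<tau>1) \<in> trivs L1" "x1 \<in> W1" and W2: "(W2, \<tau>2) \<in> trivs L2" "x2 \<in> W2"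
begin

lemma fibre_iso_in: "fibre_iso x1 x2 C \<Longrightarrow> l \<in> fibre L1 x1 \<Longrightarrow> C l \<in> fibre L2 x2"
  using linear_iso_inv(4) by (auto simp: fibre_iso_def)

lemma fibre_iso_triv:
  assumes C: "fibre_iso x1 x2 C" and l: "l \<in> fibre L1 x1"
  shows "\<tau>2 x2 (C l) = \<tau>1 x1 l * \<tau>2 x2 (C (unit_vec L1 \<tau>1 x1))"
proof -
  have iso: "linear_iso (fibre L1 x1) (fibre L2 x2) C" using C by (simp add: fibre_iso_def)
  have "C l = \<tau>1 x1 l *\<^sub>R C (unit_vec L1 \<tau>1 x1)"
    using L1.triv_expand[OF W1 l] linear_isoD(2)[OF iso L1.unit_in[OF W1]] by metis
  then show ?thesis using L2.triv_scale[OF W2 fibre_iso_in[OF C L1.unit_in[OF W1]]] by simp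
qed

lemma fibre_iso_eq_plift:
  assumes C: "fibre_iso x1 x2 C"
  shows "C = plift \<tau>1 \<tau>2 x1 x2 (\<tau>2 x2 (C (unit_vec L1 \<tau>1 x1)))"
proof
  fix l show "C l = plift \<tau>1 \<tau>2 x1 x2 (\<tau>2 x2 (C (unit_vec L1 \<tau>1 x1))) l"
    using C L2.triv_expand[OF W2 fibre_iso_in[OF C, of l]] fibre_iso_triv[OF C, of l]
    by (cases "l \<in> fibre L1 x1") (auto simp: plift_def fibre_iso_def)
qed

lemma fibre_iso_nonzero:
  assumes C: "fibre_iso x1 x2 C" shows "\<tau>2 x2 (C (unit_vec L1 \<tau>1 x1)) \<noteq> 0"
proof
  assume 0: "\<tau>2 x2 (C (unit_vec L1 \<tau>1 x1)) = 0"
  have iso: "linear_iso (fibre L1 x1) (fibre L2 x2) C" using C by (simp add: fibre_iso_def)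
  let ?l = "inv_into (fibre L1 x1) C (unit_vec L2 \<tau>2 x2)"
  have "?l \<in> fibre L1 x1" "C ?l = unit_vec L2 \<tau>2 x2"
    using linear_iso_inv[OF iso] L2.unit_in[OF W2] by auto
  then show False using fibre_iso_triv[OF C] L2.triv_unit[OF W2] 0 by force
qed

lemma plift_iso:
  assumes k: "k \<noteq> 0" shows "fibre_iso x1 x2 (plift \<tau>1 \<tau>2 x1 x2 k)"
proof -
  note s1 = L1.triv_subspace[OF W1] and s2 = L2.triv_subspace[OF W2]
  have "bij_betw (plift \<tau>1 \<tau>2 x1 x2 k) (fibre L1 x1) (fibre L2 x2)"
  proof (rule bij_betw_byWitness[where f' = "\<lambda>m. (\<tau>2 x2 m / k) *\<^sub>R unit_vec L1 \<tau>1 x1"])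
    show "\<forall>l\<in>fibre L1 x1. (\<tau>2 x2 (plift \<tau>1 \<tau>2 x1 x2 k l) / k) *\<^sub>R unit_vec L1 \<tau>1 x1 = l"
      using k L1.triv_expand[OF W1] by (simp add: plift_def L2.triv_scale[OF W2 L2.unit_in[OF W2]] L2.triv_unit[OF W2])
    show "\<forall>m\<in>fibre L2 x2. plift \<tau>1 \<tau>2 x1 x2 k ((\<tau>2 x2 m / k) *\<^sub>R unit_vec L1 \<tau>1 x1) = m"
      using k L2.triv_expand[OF W2]
      by (simp add: plift_def L1.triv_scale[OF W1 L1.unit_in[OF W1]] L1.triv_unit[OF W1] L1.unit_in[OF W1] subspace_scale[OF s1])
    show "plift \<tau>1 \<tau>2 x1 x2 k ` fibre L1 x1 \<subseteq> fibre L2 x2"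
      by (auto simp: plift_def intro!: subspace_scale[OF s2] L2.unit_in[OF W2])
    show "(\<lambda>m. (\<tau>2 x2 m / k) *\<^sub>R unit_vec L1 \<tau>1 x1) ` fibre L2 x2 \<subseteq> fibre L1 x1"
      by (auto intro!: subspace_scale[OF s1] L1.unit_in[OF W1])
  qed
  then show ?thesis
    unfolding fibre_iso_def linear_iso_def
    by (auto simp: plift_def subspace_add[OF s1] subspace_scale[OF s1] L1.triv_add[OF W1] L1.triv_scale[OF W1] algebra_simps)
qed

lemma plift_coord: "\<tau>2 x2 (plift \<tau>1 \<tau>2 x1 x2 k (unit_vec L1 \<tau>1 x1)) = k"
  by (simp add: plift_def L1.unit_in[OF W1] L1.triv_unit[OF W1] L2.triv_scale[OF W2 L2.unit_in[OF W2]] L2.triv_unit[OF W2])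

end

text \<open>Every nonzero scale is realised by an isomorphism between two given fibres, which
  produces the factor \<open>- {0}\<close>. The sets \<open>S1\<close> and \<open>S2\<close> serve
  to describe overlaps of charts.\<close>

lemma pchart_image:
  assumes U1: "(U1, \<phi>1) \<in> base L1" and W1: "(W1, \<tau>1) \<in> trivs L1"
    and U2: "(U2, \<phi>2) \<in> base L2" and W2: "(W2, \<tau>2) \<in> trivs L2"
  shows "pchart \<phi>1 \<tau>1 \<phi>2 \<tau>2 ` (pdom U1 W1 U2 W2 \<inter> {(x1, x2, C). x1 \<in> S1 \<and> x2 \<in> S2}) =
    \<phi>1 ` (U1 \<inter> W1 \<inter> S1) \<times> \<phi>2 ` (U2 \<inter> W2 \<inter> S2) \<times> (- {0})" (is "?l = ?r")
proof (intro equalityI subsetI)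
  fix z assume "z \<in> ?l"
  then obtain x1 x2 C where *: "x1 \<in> U1 \<inter> W1" "x2 \<in> U2 \<inter> W2" "x1 \<in> S1" "x2 \<in> S2" "fibre_iso x1 x2 C"
    "z = (\<phi>1 x1, \<phi>2 x2, \<tau>2 x2 (C (unit_vec L1 \<tau>1 x1)))"
    by (auto simp: pdom_def pchart_def)
  then show "z \<in> ?r" using fibre_iso_nonzero[OF W1 _ W2 _ *(5)] by auto
next
  fix z assume "z \<in> ?r"
  then obtain x1 x2 k where *: "x1 \<in> U1 \<inter> W1 \<inter> S1" "x2 \<in> U2 \<inter> W2 \<inter> S2" "z = (\<phi>1 x1, \<phi>2 x2, k)" "k \<noteq> 0" by auto
  have "z = pchart \<phi>1 \<tau>1 \<phi>2 \<tau>2 (x1, x2, plift \<tau>1 \<tau>2 x1 x2 k)"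
    using * plift_coord[OF W1 _ W2, of x1 x2 k] by (simp add: pchart_def)
  moreover have "(x1, x2, plift \<tau>1 \<tau>2 x1 x2 k) \<in> pdom U1 W1 U2 W2 \<inter> {(x1, x2, C). x1 \<in> S1 \<and> x2 \<in> S2}"
    using * plift_iso[OF W1 _ W2, of x1 x2 k] by (simp add: pdom_def)
  ultimately show "z \<in> ?l" by (rule image_eqI)
qed

lemma pchart_inj:
  assumes U1: "(U1, \<phi>1) \<in> base L1" and W1: "(W1, \<tau>1) \<in> trivs L1"
    and U2: "(U2, \<phi>2) \<in> base L2" and W2: "(W2, \<tau>2) \<in> trivs L2"
  shows "inj_on (pchart \<phi>1 \<tau>1 \<phi>2 \<tau>2) (pdom U1 W1 U2 W2)"
proof (rule inj_onI)
  fix z z' assume z: "z \<in> pdom U1 W1 U2 W2" and z': "z' \<in> pdom U1 W1 U2 W2"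
    and eq: "pchart \<phi>1 \<tau>1 \<phi>2 \<tau>2 z = pchart \<phi>1 \<tau>1 \<phi>2 \<tau>2 z'"
  obtain x1 x2 C where zz: "z = (x1, x2, C)" "x1 \<in> U1" "x1 \<in> W1" "x2 \<in> U2" "x2 \<in> W2" "fibre_iso x1 x2 C"
    using z by (auto simp: pdom_def)
  obtain x1' x2' C' where zz': "z' = (x1', x2', C')" "x1' \<in> U1" "x2' \<in> U2" "fibre_iso x1' x2' C'"
    using z' by (auto simp: pdom_def)
  have x: "x1' = x1" "x2' = x2"
    using eq zz zz' chartedD(1)[OF L1.ch U1] chartedD(1)[OF L2.ch U2] by (auto simp: pchart_def inj_on_def)
  then have "C' = C"
    using fibre_iso_eq_plift[OF W1 zz(3) W2 zz(5,6)] fibre_iso_eq_plift[OF W1 zz(3) W2 zz(5), of C'] eq zz zz'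
    by (simp add: pchart_def)
  then show "z = z'" using x zz zz' by simp
qed

lemma BP_charted: "charted BP"
  unfolding charted_def
proof (intro conjI ballI)
  have op: "open (\<phi>1 ` (U1 \<inter> W1 \<inter> S1) \<times> \<phi>2 ` (U2 \<inter> W2 \<inter> S2) \<times> (- {0::real}))"
    if "(U1, \<phi>1) \<in> base L1" "(W1, \<tau>1) \<in> trivs L1" "(U2, \<phi>2) \<in> base L2" "(W2, \<tau>2) \<in> trivs L2"
      "aopen (base L1) S1" "aopen (base L2) S2" for U1 \<phi>1 W1 \<tau>1 U2 \<phi>2 W2 \<tau>2 S1 S2
    using aopen_image[OF L1.ch that(1) openin_Int[OF L1.triv_open[OF that(2)] that(5)]]
      aopen_image[OF L2.ch that(3) openin_Int[OF L2.triv_open[OF that(4)] that(6)]]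
    by (intro open_Times) (auto simp: Int_assoc)
  fix c assume "c \<in> BP"
  then obtain U1 \<phi>1 W1 \<tau>1 U2 \<phi>2 W2 \<tau>2 where c: "(U1, \<phi>1) \<in> base L1" "(W1, \<tau>1) \<in> trivs L1"
    "(U2, \<phi>2) \<in> base L2" "(W2, \<tau>2) \<in> trivs L2" "c = (pdom U1 W1 U2 W2, pchart \<phi>1 \<tau>1 \<phi>2 \<tau>2)"
    unfolding BP_chart_iff by (elim exE conjE) (rule that)
  let ?D = "pdom U1 W1 U2 W2" and ?\<Phi> = "pchart \<phi>1 \<tau>1 \<phi>2 \<tau>2"
  note inj = pchart_inj[OF c(1-4)]
  have "?D = ?D \<inter> {(x1, x2, C). x1 \<in> points (base L1) \<and> x2 \<in> points (base L2)}"
    using chart_subset_points[OF c(1)] chart_subset_points[OF c(3)] by (auto simp: pdom_def)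
  then have "open (?\<Phi> ` ?D)"
    using pchart_image[OF c(1-4), of "points (base L1)" "points (base L2)"] op[OF c(1-4) aopen_points aopen_points] by simp
  then show "case c of (U, \<phi>) \<Rightarrow> inj_on \<phi> U \<and> open (\<phi> ` U)" using inj by (simp add: c(5))
  show "case c of (U, \<phi>) \<Rightarrow> \<forall>(V, \<psi>)\<in>BP. open (\<phi> ` (U \<inter> V)) \<and> smooth_on (\<phi> ` (U \<inter> V)) (\<psi> \<circ> inv_into U \<phi>)"
    unfolding c(5) prod.case
  proof (intro ballI)
    fix d assume "d \<in> BP"
    then obtain U1' \<phi>1' W1' \<tau>1' U2' \<phi>2' W2' \<tau>2' where d: "(U1', \<phi>1') \<in> base L1" "(W1', \<tau>1') \<in> trivs L1"
      "(U2', \<phi>2') \<in> base L2" "(W2', \<tau>2') \<in> trivs L2" "d = (pdom U1' W1' U2' W2', pchart \<phi>1' \<tau>1' \<phi>2' \<tau>2')"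
      unfolding BP_chart_iff by (elim exE conjE) (rule that)
    let ?D' = "pdom U1' W1' U2' W2'" and ?\<Phi>' = "pchart \<phi>1' \<tau>1' \<phi>2' \<tau>2'"
    let ?S1 = "U1' \<inter> W1'" and ?S2 = "U2' \<inter> W2'"
    have S: "aopen (base L1) ?S1" "aopen (base L2) ?S2"
      by (intro openin_Int aopen_chart[OF L1.ch d(1)] L1.triv_open[OF d(2)] aopen_chart[OF L2.ch d(3)] L2.triv_open[OF d(4)])+
    have DD: "?D \<inter> ?D' = ?D \<inter> {(x1, x2, C). x1 \<in> ?S1 \<and> x2 \<in> ?S2}" by (auto simp: pdom_def)
    let ?A = "\<phi>1 ` (U1 \<inter> W1 \<inter> ?S1)" and ?B = "\<phi>2 ` (U2 \<inter> W2 \<inter> ?S2)"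
    have im: "?\<Phi> ` (?D \<inter> ?D') = ?A \<times> ?B \<times> (- {0})"
      unfolding DD by (rule pchart_image[OF c(1-4)])
    have oim: "open (?A \<times> ?B \<times> (- {0::real}))" by (rule op[OF c(1-4) S])
    have oA: "open ?A" using aopen_image[OF L1.ch c(1) openin_Int[OF L1.triv_open[OF c(2)] S(1)]] by (simp add: Int_assoc)
    have oB: "open ?B" using aopen_image[OF L2.ch c(3) openin_Int[OF L2.triv_open[OF c(4)] S(2)]] by (simp add: Int_assoc)
    have oR: "open (- {0::real})" by auto
    let ?i1 = "inv_into U1 \<phi>1" and ?i2 = "inv_into U2 \<phi>2"
    have s1: "smooth_on ?A (\<lambda>y. \<phi>1' (?i1 y))"
      by (rule smooth_on_subset[OF chartedD(4)[OF L1.ch c(1) d(1)]]) auto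
    have s2: "smooth_on ?B (\<lambda>y. \<phi>2' (?i2 y))"
      by (rule smooth_on_subset[OF chartedD(4)[OF L2.ch c(3) d(3)]]) auto
    have h1: "smooth_on ?A (\<lambda>y. \<tau>1 (?i1 y) (unit_vec L1 \<tau>1' (?i1 y)))"
      by (rule smooth_on_subset[OF smooth_inD[OF L1.triv_transition[OF d(2) c(2)] c(1)]]) auto
    have h2: "smooth_on ?B (\<lambda>y. \<tau>2' (?i2 y) (unit_vec L2 \<tau>2 (?i2 y)))"
      by (rule smooth_on_subset[OF smooth_inD[OF L2.triv_transition[OF c(4) d(4)] c(3)]]) auto
    have c2: "smooth_on (?A \<times> ?B \<times> (- {0::real})) (\<lambda>z. g (fst (snd z)))" if "smooth_on ?B g" for g :: "'e2 \<Rightarrow> 'x::real_normed_vector"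
      by (rule smooth_on_snd_compose[OF oA open_Times[OF oB oR] smooth_on_fst_compose[OF oB oR that]])
    note c1 = smooth_on_fst_compose[OF oA open_Times[OF oB oR]]
    \<comment> \<open>The scale is a coordinate on homomorphisms, so it changes by a transition
      function of \<open>L1\<close> from the new to the old trivialisation and by one of
      \<open>L2\<close> from the old to the new.\<close>
    have "smooth_on (?A \<times> ?B \<times> (- {0})) (\<lambda>z. (\<phi>1' (?i1 (fst z)), \<phi>2' (?i2 (fst (snd z))),
        \<tau>1 (?i1 (fst z)) (unit_vec L1 \<tau>1' (?i1 (fst z))) * snd (snd z) *
        \<tau>2' (?i2 (fst (snd z))) (unit_vec L2 \<tau>2 (?i2 (fst (snd z))))))"
      by (intro smooth_on_Pair[OF oim] smooth_on_mult[OF oim] c1[OF s1] c1[OF h1] c2[OF s2] c2[OF h2]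
          smooth_on_snd[OF oim] smooth_on_ident)
    then have "smooth_on (?\<Phi> ` (?D \<inter> ?D')) (\<lambda>z. ?\<Phi>' (inv_into ?D ?\<Phi> z))"
      unfolding im
    proof (rule smooth_on_cong[OF oim])
      fix z assume "z \<in> ?A \<times> ?B \<times> (- {0::real})"
      then obtain w where w: "w \<in> ?D \<inter> ?D'" "z = ?\<Phi> w" unfolding im[symmetric] by blast
      obtain x1 x2 C where x: "w = (x1, x2, C)" "x1 \<in> U1" "x1 \<in> W1" "x2 \<in> U2" "x2 \<in> W2" "x1 \<in> W1'" "x2 \<in> W2'"
        "fibre_iso x1 x2 C" using w(1) by (auto simp: pdom_def)
      have "C (unit_vec L1 \<tau>1' x1) = (\<tau>1 x1 (unit_vec L1 \<tau>1' x1) * \<tau>2 x2 (C (unit_vec L1 \<tau>1 x1))) *\<^sub>R unit_vec L2 \<tau>2 x2"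
        using fibre_iso_eq_plift[OF c(2) x(3) c(4) x(5) x(8)] L1.unit_in[OF d(2) x(6)]
        unfolding plift_def by metis
      then have "\<tau>2' x2 (C (unit_vec L1 \<tau>1' x1)) = \<tau>1 x1 (unit_vec L1 \<tau>1' x1) * \<tau>2 x2 (C (unit_vec L1 \<tau>1 x1)) *
          \<tau>2' x2 (unit_vec L2 \<tau>2 x2)"
        using L2.triv_scale[OF d(4) x(7) L2.unit_in[OF c(4) x(5)]] by simp
      moreover have "inv_into ?D ?\<Phi> z = w" using inv_into_f_f[OF inj] w by auto
      ultimately show "(\<phi>1' (?i1 (fst z)), \<phi>2' (?i2 (fst (snd z))),
        \<tau>1 (?i1 (fst z)) (unit_vec L1 \<tau>1' (?i1 (fst z))) * snd (snd z) *
        \<tau>2' (?i2 (fst (snd z))) (unit_vec L2 \<tau>2 (?i2 (fst (snd z))))) = ?\<Phi>' (inv_into ?D ?\<Phi> z)"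
        using w(2) x by (simp add: pchart_def inv_chart[OF L1.ch c(1)] inv_chart[OF L2.ch c(3)])
    qed
    then show "case d of (V, \<psi>) \<Rightarrow> open (?\<Phi> ` (?D \<inter> V)) \<and> smooth_on (?\<Phi> ` (?D \<inter> V)) (\<psi> \<circ> inv_into ?D ?\<Phi>)"
      using oim im by (simp add: d(5) o_def)
  qed
qed

lemma BP_chart_around:
  assumes "x1 \<in> points (base L1)" "x2 \<in> points (base L2)"
  obtains U1 \<phi>1 W1 \<tau>1 U2 \<phi>2 W2 \<tau>2 where "(U1, \<phi>1) \<in> base L1" "x1 \<in> U1" "(W1, \<tau>1) \<in> trivs L1" "x1 \<in> W1"
    "(U2, \<phi>2) \<in> base L2" "x2 \<in> U2" "(W2, \<tau>2) \<in> trivs L2" "x2 \<in> W2" "(pdom U1 W1 U2 W2, pchart \<phi>1 \<tau>1 \<phi>2 \<tau>2) \<in> BP"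
proof -
  obtain U1 \<phi>1 where U1: "(U1, \<phi>1) \<in> base L1" "x1 \<in> U1" using pointsE[OF assms(1)] .
  obtain W1 \<tau>1 where W1: "(W1, \<tau>1) \<in> trivs L1" "x1 \<in> W1" using L1.trivE[OF assms(1)] .
  obtain U2 \<phi>2 where U2: "(U2, \<phi>2) \<in> base L2" "x2 \<in> U2" using pointsE[OF assms(2)] .
  obtain W2 \<tau>2 where W2: "(W2, \<tau>2) \<in> trivs L2" "x2 \<in> W2" using L2.trivE[OF assms(2)] .
  show thesis by (rule that[OF U1 W1 U2 W2]) (use U1 W1 U2 W2 in \<open>unfold BP_chart_iff, blast\<close>)
qed

lemma BP_points: "points BP = {(x1, x2, C). x1 \<in> points (base L1) \<and> x2 \<in> points (base L2) \<and> fibre_iso x1 x2 C}"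
proof (intro equalityI subsetI)
  fix z assume "z \<in> points BP"
  then obtain V \<Phi> where V: "(V, \<Phi>) \<in> BP" "z \<in> V" by (rule pointsE)
  obtain U1 \<phi>1 W1 \<tau>1 U2 \<phi>2 W2 \<tau>2 where c: "(U1, \<phi>1) \<in> base L1" "(W1, \<tau>1) \<in> trivs L1"
    "(U2, \<phi>2) \<in> base L2" "(W2, \<tau>2) \<in> trivs L2" "V = pdom U1 W1 U2 W2" "\<Phi> = pchart \<phi>1 \<tau>1 \<phi>2 \<tau>2"
    using BP_chartE[OF V(1)] .
  show "z \<in> {(x1, x2, C). x1 \<in> points (base L1) \<and> x2 \<in> points (base L2) \<and> fibre_iso x1 x2 C}"
    using V(2) chart_subset_points[OF c(1)] chart_subset_points[OF c(3)] by (auto simp: c(5) pdom_def)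
next
  fix z assume "z \<in> {(x1, x2, C). x1 \<in> points (base L1) \<and> x2 \<in> points (base L2) \<and> fibre_iso x1 x2 C}"
  then obtain x1 x2 C where z: "z = (x1, x2, C)" "x1 \<in> points (base L1)" "x2 \<in> points (base L2)" "fibre_iso x1 x2 C" by auto
  obtain U1 \<phi>1 W1 \<tau>1 U2 \<phi>2 W2 \<tau>2 where c: "(U1, \<phi>1) \<in> base L1" "x1 \<in> U1" "(W1, \<tau>1) \<in> trivs L1" "x1 \<in> W1"
    "(U2, \<phi>2) \<in> base L2" "x2 \<in> U2" "(W2, \<tau>2) \<in> trivs L2" "x2 \<in> W2" "(pdom U1 W1 U2 W2, pchart \<phi>1 \<tau>1 \<phi>2 \<tau>2) \<in> BP"
    using BP_chart_around[OF z(2,3)] .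
  have "z \<in> pdom U1 W1 U2 W2" using z c by (simp add: pdom_def)
  then show "z \<in> points BP" using chart_subset_points[OF c(9)] by blast
qed

lemma BP_fst_smooth: "smooth_map BP (base L1) fst" and BP_snd_smooth: "smooth_map BP (base L2) (\<lambda>(x1, x2, C). x2)"
proof -
  have *: "(\<exists>V \<psi> T. (V, \<psi>) \<in> base L1 \<and> aopen BP T \<and> z \<in> T \<and> fst ` T \<subseteq> V \<and> smooth_in BP T (\<lambda>x. \<psi> (fst x))) \<and>
    (\<exists>V \<psi> T. (V, \<psi>) \<in> base L2 \<and> aopen BP T \<and> z \<in> T \<and> (\<lambda>(x1, x2, C). x2) ` T \<subseteq> V \<and>
      smooth_in BP T (\<lambda>x. \<psi> ((\<lambda>(x1, x2, C). x2) x)))" if z: "z \<in> points BP" for z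
  proof -
    obtain x1 x2 C where zz: "z = (x1, x2, C)" "x1 \<in> points (base L1)" "x2 \<in> points (base L2)" "fibre_iso x1 x2 C"
      using z by (auto simp: BP_points)
    obtain U1 \<phi>1 W1 \<tau>1 U2 \<phi>2 W2 \<tau>2 where c: "(U1, \<phi>1) \<in> base L1" "x1 \<in> U1" "(W1, \<tau>1) \<in> trivs L1" "x1 \<in> W1"
      "(U2, \<phi>2) \<in> base L2" "x2 \<in> U2" "(W2, \<tau>2) \<in> trivs L2" "x2 \<in> W2" "(pdom U1 W1 U2 W2, pchart \<phi>1 \<tau>1 \<phi>2 \<tau>2) \<in> BP"
      using BP_chart_around[OF zz(2,3)] .
    let ?D = "pdom U1 W1 U2 W2" and ?\<Phi> = "pchart \<phi>1 \<tau>1 \<phi>2 \<tau>2"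
    note o = aopen_chart[OF BP_charted c(9)]
    have "smooth_in BP ?D (\<lambda>z. fst (?\<Phi> z))" "smooth_in BP ?D (\<lambda>z. fst (snd (?\<Phi> z)))"
      by (intro smooth_in_bounded_linear[OF BP_charted o bounded_linear_fst]
          smooth_in_bounded_linear[OF BP_charted o bounded_linear_snd] smooth_in_chart[OF BP_charted c(9)])+
    moreover have "(\<lambda>z. fst (?\<Phi> z)) = (\<lambda>z. \<phi>1 (fst z))" "(\<lambda>z. fst (snd (?\<Phi> z))) = (\<lambda>z. \<phi>2 ((\<lambda>(x1, x2, C). x2) z))"
      by (auto simp: pchart_def)
    ultimately have "smooth_in BP ?D (\<lambda>z. \<phi>1 (fst z))" "smooth_in BP ?D (\<lambda>z. \<phi>2 ((\<lambda>(x1, x2, C). x2) z))" by simp_all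
    moreover have "fst ` ?D \<subseteq> U1" "(\<lambda>(x1, x2, C). x2) ` ?D \<subseteq> U2" "z \<in> ?D" using zz c by (auto simp: pdom_def)
    ultimately show ?thesis using o c(1,5) by blast
  qed
  show "smooth_map BP (base L1) fst" by (rule smooth_mapI[OF BP_charted L1.ch]) (use * in blast)
  show "smooth_map BP (base L2) (\<lambda>(x1, x2, C). x2)" by (rule smooth_mapI[OF BP_charted L2.ch]) (use * in blast)
qed

lemma BP_hmanifold: "hmanifold BP"
  unfolding hmanifold_def
proof (intro conjI BP_charted)
  show "Hausdorff_space (atlas_topology BP)"
  proof (rule Hausdorff_fibred[OF BP_charted])
    show "continuous_map (atlas_topology BP) (prod_topology (atlas_topology (base L1)) (atlas_topology (base L2)))
      (\<lambda>z. (fst z, (\<lambda>(x1, x2, C). x2) z))"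
      unfolding continuous_map_paired
      by (intro conjI smooth_map_continuous[OF BP_fst_smooth BP_charted L1.ch] smooth_map_continuous[OF BP_snd_smooth BP_charted L2.ch])
    show "Hausdorff_space (prod_topology (atlas_topology (base L1)) (atlas_topology (base L2)))"
      using L1.hmfd L2.hmfd by (simp add: hmanifold_def Hausdorff_space_prod_topology)
    fix z z' assume z: "z \<in> points BP" and z': "z' \<in> points BP"
      and eq: "(fst z, (\<lambda>(x1, x2, C). x2) z) = (fst z', (\<lambda>(x1, x2, C). x2) z')"
    obtain x1 x2 C where zz: "z = (x1, x2, C)" "x1 \<in> points (base L1)" "x2 \<in> points (base L2)" "fibre_iso x1 x2 C"
      using z by (auto simp: BP_points)
    obtain C' where zz': "z' = (x1, x2, C')" "fibre_iso x1 x2 C'" using z' eq zz(1) by (auto simp: BP_points)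
    obtain U1 \<phi>1 W1 \<tau>1 U2 \<phi>2 W2 \<tau>2 where c: "(U1, \<phi>1) \<in> base L1" "x1 \<in> U1" "(W1, \<tau>1) \<in> trivs L1" "x1 \<in> W1"
      "(U2, \<phi>2) \<in> base L2" "x2 \<in> U2" "(W2, \<tau>2) \<in> trivs L2" "x2 \<in> W2" "(pdom U1 W1 U2 W2, pchart \<phi>1 \<tau>1 \<phi>2 \<tau>2) \<in> BP"
      using BP_chart_around[OF zz(2,3)] .
    have "z \<in> pdom U1 W1 U2 W2 \<and> z' \<in> pdom U1 W1 U2 W2" using zz zz' c by (simp add: pdom_def)
    then show "\<exists>(U, \<phi>)\<in>BP. z \<in> U \<and> z' \<in> U" using c(9) by blast
  qed
qed

abbreviation "LP \<equiv> line_product L1 L2"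

lemma LP_simps [simp]: "base LP = BP" "fibre LP z = fibre L1 (fst z)"
  by (simp_all add: line_product_def pullback_bundle_def)

lemma LP_triv: "(W1, \<tau>1) \<in> trivs L1 \<Longrightarrow> (points BP \<inter> fst -` W1, \<lambda>z. \<tau>1 (fst z)) \<in> trivs LP"
  by (auto simp: line_product_def pullback_bundle_def)

lemma LP_hline_bundle: "hline_bundle LP" and P1_hfactor: "hfactor LP L1 fst (\<lambda>_ l. l)"
  unfolding line_product_def
  by (rule hline_bundle_pullback[OF L1.hline_bundle BP_hmanifold BP_fst_smooth])+

lemma P2_hfactor: "hfactor LP L2 (\<lambda>(x1, x2, C). x2) (\<lambda>(x1, x2, C) l. C l)"
  unfolding hfactor_def LP_simps
proof (intro conjI BP_snd_smooth ballI)
  show "linear_iso (fibre L1 (fst z)) (fibre L2 ((\<lambda>(x1, x2, C). x2) z)) ((\<lambda>(x1, x2, C) l. C l) z)"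
    if "z \<in> points BP" for z
    using that by (auto simp: BP_points fibre_iso_def)
  fix c assume "c \<in> trivs LP"
  then obtain W1 \<tau>1 where W1: "(W1, \<tau>1) \<in> trivs L1" "c = (points BP \<inter> fst -` W1, \<lambda>z. \<tau>1 (fst z))"
    by (auto simp: line_product_def pullback_bundle_def)
  have u: "unit_vec LP (\<lambda>z. \<tau>1 (fst z)) z = unit_vec L1 \<tau>1 (fst z)" for z by (simp add: unit_vec_def)
  have "smooth_in BP (points BP \<inter> fst -` W1 \<inter> (\<lambda>(x1, x2, C). x2) -` W2)
      (\<lambda>z. \<tau>2 ((\<lambda>(x1, x2, C). x2) z) ((\<lambda>(x1, x2, C) l. C l) z (unit_vec LP (\<lambda>z. \<tau>1 (fst z)) z)))"
    if W2: "(W2, \<tau>2) \<in> trivs L2" for W2 \<tau>2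
  proof (rule smooth_in_local[OF BP_charted])
    fix z assume z: "z \<in> points BP \<inter> fst -` W1 \<inter> (\<lambda>(x1, x2, C). x2) -` W2"
    then obtain x1 x2 C where zz: "z = (x1, x2, C)" "x1 \<in> points (base L1)" "x2 \<in> points (base L2)" "fibre_iso x1 x2 C"
      "x1 \<in> W1" "x2 \<in> W2" by (auto simp: BP_points)
    obtain U1 \<phi>1 where U1: "(U1, \<phi>1) \<in> base L1" "x1 \<in> U1" using pointsE[OF zz(2)] .
    obtain U2 \<phi>2 where U2: "(U2, \<phi>2) \<in> base L2" "x2 \<in> U2" using pointsE[OF zz(3)] .
    have c: "(pdom U1 W1 U2 W2, pchart \<phi>1 \<tau>1 \<phi>2 \<tau>2) \<in> BP" using U1 U2 W1 W2 unfolding BP_chart_iff by blast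
    let ?D = "pdom U1 W1 U2 W2" and ?\<Phi> = "pchart \<phi>1 \<tau>1 \<phi>2 \<tau>2"
    note o = aopen_chart[OF BP_charted c]
    have "smooth_in BP ?D (\<lambda>z. snd (snd (?\<Phi> z)))"
      by (intro smooth_in_bounded_linear[OF BP_charted o bounded_linear_snd] smooth_in_chart[OF BP_charted c])
    moreover have "(\<lambda>z. snd (snd (?\<Phi> z))) =
        (\<lambda>z. \<tau>2 ((\<lambda>(x1, x2, C). x2) z) ((\<lambda>(x1, x2, C) l. C l) z (unit_vec LP (\<lambda>z. \<tau>1 (fst z)) z)))"
      unfolding u by (auto simp: pchart_def)
    moreover have "z \<in> ?D" using zz U1 U2 by (simp add: pdom_def)
    ultimately show "\<exists>T. aopen BP T \<and> z \<in> T \<and> smooth_in BP T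
      (\<lambda>z. \<tau>2 ((\<lambda>(x1, x2, C). x2) z) ((\<lambda>(x1, x2, C) l. C l) z (unit_vec LP (\<lambda>z. \<tau>1 (fst z)) z)))"
      using o by auto
  qed
  then show "case c of (W1, \<tau>1) \<Rightarrow> \<forall>(W2, \<tau>2)\<in>trivs L2. smooth_in BP (W1 \<inter> (\<lambda>(x1, x2, C). x2) -` W2)
      (\<lambda>z. \<tau>2 ((\<lambda>(x1, x2, C). x2) z) ((\<lambda>(x1, x2, C) l. C l) z (unit_vec LP \<tau>1 z)))"
    by (auto simp: W1)
qed

sublocale P1: bundle_factor LP L1 fst "\<lambda>_ l. l"
  by (intro bundle_factor.intro hbundle.intro bundle_factor_axioms.intro LP_hline_bundle L1.hline_bundle P1_hfactor)

sublocale P2: bundle_factor LP L2 "\<lambda>(x1, x2, C). x2" "\<lambda>(x1, x2, C) l. C l"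
  by (intro bundle_factor.intro hbundle.intro bundle_factor_axioms.intro LP_hline_bundle L2.hline_bundle P2_hfactor)

lemma P1_pullback_eq: "P1_pullback L1 L2 = P1.pull"
proof -
  have "(\<lambda>(x1, x2, C). x1) = (fst :: 'm1 \<times> 'm2 \<times> ('v1 \<Rightarrow> 'v2) \<Rightarrow> 'm1)" by auto
  then show ?thesis by (simp add: P1_pullback_def)
qed

lemma P2_pullback_eq: "P2_pullback L1 L2 = P2.pull"
  by (simp add: P2_pullback_def)

context
  fixes U1 \<phi>1 W1 \<tau>1 U2 \<phi>2 W2 \<tau>2 x1 x2 C
  assumes U1: "(U1, \<phi>1) \<in> base L1" "x1 \<in> U1" and W1: "(W1, \<tau>1) \<in> trivs L1" "x1 \<in> W1"
    and U2: "(U2, \<phi>2) \<in> base L2" "x2 \<in> U2" and W2: "(W2, \<tau>2) \<in> trivs L2" "x2 \<in> W2"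
    and C: "fibre_iso x1 x2 C"
begin

lemma pair_chart: "(pdom U1 W1 U2 W2, pchart \<phi>1 \<tau>1 \<phi>2 \<tau>2) \<in> base LP" "(x1, x2, C) \<in> pdom U1 W1 U2 W2"
  using U1 U2 W1 W2 C unfolding LP_simps BP_chart_iff by (blast, simp add: pdom_def)

lemma pair_point: "(x1, x2, C) \<in> points (base LP)"
  using pair_chart chart_subset_points by blast

lemma pair_triv: "(points BP \<inter> fst -` W1, \<lambda>z. \<tau>1 (fst z)) \<in> trivs LP" "(x1, x2, C) \<in> points BP \<inter> fst -` W1"
  using LP_triv[OF W1(1)] pair_point W1(2) by auto

abbreviation (input) "prep s \<equiv> (\<lambda>z. \<tau>1 (fst z) (s z)) \<circ> inv_into (pdom U1 W1 U2 W2) (pchart \<phi>1 \<tau>1 \<phi>2 \<tau>2)"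

lemma P1_rep_derivative:
  assumes s: "s \<in> sections L1"
  shows "frechet_derivative (prep (P1.pull s)) (at (pchart \<phi>1 \<tau>1 \<phi>2 \<tau>2 (x1, x2, C))) =
    (\<lambda>v. section_deriv U1 \<phi>1 \<tau>1 s x1 (fst v))"
proof (rule P1.L1.section_rep_eqI[OF pair_chart pair_triv aopen_points pair_point])
  have "(fst has_derivative fst) (at (pchart \<phi>1 \<tau>1 \<phi>2 \<tau>2 (x1, x2, C)))"
    by (rule bounded_linear_imp_has_derivative[OF bounded_linear_fst])
  then show "((\<lambda>z. ((\<lambda>y. \<tau>1 y (s y)) \<circ> inv_into U1 \<phi>1) (fst z)) has_derivative
      (\<lambda>v. section_deriv U1 \<phi>1 \<tau>1 s x1 (fst v))) (at (pchart \<phi>1 \<tau>1 \<phi>2 \<tau>2 (x1, x2, C)))"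
    by (rule has_derivative_compose) (use L1.section_rep_has_derivative[OF U1 W1 s] in \<open>simp add: pchart_def o_def\<close>)
  fix z assume z: "z \<in> points (base LP)" "z \<in> pdom U1 W1 U2 W2"
  then obtain y1 y2 D where zz: "z = (y1, y2, D)" "y1 \<in> U1" "y1 \<in> W1" by (auto simp: pdom_def)
  have "P1.pull s z = s y1" using P1.B_pull[OF z(1) s] zz(1) by simp
  then show "\<tau>1 (fst z) (P1.pull s z) = ((\<lambda>y. \<tau>1 y (s y)) \<circ> inv_into U1 \<phi>1) (fst (pchart \<phi>1 \<tau>1 \<phi>2 \<tau>2 z))"
    using zz by (simp add: pchart_def inv_chart[OF L1.ch U1(1)])
qed

lemma P2_pull_triv:
  assumes s: "s \<in> sections L2" and z: "(y1, y2, D) \<in> pdom U1 W1 U2 W2"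
  shows "\<tau>1 y1 (P2.pull s (y1, y2, D)) = \<tau>2 y2 (s y2) / \<tau>2 y2 (D (unit_vec L1 \<tau>1 y1))"
proof -
  have zp: "(y1, y2, D) \<in> points (base LP)" using z pair_chart(1) chart_subset_points by blast
  have y: "y1 \<in> W1" "y2 \<in> W2" "fibre_iso y1 y2 D" using z by (auto simp: pdom_def)
  have "P2.pull s (y1, y2, D) \<in> fibre L1 y1" "D (P2.pull s (y1, y2, D)) = s y2"
    using P2.pull_fibre[OF zp s] P2.B_pull[OF zp s] by auto
  then show ?thesis
    using fibre_iso_triv[OF W1(1) y(1) W2(1) y(2,3)] fibre_iso_nonzero[OF W1(1) y(1) W2(1) y(2,3)]
    by (metis nonzero_mult_div_cancel_right)
qed

text \<open>\<open>P2\<close> pulls back along the inverse of \<open>C\<close>, so the coordinate of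
  a section is divided by the scale. The quotient rule yields a term in the direction of the scale,
  with the value of \<open>s\<close> as coefficient.\<close>

lemma P2_rep_derivative:
  assumes s: "s \<in> sections L2"
  defines "k \<equiv> \<tau>2 x2 (C (unit_vec L1 \<tau>1 x1))"
  shows "frechet_derivative (prep (P2.pull s)) (at (pchart \<phi>1 \<tau>1 \<phi>2 \<tau>2 (x1, x2, C))) =
    (\<lambda>v. section_deriv U2 \<phi>2 \<tau>2 s x2 (fst (snd v)) / k
      - \<tau>2 x2 (s x2) * snd (snd v) / (k * k))"
proof (rule P1.L1.section_rep_eqI[OF pair_chart pair_triv aopen_points pair_point])
  let ?z = "pchart \<phi>1 \<tau>1 \<phi>2 \<tau>2 (x1, x2, C)"
  have k: "k \<noteq> 0" unfolding k_def by (rule fibre_iso_nonzero[OF W1 W2 C])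
  have "((\<lambda>z. fst (snd z)) has_derivative (\<lambda>v. fst (snd v))) (at ?z)"
    by (auto intro!: derivative_eq_intros)
  then have 1: "((\<lambda>z. ((\<lambda>y. \<tau>2 y (s y)) \<circ> inv_into U2 \<phi>2) (fst (snd z))) has_derivative
      (\<lambda>v. section_deriv U2 \<phi>2 \<tau>2 s x2 (fst (snd v)))) (at ?z)"
    by (rule has_derivative_compose) (use L2.section_rep_has_derivative[OF U2 W2 s] in \<open>simp add: pchart_def o_def\<close>)
  have 2: "((\<lambda>z. snd (snd z)) has_derivative (\<lambda>v. snd (snd v))) (at ?z)"
    by (auto intro!: derivative_eq_intros)
  have kz: "snd (snd ?z) = k" by (simp add: pchart_def k_def)
  have rz: "((\<lambda>y. \<tau>2 y (s y)) \<circ> inv_into U2 \<phi>2) (fst (snd ?z)) = \<tau>2 x2 (s x2)"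
    by (simp add: pchart_def inv_chart[OF L2.ch U2])
  show "((\<lambda>z. ((\<lambda>y. \<tau>2 y (s y)) \<circ> inv_into U2 \<phi>2) (fst (snd z)) / snd (snd z)) has_derivative
    (\<lambda>v. section_deriv U2 \<phi>2 \<tau>2 s x2 (fst (snd v)) / k
      - \<tau>2 x2 (s x2) * snd (snd v) / (k * k))) (at ?z)"
    by (rule has_derivative_eq_rhs[OF has_derivative_divide'[OF 1 2]])
      (use k in \<open>auto simp: kz rz[unfolded o_def] o_def field_simps\<close>)
  fix z assume z: "z \<in> points (base LP)" "z \<in> pdom U1 W1 U2 W2"
  then obtain y1 y2 D where zz: "z = (y1, y2, D)" "y2 \<in> U2" by (auto simp: pdom_def)
  show "\<tau>1 (fst z) (P2.pull s z) = ((\<lambda>y. \<tau>2 y (s y)) \<circ> inv_into U2 \<phi>2) (fst (snd (pchart \<phi>1 \<tau>1 \<phi>2 \<tau>2 z))) / snd (snd (pchart \<phi>1 \<tau>1 \<phi>2 \<tau>2 z))"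
    using P2_pull_triv[OF s, of y1 y2 D] z zz by (simp add: pchart_def inv_chart[OF L2.ch U2(1)])
qed

text \<open>Sections with arbitrary value and differential are available on both factors. Pullbacks
  from \<open>L1\<close> detect the first base direction and the zero-order part \<open>c\<close>;
  pullbacks from \<open>L2\<close> detect the second base direction and, through their value, the
  direction of the scale.\<close>

lemma product_derivation_coords_zero:
  fixes v c
  defines "d \<equiv> P1.L1.coord_der (pdom U1 W1 U2 W2) (pchart \<phi>1 \<tau>1 \<phi>2 \<tau>2) (\<lambda>z. \<tau>1 (fst z)) (x1, x2, C) v c"
  shows "(\<And>s. s \<in> sections L1 \<Longrightarrow> d (P1.pull s) = 0) \<Longrightarrow> fst v = 0"
    "(\<And>s. s \<in> sections L1 \<Longrightarrow> d (P1.pull s) = 0) \<Longrightarrow> c = 0"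
    "c = 0 \<Longrightarrow> (\<And>s. s \<in> sections L2 \<Longrightarrow> d (P2.pull s) = 0) \<Longrightarrow> snd v = 0"
proof -
  note triv = P1.L1.coord_der_triv[OF pair_chart pair_triv] P1.L1.triv_zero[OF pair_triv]
  have P1s: "p \<bullet> fst v + c * u = 0" if "\<And>s. s \<in> sections L1 \<Longrightarrow> d (P1.pull s) = 0" for p u
  proof -
    obtain s where s: "s \<in> sections L1" "\<tau>1 x1 (s x1) = u"
      "\<And>v. section_deriv U1 \<phi>1 \<tau>1 s x1 v = p \<bullet> v"
      using L1.section_with_jet[OF U1 W1, of u p] by metis
    have "P1.pull s (x1, x2, C) = s x1" using P1.B_pull[OF pair_point s(1)] by simp
    then show ?thesis
      using triv(1)[OF P1.pull_section[OF s(1)], of v c] triv(2) that[OF s(1)] s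
      by (simp add: d_def P1_rep_derivative[OF s(1)])
  qed
  show "fst v = 0" if "\<And>s. s \<in> sections L1 \<Longrightarrow> d (P1.pull s) = 0" using P1s[OF that, of "fst v" 0] by simp
  show "c = 0" if "\<And>s. s \<in> sections L1 \<Longrightarrow> d (P1.pull s) = 0" using P1s[OF that, of 0 1] by simp
  define k where "k = \<tau>2 x2 (C (unit_vec L1 \<tau>1 x1))"
  have k: "k \<noteq> 0" unfolding k_def by (rule fibre_iso_nonzero[OF W1 W2 C])
  have P2s: "p \<bullet> fst (snd v) / k - u * snd (snd v) / (k * k) = 0"
    if c: "c = 0" and 0: "\<And>s. s \<in> sections L2 \<Longrightarrow> d (P2.pull s) = 0" for p u
  proof -
    obtain s where s: "s \<in> sections L2" "\<tau>2 x2 (s x2) = u"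
      "\<And>v. section_deriv U2 \<phi>2 \<tau>2 s x2 v = p \<bullet> v"
      using L2.section_with_jet[OF U2 W2, of u p] by metis
    show ?thesis
      using triv(1)[OF P2.pull_section[OF s(1)], of v c] triv(2) 0[OF s(1)] s c
      by (simp add: d_def P2_rep_derivative[OF s(1)] k_def)
  qed
  show "snd v = 0" if c: "c = 0" and 0: "\<And>s. s \<in> sections L2 \<Longrightarrow> d (P2.pull s) = 0"
  proof -
    have "snd (snd v) = 0" using P2s[OF c 0, of 0 1] k by simp
    moreover have "fst (snd v) = 0" using P2s[OF c 0, of "fst (snd v)" 0] k by simp
    ultimately show ?thesis by (simp add: prod_eq_iff)
  qed
qed

end

text \<open>The pullbacks from both factors generate all first jets on the line product. Identities
  between derivations are checked on them, and there the product bracket is given.\<close>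

lemma product_derivation_zero:
  assumes z: "z \<in> points (base LP)" and d: "d \<in> derivations_at LP z"
    and 0: "\<And>s. s \<in> sections L1 \<Longrightarrow> d (P1.pull s) = 0" "\<And>s. s \<in> sections L2 \<Longrightarrow> d (P2.pull s) = 0"
  shows "d = (\<lambda>_. 0)"
proof -
  obtain x1 x2 C where zz: "z = (x1, x2, C)" "x1 \<in> points (base L1)" "x2 \<in> points (base L2)" "fibre_iso x1 x2 C"
    using z by (auto simp: BP_points)
  obtain U1 \<phi>1 W1 \<tau>1 U2 \<phi>2 W2 \<tau>2 where c: "(U1, \<phi>1) \<in> base L1" "x1 \<in> U1" "(W1, \<tau>1) \<in> trivs L1" "x1 \<in> W1"
    "(U2, \<phi>2) \<in> base L2" "x2 \<in> U2" "(W2, \<tau>2) \<in> trivs L2" "x2 \<in> W2" "(pdom U1 W1 U2 W2, pchart \<phi>1 \<tau>1 \<phi>2 \<tau>2) \<in> BP"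
    using BP_chart_around[OF zz(2,3)] .
  note cc = c(1-8) zz(4)
  obtain v k where dd: "d = P1.L1.coord_der (pdom U1 W1 U2 W2) (pchart \<phi>1 \<tau>1 \<phi>2 \<tau>2) (\<lambda>z. \<tau>1 (fst z)) (x1, x2, C) v k"
    using P1.L1.derivation_coords[OF pair_chart[OF cc] pair_triv[OF cc]] d zz(1) by blast
  note zero = product_derivation_coords_zero[OF cc, where v = v and c = k, folded dd]
  have "fst v = 0" "k = 0" using zero(1,2) 0(1) by blast+
  moreover from this have "snd v = 0" using zero(3) 0(2) by blast
  ultimately have "v = 0" "k = 0" by (auto simp: prod_eq_iff)
  then show ?thesis
    unfolding dd P1.L1.coord_der_def
    using linear_0[OF P1.L1.section_rep_linear[OF pair_chart[OF cc] pair_triv[OF cc]]] by (auto simp: fun_eq_iff)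
qed

text \<open>The projections of \<open>a\<close> to the factors are Hamiltonian derivations of
  sections \<open>r1\<close> and \<open>r2\<close>. Since pullbacks from different factors commute,
  the sum of the pullbacks of \<open>r1\<close> and \<open>r2\<close> induces \<open>a\<close> on
  the pullbacks of either factor, hence everywhere.\<close>

lemma product_full_hamiltonian:
  assumes pj: "product_jacobi_structure L1 br1 L2 br2 br"
    and full1: "full_hamiltonian L1 br1" and full2: "full_hamiltonian L2 br2"
    and br1: "\<And>s r. s \<in> sections L1 \<Longrightarrow> r \<in> sections L1 \<Longrightarrow> br1 s r \<in> sections L1"
    and br2: "\<And>s r. s \<in> sections L2 \<Longrightarrow> r \<in> sections L2 \<Longrightarrow> br2 s r \<in> sections L2"
  shows "full_hamiltonian LP br"
  unfolding full_hamiltonian_def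
proof (intro ballI)
  fix z a assume z: "z \<in> points (base LP)" and a: "a \<in> derivations_at LP z"
  interpret J: jacobi_bundle LP br
    by (intro jacobi_bundle.intro hbundle.intro LP_hline_bundle jacobi_bundle_axioms.intro)
      (use pj in \<open>simp add: product_jacobi_structure_def\<close>)
  have pj1: "\<And>s s'. s \<in> sections L1 \<Longrightarrow> s' \<in> sections L1 \<Longrightarrow> br (P1.pull s) (P1.pull s') = P1.pull (br1 s s')"
    and pj2: "\<And>s s'. s \<in> sections L2 \<Longrightarrow> s' \<in> sections L2 \<Longrightarrow> br (P2.pull s) (P2.pull s') = P2.pull (br2 s s')"
    and pj3: "\<And>s s'. s \<in> sections L1 \<Longrightarrow> s' \<in> sections L2 \<Longrightarrow> br (P1.pull s) (P2.pull s') = (\<lambda>_. 0)"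
    using pj unfolding product_jacobi_structure_def P1_pullback_eq P2_pullback_eq by simp_all
  obtain x1 x2 C where zz: "z = (x1, x2, C)" "x1 \<in> points (base L1)" "x2 \<in> points (base L2)" "fibre_iso x1 x2 C"
    using z by (auto simp: BP_points)
  have "P1.dmap z a \<in> derivations_at L1 x1" using P1.dmap_derivation[OF z a] zz by simp
  then obtain r1 where r1: "r1 \<in> sections L1" "P1.dmap z a = ham_der L1 br1 r1 x1"
    using full1 zz(2) unfolding full_hamiltonian_def by blast
  have "P2.dmap z a \<in> derivations_at L2 x2" using P2.dmap_derivation[OF z a] zz by simp
  then obtain r2 where r2: "r2 \<in> sections L2" "P2.dmap z a = ham_der L2 br2 r2 x2"
    using full2 zz(3) unfolding full_hamiltonian_def by blast
  note S = P1.pull_section[OF r1(1)] P2.pull_section[OF r2(1)]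
  define r where "r = (\<lambda>y. P1.pull r1 y + P2.pull r2 y)"
  have r: "r \<in> sections LP" unfolding r_def by (rule P1.L1.sections_add[OF S])
  let ?d = "\<lambda>s. a s - ham_der LP br r z s"
  have "?d = (\<lambda>_. 0)"
  proof (rule product_derivation_zero[OF z])
    show "?d \<in> derivations_at LP z" by (rule P1.L1.derivations_at_diff[OF z a J.ham_der_derivation[OF z r]])
    show "?d (P1.pull s) = 0" if s: "s \<in> sections L1" for s
    proof -
      have "br r (P1.pull s) z = br1 r1 s x1"
        using J.br_add_left[OF S P1.pull_section[OF s]] J.br_antisym[OF S(2) P1.pull_section[OF s], of z]
          pj1[OF r1(1) s] pj3[OF s r2(1)] P1.B_pull[OF z br1[OF r1(1) s]] zz(1) by (simp add: r_def)
      moreover have "a (P1.pull s) = br1 r1 s x1"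
        using fun_cong[OF r1(2), of s] s by (simp add: der_map_def ham_der_def)
      ultimately show ?thesis using P1.pull_section[OF s] by (simp add: J.ham_der_at)
    qed
    show "?d (P2.pull s) = 0" if s: "s \<in> sections L2" for s
    proof -
      have "br r (P2.pull s) z = P2.pull (br2 r2 s) z"
        using J.br_add_left[OF S P2.pull_section[OF s]] pj2[OF r2(1) s] pj3[OF r1(1) s] by (simp add: r_def)
      moreover have "(\<lambda>(x1, x2, C) l. C l) z (a (P2.pull s)) = br2 r2 s x2"
        using fun_cong[OF r2(2), of s] s by (simp add: der_map_def ham_der_def)
      then have "a (P2.pull s) = P2.pull (br2 r2 s) z"
        using P2.B_inj[OF z P1.L1.derivationsD(1)[OF a P2.pull_section[OF s]] P2.pull_fibre[OF z br2[OF r2(1) s]]]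
          P2.B_pull[OF z br2[OF r2(1) s]] zz(1) by simp
      ultimately show ?thesis using P2.pull_section[OF s] by (simp add: J.ham_der_at)
    qed
  qed
  then have "a = ham_der LP br r z" by (simp add: fun_eq_iff)
  then show "\<exists>r\<in>sections LP. a = ham_der LP br r z" using r by blast
qed

end

section \<open>The jet bundle and its canonical Jacobi structure\<close>

context hbundle
begin

abbreviation "JM \<equiv> jet_manifold L"

definition jdom :: "'m set \<Rightarrow> 'm set \<Rightarrow> ('m \<times> ((('m \<Rightarrow> 'v) \<Rightarrow> 'v) \<Rightarrow> 'v)) set"
  where "jdom U W = {(x, \<alpha>). x \<in> U \<inter> W \<and> \<alpha> \<in> jets_at L x}"

definition momentum :: "'m set \<Rightarrow> ('m \<Rightarrow> 'e) \<Rightarrow> ('m \<Rightarrow> 'v \<Rightarrow> real) \<Rightarrow> 'm \<Rightarrow> ((('m \<Rightarrow> 'v) \<Rightarrow> 'v) \<Rightarrow> 'v) \<Rightarrow> 'e"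
  where "momentum U \<phi> \<tau> x \<alpha> = (THE p. \<forall>v. p \<bullet> v = \<tau> x (\<alpha> (partial_der L U \<phi> \<tau> x v)))"

definition jchart :: "'m set \<Rightarrow> ('m \<Rightarrow> 'e) \<Rightarrow> ('m \<Rightarrow> 'v \<Rightarrow> real) \<Rightarrow> 'm \<times> ((('m \<Rightarrow> 'v) \<Rightarrow> 'v) \<Rightarrow> 'v) \<Rightarrow> 'e \<times> 'e \<times> real"
  where "jchart U \<phi> \<tau> = (\<lambda>(x, \<alpha>). (\<phi> x, momentum U \<phi> \<tau> x \<alpha>, \<tau> x (\<alpha> (eval_der L x))))"

lemma JM_chart_iff: "c \<in> JM \<longleftrightarrow> (\<exists>U \<phi> W \<tau>. (U, \<phi>) \<in> base L \<and> (W, \<tau>) \<in> trivs L \<and> c = (jdom U W, jchart U \<phi> \<tau>))"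
  unfolding jet_manifold_def jdom_def jchart_def momentum_def by (simp, blast)

lemma JM_chartE:
  assumes "c \<in> JM" obtains U \<phi> W \<tau> where "(U, \<phi>) \<in> base L" "(W, \<tau>) \<in> trivs L" "c = (jdom U W, jchart U \<phi> \<tau>)"
  using assms unfolding JM_chart_iff by (elim exE conjE) (rule that)

context
  fixes U \<phi> W \<tau> x
  assumes U: "(U, \<phi>) \<in> base L" "x \<in> U" and W: "(W, \<tau>) \<in> trivs L" "x \<in> W"
begin

lemma jet_coord:
  "\<alpha> \<in> jets_at L x \<Longrightarrow> \<tau> x (\<alpha> (coord_der U \<phi> \<tau> x v c)) = momentum U \<phi> \<tau> x \<alpha> \<bullet> v + c * \<tau> x (\<alpha> (eval_der L x))"
  unfolding momentum_def by (rule jet_momentum(2)[OF U W])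

lemma jet_eqI:
  assumes \<alpha>: "\<alpha> \<in> jets_at L x" and \<beta>: "\<beta> \<in> jets_at L x" and p: "momentum U \<phi> \<tau> x \<alpha> = momentum U \<phi> \<tau> x \<beta>"
    and u: "\<tau> x (\<alpha> (eval_der L x)) = \<tau> x (\<beta> (eval_der L x))"
  shows "\<alpha> = \<beta>"
proof
  fix a show "\<alpha> a = \<beta> a"
  proof (cases "a \<in> derivations_at L x")
    case True
    then obtain v c where a: "a = coord_der U \<phi> \<tau> x v c" by (rule derivation_coords[OF U W])
    show ?thesis
      by (rule triv_inj[OF W jetsD(1)[OF U W \<alpha> True] jetsD(1)[OF U W \<beta> True]])
        (simp add: a jet_coord \<alpha> \<beta> p u)
  qed (simp add: jetsD(2)[OF U W \<alpha>] jetsD(2)[OF U W \<beta>])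
qed

lemma momentum_eqI:
  assumes \<alpha>: "\<alpha> \<in> jets_at L x" and "\<And>v. \<tau> x (\<alpha> (coord_der U \<phi> \<tau> x v 0)) = p \<bullet> v"
  shows "momentum U \<phi> \<tau> x \<alpha> = p"
  unfolding momentum_def using jet_momentum(1)[OF U W \<alpha>] assms(2)
  by (intro the1_equality) (simp_all add: partial_der_eq[OF U W])

lemma jet_of_section_coords:
  assumes s: "s \<in> sections L"
  shows "\<tau> x (jet L s x (eval_der L x)) = \<tau> x (s x)"
    "\<tau> x (jet L s x (coord_der U \<phi> \<tau> x v c)) = section_deriv U \<phi> \<tau> s x v + c * \<tau> x (s x)"
proof -
  show "\<tau> x (jet L s x (coord_der U \<phi> \<tau> x v c)) = section_deriv U \<phi> \<tau> s x v + c * \<tau> x (s x)" for v c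
    by (simp add: jet_def coord_der_derivation[OF U W] coord_der_triv[OF U W s])
  from this[of 0 1] show "\<tau> x (jet L s x (eval_der L x)) = \<tau> x (s x)"
    by (simp add: eval_der_eq[OF U W] linear_0[OF section_rep_linear[OF U W s]])
qed

lemma jet_with_coords:
  obtains \<alpha> where "\<alpha> \<in> jets_at L x" "momentum U \<phi> \<tau> x \<alpha> = p" "\<tau> x (\<alpha> (eval_der L x)) = u"
proof -
  obtain s where s: "s \<in> sections L" "\<tau> x (s x) = u"
    "\<And>v. section_deriv U \<phi> \<tau> s x v = p \<bullet> v"
    using section_with_jet[OF U W, of u p] by metis
  have x: "x \<in> points (base L)" using U chart_subset_points by blast
  note j = jet_in_jets[OF x s(1)]
  show thesis
    by (rule that[OF j momentum_eqI[OF j]]) (simp_all add: jet_of_section_coords[OF s(1)] s(2,3))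
qed

end

lemma jchart_image:
  assumes U: "(U, \<phi>) \<in> base L" and W: "(W, \<tau>) \<in> trivs L"
  shows "jchart U \<phi> \<tau> ` (jdom U W \<inter> fst -` S) = \<phi> ` (U \<inter> W \<inter> S) \<times> UNIV \<times> UNIV" (is "?l = ?r")
proof (intro equalityI subsetI)
  fix z assume "z \<in> ?l" then show "z \<in> ?r" by (auto simp: jdom_def jchart_def)
next
  fix z assume "z \<in> ?r"
  then obtain x p u where *: "x \<in> U" "x \<in> W" "x \<in> S" "z = (\<phi> x, p, u)" by auto
  obtain \<alpha> where \<alpha>: "\<alpha> \<in> jets_at L x" "momentum U \<phi> \<tau> x \<alpha> = p" "\<tau> x (\<alpha> (eval_der L x)) = u"
    using jet_with_coords[OF U *(1) W *(2)] .
  have "z = jchart U \<phi> \<tau> (x, \<alpha>)" using * \<alpha> by (simp add: jchart_def)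
  moreover have "(x, \<alpha>) \<in> jdom U W \<inter> fst -` S" using * \<alpha> by (simp add: jdom_def)
  ultimately show "z \<in> ?l" by (rule image_eqI)
qed

lemma jchart_inj:
  assumes U: "(U, \<phi>) \<in> base L" and W: "(W, \<tau>) \<in> trivs L"
  shows "inj_on (jchart U \<phi> \<tau>) (jdom U W)"
proof (rule inj_onI)
  fix z z' assume z: "z \<in> jdom U W" and z': "z' \<in> jdom U W" and eq: "jchart U \<phi> \<tau> z = jchart U \<phi> \<tau> z'"
  obtain x \<alpha> where zz: "z = (x, \<alpha>)" "x \<in> U" "x \<in> W" "\<alpha> \<in> jets_at L x" using z by (auto simp: jdom_def)
  obtain x' \<beta> where zz': "z' = (x', \<beta>)" "x' \<in> U" "\<beta> \<in> jets_at L x'" using z' by (auto simp: jdom_def)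
  have x: "x' = x" using eq zz zz' chartedD(1)[OF ch U] by (auto simp: jchart_def inj_on_def)
  have "\<alpha> = \<beta>"
    by (rule jet_eqI[OF U zz(2) W zz(3,4)]) (use eq zz zz' x in \<open>auto simp: jchart_def\<close>)
  then show "z = z'" using zz zz' x by simp
qed

text \<open>The chain rule for the charts transforms the direction; the product rule for the
  transition function \<open>g\<close> adds its logarithmic derivative as a zero-order term.\<close>

lemma coord_der_change:
  assumes U: "(U, \<phi>) \<in> base L" "x \<in> U" and W: "(W, \<tau>) \<in> trivs L" "x \<in> W"
    and U': "(U', \<phi>') \<in> base L" "x \<in> U'" and W': "(W', \<tau>') \<in> trivs L" "x \<in> W'"
  defines "T \<equiv> frechet_derivative (\<lambda>y. \<phi> (inv_into U' \<phi>' y)) (at (\<phi>' x))"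
    and "g \<equiv> \<lambda>y. \<tau>' y (unit_vec L \<tau> y)"
  defines "G \<equiv> frechet_derivative (\<lambda>y. g (inv_into U' \<phi>' y)) (at (\<phi>' x))"
  shows "coord_der U' \<phi>' \<tau>' x w 0 = coord_der U \<phi> \<tau> x (T w) (G w / g x)"
proof
  have g0: "g x \<noteq> 0"
  proof
    assume "g x = 0"
    then have "unit_vec L \<tau> x = 0"
      using triv_inj[OF W' unit_in[OF W] subspace_0[OF triv_subspace[OF W]]] triv_zero[OF W'] by (simp add: g_def)
    then show False using triv_unit[OF W] triv_zero[OF W] by simp
  qed
  have xin: "\<phi>' x \<in> \<phi>' ` (U' \<inter> (W \<inter> W'))" "\<phi>' x \<in> \<phi>' ` (U' \<inter> U)" using U U' W W' by auto
  have G: "((\<lambda>y. g (inv_into U' \<phi>' y)) has_derivative G) (at (\<phi>' x))"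
    unfolding G_def g_def by (rule smooth_on_has_derivative[OF smooth_inD[OF triv_transition[OF W(1) W'(1)] U'(1)] xin(1)])
  have T: "((\<lambda>y. \<phi> (inv_into U' \<phi>' y)) has_derivative T) (at (\<phi>' x))"
    unfolding T_def by (rule smooth_on_has_derivative[OF chartedD(4)[OF ch U'(1) U(1)] xin(2)])
  fix s show "coord_der U' \<phi>' \<tau>' x w 0 s = coord_der U \<phi> \<tau> x (T w) (G w / g x) s"
  proof (cases "s \<in> sections L")
    case s: True
    let ?r = "(\<lambda>y. \<tau> y (s y)) \<circ> inv_into U \<phi>"
    let ?R = "frechet_derivative ?r (at (\<phi> x))"
    have i': "inv_into U' \<phi>' (\<phi>' x) = x" by (rule inv_chart[OF ch U'])
    have "(?r has_derivative ?R) (at (\<phi> (inv_into U' \<phi>' (\<phi>' x))))"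
      using section_rep_has_derivative[OF U W s] by (simp only: i')
    from has_derivative_compose[OF T this]
    have R: "((\<lambda>y. ?r (\<phi> (inv_into U' \<phi>' y))) has_derivative (\<lambda>w. ?R (T w))) (at (\<phi>' x))" .
    have "section_deriv U' \<phi>' \<tau>' s x =
      (\<lambda>w. g (inv_into U' \<phi>' (\<phi>' x)) * ?R (T w) + G w * ?r (\<phi> (inv_into U' \<phi>' (\<phi>' x))))"
    proof (rule section_rep_eqI[OF U' W' _ _ has_derivative_mult[OF G R]])
      show "aopen (base L) (U \<inter> W \<inter> W')" "x \<in> U \<inter> W \<inter> W'"
        using openin_Int[OF coord_open[OF U W] triv_open[OF W'(1)]] U W W' by auto
      show "\<tau>' y (s y) = g (inv_into U' \<phi>' (\<phi>' y)) * ?r (\<phi> (inv_into U' \<phi>' (\<phi>' y)))"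
        if y: "y \<in> U \<inter> W \<inter> W'" "y \<in> U'" for y
      proof -
        have yW: "y \<in> W" "y \<in> W'" "y \<in> U" using y by auto
        have "\<tau>' y (s y) = \<tau> y (s y) * g y"
          using triv_expand[OF W(1) yW(1) sectionsD(4)[OF s W(1) yW(1)]]
            triv_scale[OF W'(1) yW(2) unit_in[OF W(1) yW(1)], of "\<tau> y (s y)"] unfolding g_def by metis
        then show ?thesis using y yW by (simp add: inv_chart[OF ch U'(1)] inv_chart[OF ch U(1)])
      qed
    qed
    then have "\<tau>' x (coord_der U' \<phi>' \<tau>' x w 0 s) = g x * ?R (T w) + G w * \<tau> x (s x)"
      by (simp add: coord_der_triv[OF U' W' s] i' inv_chart[OF ch U])
    moreover have "\<tau>' x (coord_der U \<phi> \<tau> x (T w) (G w / g x) s) = (?R (T w) + G w / g x * \<tau> x (s x)) * g x"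
      using s triv_scale[OF W' unit_in[OF W]] by (simp add: coord_der_def g_def)
    moreover have "(?R (T w) + G w / g x * \<tau> x (s x)) * g x = g x * ?R (T w) + G w * \<tau> x (s x)"
      using g0 by (simp add: field_simps)
    ultimately have "\<tau>' x (coord_der U' \<phi>' \<tau>' x w 0 s) = \<tau>' x (coord_der U \<phi> \<tau> x (T w) (G w / g x) s)"
      by simp
    then show ?thesis
      by (rule triv_inj[OF W' coord_der_fibre[OF U' W' s] coord_der_fibre[OF U W s]])
  qed (simp add: coord_der_def)
qed

text \<open>Dual to the change of frame in \<open>coord_der_change\<close>. The derivative of the
  transition function mixes the value coordinate into the momentum, so the jet bundle does not
  transform like a cotangent bundle.\<close>

lemma momentum_change:
  assumes U: "(U, \<phi>) \<in> base L" "x \<in> U" and W: "(W, \<tau>) \<in> trivs L" "x \<in> W"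
    and U': "(U', \<phi>') \<in> base L" "x \<in> U'" and W': "(W', \<tau>') \<in> trivs L" "x \<in> W'" and \<alpha>: "\<alpha> \<in> jets_at L x"
  shows "momentum U' \<phi>' \<tau>' x \<alpha> \<bullet> w =
      \<tau>' x (unit_vec L \<tau> x) * (momentum U \<phi> \<tau> x \<alpha> \<bullet> frechet_derivative (\<lambda>y. \<phi> (inv_into U' \<phi>' y)) (at (\<phi>' x)) w) +
      frechet_derivative (\<lambda>y. \<tau>' (inv_into U' \<phi>' y) (unit_vec L \<tau> (inv_into U' \<phi>' y))) (at (\<phi>' x)) w * \<tau> x (\<alpha> (eval_der L x))"
    "\<tau>' x (\<alpha> (eval_der L x)) = \<tau>' x (unit_vec L \<tau> x) * \<tau> x (\<alpha> (eval_der L x))"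
proof -
  let ?g = "\<tau>' x (unit_vec L \<tau> x)"
  have change: "\<tau>' x v = ?g * \<tau> x v" if "v \<in> fibre L x" for v
    using triv_expand[OF W that] triv_scale[OF W' unit_in[OF W], of "\<tau> x v"] by (simp add: mult.commute)
  have g0: "?g \<noteq> 0" using change[OF unit_in[OF W']] triv_unit[OF W'] by auto
  have in_fib: "\<alpha> (coord_der U \<phi> \<tau> x v c) \<in> fibre L x" for v c
    by (rule jetsD(1)[OF U W \<alpha> coord_der_derivation[OF U W]])
  have "momentum U' \<phi>' \<tau>' x \<alpha> \<bullet> w = \<tau>' x (\<alpha> (coord_der U' \<phi>' \<tau>' x w 0))"
    by (simp add: jet_coord[OF U' W' \<alpha>])
  also have "\<dots> = ?g * \<tau> x (\<alpha> (coord_der U' \<phi>' \<tau>' x w 0))"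
    unfolding coord_der_change[OF U W U' W'] by (rule change[OF in_fib])
  also have "\<dots> = ?g * (momentum U \<phi> \<tau> x \<alpha> \<bullet> frechet_derivative (\<lambda>y. \<phi> (inv_into U' \<phi>' y)) (at (\<phi>' x)) w) +
      frechet_derivative (\<lambda>y. \<tau>' (inv_into U' \<phi>' y) (unit_vec L \<tau> (inv_into U' \<phi>' y))) (at (\<phi>' x)) w * \<tau> x (\<alpha> (eval_der L x))"
    unfolding coord_der_change[OF U W U' W'] jet_coord[OF U W \<alpha>] using g0 by (simp add: field_simps)
  finally show "momentum U' \<phi>' \<tau>' x \<alpha> \<bullet> w = \<dots>" .
  show "\<tau>' x (\<alpha> (eval_der L x)) = ?g * \<tau> x (\<alpha> (eval_der L x))"
    unfolding eval_der_eq[OF U W] by (rule change[OF in_fib])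
qed


lemma JM_points: "points JM = {(x, \<alpha>). x \<in> points (base L) \<and> \<alpha> \<in> jets_at L x}"
proof (intro equalityI subsetI)
  fix z assume "z \<in> points JM"
  then obtain V \<Phi> where V: "(V, \<Phi>) \<in> JM" "z \<in> V" by (rule pointsE)
  obtain U \<phi> W \<tau> where c: "(U, \<phi>) \<in> base L" "(W, \<tau>) \<in> trivs L" "(V, \<Phi>) = (jdom U W, jchart U \<phi> \<tau>)"
    using JM_chartE[OF V(1)] .
  show "z \<in> {(x, \<alpha>). x \<in> points (base L) \<and> \<alpha> \<in> jets_at L x}"
    using V(2) c(3) chart_subset_points[OF c(1)] by (auto simp: jdom_def)
next
  fix z assume "z \<in> {(x, \<alpha>). x \<in> points (base L) \<and> \<alpha> \<in> jets_at L x}"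
  then obtain x \<alpha> where z: "z = (x, \<alpha>)" "x \<in> points (base L)" "\<alpha> \<in> jets_at L x" by auto
  obtain U \<phi> where U: "(U, \<phi>) \<in> base L" "x \<in> U" using pointsE[OF z(2)] .
  obtain W \<tau> where W: "(W, \<tau>) \<in> trivs L" "x \<in> W" using trivE[OF z(2)] .
  have "(jdom U W, jchart U \<phi> \<tau>) \<in> JM" using U W unfolding JM_chart_iff by blast
  moreover have "z \<in> jdom U W" using z U W by (simp add: jdom_def)
  ultimately show "z \<in> points JM" using chart_subset_points by blast
qed

lemma JM_charted: "charted JM"
  unfolding charted_def
proof (intro conjI ballI)
  fix c assume "c \<in> JM"
  then obtain U \<phi> W \<tau> where c: "(U, \<phi>) \<in> base L" "(W, \<tau>) \<in> trivs L" "c = (jdom U W, jchart U \<phi> \<tau>)"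
    by (rule JM_chartE)
  let ?D = "jdom U W" and ?\<Phi> = "jchart U \<phi> \<tau>"
  have op: "open (\<phi> ` (U \<inter> W \<inter> S) \<times> (UNIV :: ('e \<times> real) set))" "open (\<phi> ` (U \<inter> W \<inter> S))" if "aopen (base L) S" for S
    using aopen_image[OF ch c(1) openin_Int[OF triv_open[OF c(2)] that]]
    by (auto simp: Int_assoc intro!: open_Times)
  note inj = jchart_inj[OF c(1,2)]
  have "open (?\<Phi> ` ?D)"
  proof -
    have "?D = ?D \<inter> fst -` points (base L)" using chart_subset_points[OF c(1)] by (auto simp: jdom_def)
    then show ?thesis using jchart_image[OF c(1,2), of "points (base L)"] op(1)[OF aopen_points] by simp
  qed
  then show "case c of (U, \<phi>) \<Rightarrow> inj_on \<phi> U \<and> open (\<phi> ` U)" using inj by (simp add: c(3))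
  show "case c of (U, \<phi>) \<Rightarrow> \<forall>(V, \<psi>)\<in>JM. open (\<phi> ` (U \<inter> V)) \<and> smooth_on (\<phi> ` (U \<inter> V)) (\<psi> \<circ> inv_into U \<phi>)"
    unfolding c(3) prod.case
  proof (intro ballI)
    fix d assume "d \<in> JM"
    then obtain U' \<phi>' W' \<tau>' where d: "(U', \<phi>') \<in> base L" "(W', \<tau>') \<in> trivs L" "d = (jdom U' W', jchart U' \<phi>' \<tau>')"
      by (rule JM_chartE)
    let ?D' = "jdom U' W'" and ?\<Phi>' = "jchart U' \<phi>' \<tau>'" and ?i = "inv_into U \<phi>"
    have S: "aopen (base L) (U' \<inter> W')" by (intro openin_Int aopen_chart[OF ch d(1)] triv_open[OF d(2)])
    have S': "aopen (base L) (U \<inter> W)" by (intro openin_Int aopen_chart[OF ch c(1)] triv_open[OF c(2)])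
    let ?A = "\<phi> ` (U \<inter> W \<inter> (U' \<inter> W'))" and ?A' = "\<phi>' ` (U' \<inter> W' \<inter> (U \<inter> W))"
    have oA: "open ?A" and oI: "open (?A \<times> (UNIV :: ('e \<times> real) set))" using op[OF S] by auto
    have oA': "open ?A'" using aopen_image[OF ch d(1) openin_Int[OF triv_open[OF d(2)] S']] by (simp add: Int_assoc)
    have im: "?\<Phi> ` (?D \<inter> ?D') = ?A \<times> UNIV"
    proof -
      have "?D \<inter> ?D' = ?D \<inter> fst -` (U' \<inter> W')" by (auto simp: jdom_def)
      then show ?thesis using jchart_image[OF c(1,2), of "U' \<inter> W'"] by simp
    qed
    let ?\<theta> = "\<lambda>y. \<phi>' (?i y)" and ?g = "\<lambda>x. \<tau>' x (unit_vec L \<tau> x)"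
    have th: "smooth_on ?A ?\<theta>" by (rule smooth_on_subset[OF chartedD(4)[OF ch c(1) d(1)]]) auto
    have thA: "?\<theta> ` ?A \<subseteq> ?A'" by (auto simp: inv_chart[OF ch c(1)])
    have g: "smooth_on ?A (\<lambda>y. ?g (?i y))"
      by (rule smooth_on_subset[OF smooth_inD[OF triv_transition[OF c(2) d(2)] c(1)]]) auto
    have T: "smooth_on ?A (\<lambda>y. frechet_derivative (\<lambda>y. \<phi> (inv_into U' \<phi>' y)) (at (?\<theta> y)) w)" for w
      by (rule smooth_on_compose[OF oA oA' thA th smooth_on_subset[OF smooth_on_frechet_derivative[OF chartedD(4)[OF ch d(1) c(1)]]]]) auto
    have G: "smooth_on ?A (\<lambda>y. frechet_derivative (\<lambda>y. ?g (inv_into U' \<phi>' y)) (at (?\<theta> y)) w)" for w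
      by (rule smooth_on_compose[OF oA oA' thA th smooth_on_subset[OF smooth_on_frechet_derivative[OF
            smooth_inD[OF triv_transition[OF c(2) d(2)] d(1)]]]]) auto
    note cf = smooth_on_fst_compose[OF oA open_UNIV, where 'b = "'e \<times> real"]
    let ?I = "?A \<times> (UNIV :: ('e \<times> real) set)"
    define F where "F = (\<lambda>z. ?\<Phi>' (inv_into ?D ?\<Phi> z))"
    have Fz: "fst (F z) = ?\<theta> (fst z)"
      "fst (snd (F z)) \<bullet> w = ?g (?i (fst z)) * (fst (snd z) \<bullet> frechet_derivative (\<lambda>y. \<phi> (inv_into U' \<phi>' y)) (at (?\<theta> (fst z))) w)
        + frechet_derivative (\<lambda>y. ?g (inv_into U' \<phi>' y)) (at (?\<theta> (fst z))) w * snd (snd z)"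
      "snd (snd (F z)) = ?g (?i (fst z)) * snd (snd z)" if "z \<in> ?I" for z w
    proof -
      obtain y where y: "y \<in> ?D \<inter> ?D'" "z = ?\<Phi> y" using \<open>z \<in> ?I\<close> unfolding im[symmetric] by blast
      obtain x \<alpha> where x: "y = (x, \<alpha>)" "x \<in> U" "x \<in> W" "x \<in> U'" "x \<in> W'" "\<alpha> \<in> jets_at L x"
        using y(1) by (auto simp: jdom_def)
      have "F z = ?\<Phi>' y" using inv_into_f_f[OF inj] y by (auto simp: F_def)
      then have F: "F z = (\<phi>' x, momentum U' \<phi>' \<tau>' x \<alpha>, \<tau>' x (\<alpha> (eval_der L x)))" by (simp add: x(1) jchart_def)
      have zz: "z = (\<phi> x, momentum U \<phi> \<tau> x \<alpha>, \<tau> x (\<alpha> (eval_der L x)))" using y(2) by (simp add: x(1) jchart_def)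
      note i = inv_chart[OF ch c(1) x(2)]
      note m = momentum_change[OF c(1) x(2) c(2) x(3) d(1) x(4) d(2) x(5,6)]
      show "fst (F z) = ?\<theta> (fst z)" unfolding F unfolding zz fst_conv i ..
      show "fst (snd (F z)) \<bullet> w = ?g (?i (fst z)) * (fst (snd z) \<bullet> frechet_derivative (\<lambda>y. \<phi> (inv_into U' \<phi>' y)) (at (?\<theta> (fst z))) w)
        + frechet_derivative (\<lambda>y. ?g (inv_into U' \<phi>' y)) (at (?\<theta> (fst z))) w * snd (snd z)"
        unfolding F unfolding zz fst_conv snd_conv i by (rule m(1))
      show "snd (snd (F z)) = ?g (?i (fst z)) * snd (snd z)" unfolding F unfolding zz fst_conv snd_conv i by (rule m(2))
    qed
    have s1: "smooth_on ?I (\<lambda>z. fst (F z))"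
      by (rule smooth_on_cong[OF oI cf[OF th]]) (simp only: Fz(1))
    have zz: "smooth_on ?I (\<lambda>z. fst (snd z))" "smooth_on ?I (\<lambda>z. snd (snd z))"
      by (rule smooth_on_fst[OF oI smooth_on_snd[OF oI smooth_on_ident]]) (rule smooth_on_snd[OF oI smooth_on_snd[OF oI smooth_on_ident]])
    \<comment> \<open>The momentum is known through its inner products with fixed vectors, and these
      determine its smoothness.\<close>
    have s2: "smooth_on ?I (\<lambda>z. fst (snd (F z)))"
    proof (rule smooth_on_innerI[OF oI])
      fix w
      show "smooth_on ?I (\<lambda>z. fst (snd (F z)) \<bullet> w)"
        by (rule smooth_on_cong[OF oI smooth_on_add[OF oI smooth_on_mult[OF oI cf[OF g] smooth_on_inner[OF oI zz(1) cf[OF T[of w]]]]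
                smooth_on_mult[OF oI cf[OF G[of w]] zz(2)]]]) (simp only: Fz(2))
    qed
    have s3: "smooth_on ?I (\<lambda>z. snd (snd (F z)))"
      by (rule smooth_on_cong[OF oI smooth_on_mult[OF oI cf[OF g] zz(2)]]) (simp only: Fz(3))
    have "smooth_on ?I F" using smooth_on_Pair[OF oI s1 smooth_on_Pair[OF oI s2 s3]] by simp
    then show "case d of (V, \<psi>) \<Rightarrow> open (?\<Phi> ` (?D \<inter> V)) \<and> smooth_on (?\<Phi> ` (?D \<inter> V)) (\<psi> \<circ> inv_into ?D ?\<Phi>)"
      using oI im by (simp add: d(3) o_def F_def)
  qed
qed

lemma JM_fst_smooth: "smooth_map JM (base L) fst"
proof (rule smooth_mapI[OF JM_charted ch])
  fix z assume "z \<in> points JM"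
  then obtain x \<alpha> where z: "z = (x, \<alpha>)" "x \<in> points (base L)" "\<alpha> \<in> jets_at L x" by (auto simp: JM_points)
  obtain U \<phi> where U: "(U, \<phi>) \<in> base L" "x \<in> U" using pointsE[OF z(2)] .
  obtain W \<tau> where W: "(W, \<tau>) \<in> trivs L" "x \<in> W" using trivE[OF z(2)] .
  have c: "(jdom U W, jchart U \<phi> \<tau>) \<in> JM" using U W unfolding JM_chart_iff by blast
  have "smooth_in JM (jdom U W) (\<lambda>z. fst (jchart U \<phi> \<tau> z))"
    by (rule smooth_in_bounded_linear[OF JM_charted aopen_chart[OF JM_charted c] bounded_linear_fst smooth_in_chart[OF JM_charted c]])
  moreover have "(\<lambda>z. fst (jchart U \<phi> \<tau> z)) = (\<lambda>z. \<phi> (fst z))" by (auto simp: jchart_def)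
  moreover have "z \<in> jdom U W" "fst ` jdom U W \<subseteq> U" using z U W by (auto simp: jdom_def)
  ultimately show "\<exists>V \<psi> T. (V, \<psi>) \<in> base L \<and> aopen JM T \<and> z \<in> T \<and> fst ` T \<subseteq> V \<and> smooth_in JM T (\<lambda>x. \<psi> (fst x))"
    using U(1) aopen_chart[OF JM_charted c] by auto
qed

lemma JM_hmanifold: "hmanifold JM"
  unfolding hmanifold_def
proof (intro conjI JM_charted)
  show "Hausdorff_space (atlas_topology JM)"
  proof (rule Hausdorff_fibred[OF JM_charted smooth_map_continuous[OF JM_fst_smooth JM_charted ch]])
    show "Hausdorff_space (atlas_topology (base L))" using hmfd by (simp add: hmanifold_def)
    fix z z' assume z: "z \<in> points JM" and z': "z' \<in> points JM" and eq: "fst z = fst z'"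
    obtain x \<alpha> where x: "z = (x, \<alpha>)" "x \<in> points (base L)" "\<alpha> \<in> jets_at L x" using z by (auto simp: JM_points)
    obtain \<beta> where x': "z' = (x, \<beta>)" "\<beta> \<in> jets_at L x" using z' eq x(1) by (auto simp: JM_points)
    obtain U \<phi> where U: "(U, \<phi>) \<in> base L" "x \<in> U" using pointsE[OF x(2)] .
    obtain W \<tau> where W: "(W, \<tau>) \<in> trivs L" "x \<in> W" using trivE[OF x(2)] .
    have "(jdom U W, jchart U \<phi> \<tau>) \<in> JM" using U W unfolding JM_chart_iff by blast
    moreover have "z \<in> jdom U W \<and> z' \<in> jdom U W" using x x' U W by (simp add: jdom_def)
    ultimately show "\<exists>(U, \<phi>)\<in>JM. z \<in> U \<and> z' \<in> U" by blast
  qed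
qed

lemma jet_line_bundle_hline_bundle: "hline_bundle (jet_line_bundle L)"
  and jet_line_bundle_hfactor: "hfactor (jet_line_bundle L) L fst (\<lambda>_ l. l)"
  unfolding jet_line_bundle_def
  by (rule hline_bundle_pullback[OF hline_bundle JM_hmanifold JM_fst_smooth])+

end

section \<open>The line bundle over the jet manifold, its base sections and its linear
  sections\<close>

locale jet_bundle = hbundle L for L :: "('m, 'e::finite_dim_inner, 'v::real_vector) line_bundle"
begin

abbreviation "JL \<equiv> jet_line_bundle L"

lemma JL_simps [simp]: "base JL = JM" "fibre JL z = fibre L (fst z)"
  by (simp_all add: jet_line_bundle_def pullback_bundle_def)

lemma JL_trivs: "c \<in> trivs JL \<longleftrightarrow> (\<exists>W \<tau>. (W, \<tau>) \<in> trivs L \<and> c = (points JM \<inter> fst -` W, \<lambda>z. \<tau> (fst z)))"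
  by (auto simp: jet_line_bundle_def pullback_bundle_def)

sublocale pi: bundle_factor JL L fst "\<lambda>_ l. l"
  by (intro bundle_factor.intro hbundle.intro bundle_factor_axioms.intro jet_line_bundle_hline_bundle
      hline_bundle jet_line_bundle_hfactor)

lemma base_section_eq: "base_section L = pi.pull"
  by (simp add: base_section_def)

lemma base_section_at: "(q, \<alpha>) \<in> points JM \<Longrightarrow> s \<in> sections L \<Longrightarrow> pi.pull s (q, \<alpha>) = s q"
  using pi.B_pull[of "(q, \<alpha>)" s] by simp

lemma linear_section_at: "(q, \<alpha>) \<in> points JM \<Longrightarrow> linear_section L a (q, \<alpha>) = \<alpha> (\<lambda>s. a s q)"
  by (simp add: linear_section_def)

lemma jet_pointD:
  assumes "(q, \<alpha>) \<in> points JM" shows "q \<in> points (base L)" "\<alpha> \<in> jets_at L q"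
  using assms by (auto simp: JM_points)

lemma jet_add: "(q, \<alpha>) \<in> points JM \<Longrightarrow> a \<in> derivations_at L q \<Longrightarrow> a' \<in> derivations_at L q \<Longrightarrow>
    \<alpha> (\<lambda>s. a s + k *\<^sub>R a' s) = \<alpha> a + k *\<^sub>R \<alpha> a'"
proof -
  assume z: "(q, \<alpha>) \<in> points JM" and a: "a \<in> derivations_at L q" and a': "a' \<in> derivations_at L q"
  note q = jet_pointD[OF z]
  have "(\<lambda>s. k *\<^sub>R a' s) \<in> derivations_at L q"
    using derivations_at_add[OF q(1) a' a', of "k - 1"] by (simp add: algebra_simps)
  then show ?thesis using q(2) a a' unfolding jets_at_def Hom_def by simp
qed

lemma jet_zero: "(q, \<alpha>) \<in> points JM \<Longrightarrow> \<alpha> (\<lambda>_. 0) = 0"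
  using jet_add[OF _ zero_derivation zero_derivation, of q \<alpha> "-1"] jet_pointD(1) by simp

lemma linear_section_add:
  assumes "a \<in> derivations L" "a' \<in> derivations L"
  shows "linear_section L (\<lambda>s x. a s x + k *\<^sub>R a' s x) = (\<lambda>z. linear_section L a z + k *\<^sub>R linear_section L a' z)"
proof
  fix z :: "'m \<times> ((('m \<Rightarrow> 'v) \<Rightarrow> 'v) \<Rightarrow> 'v)"
  obtain q \<alpha> where z: "z = (q, \<alpha>)" by (cases z)
  show "linear_section L (\<lambda>s x. a s x + k *\<^sub>R a' s x) z = linear_section L a z + k *\<^sub>R linear_section L a' z"
  proof (cases "z \<in> points JM")
    case True
    then show ?thesis
      unfolding z using jet_add[OF _ derivations_fieldD(3)[OF assms(1)] derivations_fieldD(3)[OF assms(2)]] jet_pointD(1)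
      by (simp add: linear_section_at)
  qed (simp add: z linear_section_def)
qed

context
  fixes U \<phi> W \<tau> q
  assumes U: "(U, \<phi>) \<in> base L" "q \<in> U" and W: "(W, \<tau>) \<in> trivs L" "q \<in> W"
begin

lemma jchart_mem: "(jdom U W, jchart U \<phi> \<tau>) \<in> base JL"
  using U W unfolding JL_simps JM_chart_iff by blast

lemma jtriv_mem: "(points JM \<inter> fst -` W, \<lambda>z. \<tau> (fst z)) \<in> trivs JL"
  using W unfolding JL_trivs by blast

lemma jdom_points: "jdom U W \<subseteq> points JM"
  using chart_subset_points[OF jchart_mem] by simp

lemma ident_linear_triv:
  assumes "(y, \<alpha>) \<in> jdom U W"
  shows "\<tau> y (linear_section L ident_field (y, \<alpha>)) = snd (snd (jchart U \<phi> \<tau> (y, \<alpha>)))"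
  using assms jdom_points by (auto simp: linear_section_at ident_field_at jchart_def)

end

context
  fixes U \<phi> W \<tau> q \<rho>
  assumes U: "(U, \<phi>) \<in> base L" "q \<in> U" and W: "(W, \<tau>) \<in> trivs L" "q \<in> W"
    and b: "bump (base L) q (U \<inter> W) \<rho>"
begin

lemma frame_linear_triv:
  assumes "(y, \<alpha>) \<in> jdom U W"
  shows "\<tau> y (linear_section L (frame_field U \<phi> W \<tau> \<rho> w) (y, \<alpha>)) = \<rho> y * (momentum U \<phi> \<tau> y \<alpha> \<bullet> w)"
proof -
  have y: "y \<in> U" "y \<in> W" "\<alpha> \<in> jets_at L y" using assms by (auto simp: jdom_def)
  have "(\<lambda>s. frame_field U \<phi> W \<tau> \<rho> w s y) = coord_der U \<phi> \<tau> y (\<rho> y *\<^sub>R w) 0"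
    using y by (simp add: frame_field_def)
  then show ?thesis
    using assms jdom_points[OF U W] by (auto simp: linear_section_at jet_coord[OF U(1) y(1) W(1) y(2,3)])
qed

lemma frame_linear_zero:
  assumes "\<rho> y = 0" shows "linear_section L (frame_field U \<phi> W \<tau> \<rho> w) (y, \<alpha>) = 0"
proof (cases "(y, \<alpha>) \<in> points JM")
  case True
  have "(\<lambda>s. frame_field U \<phi> W \<tau> \<rho> w s y) = (\<lambda>_. 0)"
    using assms linear_0[OF section_rep_linear[OF U(1) _ W(1)]] by (auto simp: frame_field_def coord_der_def fun_eq_iff)
  then show ?thesis using True jet_zero[OF True] by (simp add: linear_section_at)
qed (simp add: linear_section_def)

text \<open>Over the chart the coordinate of this section is \<rho> times the momentum component in
  direction \<open>w\<close>; off the closed set outside which \<rho> vanishes, it is zero.\<close>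

lemma frame_linear_section: "linear_section L (frame_field U \<phi> W \<tau> \<rho> w) \<in> sections JL"
proof (rule pi.L1.sectionsI)
  let ?l = "linear_section L (frame_field U \<phi> W \<tau> \<rho> w)"
  note A = frame_field_derivation[OF U W b, of w]
  show "?l z \<in> fibre JL z" if "z \<in> points (base JL)" for z
  proof -
    obtain y \<alpha> where z: "z = (y, \<alpha>)" by (cases z)
    have p: "(y, \<alpha>) \<in> points JM" using that z by simp
    have "\<alpha> (\<lambda>s. frame_field U \<phi> W \<tau> \<rho> w s y) \<in> fibre L y"
      using jet_pointD(2)[OF p] derivations_fieldD(3)[OF A jet_pointD(1)[OF p]] by (simp add: jets_at_def Hom_def)
    then show ?thesis using p by (simp add: z linear_section_at)
  qed
  show "?l z = 0" if "z \<notin> points (base JL)" for z using that by (cases z) (simp add: linear_section_def)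
  fix z assume z: "z \<in> points (base JL)"
  obtain y \<alpha> where zz: "z = (y, \<alpha>)" by (cases z)
  have y: "y \<in> points (base L)" "\<alpha> \<in> jets_at L y" using jet_pointD z zz by auto
  obtain C where C: "closedin (atlas_topology (base L)) C" "C \<subseteq> U \<inter> W" "\<And>y. y \<notin> C \<Longrightarrow> \<rho> y = 0"
    using b by (auto simp: bump_def)
  show "\<exists>V \<sigma> T. (V, \<sigma>) \<in> trivs JL \<and> aopen (base JL) T \<and> z \<in> T \<and> T \<subseteq> V \<and> smooth_in (base JL) T (\<lambda>x. \<sigma> x (?l x))"
  proof (cases "y \<in> C")
    case True
    let ?D = "jdom U W"
    note o = aopen_chart[OF pi.L1.ch jchart_mem[OF U W]]
    have "smooth_in (base JL) ?D (\<lambda>z. fst (snd (jchart U \<phi> \<tau> z)))"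
      by (intro smooth_in_bounded_linear[OF pi.L1.ch o bounded_linear_fst]
          smooth_in_bounded_linear[OF pi.L1.ch o bounded_linear_snd] smooth_in_chart[OF pi.L1.ch jchart_mem[OF U W]])
    moreover have "smooth_in (base JL) ?D (\<lambda>z. \<rho> (fst z))"
      by (rule smooth_in_pullback[OF pi.b_smooth pi.L1.ch ch o aopen_points _ smooth_functionsD(1)[OF bump_smooth[OF b]]])
        (use jdom_points[OF U W] pi.b_points in auto)
    ultimately have "smooth_in (base JL) ?D (\<lambda>z. \<rho> (fst z) * (fst (snd (jchart U \<phi> \<tau> z)) \<bullet> w))"
      by (intro smooth_in_mult[OF pi.L1.ch o] smooth_in_inner[OF pi.L1.ch o] smooth_in_const)
    then have "smooth_in (base JL) ?D (\<lambda>z. \<tau> (fst z) (?l z))"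
      by (rule smooth_in_cong[OF pi.L1.ch o]) (auto simp: frame_linear_triv jchart_def)
    moreover have "z \<in> ?D" using True C(2) y(2) by (auto simp: zz jdom_def)
    moreover have "?D \<subseteq> points JM \<inter> fst -` W" using jdom_points[OF U W] by (auto simp: jdom_def)
    ultimately show ?thesis using o jtriv_mem[OF U W] by blast
  next
    case False
    obtain W' \<tau>' where W': "(W', \<tau>') \<in> trivs L" "y \<in> W'" using trivE[OF y(1)] .
    have t: "(points JM \<inter> fst -` W', \<lambda>z. \<tau>' (fst z)) \<in> trivs JL" using W' unfolding JL_trivs by blast
    let ?T = "points (base JL) \<inter> fst -` (W' - C)"
    have o: "aopen (base JL) ?T"
      by (rule smooth_map_aopen_vimage[OF pi.b_smooth pi.L1.ch ch openin_diff[OF triv_open[OF W'(1)] C(1)]])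
    have "smooth_in (base JL) ?T (\<lambda>z. \<tau>' (fst z) (?l z))"
    proof (rule smooth_in_cong[OF pi.L1.ch o smooth_in_const[of _ _ 0]])
      fix x assume x: "x \<in> ?T"
      then have "?l x = 0" using frame_linear_zero[OF C(3), of "fst x" w "snd x"] by auto
      then show "0 = \<tau>' (fst x) (?l x)" using x triv_zero[OF W'(1)] by auto
    qed
    moreover have "z \<in> ?T" "?T \<subseteq> points JM \<inter> fst -` W'" using False W' z zz by auto
    ultimately show ?thesis using o t by blast
  qed
qed

end

lemma ident_linear_section: "linear_section L ident_field \<in> sections JL"
proof (rule pi.L1.sectionsI)
  let ?l = "linear_section L ident_field"
  show "?l z = 0" if "z \<notin> points (base JL)" for z using that by (cases z) (simp add: linear_section_def)
  fix z assume z: "z \<in> points (base JL)"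
  obtain y \<alpha> where zz: "z = (y, \<alpha>)" by (cases z)
  have y: "y \<in> points (base L)" "\<alpha> \<in> jets_at L y" using jet_pointD z zz by auto
  show "?l z \<in> fibre JL z"
    using y eval_der_derivation[OF y(1)] z unfolding zz by (simp add: linear_section_at ident_field_at jets_at_def Hom_def)
  obtain U \<phi> where U: "(U, \<phi>) \<in> base L" "y \<in> U" using pointsE[OF y(1)] .
  obtain W \<tau> where W: "(W, \<tau>) \<in> trivs L" "y \<in> W" using trivE[OF y(1)] .
  note jc = jchart_mem[OF U W] and jt = jtriv_mem[OF U W]
  note o = aopen_chart[OF pi.L1.ch jc]
  have "smooth_in (base JL) (jdom U W) (\<lambda>z. snd (snd (jchart U \<phi> \<tau> z)))"
    by (intro smooth_in_bounded_linear[OF pi.L1.ch o bounded_linear_snd] smooth_in_chart[OF pi.L1.ch jc])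
  then have "smooth_in (base JL) (jdom U W) (\<lambda>z. \<tau> (fst z) (?l z))"
    by (rule smooth_in_cong[OF pi.L1.ch o]) (auto simp: ident_linear_triv[OF U W])
  moreover have "z \<in> jdom U W" using y U W by (simp add: zz jdom_def)
  moreover have "jdom U W \<subseteq> points JM \<inter> fst -` W" using jdom_points[OF U W] by (auto simp: jdom_def)
  ultimately show "\<exists>V \<sigma> T. (V, \<sigma>) \<in> trivs JL \<and> aopen (base JL) T \<and> z \<in> T \<and> T \<subseteq> V \<and> smooth_in (base JL) T (\<lambda>x. \<sigma> x (?l x))"
    using o jt by blast
qed

end

section \<open>First derivatives of base and linear sections\<close>

context jet_bundle
begin

context
  fixes U \<phi> W \<tau> q \<alpha>
  assumes z: "(q, \<alpha>) \<in> points JM" and U: "(U, \<phi>) \<in> base L" "q \<in> U" and W: "(W, \<tau>) \<in> trivs L" "q \<in> W"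
begin

abbreviation (input) "jrep s \<equiv> (\<lambda>z. \<tau> (fst z) (s z)) \<circ> inv_into (jdom U W) (jchart U \<phi> \<tau>)"

lemma jet_chart: "(jdom U W, jchart U \<phi> \<tau>) \<in> base JL" "(q, \<alpha>) \<in> jdom U W"
  using jchart_mem[OF U W] z U W by (auto simp: jdom_def JM_points)

lemma jet_triv: "(points JM \<inter> fst -` W, \<lambda>z. \<tau> (fst z)) \<in> trivs JL" "(q, \<alpha>) \<in> points JM \<inter> fst -` W"
  using jtriv_mem[OF U W] z W by auto

lemma base_rep_derivative:
  assumes s: "s \<in> sections L"
  shows "frechet_derivative (jrep (pi.pull s)) (at (jchart U \<phi> \<tau> (q, \<alpha>))) =
    (\<lambda>v. section_deriv U \<phi> \<tau> s q (fst v))"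
proof -
  let ?r = "(\<lambda>y. \<tau> y (s y)) \<circ> inv_into U \<phi>"
  have "(fst has_derivative fst) (at (jchart U \<phi> \<tau> (q, \<alpha>)))"
    by (rule bounded_linear_imp_has_derivative[OF bounded_linear_fst])
  then have D: "((\<lambda>z. ?r (fst z)) has_derivative (\<lambda>v. frechet_derivative ?r (at (\<phi> q)) (fst v))) (at (jchart U \<phi> \<tau> (q, \<alpha>)))"
    by (rule has_derivative_compose) (use section_rep_has_derivative[OF U W s] in \<open>simp add: jchart_def o_def\<close>)
  show ?thesis
  proof (rule pi.L1.section_rep_eqI[OF jet_chart jet_triv aopen_chart[OF pi.L1.ch jet_chart(1)] jet_chart(2) D])
    fix y assume "y \<in> jdom U W"
    then obtain x \<beta> where y: "y = (x, \<beta>)" "x \<in> U" "(x, \<beta>) \<in> jdom U W" by (auto simp: jdom_def)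
    then have "(x, \<beta>) \<in> points JM" using jdom_points[OF U W] by blast
    then show "\<tau> (fst y) (pi.pull s y) = ?r (fst (jchart U \<phi> \<tau> y))"
      using y base_section_at[OF _ s] by (simp add: jchart_def inv_chart[OF ch U(1)])
  qed
qed

lemma ident_rep_derivative:
  "frechet_derivative (jrep (linear_section L ident_field)) (at (jchart U \<phi> \<tau> (q, \<alpha>))) = (\<lambda>v. snd (snd v))"
proof -
  have D: "((\<lambda>z. snd (snd z)) has_derivative (\<lambda>v. snd (snd v))) (at (jchart U \<phi> \<tau> (q, \<alpha>)))"
    by (auto intro!: derivative_eq_intros)
  show ?thesis
    by (rule pi.L1.section_rep_eqI[OF jet_chart jet_triv aopen_chart[OF pi.L1.ch jet_chart(1)] jet_chart(2) D])
      (auto simp: ident_linear_triv[OF U W])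
qed

lemma frame_rep_derivative:
  assumes b: "bump (base L) q (U \<inter> W) \<rho>"
  shows "frechet_derivative (jrep (linear_section L (frame_field U \<phi> W \<tau> \<rho> w))) (at (jchart U \<phi> \<tau> (q, \<alpha>))) =
    (\<lambda>v. fst (snd v) \<bullet> w)"
proof -
  obtain N where N: "aopen (base L) N" "q \<in> N" "N \<subseteq> U \<inter> W" "\<And>y. y \<in> N \<Longrightarrow> \<rho> y = 1" using bumpE[OF b] by blast
  have oN: "aopen (base JL) (points (base JL) \<inter> fst -` N)" by (rule smooth_map_aopen_vimage[OF pi.b_smooth pi.L1.ch ch N(1)])
  have zN: "(q, \<alpha>) \<in> points (base JL) \<inter> fst -` N" using z N by simp
  have D: "((\<lambda>z. fst (snd z) \<bullet> w) has_derivative (\<lambda>v. fst (snd v) \<bullet> w)) (at (jchart U \<phi> \<tau> (q, \<alpha>)))"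
    by (auto intro!: derivative_eq_intros)
  show ?thesis
  proof (rule pi.L1.section_rep_eqI[OF jet_chart jet_triv oN zN D])
    fix y assume y: "y \<in> points (base JL) \<inter> fst -` N" "y \<in> jdom U W"
    then show "\<tau> (fst y) (linear_section L (frame_field U \<phi> W \<tau> \<rho> w) y) = fst (snd (jchart U \<phi> \<tau> y)) \<bullet> w"
      using frame_linear_triv[OF U W b, of "fst y" "snd y" w] N(4)[of "fst y"] by (simp add: jchart_def split_beta)
  qed
qed

text \<open>Base sections detect the direction along the base and the zero-order part, the linear
  sections of frame fields detect the momentum direction, and that of the identity field detects the
  direction of the value coordinate.\<close>

lemma jet_derivation_zero:
  assumes b: "bump (base L) q (U \<inter> W) \<rho>" and d: "d \<in> derivations_at JL (q, \<alpha>)"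
    and d1: "\<And>s. s \<in> sections L \<Longrightarrow> d (pi.pull s) = 0"
    and d2: "\<And>w. d (linear_section L (frame_field U \<phi> W \<tau> \<rho> w)) = 0"
    and d3: "d (linear_section L ident_field) = 0"
  shows "d = (\<lambda>_. 0)"
proof -
  obtain v c where dd: "d = pi.L1.coord_der (jdom U W) (jchart U \<phi> \<tau>) (\<lambda>z. \<tau> (fst z)) (q, \<alpha>) v c"
    using pi.L1.derivation_coords[OF jet_chart jet_triv d] .
  note triv = pi.L1.coord_der_triv[OF jet_chart jet_triv, of _ v c] pi.L1.triv_zero[OF jet_triv]
  have key: "p \<bullet> fst v + c * u = 0" for p u
  proof -
    obtain s where s: "s \<in> sections L" "\<tau> q (s q) = u"
      "\<And>v. section_deriv U \<phi> \<tau> s q v = p \<bullet> v"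
      using section_with_jet[OF U W, of u p] by metis
    then show ?thesis
      using triv(1)[OF pi.pull_section[OF s(1)]] triv(2) d1[OF s(1)] base_section_at[OF z s(1)] base_rep_derivative[OF s(1)]
      by (simp add: dd)
  qed
  have c: "c = 0" using key[of 0 1] by simp
  have v1: "fst v = 0" using key[of "fst v" 0] by simp
  have v3: "snd (snd v) = 0"
    using triv(1)[OF ident_linear_section] triv(2) d3 c ident_rep_derivative by (simp add: dd)
  have v2: "fst (snd v) \<bullet> w = 0" for w
    using triv(1)[OF frame_linear_section[OF U W b, of w]] triv(2) d2[of w] c frame_rep_derivative[OF b, of w] by (simp add: dd)
  have "fst (snd v) = 0" using v2[of "fst (snd v)"] by simp
  then have "v = 0" using v1 v3 by (simp add: prod_eq_iff)
  then show ?thesis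
    unfolding dd pi.L1.coord_der_def c
    using linear_0[OF pi.L1.section_rep_linear[OF jet_chart jet_triv]] by (auto simp: fun_eq_iff)
qed

end

end

section \<open>The canonical Jacobi structure and its Hamiltonian derivations\<close>

locale canonical_jacobi = jet_bundle L for L :: "('m, 'e::finite_dim_inner, 'v::real_vector) line_bundle" +
  fixes br
  assumes canonical: "canonical_jacobi_structure L br"
begin

sublocale J: jacobi_bundle "jet_line_bundle L" br
  by (intro jacobi_bundle.intro hbundle.intro jet_line_bundle_hline_bundle jacobi_bundle_axioms.intro)
    (use canonical in \<open>simp add: canonical_jacobi_structure_def\<close>)

lemma br_linear_linear: "a \<in> derivations L \<Longrightarrow> a' \<in> derivations L \<Longrightarrow>
    br (linear_section L a) (linear_section L a') = linear_section L (commutator a a')"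
  and br_linear_base: "a \<in> derivations L \<Longrightarrow> s \<in> sections L \<Longrightarrow> br (linear_section L a) (pi.pull s) = pi.pull (a s)"
  and br_base_base: "s \<in> sections L \<Longrightarrow> r \<in> sections L \<Longrightarrow> br (pi.pull s) (pi.pull r) = (\<lambda>_. 0)"
  using canonical unfolding canonical_jacobi_structure_def base_section_eq by blast+

text \<open>A given derivation is matched in two stages. The linear section of a suitable field
  reproduces it on base sections. The remaining defect on linear sections is removed by adding a
  base section, whose brackets with base sections vanish and whose brackets with linear sections can
  be prescribed through its value and differential.\<close>

lemma canonical_full_hamiltonian: "full_hamiltonian JL br"
  unfolding full_hamiltonian_def
proof (intro ballI)
  fix z a assume zb: "z \<in> points (base JL)" and a: "a \<in> derivations_at JL z"
  obtain q \<alpha> where zz: "z = (q, \<alpha>)" by (cases z)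
  have z: "(q, \<alpha>) \<in> points JM" using zb zz by simp
  note q = jet_pointD[OF z]
  obtain U \<phi> where U: "(U, \<phi>) \<in> base L" "q \<in> U" using pointsE[OF q(1)] .
  obtain W \<tau> where W: "(W, \<tau>) \<in> trivs L" "q \<in> W" using trivE[OF q(1)] .
  obtain \<rho> where b: "bump (base L) q (U \<inter> W) \<rho>"
    using bump_exists[OF hmfd coord_open[OF U W], of q] U W by auto
  let ?A = "frame_field U \<phi> W \<tau> \<rho>" and ?l = "\<lambda>a. linear_section L a"
  note A = frame_field_derivation[OF U W b] and lA = frame_linear_section[OF U W b]
  have A_add: "?A (w + k *\<^sub>R w') = (\<lambda>s x. ?A w s x + k *\<^sub>R ?A w' s x)" for w w' k
  proof (intro ext)
    fix s x
    show "?A (w + k *\<^sub>R w') s x = ?A w s x + k *\<^sub>R ?A w' s x"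
      using coord_der_linear(1)[OF U(1) _ W(1), of x "\<rho> x *\<^sub>R w" "\<rho> x *\<^sub>R k *\<^sub>R w'" 0 0]
        coord_der_linear(2)[OF U(1) _ W(1), of x k "\<rho> x *\<^sub>R w'" 0]
      by (simp add: frame_field_def scaleR_add_right mult.commute)
  qed
  have l_add: "?l (?A (w + k *\<^sub>R w')) = (\<lambda>z. ?l (?A w) z + k *\<^sub>R ?l (?A w') z)" for w w' k
    unfolding A_add by (rule linear_section_add[OF A A])
  have A_at: "?A w s q = coord_der U \<phi> \<tau> q w 0 s" for w s
    using U W bump_at[OF b] by (simp add: frame_field_def)
  have "pi.dmap z a \<in> derivations_at L q" using pi.dmap_derivation[OF zb a] zz by simp
  then obtain w c where a0: "pi.dmap z a = coord_der U \<phi> \<tau> q w c" by (rule derivation_coords[OF U W])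
  \<comment> \<open>\<open>A0\<close> is a field that extends the projection of \<open>a\<close> to
    the derivations of \<open>L\<close> at \<open>q\<close>. The bracket of its linear section with
    a base section is \<open>A0\<close> applied to that section, as it should be.\<close>
  define A0 where "A0 = (\<lambda>s x. ?A w s x + c *\<^sub>R ident_field s x)"
  have A0: "A0 \<in> derivations L" unfolding A0_def by (rule derivations_field_add[OF A ident_field_derivation])
  have A0_at: "A0 s q = pi.dmap z a s" for s
    unfolding a0 A0_def A_at using coord_der_linear(1)[OF U W, of w 0 0 c] coord_der_linear(2)[OF U W, of c 0 1]
      eval_der_eq[OF U W] fun_cong[OF ident_field_at[of q], of s] by (simp add: fun_eq_iff)
  define r0 where "r0 = ?l A0"
  have r0_eq: "r0 = (\<lambda>z. ?l (?A w) z + c *\<^sub>R ?l ident_field z)"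
    unfolding r0_def A0_def by (rule linear_section_add[OF A ident_field_derivation])
  have r0: "r0 \<in> sections JL"
    unfolding r0_eq by (intro pi.L1.sections_add lA pi.L1.sections_scale ident_linear_section)
  note T = jtriv_mem[OF U W]
  have zT: "z \<in> points JM \<inter> fst -` W" using z W zz by simp
  have fib: "s \<in> sections JL \<Longrightarrow> s z \<in> fibre L q" "s \<in> sections JL \<Longrightarrow> a s \<in> fibre L q" for s
    using pi.L1.sectionsD(1)[OF _ zb, of s] pi.L1.derivationsD(1)[OF a, of s] zz by simp_all
  \<comment> \<open>The defect of \<open>r0\<close> on linear sections, read in the trivialisation.
    It is linear on the frame directions, hence given by a vector \<open>p\<close> and by one number
    for the identity field; these become the differential and the value of \<open>s\<close>.\<close>
  define h where "h = (\<lambda>s. \<tau> q (br r0 s z) - \<tau> q (a s))"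
  have h_add: "h (\<lambda>z. s z + k *\<^sub>R s' z) = h s + k * h s'" if "s \<in> sections JL" "s' \<in> sections JL" for s s' k
  proof -
    note S = that pi.L1.sections_scale[OF that(2)]
    have "br r0 (\<lambda>z. s z + k *\<^sub>R s' z) z = br r0 s z + k *\<^sub>R br r0 s' z"
      using J.br_add_right[OF r0 S(1) S(3), of k] J.br_scale_right[OF r0 S(2), of k] by simp
    moreover have "a (\<lambda>z. s z + k *\<^sub>R s' z) = a s + k *\<^sub>R a s'"
      using pi.L1.derivationsD(3)[OF a S(1) S(3), of k] pi.L1.derivationsD(4)[OF a S(2), of k] by simp
    ultimately show ?thesis
      using fib(1)[OF J.br_section[OF r0 that(1)]] fib(1)[OF J.br_section[OF r0 that(2)]] fib(2)[OF that(1)] fib(2)[OF that(2)]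
        subspace_scale[OF fibre_subspace[OF q(1)]]
      by (simp add: h_def triv_add[OF W] triv_scale[OF W] algebra_simps)
  qed
  have "linear (\<lambda>w. h (?l (?A w)))"
  proof (rule linearI)
    show "h (?l (?A (w1 + w2))) = h (?l (?A w1)) + h (?l (?A w2))" for w1 w2
      using h_add[OF lA lA, of w1 1 w2] l_add[of w1 1 w2] by simp
    have z0: "h (?l (?A 0)) = 0" using h_add[OF lA lA, of 0 1 0] l_add[of 0 1 0] by simp
    show "h (?l (?A (k *\<^sub>R w1))) = k *\<^sub>R h (?l (?A w1))" for k w1
      using h_add[OF lA lA, of 0 k w1] l_add[of 0 k w1] z0 by simp
  qed
  from riesz_ex1[OF this] obtain p where p: "\<And>w. p \<bullet> w = h (?l (?A w))" by blast
  obtain s where s: "s \<in> sections L" "\<tau> q (s q) = h (?l ident_field)"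
    "\<And>v. section_deriv U \<phi> \<tau> s q v = p \<bullet> v"
    using section_with_jet[OF U W, of "h (?l ident_field)" p] by metis
  note ps = pi.pull_section[OF s(1)]
  define r where "r = (\<lambda>z. r0 z + pi.pull s z)"
  have r: "r \<in> sections JL" unfolding r_def by (rule pi.L1.sections_add[OF r0 ps])
  have br_r: "br r t z = br r0 t z + br (pi.pull s) t z" if "t \<in> sections JL" for t
    using J.br_add_left[OF r0 ps that] by (simp add: r_def)
  \<comment> \<open>Adding \<open>pi.pull s\<close> changes the bracket with \<open>?l B\<close> by
    \<open>- B s\<close>; brackets with base sections stay the same.\<close>
  have lin: "br r (?l B) z = a (?l B)" if B: "B \<in> derivations L" "?l B \<in> sections JL" "\<tau> q (B s q) = h (?l B)" for B
  proof -
    have "br (pi.pull s) (?l B) z = - B s q"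
      using J.br_antisym[OF ps B(2), of z] br_linear_base[OF B(1) s(1)] base_section_at[OF z derivations_fieldD(1)[OF B(1) s(1)]] zz
      by simp
    then have "br r (?l B) z = br r0 (?l B) z - B s q" using br_r[OF B(2)] by simp
    moreover have Bq: "B s q \<in> fibre L q" using sectionsD(1)[OF derivations_fieldD(1)[OF B(1) s(1)] q(1)] .
    ultimately have "\<tau> q (br r (?l B) z) = \<tau> q (a (?l B))"
      using triv_diff[OF W fib(1)[OF J.br_section[OF r0 B(2)]] Bq] B(3) by (simp add: h_def)
    then show ?thesis by (rule triv_inj[OF W fib(1)[OF J.br_section[OF r B(2)]] fib(2)[OF B(2)]])
  qed
  let ?d = "\<lambda>t. a t - ham_der JL br r z t"
  have "?d = (\<lambda>_. 0)"
  proof (rule jet_derivation_zero[OF z U W b])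
    show "?d \<in> derivations_at JL (q, \<alpha>)"
      using pi.L1.derivations_at_diff[OF zb a J.ham_der_derivation[OF zb r]] zz by simp
    show "?d (pi.pull t) = 0" if t: "t \<in> sections L" for t
    proof -
      have "br r (pi.pull t) z = A0 t q"
        using br_r[OF pi.pull_section[OF t]] br_linear_base[OF A0 t] br_base_base[OF s(1) t]
          base_section_at[OF z derivations_fieldD(1)[OF A0 t]] zz by (simp add: r0_def)
      then show ?thesis using A0_at t pi.pull_section[OF t] by (simp add: J.ham_der_at der_map_def)
    qed
    show "?d (?l (?A w)) = 0" for w
    proof -
      have "\<tau> q (?A w s q) = h (?l (?A w))" by (simp add: A_at coord_der_triv[OF U W s(1)] s(3) p)
      then show ?thesis using lin[OF A lA] by (simp add: J.ham_der_at lA)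
    qed
    have "\<tau> q (ident_field s q) = h (?l ident_field)" using s by (simp add: ident_field_def)
    then show "?d (?l ident_field) = 0"
      using lin[OF ident_field_derivation ident_linear_section] by (simp add: J.ham_der_at ident_linear_section)
  qed
  then have "a = ham_der JL br r z" by (simp add: fun_eq_iff)
  then show "\<exists>r\<in>sections JL. a = ham_der JL br r z" using r by blast
qed

end

section \<open>Submanifolds given as graphs\<close>

text \<open>Countably many covering charts, each combined with the members of a countable base of
  the model space, give a base.\<close>

lemma second_countable_atlas:
  fixes A :: "('m, 'e::finite_dim_inner) atlas"
  assumes A: "charted A" and C: "countable C" "C \<subseteq> A" "points A \<subseteq> (\<Union>(U, \<phi>)\<in>C. U)"
  shows "second_countable (atlas_topology A)"
proof -
  obtain \<B> :: "'e set set" where B: "countable \<B>" "\<forall>V\<in>\<B>. open V"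
    "\<forall>U x. open U \<and> x \<in> U \<longrightarrow> (\<exists>V\<in>\<B>. x \<in> V \<and> V \<subseteq> U)"
    using countable_open_base by blast
  define F where "F = (\<lambda>((U, \<phi>), V). U \<inter> (\<phi> :: 'm \<Rightarrow> 'e) -` V)"
  show ?thesis
    unfolding second_countable_def
  proof (intro exI[of _ "F ` (C \<times> \<B>)"] conjI allI impI ballI)
    show "countable (F ` (C \<times> \<B>))" using B(1) C(1) by auto
    show "aopen A V" if V: "V \<in> F ` (C \<times> \<B>)" for V
    proof -
      obtain U \<phi> T where "(U, \<phi>) \<in> C" "T \<in> \<B>" "V = U \<inter> \<phi> -` T" using V by (auto simp: F_def)
      then show ?thesis using aopen_chart_vimage C(2) B(2) by blast
    qed
    fix S x assume *: "aopen A S \<and> x \<in> S"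
    then have "x \<in> points A" using aopen_imp_subset by blast
    then obtain U \<phi> where U: "(U, \<phi>) \<in> C" "x \<in> U" using C(3) by blast
    then have UA: "(U, \<phi>) \<in> A" using C(2) by blast
    have "open (\<phi> ` (U \<inter> S))" using * aopen_image[OF A UA] by blast
    then obtain V where V: "V \<in> \<B>" "\<phi> x \<in> V" "V \<subseteq> \<phi> ` (U \<inter> S)" using B(3) U * by blast
    have "F ((U, \<phi>), V) \<subseteq> S" using V(3) chartedD(1)[OF A UA] by (auto simp: F_def inj_on_def)
    moreover have "x \<in> F ((U, \<phi>), V)" using U V by (simp add: F_def)
    ultimately show "\<exists>V\<in>F ` (C \<times> \<B>). x \<in> V \<and> V \<subseteq> S" using U V by blast
  qed
qed

text \<open>Over each chart in \<open>A'\<close> the set \<open>S\<close> is a graph over its image under the projection \<open>pr\<close> of the model space.\<close>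

locale graph_submanifold =
  fixes A :: "('m, 'e::finite_dim_inner) atlas" and A' :: "('m, 'e) atlas" and S :: "'m set"
    and pr :: "'e \<Rightarrow> 'k::finite_dim_inner"
  assumes hmanifold_A: "hmanifold A" and sub: "A' \<subseteq> A" and cover: "\<And>x. x \<in> S \<Longrightarrow> \<exists>(U, \<phi>)\<in>A'. x \<in> U"
    and pr: "bounded_linear pr"
    and image_open: "\<And>U \<phi>. (U, \<phi>) \<in> A' \<Longrightarrow> open ((\<lambda>x. pr (\<phi> x)) ` (U \<inter> S))"
    and graph: "\<And>U \<phi>. (U, \<phi>) \<in> A' \<Longrightarrow>
      \<exists>G. smooth_on ((\<lambda>x. pr (\<phi> x)) ` (U \<inter> S)) G \<and> (\<forall>x\<in>U \<inter> S. G (pr (\<phi> x)) = \<phi> x)"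
begin

definition SA :: "('m, 'k) atlas"
  where "SA = {(U \<inter> S, \<lambda>x. pr (\<phi> x)) |U \<phi>. (U, \<phi>) \<in> A'}"

lemmas chA = hmanifold_charted[OF hmanifold_A]

lemma SA_chart: "(U, \<phi>) \<in> A' \<Longrightarrow> (U \<inter> S, \<lambda>x. pr (\<phi> x)) \<in> SA"
  by (auto simp: SA_def)

lemma SA_chartE:
  assumes "c \<in> SA" obtains U \<phi> where "(U, \<phi>) \<in> A'" "c = (U \<inter> S, \<lambda>x. pr (\<phi> x))"
  using assms by (auto simp: SA_def)

lemma SA_points: "points SA = S"
proof (intro equalityI subsetI)
  show "x \<in> S" if "x \<in> points SA" for x using that by (auto simp: points_def SA_def)
  show "x \<in> points SA" if x: "x \<in> S" for x
  proof -
    obtain U \<phi> where "(U, \<phi>) \<in> A'" "x \<in> U" using cover[OF x] by blast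
    then show ?thesis using chart_subset_points[OF SA_chart] x by blast
  qed
qed

lemma SA_inj: "(U, \<phi>) \<in> A' \<Longrightarrow> inj_on (\<lambda>x. pr (\<phi> x)) (U \<inter> S)"
proof (rule inj_onI)
  fix x y assume U: "(U, \<phi>) \<in> A'" and xy: "x \<in> U \<inter> S" "y \<in> U \<inter> S" "pr (\<phi> x) = pr (\<phi> y)"
  obtain G where "\<forall>x\<in>U \<inter> S. G (pr (\<phi> x)) = \<phi> x" using graph[OF U] by blast
  then have "\<phi> x = \<phi> y" using xy by metis
  then show "x = y" using chartedD(1)[OF chA subsetD[OF sub U]] xy by (auto simp: inj_on_def)
qed

lemma SA_charted: "charted SA"
  unfolding charted_def
proof (intro conjI ballI)
  fix c assume "c \<in> SA"
  then obtain U \<phi> where U: "(U, \<phi>) \<in> A'" "c = (U \<inter> S, \<lambda>x. pr (\<phi> x))" by (rule SA_chartE)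
  let ?p = "\<lambda>x. pr (\<phi> x)"
  note UA = subsetD[OF sub U(1)]
  show "case c of (U, \<phi>) \<Rightarrow> inj_on \<phi> U \<and> open (\<phi> ` U)"
    using SA_inj[OF U(1)] image_open[OF U(1)] by (simp add: U(2))
  obtain G where G: "smooth_on (?p ` (U \<inter> S)) G" "\<And>x. x \<in> U \<inter> S \<Longrightarrow> G (?p x) = \<phi> x" using graph[OF U(1)] by blast
  show "case c of (U, \<phi>) \<Rightarrow> \<forall>(V, \<psi>)\<in>SA. open (\<phi> ` (U \<inter> V)) \<and> smooth_on (\<phi> ` (U \<inter> V)) (\<psi> \<circ> inv_into U \<phi>)"
    unfolding U(2) prod.case
  proof (intro ballI)
    fix d assume "d \<in> SA"
    then obtain V \<psi> where V: "(V, \<psi>) \<in> A'" "d = (V \<inter> S, \<lambda>x. pr (\<psi> x))" by (rule SA_chartE)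
    note VA = subsetD[OF sub V(1)]
    \<comment> \<open>The overlap is the preimage of an open set under the graph map, hence open in
      the projected chart.\<close>
    have eq: "?p ` (U \<inter> S \<inter> (V \<inter> S)) = ?p ` (U \<inter> S) \<inter> G -` (\<phi> ` (U \<inter> V))"
    proof (intro equalityI subsetI)
      fix y assume "y \<in> ?p ` (U \<inter> S \<inter> (V \<inter> S))"
      then show "y \<in> ?p ` (U \<inter> S) \<inter> G -` (\<phi> ` (U \<inter> V))" using G(2) by auto
    next
      fix y assume "y \<in> ?p ` (U \<inter> S) \<inter> G -` (\<phi> ` (U \<inter> V))"
      then obtain x x' where x: "x \<in> U \<inter> S" "y = ?p x" "x' \<in> U \<inter> V" "G y = \<phi> x'" by blast
      then have "\<phi> x = \<phi> x'" using G(2) by simp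
      then have "x = x'" using chartedD(1)[OF chA UA] x by (auto simp: inj_on_def)
      then show "y \<in> ?p ` (U \<inter> S \<inter> (V \<inter> S))" using x by auto
    qed
    have o: "open (?p ` (U \<inter> S \<inter> (V \<inter> S)))"
      unfolding eq
      by (rule continuous_open_preimage[OF smooth_on_imp_continuous_on[OF G(1)] image_open[OF U(1)] chartedD(3)[OF chA UA VA]])
    have "smooth_on (?p ` (U \<inter> S \<inter> (V \<inter> S))) (\<lambda>y. pr (\<psi> (inv_into U \<phi> (G y))))"
      by (rule smooth_on_bounded_linear_comp[OF o pr smooth_on_compose[OF o chartedD(3)[OF chA UA VA] _ smooth_on_subset[OF G(1)]
            chartedD(4)[OF chA UA VA]]]) (auto simp: eq)
    then have "smooth_on (?p ` (U \<inter> S \<inter> (V \<inter> S))) (\<lambda>y. pr (\<psi> (inv_into (U \<inter> S) ?p y)))"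
      by (rule smooth_on_cong[OF o]) (use G(2) inv_into_f_f[OF SA_inj[OF U(1)]] in \<open>auto simp: inv_chart[OF chA UA]\<close>)
    then show "case d of (V, \<psi>) \<Rightarrow> open (?p ` (U \<inter> S \<inter> V)) \<and> smooth_on (?p ` (U \<inter> S \<inter> V)) (\<psi> \<circ> inv_into (U \<inter> S) ?p)"
      using o by (simp add: V(2) o_def)
  qed
qed

lemma SA_chart_smooth:
  assumes U: "(U, \<phi>) \<in> A'" shows "smooth_in SA (U \<inter> S) \<phi>"
proof -
  let ?p = "\<lambda>x. pr (\<phi> x)"
  obtain G where G: "smooth_on (?p ` (U \<inter> S)) G" "\<And>x. x \<in> U \<inter> S \<Longrightarrow> G (?p x) = \<phi> x" using graph[OF U] by blast
  have "smooth_on (?p ` (U \<inter> S)) (\<lambda>y. \<phi> (inv_into (U \<inter> S) ?p y))"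
    by (rule smooth_on_cong[OF image_open[OF U] G(1)]) (use G(2) inv_into_f_f[OF SA_inj[OF U]] in auto)
  then show ?thesis
    by (intro smooth_in_chartI[OF SA_charted SA_chart[OF U] aopen_chart[OF SA_charted SA_chart[OF U]]]) auto
qed

lemma SA_inclusion_smooth: "smooth_map SA A (\<lambda>x. x)"
proof (rule smooth_mapI[OF SA_charted chA])
  fix x assume "x \<in> points SA"
  then have xS: "x \<in> S" by (simp add: SA_points)
  then obtain U \<phi> where U: "(U, \<phi>) \<in> A'" "x \<in> U" using cover by blast
  then show "\<exists>V \<psi> T. (V, \<psi>) \<in> A \<and> aopen SA T \<and> x \<in> T \<and> (\<lambda>x. x) ` T \<subseteq> V \<and> smooth_in SA T (\<lambda>x. \<psi> x)"
    using sub xS SA_chart_smooth[OF U(1)] aopen_chart[OF SA_charted SA_chart[OF U(1)]]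
    by (intro exI[of _ U] exI[of _ \<phi>] exI[of _ "U \<inter> S"]) auto
qed

text \<open>The projection extends an open set of the submanifold constantly along its fibres to the
  ambient chart. As the submanifold is a graph, it meets the extension only in the part of the
  original set over the chart; this is how it gets the subspace topology.\<close>

lemma SA_extend_open:
  assumes U: "(U, \<phi>) \<in> A'" and T: "aopen SA T"
  shows "aopen A (U \<inter> (\<lambda>x. pr (\<phi> x)) -` ((\<lambda>x. pr (\<phi> x)) ` (U \<inter> S \<inter> T)))"
proof -
  have "open (pr -` ((\<lambda>x. pr (\<phi> x)) ` (U \<inter> S \<inter> T)))"
    using aopen_image[OF SA_charted SA_chart[OF U] T] continuous_on_open_vimage[OF open_UNIV, of pr]
      linear_continuous_on[OF pr, of UNIV] by simp
  from aopen_chart_vimage[OF subsetD[OF sub U] this] show ?thesis by (simp add: vimage_def)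
qed

lemma SA_topology: "atlas_topology SA = subtopology (atlas_topology A) S"
proof (rule topology_eq[THEN iffD2], rule allI)
  fix T
  have "openin (subtopology (atlas_topology A) S) T" if T: "aopen SA T"
  proof (subst openin_subopen, rule ballI)
    fix x assume x: "x \<in> T"
    then have xS: "x \<in> S" using aopen_imp_subset[OF T] by (auto simp: SA_points)
    then obtain U \<phi> where U: "(U, \<phi>) \<in> A'" "x \<in> U" using cover by blast
    let ?N = "U \<inter> (\<lambda>x. pr (\<phi> x)) -` ((\<lambda>x. pr (\<phi> x)) ` (U \<inter> S \<inter> T))"
    have "openin (subtopology (atlas_topology A) S) (?N \<inter> S)"
      using SA_extend_open[OF U(1) T] by (auto simp: openin_subtopology)
    moreover have "?N \<inter> S \<subseteq> T" using SA_inj[OF U(1)] by (auto simp: inj_on_def)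
    moreover have "x \<in> ?N \<inter> S" using x xS U by auto
    ultimately show "\<exists>N. openin (subtopology (atlas_topology A) S) N \<and> x \<in> N \<and> N \<subseteq> T" by blast
  qed
  moreover have "aopen SA T" if T: "openin (subtopology (atlas_topology A) S) T"
  proof -
    obtain N where N: "aopen A N" "T = N \<inter> S" using T by (auto simp: openin_subtopology)
    have "T = points SA \<inter> (\<lambda>x. x) -` N" by (auto simp: N(2) SA_points)
    then show ?thesis using smooth_map_aopen_vimage[OF SA_inclusion_smooth SA_charted chA N(1)] by simp
  qed
  ultimately show "aopen SA T \<longleftrightarrow> openin (subtopology (atlas_topology A) S) T" by blast
qed

lemma SA_hmanifold: "hmanifold SA"
  using hmanifold_A SA_charted unfolding hmanifold_def SA_topology by (simp add: Hausdorff_space_subtopology)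

text \<open>Extend \<open>g\<close> constantly along the fibres of the projection and cut off; on
  the submanifold near \<open>x\<close> the result is again \<open>g\<close>.\<close>

lemma SA_extend_function:
  assumes g: "g \<in> smooth_functions SA" and x: "x \<in> S"
  obtains f N where "f \<in> smooth_functions A" "aopen SA N" "x \<in> N" "\<And>y. y \<in> N \<Longrightarrow> f y = g y"
proof -
  obtain U \<phi> where U: "(U, \<phi>) \<in> A'" "x \<in> U" using cover[OF x] by blast
  let ?p = "\<lambda>x. pr (\<phi> x)"
  define M where "M = U \<inter> ?p -` (?p ` (U \<inter> S))"
  have M: "aopen A M" using SA_extend_open[OF U(1) aopen_points] by (simp add: M_def SA_points Int_absorb2)
  define h where "h = (\<lambda>y. g (inv_into (U \<inter> S) ?p (?p y)))"
  have sm: "smooth_on (?p ` (U \<inter> S)) (\<lambda>y. g (inv_into (U \<inter> S) ?p y))"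
    using smooth_inD[OF smooth_functionsD(1)[OF g] SA_chart[OF U(1)]] by (simp add: SA_points Int_absorb2)
  have MU: "M \<subseteq> U" by (simp add: M_def)
  have pM: "smooth_in A M ?p"
    by (rule smooth_in_bounded_linear[OF chA M pr smooth_in_subset[OF smooth_in_chart[OF chA subsetD[OF sub U(1)]] MU]])
  have h: "smooth_in A M h"
    unfolding h_def by (rule smooth_in_compose[OF chA M pM image_open[OF U(1)] _ sm]) (auto simp: M_def)
  have xM: "x \<in> M" using U x by (simp add: M_def)
  obtain \<rho> where b: "bump A x M \<rho>" using bump_exists[OF hmanifold_A M xM] .
  obtain N where N: "aopen A N" "x \<in> N" "N \<subseteq> M" "\<And>y. y \<in> N \<Longrightarrow> \<rho> y = 1" using bumpE[OF b] by blast
  show thesis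
  proof (rule that)
    show "(\<lambda>y. \<rho> y * h y) \<in> smooth_functions A" by (rule bump_mult_smooth[OF chA b M h])
    show "aopen SA (points SA \<inter> (\<lambda>x. x) -` N)" by (rule smooth_map_aopen_vimage[OF SA_inclusion_smooth SA_charted chA N(1)])
    show "x \<in> points SA \<inter> (\<lambda>x. x) -` N" using x N by (simp add: SA_points)
    fix y assume "y \<in> points SA \<inter> (\<lambda>x. x) -` N"
    then have "y \<in> N" "y \<in> U \<inter> S" using N(3) by (auto simp: SA_points M_def)
    then show "\<rho> y * h y = g y" using N(4) inv_into_f_f[OF SA_inj[OF U(1)]] by (simp add: h_def)
  qed
qed

text \<open>Functions on the submanifold are locally restrictions of ambient functions, and tangent
  vectors are local.\<close>

lemma SA_tangent_inj:
  assumes x: "x \<in> S"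
  shows "inj_on (tangent_map SA A (\<lambda>x. x)) (tangent_space SA x)"
proof (rule inj_onI)
  fix X Y assume X: "X \<in> tangent_space SA x" and Y: "Y \<in> tangent_space SA x"
    and eq: "tangent_map SA A (\<lambda>x. x) X = tangent_map SA A (\<lambda>x. x) Y"
  show "X = Y"
  proof
    fix g show "X g = Y g"
    proof (cases "g \<in> smooth_functions SA")
      case True
      obtain f N where f: "f \<in> smooth_functions A" "aopen SA N" "x \<in> N" "\<And>y. y \<in> N \<Longrightarrow> f y = g y"
        using SA_extend_function[OF True x] by blast
      let ?f = "\<lambda>y. if y \<in> points SA then f y else 0"
      have "smooth_in SA (points SA) f"
        by (rule smooth_in_pullback[OF SA_inclusion_smooth SA_charted chA aopen_points aopen_points _ smooth_functionsD(1)[OF f(1)]])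
          (use smooth_map_points[OF SA_inclusion_smooth] in auto)
      then have "smooth_in SA (points SA) ?f" by (rule smooth_in_cong[OF SA_charted aopen_points]) simp
      then have f': "?f \<in> smooth_functions SA" by (simp add: smooth_functions_iff)
      have eq': "g y = ?f y" if "y \<in> N" for y
        using f(4)[OF that] subsetD[OF aopen_imp_subset[OF f(2)] that] by simp
      have "X g = X ?f" "Y g = Y ?f"
        by (rule tangent_local[OF SA_hmanifold X f(2,3) True f' eq'], assumption)
          (rule tangent_local[OF SA_hmanifold Y f(2,3) True f' eq'], assumption)
      moreover have "X ?f = Y ?f" using fun_cong[OF eq, of f] f(1) by (simp add: tangent_map_def)
      ultimately show ?thesis by simp
    next
      case False
      then show ?thesis using tangentD(4)[OF X] tangentD(4)[OF Y] by simp
    qed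
  qed
qed

lemma SA_embedded:
  assumes "second_countable (atlas_topology SA)" shows "embedded_submanifold A SA"
  unfolding embedded_submanifold_def manifold_iff
  using assms SA_hmanifold SA_inclusion_smooth SA_tangent_inj SA_topology by (simp add: SA_points)

end

section \<open>Jet lifts\<close>

context bundle_factor
begin

definition bdom :: "'m set \<Rightarrow> 'm set \<Rightarrow> 'n set \<Rightarrow> 'n set \<Rightarrow> 'm set"
  where "bdom U1 W1 U2 W2 = U1 \<inter> W1 \<inter> (points (base L1) \<inter> b -` (U2 \<inter> W2))"

definition brep :: "'m set \<Rightarrow> ('m \<Rightarrow> 'e) \<Rightarrow> ('n \<Rightarrow> 'f) \<Rightarrow> 'e \<Rightarrow> 'f"
  where "brep U1 \<phi>1 \<phi>2 = (\<lambda>y. \<phi>2 (b (inv_into U1 \<phi>1 y)))"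

definition mult :: "('m \<Rightarrow> 'v \<Rightarrow> real) \<Rightarrow> ('n \<Rightarrow> 'w \<Rightarrow> real) \<Rightarrow> 'm \<Rightarrow> real"
  where "mult \<tau>1 \<tau>2 x = \<tau>2 (b x) (B x (unit_vec L1 \<tau>1 x))"

definition mrep :: "'m set \<Rightarrow> ('m \<Rightarrow> 'e) \<Rightarrow> ('m \<Rightarrow> 'v \<Rightarrow> real) \<Rightarrow> ('n \<Rightarrow> 'w \<Rightarrow> real) \<Rightarrow> 'e \<Rightarrow> real"
  where "mrep U1 \<phi>1 \<tau>1 \<tau>2 = (\<lambda>y. mult \<tau>1 \<tau>2 (inv_into U1 \<phi>1 y))"

context
  fixes U1 \<phi>1 W1 \<tau>1 U2 \<phi>2 W2 \<tau>2
  assumes U1: "(U1, \<phi>1) \<in> base L1" and W1: "(W1, \<tau>1) \<in> trivs L1"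
    and U2: "(U2, \<phi>2) \<in> base L2" and W2: "(W2, \<tau>2) \<in> trivs L2"
begin

lemma bdom_open: "aopen (base L1) (bdom U1 W1 U2 W2)"
  unfolding bdom_def
  by (intro openin_Int aopen_chart[OF L1.ch U1] L1.triv_open[OF W1] smooth_map_aopen_vimage[OF b_smooth L1.ch L2.ch]
      aopen_chart[OF L2.ch U2] L2.triv_open[OF W2])

lemma bdom_image_open: "open (\<phi>1 ` bdom U1 W1 U2 W2)"
proof -
  have "U1 \<inter> bdom U1 W1 U2 W2 = bdom U1 W1 U2 W2" by (auto simp: bdom_def)
  then show ?thesis using aopen_image[OF L1.ch U1 bdom_open] by simp
qed

lemma bdomD:
  assumes "x \<in> bdom U1 W1 U2 W2"
  shows "x \<in> U1" "x \<in> W1" "b x \<in> U2" "b x \<in> W2" "x \<in> points (base L1)"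
  using assms by (auto simp: bdom_def)

lemma brep_at: "x \<in> bdom U1 W1 U2 W2 \<Longrightarrow> brep U1 \<phi>1 \<phi>2 (\<phi>1 x) = \<phi>2 (b x)"
  and mrep_at: "x \<in> bdom U1 W1 U2 W2 \<Longrightarrow> mrep U1 \<phi>1 \<tau>1 \<tau>2 (\<phi>1 x) = mult \<tau>1 \<tau>2 x"
  by (simp_all add: brep_def mrep_def inv_chart[OF L1.ch U1] bdomD)

lemma brep_smooth: "smooth_on (\<phi>1 ` bdom U1 W1 U2 W2) (brep U1 \<phi>1 \<phi>2)"
  unfolding brep_def
  by (rule smooth_on_subset[OF smooth_inD[OF smooth_mapD(2)[OF b_smooth L1.ch U2] U1]]) (auto simp: bdom_def)

lemma mrep_smooth: "smooth_on (\<phi>1 ` bdom U1 W1 U2 W2) (mrep U1 \<phi>1 \<tau>1 \<tau>2)"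
  unfolding mrep_def mult_def
  by (rule smooth_on_subset[OF smooth_inD[OF B_smooth[OF W1 W2] U1]]) (auto simp: bdom_def)

lemma mult_nonzero: "x \<in> bdom U1 W1 U2 W2 \<Longrightarrow> mult \<tau>1 \<tau>2 x \<noteq> 0"
  unfolding mult_def by (rule B_unit_nonzero[OF W1 _ W2]) (auto simp: bdom_def)

lemma mrep_nonzero: "y \<in> \<phi>1 ` bdom U1 W1 U2 W2 \<Longrightarrow> mrep U1 \<phi>1 \<tau>1 \<tau>2 y \<noteq> 0"
  using mrep_at mult_nonzero by auto

abbreviation (input) "Db x \<equiv> frechet_derivative (brep U1 \<phi>1 \<phi>2) (at (\<phi>1 x))"
abbreviation (input) "Dm x \<equiv> frechet_derivative (mrep U1 \<phi>1 \<tau>1 \<tau>2) (at (\<phi>1 x))"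

context
  fixes x assumes x: "x \<in> bdom U1 W1 U2 W2"
begin

lemma inv_B_triv:
  assumes "v \<in> fibre L2 (b x)"
  shows "\<tau>1 x (inv_into (fibre L1 x) (B x) v) = \<tau>2 (b x) v / mult \<tau>1 \<tau>2 x"
  using B_triv[OF W1 bdomD(2)[OF x] W2 bdomD(4)[OF x] B_inv(2)[OF bdomD(5)[OF x] assms]]
    B_inv(1)[OF bdomD(5)[OF x] assms] mult_nonzero[OF x] by (simp add: mult_def)

text \<open>A pulled-back section is represented by the representative of \<open>s\<close> composed
  with \<open>b\<close> and divided by the multiplier of \<open>B\<close>. The quotient rule
  therefore subtracts the logarithmic derivative of the multiplier from the zero-order part.\<close>

lemma dmap_coord:
  "dmap x (L1.coord_der U1 \<phi>1 \<tau>1 x w c) =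
    L2.coord_der U2 \<phi>2 \<tau>2 (b x) (Db x w) (c - Dm x w / mult \<tau>1 \<tau>2 x)"
proof
  note xx = bdomD[OF x]
  note UW1 = U1 xx(1) W1 xx(2) and UW2 = U2 xx(3) W2 xx(4)
  fix s show "dmap x (L1.coord_der U1 \<phi>1 \<tau>1 x w c) s =
      L2.coord_der U2 \<phi>2 \<tau>2 (b x) (Db x w) (c - Dm x w / mult \<tau>1 \<tau>2 x) s"
  proof (cases "s \<in> sections L2")
    case s: True
    let ?r = "(\<lambda>y. \<tau>2 y (s y)) \<circ> inv_into U2 \<phi>2"
    let ?R = "frechet_derivative ?r (at (\<phi>2 (b x)))"
    let ?k = "mult \<tau>1 \<tau>2 x"
    have xi: "\<phi>1 x \<in> \<phi>1 ` bdom U1 W1 U2 W2" using x by simp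
    have k: "?k \<noteq> 0" by (rule mult_nonzero[OF x])
    have rep: "\<tau>1 y (pull s y) = ?r (brep U1 \<phi>1 \<phi>2 (\<phi>1 y)) / mrep U1 \<phi>1 \<tau>1 \<tau>2 (\<phi>1 y)" if "y \<in> bdom U1 W1 U2 W2" for y
      using pull_triv[OF W1 bdomD(2)[OF that] W2 bdomD(4)[OF that] s] bdomD[OF that]
      by (simp add: brep_at that mrep_at mult_def inv_chart[OF L2.ch U2])
    have "(?r has_derivative ?R) (at (brep U1 \<phi>1 \<phi>2 (\<phi>1 x)))"
      using L2.section_rep_has_derivative[OF UW2 s] by (simp only: brep_at[OF x])
    from has_derivative_compose[OF smooth_on_has_derivative[OF brep_smooth xi] this]
    have 1: "((\<lambda>y. ?r (brep U1 \<phi>1 \<phi>2 y)) has_derivative (\<lambda>w. ?R (Db x w))) (at (\<phi>1 x))" .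
    have 2: "(mrep U1 \<phi>1 \<tau>1 \<tau>2 has_derivative Dm x) (at (\<phi>1 x))"
      by (rule smooth_on_has_derivative[OF mrep_smooth xi])
    have "section_deriv U1 \<phi>1 \<tau>1 (pull s) x =
        (\<lambda>w. (?R (Db x w) * mrep U1 \<phi>1 \<tau>1 \<tau>2 (\<phi>1 x) - ?r (brep U1 \<phi>1 \<phi>2 (\<phi>1 x)) * Dm x w) /
          (mrep U1 \<phi>1 \<tau>1 \<tau>2 (\<phi>1 x) * mrep U1 \<phi>1 \<tau>1 \<tau>2 (\<phi>1 x)))"
      by (rule L1.section_rep_eqI[OF UW1 bdom_open x has_derivative_divide'[OF 1 2]])
        (use mrep_nonzero[OF xi] rep in auto)
    then have D: "section_deriv U1 \<phi>1 \<tau>1 (pull s) x w =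
        (?R (Db x w) * ?k - \<tau>2 (b x) (s (b x)) * Dm x w) / (?k * ?k)"
      by (simp add: brep_at[OF x] mrep_at[OF x] inv_chart[OF L2.ch UW2(1,2)])
    have ps: "pull s \<in> sections L1" by (rule pull_section[OF s])
    have in1: "L1.coord_der U1 \<phi>1 \<tau>1 x w c (pull s) \<in> fibre L1 x" by (rule L1.coord_der_fibre[OF UW1 ps])
    have "\<tau>2 (b x) (B x (L1.coord_der U1 \<phi>1 \<tau>1 x w c (pull s))) =
        ((?R (Db x w) * ?k - \<tau>2 (b x) (s (b x)) * Dm x w) / (?k * ?k) + c * (\<tau>2 (b x) (s (b x)) / ?k)) * ?k"
      using B_triv[OF W1 xx(2) W2 xx(4) in1] L1.coord_der_triv[OF UW1 ps, of w c] D
        pull_triv[OF W1 xx(2) W2 xx(4) s] by (simp add: mult_def)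
    also have "\<dots> = ?R (Db x w) + (c - Dm x w / ?k) * \<tau>2 (b x) (s (b x))"
      using k by (simp add: field_simps)
    finally have "\<tau>2 (b x) (B x (L1.coord_der U1 \<phi>1 \<tau>1 x w c (pull s))) =
        \<tau>2 (b x) (L2.coord_der U2 \<phi>2 \<tau>2 (b x) (Db x w) (c - Dm x w / ?k) s)"
      by (simp add: L2.coord_der_triv[OF UW2 s])
    then show ?thesis
      using L2.triv_inj[OF W2 xx(4) B_inv(4)[OF xx(5) in1] L2.coord_der_fibre[OF UW2 s]] s by (simp add: der_map_def)
  qed (simp add: der_map_def L2.coord_der_def)
qed

end

end

text \<open>The first jet of a point of the jet lift as a function of the second one. The value 0
  off the derivations makes it an element of \<open>Hom\<close>.\<close>

definition jpull :: "'m \<Rightarrow> ((('n \<Rightarrow> 'w) \<Rightarrow> 'w) \<Rightarrow> 'w) \<Rightarrow> ((('m \<Rightarrow> 'v) \<Rightarrow> 'v) \<Rightarrow> 'v)"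
  where "jpull x \<beta> = (\<lambda>a. if a \<in> derivations_at L1 x then inv_into (fibre L1 x) (B x) (\<beta> (dmap x a)) else 0)"

lemma jet_fibre: "y \<in> points (base L2) \<Longrightarrow> \<beta> \<in> jets_at L2 y \<Longrightarrow> a \<in> derivations_at L2 y \<Longrightarrow> \<beta> a \<in> fibre L2 y"
  by (simp add: jets_at_def Hom_def)

lemma jpull_jet:
  assumes x: "x \<in> points (base L1)" and \<beta>: "\<beta> \<in> jets_at L2 (b x)" shows "jpull x \<beta> \<in> jets_at L1 x"
proof -
  note d = dmap_derivation[OF x] and bx = b_points[OF x]
  have add: "(\<lambda>s. a s + a' s) \<in> derivations_at L1 x" "dmap x (\<lambda>s. a s + a' s) = (\<lambda>s. dmap x a s + dmap x a' s)"
    if "a \<in> derivations_at L1 x" "a' \<in> derivations_at L1 x" for a a'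
    using L1.derivations_at_add[OF x that, of 1] B_lin(1)[OF x] L1.derivationsD(1)[OF that(1)] L1.derivationsD(1)[OF that(2)]
    by (auto simp: der_map_def pull_section)
  have scale: "(\<lambda>s. k *\<^sub>R a s) \<in> derivations_at L1 x" "dmap x (\<lambda>s. k *\<^sub>R a s) = (\<lambda>s. k *\<^sub>R dmap x a s)"
    if "a \<in> derivations_at L1 x" for a k
    using L1.derivations_at_add[OF x that that, of "k - 1"] B_lin(2)[OF x] L1.derivationsD(1)[OF that]
    by (auto simp: der_map_def pull_section algebra_simps)
  note iso = linear_iso_inv_into[OF B_iso[OF x] L1.fibre_subspace[OF x]]
  have b1: "\<beta> (\<lambda>s. a s + a' s) = \<beta> a + \<beta> a'" if "a \<in> derivations_at L2 (b x)" "a' \<in> derivations_at L2 (b x)" for a a'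
    using \<beta> that by (simp add: jets_at_def Hom_def)
  have b2: "\<beta> (\<lambda>s. k *\<^sub>R a s) = k *\<^sub>R \<beta> a" if "a \<in> derivations_at L2 (b x)" for a k
    using \<beta> that by (simp add: jets_at_def Hom_def)
  note fib = jet_fibre[OF bx \<beta> d]
  show ?thesis
    unfolding jets_at_def Hom_def
  proof (intro CollectI conjI ballI allI impI)
    show "jpull x \<beta> a \<in> fibre L1 x" if "a \<in> derivations_at L1 x" for a
      using that B_inv(2)[OF x fib[OF that]] by (simp add: jpull_def)
    show "jpull x \<beta> a = 0" if "a \<notin> derivations_at L1 x" for a using that by (simp add: jpull_def)
    show "jpull x \<beta> (\<lambda>s. a s + a' s) = jpull x \<beta> a + jpull x \<beta> a'"
      if "a \<in> derivations_at L1 x" "a' \<in> derivations_at L1 x" for a a'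
      using that add[OF that] b1[OF d d, OF that] linear_isoD(1)[OF iso fib fib, OF that] by (simp add: jpull_def)
    show "jpull x \<beta> (\<lambda>s. k *\<^sub>R a s) = k *\<^sub>R jpull x \<beta> a" if "a \<in> derivations_at L1 x" for a k
      using that scale[OF that] b2[OF d, OF that] linear_isoD(2)[OF iso fib, OF that] by (simp add: jpull_def)
  qed
qed

lemma B_jpull:
  assumes x: "x \<in> points (base L1)" and \<beta>: "\<beta> \<in> jets_at L2 (b x)" and a: "a \<in> derivations_at L1 x"
  shows "B x (jpull x \<beta> a) = \<beta> (dmap x a)"
  using a B_inv(1)[OF x jet_fibre[OF b_points[OF x] \<beta> dmap_derivation[OF x a]]] by (simp add: jpull_def)

lemma jpull_jet_of_section:
  assumes x: "x \<in> points (base L1)" and s: "s \<in> sections L2"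
  shows "jpull x (jet L2 s (b x)) = jet L1 (pull s) x"
proof
  fix a show "jpull x (jet L2 s (b x)) a = jet L1 (pull s) x a"
    using dmap_derivation[OF x, of a] B_inv(3)[OF x L1.derivationsD(1)[OF _ pull_section[OF s]]]
    by (simp add: jpull_def jet_def dmap_at[OF s])
qed

text \<open>Dual to \<open>dmap_coord\<close>: the jet is evaluated on the images of the coordinate
  derivations. The resulting expressions are smooth in the coordinates of \<open>q\<close> and
  \<beta>, which makes the jet lift a smooth graph.\<close>

lemma jpull_coords:
  assumes U1: "(U1, \<phi>1) \<in> base L1" and W1: "(W1, \<tau>1) \<in> trivs L1"
    and U2: "(U2, \<phi>2) \<in> base L2" and W2: "(W2, \<tau>2) \<in> trivs L2"
    and x: "x \<in> bdom U1 W1 U2 W2" and \<beta>: "\<beta> \<in> jets_at L2 (b x)"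
  shows "\<tau>1 x (jpull x \<beta> (eval_der L1 x)) = \<tau>2 (b x) (\<beta> (eval_der L2 (b x))) / mult \<tau>1 \<tau>2 x"
    "L1.momentum U1 \<phi>1 \<tau>1 x (jpull x \<beta>) \<bullet> w =
      (L2.momentum U2 \<phi>2 \<tau>2 (b x) \<beta> \<bullet> frechet_derivative (brep U1 \<phi>1 \<phi>2) (at (\<phi>1 x)) w
        - frechet_derivative (mrep U1 \<phi>1 \<tau>1 \<tau>2) (at (\<phi>1 x)) w / mult \<tau>1 \<tau>2 x * \<tau>2 (b x) (\<beta> (eval_der L2 (b x))))
      / mult \<tau>1 \<tau>2 x"
proof -
  note A = U1 W1 U2 W2 and xx = bdomD[OF U1 W1 U2 W2 x]
  note UW1 = U1 xx(1) W1 xx(2) and UW2 = U2 xx(3) W2 xx(4)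
  have e: "eval_der L1 x \<in> derivations_at L1 x" by (rule L1.eval_der_derivation[OF xx(5)])
  have "eval_der L2 (b x) \<in> derivations_at L2 (b x)" by (rule L2.eval_der_derivation[OF b_points[OF xx(5)]])
  then show "\<tau>1 x (jpull x \<beta> (eval_der L1 x)) = \<tau>2 (b x) (\<beta> (eval_der L2 (b x))) / mult \<tau>1 \<tau>2 x"
    using inv_B_triv[OF A x jet_fibre[OF b_points[OF xx(5)] \<beta>]] e by (simp add: jpull_def dmap_eval[OF xx(5)])
  have d: "L1.coord_der U1 \<phi>1 \<tau>1 x w 0 \<in> derivations_at L1 x" by (rule L1.coord_der_derivation[OF UW1])
  have "L1.momentum U1 \<phi>1 \<tau>1 x (jpull x \<beta>) \<bullet> w = \<tau>1 x (jpull x \<beta> (L1.coord_der U1 \<phi>1 \<tau>1 x w 0))"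
    by (simp add: L1.jet_coord[OF UW1 jpull_jet[OF xx(5) \<beta>]])
  also have "\<dots> = \<tau>2 (b x) (\<beta> (dmap x (L1.coord_der U1 \<phi>1 \<tau>1 x w 0))) / mult \<tau>1 \<tau>2 x"
    using inv_B_triv[OF A x jet_fibre[OF b_points[OF xx(5)] \<beta> dmap_derivation[OF xx(5) d]]] d by (simp add: jpull_def)
  finally show "L1.momentum U1 \<phi>1 \<tau>1 x (jpull x \<beta>) \<bullet> w =
      (L2.momentum U2 \<phi>2 \<tau>2 (b x) \<beta> \<bullet> frechet_derivative (brep U1 \<phi>1 \<phi>2) (at (\<phi>1 x)) w
        - frechet_derivative (mrep U1 \<phi>1 \<tau>1 \<tau>2) (at (\<phi>1 x)) w / mult \<tau>1 \<tau>2 x * \<tau>2 (b x) (\<beta> (eval_der L2 (b x))))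
      / mult \<tau>1 \<tau>2 x"
    unfolding dmap_coord[OF A x] L2.jet_coord[OF UW2 \<beta>] by simp
qed

end

section \<open>Brackets of sections that vanish on a jet prolongation\<close>

context canonical_jacobi
begin

lemma commutator_ident:
  assumes "a \<in> derivations L" shows "commutator ident_field a = (\<lambda>s x. 0)"
proof (intro ext)
  fix s x
  note f = derivations_fieldD[OF assms]
  show "commutator ident_field a s x = 0"
  proof (cases "s \<in> sections L")
    case True
    then show ?thesis using f(1) by (simp add: commutator_def ident_field_def)
  next
    case False
    have "a (\<lambda>_. 0) = (\<lambda>_. 0)"
    proof
      fix y show "a (\<lambda>_. 0) y = 0"
        using derivationsD(4)[OF f(3) sections_zero, of y 0] sectionsD(2)[OF f(1)[OF sections_zero], of y]
        by (cases "y \<in> points (base L)") auto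
    qed
    then show ?thesis using False f(2) sections_zero by (simp add: commutator_def ident_field_def)
  qed
qed

text \<open>\<open>vanishing_section s a\<close> vanishes on the image of the jet prolongation of \<open>s\<close>.\<close>

definition vanishing_section :: "('m \<Rightarrow> 'v) \<Rightarrow> (('m \<Rightarrow> 'v) \<Rightarrow> 'm \<Rightarrow> 'v) \<Rightarrow> 'm \<times> ((('m \<Rightarrow> 'v) \<Rightarrow> 'v) \<Rightarrow> 'v) \<Rightarrow> 'v"
  where "vanishing_section s a = (\<lambda>z. linear_section L a z - pi.pull (a s) z)"

context
  fixes s assumes s: "s \<in> sections L"
begin

lemma vanishing_section_section:
  assumes "a \<in> derivations L" "linear_section L a \<in> sections JL"
  shows "vanishing_section s a \<in> sections JL"
  unfolding vanishing_section_def
  by (intro pi.L1.sections_diff assms pi.pull_section derivations_fieldD(1)[OF assms(1)] s)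

lemma vanishing_section_at:
  assumes "a \<in> derivations L" "(q, \<alpha>) \<in> points JM"
  shows "vanishing_section s a (q, \<alpha>) = \<alpha> (\<lambda>s. a s q) - a s q"
  by (simp add: vanishing_section_def linear_section_at[OF assms(2)] base_section_at[OF assms(2) derivations_fieldD(1)[OF assms(1) s]])

lemma br_base_vanishing:
  assumes t: "t \<in> sections L" and a: "a \<in> derivations L" "linear_section L a \<in> sections JL"
  shows "br (pi.pull t) (vanishing_section s a) z = - pi.pull (a t) z"
proof -
  note as = derivations_fieldD(1)[OF a(1) s]
  have "br (pi.pull t) (vanishing_section s a) z = br (pi.pull t) (linear_section L a) z - br (pi.pull t) (pi.pull (a s)) z"
    unfolding vanishing_section_def
    using J.br_diff_right[OF pi.pull_section[OF t] a(2) pi.pull_section[OF as]] by simp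
  then show ?thesis
    using J.br_antisym[OF pi.pull_section[OF t] a(2), of z] br_linear_base[OF a(1) t] br_base_base[OF t as] by simp
qed

text \<open>At the jet of \<open>s\<close> the defining relations expand the bracket to
  \<open>[a, a'] s - a (a' s) + a' (a s)\<close>. It is essential that the bracket is taken at the
  jet of this same \<open>s\<close>, where the linear section of the commutator equals the
  commutator applied to \<open>s\<close>.\<close>

lemma br_vanishing:
  assumes a: "a \<in> derivations L" "linear_section L a \<in> sections JL"
    and a': "a' \<in> derivations L" "linear_section L a' \<in> sections JL" and z: "(q, jet L s q) \<in> points JM"
  shows "br (vanishing_section s a) (vanishing_section s a') (q, jet L s q) = 0"
proof -
  let ?z = "(q, jet L s q)"
  note as = derivations_fieldD(1)[OF a(1) s] and a's = derivations_fieldD(1)[OF a'(1) s]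
  have "br (vanishing_section s a) (vanishing_section s a') ?z =
      br (linear_section L a) (vanishing_section s a') ?z - br (pi.pull (a s)) (vanishing_section s a') ?z"
    using J.br_diff_left[OF a(2) pi.pull_section[OF as] vanishing_section_section[OF a']]
    by (simp add: vanishing_section_def)
  also have "br (pi.pull (a s)) (vanishing_section s a') ?z = - a' (a s) q"
    using br_base_vanishing[OF as a'] base_section_at[OF z derivations_fieldD(1)[OF a'(1) as]] by simp
  also have "br (linear_section L a) (vanishing_section s a') ?z =
      linear_section L (commutator a a') ?z - a (a' s) q"
    unfolding vanishing_section_def
    using J.br_diff_right[OF a(2) a'(2) pi.pull_section[OF a's]] br_linear_linear[OF a(1) a'(1)] br_linear_base[OF a(1) a's]
      base_section_at[OF z derivations_fieldD(1)[OF a(1) a's]] by simp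
  also have "linear_section L (commutator a a') ?z = commutator a a' s q"
    using linear_section_at[OF z] commutator_derivation[OF a(1) a'(1) jet_pointD(1)[OF z]] by (simp add: jet_def)
  finally show ?thesis by (simp add: commutator_def)
qed

text \<open>On base sections the linear part acts as the identity. On the linear section of
  \<open>a\<close> it contributes nothing, since \<open>a\<close> commutes with the identity, while
  \<open>- pi.pull s\<close> contributes \<open>a s\<close>, which is the value of that linear
  section at the jet of \<open>s\<close>.\<close>

lemma unit_hamiltonian:
  assumes z: "(q, jet L s q) \<in> points JM"
  shows "ham_der JL br (vanishing_section s ident_field) (q, jet L s q) = eval_der JL (q, jet L s q)"
proof -
  let ?z = "(q, jet L s q)" and ?V = "vanishing_section s ident_field"
  note q = jet_pointD[OF z]
  have zb: "?z \<in> points (base JL)" using z by simp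
  obtain U \<phi> where U: "(U, \<phi>) \<in> base L" "q \<in> U" using pointsE[OF q(1)] .
  obtain W \<tau> where W: "(W, \<tau>) \<in> trivs L" "q \<in> W" using trivE[OF q(1)] .
  obtain \<rho> where b: "bump (base L) q (U \<inter> W) \<rho>"
    using bump_exists[OF hmfd coord_open[OF U W], of q] U W by auto
  note I = ident_field_derivation ident_linear_section
  have V: "?V \<in> sections JL" by (rule vanishing_section_section[OF I])
  have Is: "ident_field t = t" if "t \<in> sections L" for t using that by (simp add: ident_field_def)
  have lin: "br ?V (linear_section L a) ?z = linear_section L a ?z"
    if a: "a \<in> derivations L" "linear_section L a \<in> sections JL" for a
  proof -
    have "br ?V (linear_section L a) ?z =
        br (linear_section L ident_field) (linear_section L a) ?z - br (pi.pull s) (linear_section L a) ?z"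
      unfolding vanishing_section_def Is[OF s]
      using J.br_diff_left[OF I(2) pi.pull_section[OF s] a(2)] by simp
    also have "br (linear_section L ident_field) (linear_section L a) ?z = 0"
      using br_linear_linear[OF I(1) a(1)] commutator_ident[OF a(1)] linear_section_at[OF z] jet_zero[OF z] by simp
    also have "br (pi.pull s) (linear_section L a) ?z = - a s q"
      using J.br_antisym[OF pi.pull_section[OF s] a(2), of ?z] br_linear_base[OF a(1) s]
        base_section_at[OF z derivations_fieldD(1)[OF a(1) s]] by simp
    also have "a s q = linear_section L a ?z"
      using linear_section_at[OF z] derivations_fieldD(3)[OF a(1) q(1)] by (simp add: jet_def)
    finally show ?thesis by simp
  qed
  let ?d = "\<lambda>t. ham_der JL br ?V ?z t - eval_der JL ?z t"
  have "?d = (\<lambda>_. 0)"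
  proof (rule jet_derivation_zero[OF z U W b])
    show "?d \<in> derivations_at JL ?z"
      by (rule pi.L1.derivations_at_diff[OF zb J.ham_der_derivation[OF zb V] pi.L1.eval_der_derivation[OF zb]])
    show "?d (pi.pull t) = 0" if t: "t \<in> sections L" for t
    proof -
      have "br ?V (pi.pull t) ?z = pi.pull t ?z"
        using J.br_diff_left[OF I(2) pi.pull_section[OF s] pi.pull_section[OF t]] br_linear_base[OF I(1) t]
          br_base_base[OF s t] by (simp add: vanishing_section_def Is s t)
      then show ?thesis using pi.pull_section[OF t] by (simp add: J.ham_der_at eval_der_def)
    qed
    show "?d (linear_section L (frame_field U \<phi> W \<tau> \<rho> w)) = 0" for w
      using lin[OF frame_field_derivation[OF U W b] frame_linear_section[OF U W b]] frame_linear_section[OF U W b]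
      by (simp add: J.ham_der_at eval_der_def)
    show "?d (linear_section L ident_field) = 0"
      using lin[OF I] I(2) by (simp add: J.ham_der_at eval_der_def)
  qed
  then show ?thesis by (simp add: fun_eq_iff)
qed

end

end

section \<open>The jet lift as a Legendrian submanifold\<close>

locale jet_lift_setup =
  Q1: canonical_jacobi L1 br1 + Q2: canonical_jacobi L2 br2 + F: bundle_factor L1 L2 b B
  for L1 :: "('m, 'e::finite_dim_inner, 'v::real_vector) line_bundle" and br1
    and L2 :: "('n, 'f::finite_dim_inner, 'w::real_vector) line_bundle" and br2 and b B +
  fixes br
  assumes product: "product_jacobi_structure (jet_line_bundle L1) br1 (jet_line_bundle L2) (op_bracket br2) br"
    and second_countable_base: "second_countable (atlas_topology (base L1))"
begin

sublocale P: bundle_pair "jet_line_bundle L1" "jet_line_bundle L2"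
  by (intro bundle_pair.intro hbundle.intro Q1.jet_line_bundle_hline_bundle Q2.jet_line_bundle_hline_bundle)

sublocale J: jacobi_bundle "line_product (jet_line_bundle L1) (jet_line_bundle L2)" br
  by (intro jacobi_bundle.intro hbundle.intro P.LP_hline_bundle jacobi_bundle_axioms.intro)
    (use product in \<open>simp add: product_jacobi_structure_def\<close>)

lemma br_P1_P1: "s \<in> sections Q1.JL \<Longrightarrow> s' \<in> sections Q1.JL \<Longrightarrow> br (P.P1.pull s) (P.P1.pull s') = P.P1.pull (br1 s s')"
  and br_P2_P2: "t \<in> sections Q2.JL \<Longrightarrow> t' \<in> sections Q2.JL \<Longrightarrow>
    br (P.P2.pull t) (P.P2.pull t') = P.P2.pull (op_bracket br2 t t')"
  and br_P1_P2: "s \<in> sections Q1.JL \<Longrightarrow> t \<in> sections Q2.JL \<Longrightarrow> br (P.P1.pull s) (P.P2.pull t) = (\<lambda>_. 0)"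
  using product unfolding product_jacobi_structure_def P.P1_pullback_eq P.P2_pullback_eq by blast+

lemma LP_full_hamiltonian: "full_hamiltonian P.LP br"
proof (rule P.product_full_hamiltonian[OF product Q1.canonical_full_hamiltonian])
  show "full_hamiltonian (jet_line_bundle L2) (op_bracket br2)"
    by (rule full_hamiltonian_op[OF Q2.pi.L1.hbundle_axioms Q2.canonical_full_hamiltonian])
      (simp add: Q2.J.br_minus_left)
  show "op_bracket br2 s r \<in> sections (jet_line_bundle L2)"
    if "s \<in> sections (jet_line_bundle L2)" "r \<in> sections (jet_line_bundle L2)" for s r
    using Q2.pi.L1.sections_minus[OF Q2.J.br_section[OF that]] by (simp add: op_bracket_def)
qed (rule Q1.J.br_section)

text \<open>At a point with isomorphism \<open>C\<close> this vanishes exactly when \<open>C\<close>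
  maps the value of \<open>s\<close> to that of \<open>t\<close>.\<close>

definition pair_section where "pair_section s t = (\<lambda>z. P.P1.pull s z - P.P2.pull t z)"

context
  fixes s t assumes st: "s \<in> sections Q1.JL" "t \<in> sections Q2.JL"
begin

lemma pair_section_section: "pair_section s t \<in> sections P.LP"
  unfolding pair_section_def by (intro P.P1.L1.sections_diff P.P1.pull_section P.P2.pull_section st)

lemma br_pair_P1:
  assumes s': "s' \<in> sections Q1.JL"
  shows "br (pair_section s t) (P.P1.pull s') = P.P1.pull (br1 s s')"
proof
  fix z
  note S = P.P1.pull_section[OF st(1)] P.P2.pull_section[OF st(2)] P.P1.pull_section[OF s']
  show "br (pair_section s t) (P.P1.pull s') z = P.P1.pull (br1 s s') z"
    unfolding pair_section_def
    using J.br_diff_left[OF S] J.br_antisym[OF S(2,3), of z] br_P1_P1[OF st(1) s'] br_P1_P2[OF s' st(2)] by simp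
qed

lemma br_pair_P2:
  assumes t': "t' \<in> sections Q2.JL"
  shows "br (pair_section s t) (P.P2.pull t') = P.P2.pull (br2 t t')"
proof
  fix z
  note S = P.P1.pull_section[OF st(1)] P.P2.pull_section[OF st(2)] P.P2.pull_section[OF t']
  show "br (pair_section s t) (P.P2.pull t') z = P.P2.pull (br2 t t') z"
    unfolding pair_section_def
    using J.br_diff_left[OF S] br_P2_P2[OF st(2) t'] br_P1_P2[OF st(1) t'] P.P2.pull_minus[OF Q2.J.br_section[OF st(2) t']]
    by (simp add: op_bracket_def)
qed

text \<open>The opposite bracket on the second factor supplies the minus sign that turns the bracket
  of two differences into a difference again; the signs of the two second components cancel each
  other, and the mixed brackets vanish.\<close>

lemma br_pair:
  assumes "s' \<in> sections Q1.JL" "t' \<in> sections Q2.JL"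
  shows "br (pair_section s t) (pair_section s' t') = pair_section (br1 s s') (br2 t t')"
proof -
  have "br (pair_section s t) (pair_section s' t') =
      (\<lambda>z. br (pair_section s t) (P.P1.pull s') z - br (pair_section s t) (P.P2.pull t') z)"
    unfolding pair_section_def[of s' t']
    by (rule J.br_diff_right[OF pair_section_section P.P1.pull_section[OF assms(1)] P.P2.pull_section[OF assms(2)]])
  then show ?thesis unfolding br_pair_P1[OF assms(1)] br_pair_P2[OF assms(2)] by (simp add: pair_section_def)
qed

end

section \<open>Parametrisation and smooth structure of the jet lift\<close>

definition Bext :: "'m \<Rightarrow> 'v \<Rightarrow> 'w"
  where "Bext q = (\<lambda>l. if l \<in> fibre L1 q then B q l else 0)"

text \<open>The parameters are the point \<open>q\<close> and the second jet \<beta>; the first jet,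
  the second base point and the isomorphism are determined by them.\<close>

definition lift where "lift q \<beta> = ((q, F.jpull q \<beta>), (b q, \<beta>), Bext q)"

abbreviation "S \<equiv> jet_lift L1 L2 b B"

lemma lift_BP:
  assumes q: "q \<in> points (base L1)" and \<beta>: "\<beta> \<in> jets_at L2 (b q)" shows "lift q \<beta> \<in> points P.BP"
proof -
  note iso = F.B_iso[OF q] and sub = Q1.fibre_subspace[OF q]
  have "bij_betw (Bext q) (fibre L1 q) (fibre L2 (b q))"
    using iso by (subst bij_betw_cong[where g = "B q"]) (auto simp: Bext_def linear_iso_def)
  then have "linear_iso (fibre L1 q) (fibre L2 (b q)) (Bext q)"
    using linear_isoD[OF iso] subspace_add[OF sub] subspace_scale[OF sub] by (simp add: linear_iso_def Bext_def)
  then show ?thesis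
    using q \<beta> F.jpull_jet[OF q \<beta>] F.b_points[OF q]
    by (simp add: lift_def P.BP_points P.fibre_iso_def Q1.JM_points Q2.JM_points Bext_def)
qed

lemma S_iff: "z \<in> S \<longleftrightarrow> (\<exists>q\<in>points (base L1). \<exists>\<beta>\<in>jets_at L2 (b q). z = lift q \<beta>)"
proof
  assume "z \<in> S"
  then obtain q \<alpha> q2 \<beta> C where z: "z = ((q, \<alpha>), (q2, \<beta>), C)" "((q, \<alpha>), (q2, \<beta>), C) \<in> points P.BP" "q2 = b q"
    "\<And>a. a \<in> derivations_at L1 q \<Longrightarrow> \<alpha> a = inv_into (fibre L1 q) (B q) (\<beta> (F.dmap q a))"
    "\<And>l. l \<in> fibre L1 q \<Longrightarrow> C l = B q l"
    unfolding jet_lift_def by blast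
  have q: "q \<in> points (base L1)" "\<alpha> \<in> jets_at L1 q" "\<beta> \<in> jets_at L2 (b q)" "\<And>l. l \<notin> fibre L1 q \<Longrightarrow> C l = 0"
    using z(2,3) by (auto simp: P.BP_points Q1.JM_points Q2.JM_points P.fibre_iso_def)
  have "\<alpha> = F.jpull q \<beta>" using z(4) q(2) by (auto simp: F.jpull_def jets_at_def Hom_def)
  moreover have "C = Bext q" using z(5) q(4) by (auto simp: Bext_def)
  ultimately have "z = lift q \<beta>" using z by (simp add: lift_def)
  then show "\<exists>q\<in>points (base L1). \<exists>\<beta>\<in>jets_at L2 (b q). z = lift q \<beta>" using q by blast
next
  assume "\<exists>q\<in>points (base L1). \<exists>\<beta>\<in>jets_at L2 (b q). z = lift q \<beta>"
  then obtain q \<beta> where q: "q \<in> points (base L1)" "\<beta> \<in> jets_at L2 (b q)" "z = lift q \<beta>" by blast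
  then show "z \<in> S" using lift_BP[OF q(1,2)] unfolding jet_lift_def by (auto simp: lift_def F.jpull_def Bext_def)
qed

definition cdom where "cdom U1 W1 U2 W2 =
  P.pdom (Q1.jdom U1 W1) (points Q1.JM \<inter> fst -` W1) (Q2.jdom U2 W2) (points Q2.JM \<inter> fst -` W2)"

definition cchart where "cchart U1 \<phi>1 \<tau>1 U2 \<phi>2 \<tau>2 =
  P.pchart (Q1.jchart U1 \<phi>1 \<tau>1) (\<lambda>z. \<tau>1 (fst z)) (Q2.jchart U2 \<phi>2 \<tau>2) (\<lambda>z. \<tau>2 (fst z))"

text \<open>The jet lift is a graph over the base point \<open>q\<close> and the fibre coordinates of the second jet.\<close>

definition cpr :: "('e \<times> 'e \<times> real) \<times> ('f \<times> 'f \<times> real) \<times> real \<Rightarrow> 'e \<times> 'f \<times> real"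
  where "cpr v = (fst (fst v), snd (fst (snd v)))"

lemma cpr_bounded_linear: "bounded_linear cpr"
  unfolding cpr_def
  by (intro bounded_linear_Pair bounded_linear_compose[OF bounded_linear_fst] bounded_linear_compose[OF bounded_linear_snd]
      bounded_linear_fst bounded_linear_snd bounded_linear_ident)

definition charts where "charts = {(cdom U1 W1 U2 W2, cchart U1 \<phi>1 \<tau>1 U2 \<phi>2 \<tau>2) |U1 \<phi>1 W1 \<tau>1 U2 \<phi>2 W2 \<tau>2.
  (U1, \<phi>1) \<in> base L1 \<and> (W1, \<tau>1) \<in> trivs L1 \<and> (U2, \<phi>2) \<in> base L2 \<and> (W2, \<tau>2) \<in> trivs L2}"

lemma chartsE:
  assumes "(V, \<Phi>) \<in> charts"
  obtains U1 \<phi>1 W1 \<tau>1 U2 \<phi>2 W2 \<tau>2 where "(U1, \<phi>1) \<in> base L1" "(W1, \<tau>1) \<in> trivs L1" "(U2, \<phi>2) \<in> base L2"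
    "(W2, \<tau>2) \<in> trivs L2" "V = cdom U1 W1 U2 W2" "\<Phi> = cchart U1 \<phi>1 \<tau>1 U2 \<phi>2 \<tau>2"
  using assms unfolding charts_def by blast

lemma charts_BP: "charts \<subseteq> P.BP"
proof
  fix c assume "c \<in> charts"
  then obtain U1 \<phi>1 W1 \<tau>1 U2 \<phi>2 W2 \<tau>2 where c: "(U1, \<phi>1) \<in> base L1" "(W1, \<tau>1) \<in> trivs L1" "(U2, \<phi>2) \<in> base L2"
    "(W2, \<tau>2) \<in> trivs L2" "c = (cdom U1 W1 U2 W2, cchart U1 \<phi>1 \<tau>1 U2 \<phi>2 \<tau>2)"
    unfolding charts_def by blast
  have "(Q1.jdom U1 W1, Q1.jchart U1 \<phi>1 \<tau>1) \<in> base Q1.JL" "(points Q1.JM \<inter> fst -` W1, \<lambda>z. \<tau>1 (fst z)) \<in> trivs Q1.JL"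
    "(Q2.jdom U2 W2, Q2.jchart U2 \<phi>2 \<tau>2) \<in> base Q2.JL" "(points Q2.JM \<inter> fst -` W2, \<lambda>z. \<tau>2 (fst z)) \<in> trivs Q2.JL"
    using c unfolding Q1.JL_simps Q2.JL_simps Q1.JM_chart_iff Q2.JM_chart_iff Q1.JL_trivs Q2.JL_trivs by blast+
  then show "c \<in> P.BP" unfolding P.BP_chart_iff c(5) cdom_def cchart_def by blast
qed

context
  fixes U1 \<phi>1 W1 \<tau>1 U2 \<phi>2 W2 \<tau>2
  assumes U1: "(U1, \<phi>1) \<in> base L1" and W1: "(W1, \<tau>1) \<in> trivs L1"
    and U2: "(U2, \<phi>2) \<in> base L2" and W2: "(W2, \<tau>2) \<in> trivs L2"
begin

lemma charts_mem: "(cdom U1 W1 U2 W2, cchart U1 \<phi>1 \<tau>1 U2 \<phi>2 \<tau>2) \<in> charts"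
  using U1 W1 U2 W2 unfolding charts_def by blast

lemma lift_cdom:
  assumes q: "q \<in> points (base L1)" and \<beta>: "\<beta> \<in> jets_at L2 (b q)"
  shows "lift q \<beta> \<in> cdom U1 W1 U2 W2 \<longleftrightarrow> q \<in> F.bdom U1 W1 U2 W2"
  using lift_BP[OF q \<beta>] q \<beta> F.jpull_jet[OF q \<beta>]
  by (auto simp: cdom_def P.pdom_def lift_def P.BP_points Q1.jdom_def Q2.jdom_def Q1.JM_points Q2.JM_points F.bdom_def)

lemma cdom_S: "z \<in> cdom U1 W1 U2 W2 \<inter> S \<longleftrightarrow> (\<exists>q\<in>F.bdom U1 W1 U2 W2. \<exists>\<beta>\<in>jets_at L2 (b q). z = lift q \<beta>)"
  using lift_cdom F.bdomD(5)[OF U1 W1 U2 W2] by (auto simp: S_iff)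

lemma cchart_lift:
  assumes q: "q \<in> F.bdom U1 W1 U2 W2"
  shows "cchart U1 \<phi>1 \<tau>1 U2 \<phi>2 \<tau>2 (lift q \<beta>) =
    ((\<phi>1 q, Q1.momentum U1 \<phi>1 \<tau>1 q (F.jpull q \<beta>), \<tau>1 q (F.jpull q \<beta> (eval_der L1 q))),
     (\<phi>2 (b q), Q2.momentum U2 \<phi>2 \<tau>2 (b q) \<beta>, \<tau>2 (b q) (\<beta> (eval_der L2 (b q)))), F.mult \<tau>1 \<tau>2 q)"
proof -
  have "unit_vec Q1.JL (\<lambda>z. \<tau>1 (fst z)) (q, F.jpull q \<beta>) = unit_vec L1 \<tau>1 q" by (simp add: unit_vec_def)
  then show ?thesis
    using Q1.unit_in[OF W1 F.bdomD(2)[OF U1 W1 U2 W2 q]]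
    by (simp add: cchart_def P.pchart_def lift_def Q1.jchart_def Q2.jchart_def Bext_def F.mult_def)
qed

lemma cpr_lift:
  assumes q: "q \<in> F.bdom U1 W1 U2 W2"
  shows "cpr (cchart U1 \<phi>1 \<tau>1 U2 \<phi>2 \<tau>2 (lift q \<beta>)) =
    (\<phi>1 q, Q2.momentum U2 \<phi>2 \<tau>2 (b q) \<beta>, \<tau>2 (b q) (\<beta> (eval_der L2 (b q))))"
  by (simp add: cchart_lift[OF q] cpr_def)

lemma cpr_image:
  "(\<lambda>z. cpr (cchart U1 \<phi>1 \<tau>1 U2 \<phi>2 \<tau>2 z)) ` (cdom U1 W1 U2 W2 \<inter> S) = \<phi>1 ` F.bdom U1 W1 U2 W2 \<times> UNIV"
proof (intro equalityI subsetI)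
  fix y assume "y \<in> (\<lambda>z. cpr (cchart U1 \<phi>1 \<tau>1 U2 \<phi>2 \<tau>2 z)) ` (cdom U1 W1 U2 W2 \<inter> S)"
  then obtain z where z: "z \<in> cdom U1 W1 U2 W2 \<inter> S" "y = cpr (cchart U1 \<phi>1 \<tau>1 U2 \<phi>2 \<tau>2 z)" by blast
  then obtain q \<beta> where "q \<in> F.bdom U1 W1 U2 W2" "y = cpr (cchart U1 \<phi>1 \<tau>1 U2 \<phi>2 \<tau>2 (lift q \<beta>))"
    using cdom_S[THEN iffD1, OF z(1)] by blast
  then show "y \<in> \<phi>1 ` F.bdom U1 W1 U2 W2 \<times> UNIV" by (simp add: cpr_lift)
next
  fix y assume "y \<in> \<phi>1 ` F.bdom U1 W1 U2 W2 \<times> (UNIV :: ('f \<times> real) set)"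
  then obtain q p u where q: "q \<in> F.bdom U1 W1 U2 W2" "y = (\<phi>1 q, p, u)" by auto
  note qq = F.bdomD[OF U1 W1 U2 W2 q(1)]
  obtain \<beta> where \<beta>: "\<beta> \<in> jets_at L2 (b q)" "Q2.momentum U2 \<phi>2 \<tau>2 (b q) \<beta> = p" "\<tau>2 (b q) (\<beta> (eval_der L2 (b q))) = u"
    using Q2.jet_with_coords[OF U2 qq(3) W2 qq(4)] .
  have "lift q \<beta> \<in> cdom U1 W1 U2 W2 \<inter> S" using q(1) \<beta>(1) cdom_S by blast
  moreover have "y = cpr (cchart U1 \<phi>1 \<tau>1 U2 \<phi>2 \<tau>2 (lift q \<beta>))" using q \<beta> by (simp add: cpr_lift)
  ultimately show "y \<in> (\<lambda>z. cpr (cchart U1 \<phi>1 \<tau>1 U2 \<phi>2 \<tau>2 z)) ` (cdom U1 W1 U2 W2 \<inter> S)" by (rule rev_image_eqI)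
qed

lemma cpr_image_open: "open ((\<lambda>z. cpr (cchart U1 \<phi>1 \<tau>1 U2 \<phi>2 \<tau>2 z)) ` (cdom U1 W1 U2 W2 \<inter> S))"
  unfolding cpr_image by (intro open_Times F.bdom_image_open[OF U1 W1 U2 W2] open_UNIV)

text \<open>The remaining coordinates are explicit: momentum and value of the first jet by
  \<open>jpull_coords\<close>, the second base point by \<open>brep\<close>, the scale by
  \<open>mrep\<close>. The momentum is assembled from components because \<open>jpull_coords\<close>
  gives its inner products.\<close>

lemma cchart_graph:
  "\<exists>G. smooth_on ((\<lambda>z. cpr (cchart U1 \<phi>1 \<tau>1 U2 \<phi>2 \<tau>2 z)) ` (cdom U1 W1 U2 W2 \<inter> S)) G \<and>
    (\<forall>z\<in>cdom U1 W1 U2 W2 \<inter> S. G (cpr (cchart U1 \<phi>1 \<tau>1 U2 \<phi>2 \<tau>2 z)) = cchart U1 \<phi>1 \<tau>1 U2 \<phi>2 \<tau>2 z)"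
proof -
  note A = U1 W1 U2 W2
  let ?O = "\<phi>1 ` F.bdom U1 W1 U2 W2"
  let ?I = "?O \<times> (UNIV :: ('f \<times> real) set)"
  have oO: "open ?O" by (rule F.bdom_image_open[OF A])
  have oI: "open ?I" by (intro open_Times oO open_UNIV)
  define bh where "bh = F.brep U1 \<phi>1 \<phi>2"
  define mh where "mh = F.mrep U1 \<phi>1 \<tau>1 \<tau>2"
  define p1 where "p1 = (\<lambda>z :: 'e \<times> 'f \<times> real. \<Sum>e\<in>onb. ((fst (snd z) \<bullet> frechet_derivative bh (at (fst z)) e
    - frechet_derivative mh (at (fst z)) e / mh (fst z) * snd (snd z)) / mh (fst z)) *\<^sub>R e)"
  define G where "G = (\<lambda>z :: 'e \<times> 'f \<times> real. ((fst z, p1 z, snd (snd z) / mh (fst z)), (bh (fst z), fst (snd z), snd (snd z)), mh (fst z)))"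
  have bs: "smooth_on ?O bh" unfolding bh_def by (rule F.brep_smooth[OF A])
  have ms: "smooth_on ?O mh" unfolding mh_def by (rule F.mrep_smooth[OF A])
  have m0: "mh (fst z) \<noteq> 0" if "z \<in> ?I" for z using that F.mrep_nonzero[OF A] by (auto simp: mh_def)
  note cf = smooth_on_fst_compose[OF oO open_UNIV, where 'b = "'f \<times> real"]
  note zs = smooth_on_fst[OF oI smooth_on_ident] smooth_on_snd[OF oI smooth_on_ident]
  note zz = smooth_on_fst[OF oI zs(2)] smooth_on_snd[OF oI zs(2)]
  have "smooth_on ?I p1"
    unfolding p1_def
    by (intro smooth_on_sum[OF oI] smooth_on_scaleR[OF oI] smooth_on_const smooth_on_divide[OF oI] smooth_on_diff[OF oI]
        smooth_on_mult[OF oI] smooth_on_inner[OF oI] zz cf[OF ms] cf[OF smooth_on_frechet_derivative[OF bs]]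
        cf[OF smooth_on_frechet_derivative[OF ms]] m0)
  then have "smooth_on ?I G"
    unfolding G_def
    by (intro smooth_on_Pair[OF oI] smooth_on_divide[OF oI] zs zz cf[OF ms] cf[OF bs] m0)
  moreover have "G (cpr (cchart U1 \<phi>1 \<tau>1 U2 \<phi>2 \<tau>2 z)) = cchart U1 \<phi>1 \<tau>1 U2 \<phi>2 \<tau>2 z" if zS: "z \<in> cdom U1 W1 U2 W2 \<inter> S" for z
  proof -
    obtain q \<beta> where q: "q \<in> F.bdom U1 W1 U2 W2" "\<beta> \<in> jets_at L2 (b q)" "z = lift q \<beta>" using cdom_S[THEN iffD1, OF zS] by blast
    note c = F.jpull_coords[OF A q(1,2)]
    let ?z = "(\<phi>1 q, Q2.momentum U2 \<phi>2 \<tau>2 (b q) \<beta>, \<tau>2 (b q) (\<beta> (eval_der L2 (b q))))"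
    have mq: "mh (\<phi>1 q) = F.mult \<tau>1 \<tau>2 q" "bh (\<phi>1 q) = \<phi>2 (b q)"
      unfolding mh_def bh_def by (rule F.mrep_at[OF A q(1)]) (rule F.brep_at[OF A q(1)])
    have "Q1.momentum U1 \<phi>1 \<tau>1 q (F.jpull q \<beta>) = (\<Sum>e\<in>onb. (Q1.momentum U1 \<phi>1 \<tau>1 q (F.jpull q \<beta>) \<bullet> e) *\<^sub>R e)"
      by (rule onb_expansion)
    then have "Q1.momentum U1 \<phi>1 \<tau>1 q (F.jpull q \<beta>) = p1 ?z"
      unfolding c(2) by (simp add: p1_def mq bh_def[symmetric] mh_def[symmetric])
    then show ?thesis
      unfolding q(3) cpr_lift[OF q(1)] unfolding cchart_lift[OF q(1)] by (simp add: G_def mq c(1))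
  qed
  ultimately show ?thesis unfolding cpr_image by blast
qed

end

sublocale G: graph_submanifold "base_product (jet_line_bundle L1) (jet_line_bundle L2)" charts S cpr
proof (rule graph_submanifold.intro)
  show "hmanifold P.BP" by (rule P.BP_hmanifold)
  show "charts \<subseteq> P.BP" by (rule charts_BP)
  show "bounded_linear cpr" by (rule cpr_bounded_linear)
  show "\<exists>(U, \<phi>)\<in>charts. z \<in> U" if z: "z \<in> S" for z
  proof -
    obtain q \<beta> where q: "q \<in> points (base L1)" "\<beta> \<in> jets_at L2 (b q)" "z = lift q \<beta>" using z S_iff by blast
    obtain U1 \<phi>1 where U1: "(U1, \<phi>1) \<in> base L1" "q \<in> U1" using pointsE[OF q(1)] .
    obtain W1 \<tau>1 where W1: "(W1, \<tau>1) \<in> trivs L1" "q \<in> W1" using Q1.trivE[OF q(1)] .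
    obtain U2 \<phi>2 where U2: "(U2, \<phi>2) \<in> base L2" "b q \<in> U2" using pointsE[OF F.b_points[OF q(1)]] .
    obtain W2 \<tau>2 where W2: "(W2, \<tau>2) \<in> trivs L2" "b q \<in> W2" using Q2.trivE[OF F.b_points[OF q(1)]] .
    have "z \<in> cdom U1 W1 U2 W2"
      using lift_cdom[OF U1(1) W1(1) U2(1) W2(1) q(1,2)] q U1 W1 U2 W2 by (simp add: F.bdom_def)
    then show ?thesis using charts_mem[OF U1(1) W1(1) U2(1) W2(1)] by blast
  qed
  fix V \<Phi> assume "(V, \<Phi>) \<in> charts"
  then obtain U1 \<phi>1 W1 \<tau>1 U2 \<phi>2 W2 \<tau>2 where c: "(U1, \<phi>1) \<in> base L1" "(W1, \<tau>1) \<in> trivs L1" "(U2, \<phi>2) \<in> base L2"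
    "(W2, \<tau>2) \<in> trivs L2" "V = cdom U1 W1 U2 W2" "\<Phi> = cchart U1 \<phi>1 \<tau>1 U2 \<phi>2 \<tau>2" by (rule chartsE)
  show "open ((\<lambda>x. cpr (\<Phi> x)) ` (V \<inter> S))" unfolding c(5,6) by (rule cpr_image_open[OF c(1-4)])
  show "\<exists>G. smooth_on ((\<lambda>x. cpr (\<Phi> x)) ` (V \<inter> S)) G \<and> (\<forall>x\<in>V \<inter> S. G (cpr (\<Phi> x)) = \<Phi> x)"
    unfolding c(5,6) by (rule cchart_graph[OF c(1-4)])
qed

text \<open>The base of \<open>L1\<close> is second countable, hence Lindelof, so countably many
  domains \<open>bdom\<close> cover it. A chart of the jet lift contains the whole fibres over its
  domain, so the corresponding charts cover the jet lift.\<close>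

lemma SA_second_countable: "second_countable (atlas_topology G.SA)"
proof -
  define adm where "adm = (\<lambda>((U1, \<phi>1), (W1, \<tau>1), (U2, \<phi>2), (W2, \<tau>2)). ((U1, \<phi>1) :: 'm set \<times> ('m \<Rightarrow> 'e)) \<in> base L1 \<and>
    ((W1, \<tau>1) :: 'm set \<times> ('m \<Rightarrow> 'v \<Rightarrow> real)) \<in> trivs L1 \<and> ((U2, \<phi>2) :: 'n set \<times> ('n \<Rightarrow> 'f)) \<in> base L2 \<and>
    ((W2, \<tau>2) :: 'n set \<times> ('n \<Rightarrow> 'w \<Rightarrow> real)) \<in> trivs L2)"
  define dom where "dom = (\<lambda>((U1, \<phi>1 :: 'm \<Rightarrow> 'e), (W1, \<tau>1 :: 'm \<Rightarrow> 'v \<Rightarrow> real), (U2, \<phi>2 :: 'n \<Rightarrow> 'f), (W2, \<tau>2 :: 'n \<Rightarrow> 'w \<Rightarrow> real)). F.bdom U1 W1 U2 W2)"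
  define chart where "chart = (\<lambda>((U1, \<phi>1), (W1, \<tau>1), (U2, \<phi>2), (W2, \<tau>2)).
    (cdom U1 W1 U2 W2 \<inter> S, \<lambda>z. cpr (cchart U1 \<phi>1 \<tau>1 U2 \<phi>2 \<tau>2 z)))"
  define \<O> where "\<O> = dom ` Collect adm"
  have op: "aopen (base L1) T" if "T \<in> \<O>" for T
    using that F.bdom_open by (auto simp: \<O>_def adm_def dom_def)
  have "points (base L1) \<subseteq> \<Union>\<O>"
  proof
    fix q assume q: "q \<in> points (base L1)"
    obtain U1 \<phi>1 where U1: "(U1, \<phi>1) \<in> base L1" "q \<in> U1" using pointsE[OF q] .
    obtain W1 \<tau>1 where W1: "(W1, \<tau>1) \<in> trivs L1" "q \<in> W1" using Q1.trivE[OF q] .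
    obtain U2 \<phi>2 where U2: "(U2, \<phi>2) \<in> base L2" "b q \<in> U2" using pointsE[OF F.b_points[OF q]] .
    obtain W2 \<tau>2 where W2: "(W2, \<tau>2) \<in> trivs L2" "b q \<in> W2" using Q2.trivE[OF F.b_points[OF q]] .
    have "q \<in> dom ((U1, \<phi>1), (W1, \<tau>1), (U2, \<phi>2), (W2, \<tau>2))" "adm ((U1, \<phi>1), (W1, \<tau>1), (U2, \<phi>2), (W2, \<tau>2))"
      using q U1 W1 U2 W2 by (simp_all add: dom_def adm_def F.bdom_def)
    then show "q \<in> \<Union>\<O>" unfolding \<O>_def by blast
  qed
  then obtain \<V> where V: "countable \<V>" "\<V> \<subseteq> \<O>" "points (base L1) \<subseteq> \<Union>\<V>"
    using second_countable_imp_Lindelof_space[OF second_countable_base] op unfolding Lindelof_space_alt topspace_atlas by meson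
  have "\<forall>T\<in>\<V>. \<exists>c. adm c \<and> T = dom c" using V(2) unfolding \<O>_def by blast
  then obtain pick where pick: "\<And>T. T \<in> \<V> \<Longrightarrow> adm (pick T) \<and> T = dom (pick T)" by metis
  show ?thesis
  proof (rule second_countable_atlas[OF G.SA_charted, of "(\<lambda>T. chart (pick T)) ` \<V>"])
    show "countable ((\<lambda>T. chart (pick T)) ` \<V>)" using V(1) by simp
    have "chart c \<in> G.SA" if "adm c" for c
      using that G.SA_chart[OF charts_mem] by (auto simp: adm_def chart_def)
    then show "(\<lambda>T. chart (pick T)) ` \<V> \<subseteq> G.SA" using pick by blast
    show "points G.SA \<subseteq> (\<Union>(U, \<phi>)\<in>(\<lambda>T. chart (pick T)) ` \<V>. U)"
    proof
      fix z assume "z \<in> points G.SA"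
      then have zS: "z \<in> S" by (simp add: G.SA_points)
      then obtain q \<beta> where q: "q \<in> points (base L1)" "\<beta> \<in> jets_at L2 (b q)" "z = lift q \<beta>" using S_iff by blast
      obtain T where T: "T \<in> \<V>" "q \<in> T" using V(3) q(1) by blast
      obtain U1 \<phi>1 W1 \<tau>1 U2 \<phi>2 W2 \<tau>2 where c: "pick T = ((U1, \<phi>1), (W1, \<tau>1), (U2, \<phi>2), (W2, \<tau>2))"
        by (metis prod.exhaust)
      have A: "(U1, \<phi>1) \<in> base L1" "(W1, \<tau>1) \<in> trivs L1" "(U2, \<phi>2) \<in> base L2" "(W2, \<tau>2) \<in> trivs L2" "q \<in> F.bdom U1 W1 U2 W2"
        using pick[OF T(1)] T(2) by (auto simp: c adm_def dom_def)
      then have "z \<in> fst (chart (pick T))" using lift_cdom[OF A(1-4) q(1,2)] zS q(3) by (simp add: c chart_def)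
      then show "z \<in> (\<Union>(U, \<phi>)\<in>(\<lambda>T. chart (pick T)) ` \<V>. U)" using T(1) by force
    qed
  qed
qed

lemma embedded: "embedded_submanifold (base P.LP) G.SA"
  using G.SA_embedded[OF SA_second_countable] by simp

end

text \<open>Each term of the product rule keeps a factor that vanishes at \<open>x\<close>. This is
  the source of the first-order vanishing of the frame generators along the jet lift.\<close>

lemma has_derivative_inner_zero:
  fixes f g :: "'a::real_normed_vector \<Rightarrow> 'b::real_inner"
  assumes f: "f differentiable at x" "f x = 0" and g: "g differentiable at x" "g x = 0"
  shows "((\<lambda>y. f y \<bullet> g y) has_derivative (\<lambda>_. 0)) (at x)"
proof -
  obtain f' g' where "(f has_derivative f') (at x)" "(g has_derivative g') (at x)"
    using f(1) g(1) unfolding differentiable_def by blast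
  from has_derivative_inner[OF this] show ?thesis using f(2) g(2) by simp
qed

lemma has_derivative_divide_zero:
  fixes f g :: "'a::real_normed_vector \<Rightarrow> real"
  assumes f: "(f has_derivative (\<lambda>_. 0)) (at x)" "f x = 0" and g: "g differentiable at x" "g x \<noteq> 0"
  shows "((\<lambda>y. f y / g y) has_derivative (\<lambda>_. 0)) (at x)"
proof -
  obtain g' where "(g has_derivative g') (at x)" using g(1) unfolding differentiable_def by blast
  from has_derivative_divide'[OF f(1) this g(2)] show ?thesis using f(2) by simp
qed

section \<open>Restriction to the jet lift and the generating sections\<close>

context jet_lift_setup
begin

abbreviation "LS \<equiv> pullback_bundle G.SA (\<lambda>x. x) P.LP"

lemma LS_simps [simp]: "base LS = G.SA" "fibre LS z = fibre L1 (fst (fst z))"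
  by (simp_all add: pullback_bundle_def)

lemma LS_trivs: "(W, \<tau>) \<in> trivs P.LP \<Longrightarrow> (S \<inter> W, \<tau>) \<in> trivs LS"
  unfolding pullback_bundle_def by (auto simp: G.SA_points)

sublocale I: bundle_factor "pullback_bundle G.SA (\<lambda>x. x) (line_product (jet_line_bundle L1) (jet_line_bundle L2))"
  "line_product (jet_line_bundle L1) (jet_line_bundle L2)" "\<lambda>x. x" "\<lambda>_ l. l"
  by (intro bundle_factor.intro hbundle.intro bundle_factor_axioms.intro P.LP_hline_bundle
      hline_bundle_pullback[OF P.LP_hline_bundle G.SA_hmanifold]) (simp_all add: G.SA_inclusion_smooth)

lemma B_diff: "x \<in> points (base L1) \<Longrightarrow> u \<in> fibre L1 x \<Longrightarrow> v \<in> fibre L1 x \<Longrightarrow> B x (u - v) = B x u - B x v"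
  using F.B_lin(1)[of x u "- v"] F.B_minus[of x v] subspace_neg[OF Q1.fibre_subspace] by simp

definition gen1 where "gen1 t = pair_section (Q1.pi.pull (F.pull t)) (Q2.pi.pull t)"
definition gen2 where "gen2 s A Z = pair_section (Q1.vanishing_section (F.pull s) A) (Q2.vanishing_section s Z)"

text \<open>The relation between \<open>A\<close> and \<open>Z\<close> is kept apart from this
  predicate: it is imposed at a single point, while nearby both fields enter through explicit
  coefficients.\<close>

definition linear_pair where "linear_pair A Z \<longleftrightarrow> A \<in> derivations L1 \<and> linear_section L1 A \<in> sections Q1.JL \<and>
  Z \<in> derivations L2 \<and> linear_section L2 Z \<in> sections Q2.JL"

lemma linear_pairD:
  assumes "linear_pair A Z"
  shows "A \<in> derivations L1" "linear_section L1 A \<in> sections Q1.JL" "Z \<in> derivations L2" "linear_section L2 Z \<in> sections Q2.JL"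
  using assms by (auto simp: linear_pair_def)

lemma linear_pair_ident: "linear_pair Q1.ident_field Q2.ident_field"
  by (simp add: linear_pair_def Q1.ident_field_derivation Q2.ident_field_derivation Q1.ident_linear_section Q2.ident_linear_section)

lemma gen1_sections:
  assumes "t \<in> sections L2"
  shows "Q1.pi.pull (F.pull t) \<in> sections Q1.JL" "Q2.pi.pull t \<in> sections Q2.JL" "gen1 t \<in> sections P.LP"
  unfolding gen1_def by (intro pair_section_section Q1.pi.pull_section Q2.pi.pull_section F.pull_section assms)+

lemma gen2_sections:
  assumes s: "s \<in> sections L2" and AZ: "linear_pair A Z"
  shows "Q1.vanishing_section (F.pull s) A \<in> sections Q1.JL" "Q2.vanishing_section s Z \<in> sections Q2.JL" "gen2 s A Z \<in> sections P.LP"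
  unfolding gen2_def
  by (intro pair_section_section Q1.vanishing_section_section Q2.vanishing_section_section F.pull_section s linear_pairD[OF AZ])+

context
  fixes q \<beta> assumes q: "q \<in> points (base L1)" and \<beta>: "\<beta> \<in> jets_at L2 (b q)"
begin

lemma lift_points: "lift q \<beta> \<in> points (base P.LP)" "lift q \<beta> \<in> S"
  "(q, F.jpull q \<beta>) \<in> points Q1.JM" "(b q, \<beta>) \<in> points Q2.JM"
proof -
  show "lift q \<beta> \<in> points (base P.LP)" using lift_BP[OF q \<beta>] by simp
  show "lift q \<beta> \<in> S" using S_iff q \<beta> by blast
  show "(q, F.jpull q \<beta>) \<in> points Q1.JM" "(b q, \<beta>) \<in> points Q2.JM"
    using q \<beta> F.jpull_jet[OF q \<beta>] F.b_points[OF q] by (simp_all add: Q1.JM_points Q2.JM_points)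
qed

lemma P1_pull_lift: "u \<in> sections Q1.JL \<Longrightarrow> P.P1.pull u (lift q \<beta>) = u (q, F.jpull q \<beta>)"
  using P.P1.B_pull[OF lift_points(1), of u] by (simp add: lift_def)

lemma P2_pull_lift:
  assumes v: "v \<in> sections Q2.JL"
  shows "P.P2.pull v (lift q \<beta>) \<in> fibre L1 q" "B q (P.P2.pull v (lift q \<beta>)) = v (b q, \<beta>)"
proof -
  show f: "P.P2.pull v (lift q \<beta>) \<in> fibre L1 q" using P.P2.pull_fibre[OF lift_points(1) v] by (simp add: lift_def)
  show "B q (P.P2.pull v (lift q \<beta>)) = v (b q, \<beta>)"
    using P.P2.B_pull[OF lift_points(1) v] f by (simp add: lift_def Bext_def)
qed

lemma pair_section_lift:
  assumes u: "u \<in> sections Q1.JL" and v: "v \<in> sections Q2.JL"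
  shows "pair_section u v (lift q \<beta>) \<in> fibre L1 q"
    "B q (pair_section u v (lift q \<beta>)) = B q (u (q, F.jpull q \<beta>)) - v (b q, \<beta>)"
    "B q (u (q, F.jpull q \<beta>)) = v (b q, \<beta>) \<Longrightarrow> pair_section u v (lift q \<beta>) = 0"
proof -
  have uf: "u (q, F.jpull q \<beta>) \<in> fibre L1 q"
    using Q1.pi.L1.sectionsD(1)[OF u, of "(q, F.jpull q \<beta>)"] lift_points(3) by simp
  note v2 = P2_pull_lift[OF v]
  show f: "pair_section u v (lift q \<beta>) \<in> fibre L1 q"
    using subspace_diff[OF Q1.fibre_subspace[OF q] uf v2(1)] by (simp add: pair_section_def P1_pull_lift[OF u])
  show e: "B q (pair_section u v (lift q \<beta>)) = B q (u (q, F.jpull q \<beta>)) - v (b q, \<beta>)"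
    by (simp add: pair_section_def P1_pull_lift[OF u] B_diff[OF q uf v2(1)] v2(2))
  show "pair_section u v (lift q \<beta>) = 0" if "B q (u (q, F.jpull q \<beta>)) = v (b q, \<beta>)"
    by (rule F.B_inj[OF q f]) (use e that F.B_0[OF q] subspace_0[OF Q1.fibre_subspace[OF q]] in auto)
qed

lemma gen1_lift:
  assumes t: "t \<in> sections L2" shows "gen1 t (lift q \<beta>) = 0"
  unfolding gen1_def
  by (rule pair_section_lift(3)[OF gen1_sections(1,2)[OF t]])
    (simp add: Q1.base_section_at[OF lift_points(3) F.pull_section[OF t]] Q2.base_section_at[OF lift_points(4) t] F.B_pull[OF q t])

lemma gen2_lift:
  assumes s: "s \<in> sections L2" and AZ: "linear_pair A Z"
  shows "B q (gen2 s A Z (lift q \<beta>)) = \<beta> (F.dmap q (\<lambda>s. A s q)) - F.dmap q (\<lambda>s. A s q) s - (\<beta> (\<lambda>s. Z s (b q)) - Z s (b q))"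
    "(\<lambda>s. Z s (b q)) = F.dmap q (\<lambda>s. A s q) \<Longrightarrow> gen2 s A Z (lift q \<beta>) = 0"
proof -
  note A = linear_pairD[OF AZ] and sec = gen2_sections(1,2)[OF s AZ]
  have Aq: "(\<lambda>s. A s q) \<in> derivations_at L1 q" by (rule Q1.derivations_fieldD(3)[OF A(1) q])
  have f: "F.jpull q \<beta> (\<lambda>s. A s q) \<in> fibre L1 q" "A (F.pull s) q \<in> fibre L1 q"
    using F.jpull_jet[OF q \<beta>] Aq Q1.derivationsD(1)[OF Aq F.pull_section[OF s]] by (auto simp: jets_at_def Hom_def)
  have "B q (Q1.vanishing_section (F.pull s) A (q, F.jpull q \<beta>)) = \<beta> (F.dmap q (\<lambda>s. A s q)) - F.dmap q (\<lambda>s. A s q) s"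
    by (simp add: Q1.vanishing_section_at[OF F.pull_section[OF s] A(1) lift_points(3)] B_diff[OF q f] F.B_jpull[OF q \<beta> Aq] F.dmap_at[OF s])
  note v = this Q2.vanishing_section_at[OF s A(3) lift_points(4)]
  show "B q (gen2 s A Z (lift q \<beta>)) = \<beta> (F.dmap q (\<lambda>s. A s q)) - F.dmap q (\<lambda>s. A s q) s - (\<beta> (\<lambda>s. Z s (b q)) - Z s (b q))"
    unfolding gen2_def pair_section_lift(2)[OF sec] v ..
  show "gen2 s A Z (lift q \<beta>) = 0" if eq: "(\<lambda>s. Z s (b q)) = F.dmap q (\<lambda>s. A s q)"
    unfolding gen2_def by (rule pair_section_lift(3)[OF sec]) (simp only: v fun_cong[OF eq, of s] eq)
qed

lemma gen2_ident_lift: "s \<in> sections L2 \<Longrightarrow> gen2 s Q1.ident_field Q2.ident_field (lift q \<beta>) = 0"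
  by (rule gen2_lift(2)[OF _ linear_pair_ident]) (simp_all add: Q1.ident_field_at Q2.ident_field_at F.dmap_eval[OF q])

lemma br_pair_lift_zero:
  assumes u: "u \<in> sections Q1.JL" "u' \<in> sections Q1.JL" and v: "v \<in> sections Q2.JL" "v' \<in> sections Q2.JL"
    and eq: "B q (br1 u u' (q, F.jpull q \<beta>)) = br2 v v' (b q, \<beta>)"
  shows "br (pair_section u v) (pair_section u' v') (lift q \<beta>) = 0"
  unfolding br_pair[OF u(1) v(1) u(2) v(2)]
  by (rule pair_section_lift(3)[OF Q1.J.br_section[OF u] Q2.J.br_section[OF v] eq])

end

lemma restriction_at: "V \<in> sections P.LP \<Longrightarrow> z \<in> S \<Longrightarrow> I.pull V z = V z"
  using I.B_pull[of z V] by (simp add: G.SA_points)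

text \<open>The restriction is the zero section, which every derivation annihilates by
  linearity.\<close>

lemma restriction_zero:
  assumes V: "V \<in> sections P.LP" and 0: "\<And>q \<beta>. q \<in> points (base L1) \<Longrightarrow> \<beta> \<in> jets_at L2 (b q) \<Longrightarrow> V (lift q \<beta>) = 0"
    and a: "a \<in> derivations_at LS z"
  shows "a (I.pull V) = 0"
proof -
  have "I.pull V = (\<lambda>y. 0 *\<^sub>R I.pull V y)"
  proof
    fix y show "I.pull V y = 0 *\<^sub>R I.pull V y"
    proof (cases "y \<in> S")
      case True
      then obtain q \<beta> where "q \<in> points (base L1)" "\<beta> \<in> jets_at L2 (b q)" "y = lift q \<beta>" using S_iff by blast
      then show ?thesis using 0 restriction_at[OF V True] by simp
    qed (simp add: section_pullback_def G.SA_points)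
  qed
  then show ?thesis using I.L1.derivationsD(4)[OF a I.pull_section[OF V], of 0] by simp
qed


section \<open>Tangency to the jet lift at a fixed point\<close>

context
  fixes q U1 \<phi>1 W1 \<tau>1 \<rho>1 U2 \<phi>2 W2 \<tau>2 \<rho>2 s N u0 p0
  assumes U1: "(U1, \<phi>1) \<in> base L1" "q \<in> U1" and W1: "(W1, \<tau>1) \<in> trivs L1" "q \<in> W1"
    and U2: "(U2, \<phi>2) \<in> base L2" "b q \<in> U2" and W2: "(W2, \<tau>2) \<in> trivs L2" "b q \<in> W2"
    and \<rho>1: "bump (base L1) q (U1 \<inter> W1) \<rho>1" and \<rho>2: "bump (base L2) (b q) (U2 \<inter> W2) \<rho>2"
    and s: "s \<in> sections L2" and N: "aopen (base L2) N" "b q \<in> N" "N \<subseteq> U2 \<inter> W2"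
    and s_affine: "\<And>y. y \<in> N \<Longrightarrow> \<tau>2 y (s y) = u0 + p0 \<bullet> (\<phi>2 y - \<phi>2 (b q))"
begin

lemmas point_charts = U1(1) W1(1) U2(1) W2(1)

abbreviation (input) "\<beta>0 \<equiv> jet L2 s (b q)"
abbreviation (input) "\<alpha>0 \<equiv> F.jpull q (jet L2 s (b q))"
abbreviation (input) "z0 \<equiv> lift q (jet L2 s (b q))"
abbreviation (input) "O0 \<equiv> F.bdom U1 W1 U2 W2"
abbreviation (input) "bh \<equiv> F.brep U1 \<phi>1 \<phi>2"
abbreviation (input) "mh \<equiv> F.mrep U1 \<phi>1 \<tau>1 \<tau>2"
abbreviation (input) "Db y w \<equiv> frechet_derivative (F.brep U1 \<phi>1 \<phi>2) (at y) w"
abbreviation (input) "Dm y w \<equiv> frechet_derivative (F.mrep U1 \<phi>1 \<tau>1 \<tau>2) (at y) w"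
abbreviation (input) "cc \<equiv> cchart U1 \<phi>1 \<tau>1 U2 \<phi>2 \<tau>2"
abbreviation (input) "cd \<equiv> cdom U1 W1 U2 W2"

definition frame1 where "frame1 w = Q1.frame_field U1 \<phi>1 W1 \<tau>1 \<rho>1 w"

text \<open>The coefficients are those that \<open>dmap_coord\<close> gives for the derivation
  \<open>(w, 0)\<close> at \<open>q\<close>; they are kept constant near \<open>b q\<close>.\<close>

definition frame2 where "frame2 w = (\<lambda>s x. Q2.frame_field U2 \<phi>2 W2 \<tau>2 \<rho>2 (Db (\<phi>1 q) w) s x
  + (- Dm (\<phi>1 q) w / F.mult \<tau>1 \<tau>2 q) *\<^sub>R Q2.ident_field s x)"

lemma q_bdom: "q \<in> O0" and q_points: "q \<in> points (base L1)" and \<beta>0_jet: "\<beta>0 \<in> jets_at L2 (b q)"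
proof -
  show q: "q \<in> points (base L1)" using U1 chart_subset_points by blast
  then show "q \<in> O0" using U1 W1 U2 W2 by (simp add: F.bdom_def)
  show "\<beta>0 \<in> jets_at L2 (b q)" by (rule Q2.jet_in_jets[OF F.b_points[OF q] s])
qed

lemmas z0_points = lift_points[OF q_points \<beta>0_jet]

lemma \<alpha>0_eq: "\<alpha>0 = jet L1 (F.pull s) q"
  by (rule F.jpull_jet_of_section[OF q_points s])

lemma frame_pair: "linear_pair (frame1 w) (frame2 w)"
proof -
  note d = Q2.frame_field_derivation[OF U2 W2 \<rho>2] Q2.ident_field_derivation
  show ?thesis
    unfolding linear_pair_def frame1_def frame2_def Q2.linear_section_add[OF d]
    by (intro conjI Q1.frame_field_derivation[OF U1 W1 \<rho>1] Q1.frame_linear_section[OF U1 W1 \<rho>1] Q2.derivations_field_add[OF d]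
        Q2.pi.L1.sections_add Q2.pi.L1.sections_scale Q2.frame_linear_section[OF U2 W2 \<rho>2] Q2.ident_linear_section)
qed

text \<open>By \<open>dmap_coord\<close> the two derivations differ only in the point at which the
  coefficients are evaluated, \<open>x\<close> for the image of \<open>frame1 w\<close> and
  \<open>q\<close> for \<open>frame2 w\<close>. For \<open>x = q\<close> they coincide.\<close>

lemma frame_at:
  assumes x: "x \<in> O0" and 1: "\<rho>1 x = 1" "\<rho>2 (b x) = 1"
  shows "F.dmap x (\<lambda>s. frame1 w s x) = Q2.coord_der U2 \<phi>2 \<tau>2 (b x) (Db (\<phi>1 x) w) (- Dm (\<phi>1 x) w / F.mult \<tau>1 \<tau>2 x)"
    "(\<lambda>s. frame2 w s (b x)) = Q2.coord_der U2 \<phi>2 \<tau>2 (b x) (Db (\<phi>1 q) w) (- Dm (\<phi>1 q) w / F.mult \<tau>1 \<tau>2 q)"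
proof -
  note xx = F.bdomD[OF point_charts x]
  have "(\<lambda>s. frame1 w s x) = Q1.coord_der U1 \<phi>1 \<tau>1 x w 0"
    using xx 1 by (simp add: frame1_def Q1.frame_field_def)
  then show "F.dmap x (\<lambda>s. frame1 w s x) = Q2.coord_der U2 \<phi>2 \<tau>2 (b x) (Db (\<phi>1 x) w) (- Dm (\<phi>1 x) w / F.mult \<tau>1 \<tau>2 x)"
    using F.dmap_coord[OF point_charts x, of w 0] by simp
  note UW2 = U2(1) xx(3) W2(1) xx(4)
  let ?k = "- Dm (\<phi>1 q) w / F.mult \<tau>1 \<tau>2 q"
  have "Q2.ident_field s' (b x) = Q2.coord_der U2 \<phi>2 \<tau>2 (b x) 0 1 s'" for s'
    using fun_cong[OF Q2.ident_field_at[of "b x"], of s'] fun_cong[OF Q2.eval_der_eq[OF UW2], of s'] by simp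
  then show "(\<lambda>s. frame2 w s (b x)) = Q2.coord_der U2 \<phi>2 \<tau>2 (b x) (Db (\<phi>1 q) w) (- Dm (\<phi>1 q) w / F.mult \<tau>1 \<tau>2 q)"
    using xx 1 Q2.coord_der_linear(1)[OF UW2, of "Db (\<phi>1 q) w" 0 0 ?k] Q2.coord_der_linear(2)[OF UW2, of ?k 0 1]
    by (simp add: frame2_def Q2.frame_field_def)
qed

lemma frame_related: "(\<lambda>s. frame2 w s (b q)) = F.dmap q (\<lambda>s. frame1 w s q)"
  using frame_at[OF q_bdom bump_at[OF \<rho>1] bump_at[OF \<rho>2], of w] by simp

lemma base_jet_coords: "cpr (cc z0) = (\<phi>1 q, p0, u0)"
proof -
  note j = Q2.jet_of_section_coords[OF U2 W2 s]
  have "section_deriv U2 \<phi>2 \<tau>2 s (b q) = (\<lambda>v. p0 \<bullet> v)"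
    by (rule Q2.section_rep_eqI[OF U2 W2 N(1,2), where g = "\<lambda>y. u0 + p0 \<bullet> (y - \<phi>2 (b q))"])
      (auto intro!: derivative_eq_intros simp: s_affine)
  then have "Q2.momentum U2 \<phi>2 \<tau>2 (b q) \<beta>0 = p0"
    using j(2)[of _ 0] by (intro Q2.momentum_eqI[OF U2 W2 \<beta>0_jet]) simp
  then show ?thesis by (simp add: cpr_lift[OF point_charts q_bdom] j(1) s_affine[OF N(2)])
qed

text \<open>The coordinate representative of the generator on the jet lift: a sum of products of functions that vanish at the point.\<close>

definition frame_rep :: "'e \<Rightarrow> 'e \<times> 'f \<times> real \<Rightarrow> real" where
  "frame_rep w = (\<lambda>(y, p, u). ((p - p0) \<bullet> (Db y w - Db (\<phi>1 q) w) + (u - (u0 + p0 \<bullet> (bh y - bh (\<phi>1 q)))) \<bullet>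
    (- Dm y w / mh y - (- Dm (\<phi>1 q) w / mh (\<phi>1 q)))) / mh y)"

text \<open>Pairing a derivation \<open>(v, c)\<close> with \<beta> minus the jet of
  \<open>s\<close> gives \<open>(P - p0) \<bullet> v + (U - \<sigma>) c\<close>, because the affine
  section \<open>s\<close> has the constant momentum \<open>p0\<close>. The generator is a
  difference of two such pairings, so the differences of the coefficients appear as second factors;
  division by the multiplier accounts for \<open>B\<close>.\<close>

lemma gen2_frame_rep:
  assumes x: "x \<in> O0" and 1: "\<rho>1 x = 1" "\<rho>2 (b x) = 1" and xN: "b x \<in> N" and \<beta>: "\<beta> \<in> jets_at L2 (b x)"
  shows "\<tau>1 x (gen2 s (frame1 w) (frame2 w) (lift x \<beta>)) = frame_rep w (cpr (cc (lift x \<beta>)))"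
proof -
  note xx = F.bdomD[OF point_charts x]
  note UW2 = U2(1) xx(3) W2(1) xx(4)
  let ?V = "gen2 s (frame1 w) (frame2 w) (lift x \<beta>)"
  define v1 where "v1 = Db (\<phi>1 x) w"
  define c1 where "c1 = - Dm (\<phi>1 x) w / F.mult \<tau>1 \<tau>2 x"
  define v2 where "v2 = Db (\<phi>1 q) w"
  define c2 where "c2 = - Dm (\<phi>1 q) w / F.mult \<tau>1 \<tau>2 q"
  let ?D = "\<lambda>v c. Q2.coord_der U2 \<phi>2 \<tau>2 (b x) v c"
  define \<sigma> where "\<sigma> = \<tau>2 (b x) (s (b x))"
  have \<sigma>: "\<sigma> = u0 + p0 \<bullet> (bh (\<phi>1 x) - bh (\<phi>1 q))"
    by (simp add: \<sigma>_def s_affine[OF xN] F.brep_at[OF point_charts x] F.brep_at[OF point_charts q_bdom])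
  have Ds: "section_deriv U2 \<phi>2 \<tau>2 s (b x) = (\<lambda>v. p0 \<bullet> v)"
    by (rule Q2.section_rep_eqI[OF UW2 N(1) xN, where g = "\<lambda>y. u0 + p0 \<bullet> (y - \<phi>2 (b q))"])
      (auto intro!: derivative_eq_intros simp: s_affine)
  have fib: "\<beta> (?D v c) \<in> fibre L2 (b x)" "?D v c s \<in> fibre L2 (b x)" for v c
    using F.jet_fibre[OF F.b_points[OF xx(5)] \<beta> Q2.coord_der_derivation[OF UW2]] Q2.coord_der_fibre[OF UW2 s] by auto
  note sub = Q2.fibre_subspace[OF F.b_points[OF xx(5)]]
  note sec = gen2_sections[OF s frame_pair]
  have Vf: "?V \<in> fibre L1 x" unfolding gen2_def by (rule pair_section_lift(1)[OF xx(5) \<beta> sec(1,2)])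
  have BV: "B x ?V = \<beta> (?D v1 c1) - ?D v1 c1 s - (\<beta> (?D v2 c2) - ?D v2 c2 s)"
    using gen2_lift(1)[OF xx(5) \<beta> s frame_pair, of w] fun_cong[OF frame_at(2)[OF x 1, of w], of s]
    unfolding frame_at[OF x 1] v1_def v2_def c1_def c2_def by simp
  define P where "P = Q2.momentum U2 \<phi>2 \<tau>2 (b x) \<beta>"
  define U where "U = \<tau>2 (b x) (\<beta> (eval_der L2 (b x)))"
  have tval: "\<tau>2 (b x) (\<beta> (?D v c) - ?D v c s) = (P - p0) \<bullet> v + (U - \<sigma>) * c" for v c
    unfolding Q2.triv_diff[OF W2(1) xx(4) fib] Q2.jet_coord[OF UW2 \<beta>] Q2.coord_der_triv[OF UW2 s] Ds
    by (simp add: P_def U_def \<sigma>_def algebra_simps inner_diff_left)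
  have "\<tau>1 x ?V = \<tau>2 (b x) (B x ?V) / F.mult \<tau>1 \<tau>2 x"
    using F.inv_B_triv[OF point_charts x, of "B x ?V"] F.B_inv(3,4)[OF xx(5) Vf] by simp
  also have "\<tau>2 (b x) (B x ?V) = (P - p0) \<bullet> (v1 - v2) + (U - \<sigma>) * (c1 - c2)"
    unfolding BV Q2.triv_diff[OF W2(1) xx(4) subspace_diff[OF sub fib] subspace_diff[OF sub fib]] tval
    by (simp add: algebra_simps inner_diff_right)
  finally show ?thesis
    unfolding cpr_lift[OF point_charts x] frame_rep_def prod.case \<sigma>
    by (simp add: P_def U_def v1_def v2_def c1_def c2_def F.mrep_at[OF point_charts x] F.mrep_at[OF point_charts q_bdom])
qed

text \<open>At the point one has \<open>p = p0\<close>, \<open>u = u0\<close> and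
  \<open>y = \<phi>1 q\<close>, so in each product both factors vanish, and division by the nonzero
  multiplier does no harm.\<close>

lemma frame_rep_derivative_zero: "(frame_rep w has_derivative (\<lambda>_. 0)) (at (cpr (cc z0)))"
proof -
  let ?O = "\<phi>1 ` O0"
  let ?I = "?O \<times> (UNIV :: ('f \<times> real) set)"
  have oO: "open ?O" by (rule F.bdom_image_open[OF point_charts])
  have oI: "open ?I" by (intro open_Times oO open_UNIV)
  note zs = smooth_on_fst[OF oI smooth_on_ident] smooth_on_snd[OF oI smooth_on_ident]
  note zz = smooth_on_fst[OF oI zs(2)] smooth_on_snd[OF oI zs(2)]
  note bs = F.brep_smooth[OF point_charts] and ms = F.mrep_smooth[OF point_charts]
  note cf = smooth_on_fst_compose[OF oO open_UNIV, where 'b = "'f \<times> real"]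
  have m0: "mh (fst z) \<noteq> 0" if "z \<in> ?I" for z using that F.mrep_nonzero[OF point_charts] by auto
  have qO: "(\<phi>1 q, p0, u0) \<in> ?I" using q_bdom by auto
  have d1: "smooth_on ?I (\<lambda>z. fst (snd z) - p0)" "smooth_on ?I (\<lambda>z. Db (fst z) w - Db (\<phi>1 q) w)"
    by (intro smooth_on_diff[OF oI] zz cf[OF smooth_on_frechet_derivative[OF bs]] smooth_on_const)+
  have d2: "smooth_on ?I (\<lambda>z. snd (snd z) - (u0 + p0 \<bullet> (bh (fst z) - bh (\<phi>1 q))))"
    by (intro smooth_on_diff[OF oI] smooth_on_add[OF oI] smooth_on_inner[OF oI] zz cf[OF bs] smooth_on_const)
  have d3: "smooth_on ?I (\<lambda>z. - Dm (fst z) w / mh (fst z) - (- Dm (\<phi>1 q) w / mh (\<phi>1 q)))"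
    by (intro smooth_on_diff[OF oI _ smooth_on_const] smooth_on_divide[OF oI] smooth_on_minus oI cf[OF smooth_on_frechet_derivative[OF ms]] cf[OF ms] m0)
  note diff = smooth_on_differentiable[OF _ qO]
  note h = has_derivative_add[OF has_derivative_inner_zero[OF diff[OF d1(1)] _ diff[OF d1(2)]]
    has_derivative_inner_zero[OF diff[OF d2] _ diff[OF d3]]]
  have "((\<lambda>z. ((fst (snd z) - p0) \<bullet> (Db (fst z) w - Db (\<phi>1 q) w) +
      (snd (snd z) - (u0 + p0 \<bullet> (bh (fst z) - bh (\<phi>1 q)))) \<bullet> (- Dm (fst z) w / mh (fst z) - (- Dm (\<phi>1 q) w / mh (\<phi>1 q))))
      / mh (fst z)) has_derivative (\<lambda>_. 0)) (at (\<phi>1 q, p0, u0))"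
    by (rule has_derivative_divide_zero[OF _ _ diff[OF cf[OF ms]]], rule has_derivative_eq_rhs[OF h]) (use m0[OF qO] in simp_all)
  then show ?thesis unfolding base_jet_coords frame_rep_def by (simp add: case_prod_beta')
qed

lemma z0_cdom: "z0 \<in> cd \<inter> S"
  using lift_cdom[OF point_charts q_points \<beta>0_jet] q_bdom z0_points(2) by simp

lemma LP_triv: "(points P.BP \<inter> fst -` (points Q1.JM \<inter> fst -` W1), \<lambda>z. \<tau>1 (fst (fst z))) \<in> trivs P.LP"
  by (rule P.LP_triv[OF Q1.jtriv_mem[OF U1 W1]])

lemma LP_triv_at: "z0 \<in> points P.BP \<inter> fst -` (points Q1.JM \<inter> fst -` W1)"
  using z0_points W1 by (auto simp: lift_def)

lemma LP_chart: "(cd, cc) \<in> base P.LP" "z0 \<in> cd"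
  using charts_mem[OF point_charts] charts_BP z0_cdom by auto

lemma LS_chart: "(cd \<inter> S, \<lambda>z. cpr (cc z)) \<in> base LS" "z0 \<in> cd \<inter> S"
  using G.SA_chart[OF charts_mem[OF point_charts]] z0_cdom by simp_all

lemma LS_triv: "(S \<inter> (points P.BP \<inter> fst -` (points Q1.JM \<inter> fst -` W1)), \<lambda>z. \<tau>1 (fst (fst z))) \<in> trivs LS"
  "z0 \<in> S \<inter> (points P.BP \<inter> fst -` (points Q1.JM \<inter> fst -` W1))"
  using LS_trivs[OF LP_triv] LP_triv_at z0_points(2) by auto

text \<open>Value and differential of the restricted section vanish at the point, and a derivation
  there is determined by coordinates that see nothing else.\<close>

lemma restricted_gen2_frame:
  assumes a: "a \<in> derivations_at LS z0" shows "a (I.pull (gen2 s (frame1 w) (frame2 w))) = 0"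
proof -
  let ?V = "gen2 s (frame1 w) (frame2 w)"
  note V = gen2_sections(3)[OF s frame_pair]
  obtain N1 where N1: "aopen (base L1) N1" "q \<in> N1" "N1 \<subseteq> U1 \<inter> W1" "\<And>y. y \<in> N1 \<Longrightarrow> \<rho>1 y = 1" using bumpE[OF \<rho>1] by blast
  obtain N2 where N2: "aopen (base L2) N2" "b q \<in> N2" "N2 \<subseteq> U2 \<inter> W2" "\<And>y. y \<in> N2 \<Longrightarrow> \<rho>2 y = 1" using bumpE[OF \<rho>2] by blast
  \<comment> \<open>Over \<open>T\<close> both cut-off functions are 1 and \<open>s\<close> is given
    by its affine formula, so \<open>gen2_frame_rep\<close> applies.\<close>
  define T where "T = O0 \<inter> N1 \<inter> (points (base L1) \<inter> b -` (N2 \<inter> N))"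
  have T: "aopen (base L1) T" unfolding T_def
    by (intro openin_Int F.bdom_open[OF point_charts] N1(1) N2(1) N(1) smooth_map_aopen_vimage[OF F.b_smooth Q1.ch Q2.ch])
  have qT: "q \<in> T" using q_bdom q_points N1(2) N2(2) N(2) by (simp add: T_def)
  define M where "M = (cd \<inter> S) \<inter> (\<lambda>z. cpr (cc z)) -` (\<phi>1 ` (U1 \<inter> T) \<times> UNIV)"
  have M: "aopen (base LS) M" unfolding M_def
    by (rule aopen_chart_vimage[OF LS_chart(1)]) (intro open_Times open_UNIV aopen_image[OF Q1.ch U1(1) T])
  have zM: "z0 \<in> M" using z0_cdom qT U1(2) by (auto simp: M_def base_jet_coords)
  have rep: "frechet_derivative ((\<lambda>z. \<tau>1 (fst (fst z)) (I.pull ?V z)) \<circ> inv_into (cd \<inter> S) (\<lambda>z. cpr (cc z))) (at (cpr (cc z0))) = (\<lambda>_. 0)"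
  proof (rule I.L1.section_rep_eqI[OF LS_chart LS_triv M zM frame_rep_derivative_zero])
    fix y assume y: "y \<in> M"
    then have yS: "y \<in> cd \<inter> S" by (simp add: M_def)
    then obtain x \<beta> where x: "x \<in> O0" "\<beta> \<in> jets_at L2 (b x)" "y = lift x \<beta>" using cdom_S[OF point_charts] by blast
    have "\<phi>1 x \<in> \<phi>1 ` (U1 \<inter> T)" using y x(1) by (simp add: M_def x(3) cpr_lift[OF point_charts x(1)])
    then have "x \<in> T" using chartedD(1)[OF Q1.ch U1(1)] F.bdomD(1)[OF point_charts x(1)] by (auto simp: inj_on_def)
    then have "\<rho>1 x = 1" "\<rho>2 (b x) = 1" "b x \<in> N" using N1(4) N2(4) by (auto simp: T_def)
    from gen2_frame_rep[OF x(1) this x(2)] show "\<tau>1 (fst (fst y)) (I.pull ?V y) = frame_rep w (cpr (cc y))"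
      using restriction_at[OF V, of y] yS by (simp add: x(3)) (simp add: lift_def)
  qed
  obtain v c where a: "a = I.L1.coord_der (cd \<inter> S) (\<lambda>z. cpr (cc z)) (\<lambda>z. \<tau>1 (fst (fst z))) z0 v c"
    using I.L1.derivation_coords[OF LS_chart LS_triv a] .
  have "I.pull ?V z0 = 0"
    using restriction_at[OF V z0_points(2)] gen2_lift(2)[OF q_points \<beta>0_jet s frame_pair frame_related] by simp
  then show ?thesis unfolding a I.L1.coord_der_def rep using I.L1.triv_zero[OF LS_triv] by simp
qed

text \<open>Subtract from \<open>a\<close> a derivation of the restriction with the same coordinates
  along the graph. The difference \<open>d\<close> still annihilates all generators, since these
  restrict to zero up to first order. The coordinates transverse to the graph are then eliminated in
  turn: the generators from base sections remove everything seen by the second factor, the linear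
  ones what is left on the first.\<close>

lemma gen_restricted:
  assumes a: "a \<in> derivations_at P.LP z0" and gen1: "\<And>t. t \<in> sections L2 \<Longrightarrow> a (gen1 t) = 0"
    and unit: "a (gen2 s Q1.ident_field Q2.ident_field) = 0" and frame: "\<And>w. a (gen2 s (frame1 w) (frame2 w)) = 0"
  shows "a \<in> I.dmap z0 ` derivations_at LS z0"
proof -
  let ?\<tau> = "\<lambda>z. \<tau>1 (fst (fst z))"
  have z0: "z0 = ((q, \<alpha>0), (b q, \<beta>0), Bext q)" by (simp add: lift_def)
  have C: "P.fibre_iso (q, \<alpha>0) (b q, \<beta>0) (Bext q)" using z0_points(1) by (simp add: z0 P.BP_points)
  note c1 = Q1.jet_chart[OF z0_points(3) U1 W1] Q1.jet_triv[OF z0_points(3) U1 W1]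
  note c2 = Q2.jet_chart[OF z0_points(4) U2 W2] Q2.jet_triv[OF z0_points(4) U2 W2]
  note LPc = LP_chart LP_triv LP_triv_at
  have zS: "z0 \<in> points (base LS)" using z0_points(2) by (simp add: G.SA_points)
  let ?a = "P.P1.L1.coord_der cd cc ?\<tau> z0" and ?a' = "I.L1.coord_der (cd \<inter> S) (\<lambda>z. cpr (cc z)) ?\<tau> z0"
  obtain v c where av: "a = ?a v c" using P.P1.L1.derivation_coords[OF LPc a] .
  \<comment> \<open>The candidate preimage has the coordinates that \<open>a\<close> shows along the
    graph, and the same zero-order part.\<close>
  define a' where "a' = ?a' (cpr v) c"
  have a': "a' \<in> derivations_at LS z0" unfolding a'_def by (rule I.L1.coord_der_derivation[OF LS_chart LS_triv])
  define d where "d = (\<lambda>r. a r - I.dmap z0 a' r)"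
  have d: "d \<in> derivations_at P.LP z0"
    unfolding d_def by (rule P.P1.L1.derivations_at_diff[OF z0_points(1) a I.dmap_derivation[OF zS a']])
  have d_at: "d r = a r - a' (I.pull r)" if "r \<in> sections P.LP" for r using that by (simp add: d_def I.dmap_at)
  obtain v' c' where dv: "d = ?a v' c'" using P.P1.L1.derivation_coords[OF LPc d] .
  \<comment> \<open>Test \<open>d\<close> on sections whose coordinate near the point is an affine
    function of \<open>cpr\<close>. On these \<open>a\<close> and the image of \<open>a'\<close>
    agree by construction, and their differentials detect the coordinates along the graph.\<close>
  have key: "e \<bullet> cpr v' + c' * u = 0" for e u
  proof -
    define h where "h = (\<lambda>y. u + e \<bullet> (y - cpr (cc z0)))"
    define T where "T = cd \<inter> (points P.BP \<inter> fst -` (points Q1.JM \<inter> fst -` W1))"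
    have oT: "aopen (base P.LP) T" "z0 \<in> T" "T \<subseteq> points P.BP \<inter> fst -` (points Q1.JM \<inter> fst -` W1)"
      unfolding T_def using P.P1.L1.coord_open[OF LPc] LPc by auto
    note ch = P.P1.L1.ch
    have hs: "smooth_in (base P.LP) T (\<lambda>y. h (cpr (cc y)))"
      unfolding h_def
      by (intro smooth_in_add[OF ch oT(1)] smooth_in_inner[OF ch oT(1)] smooth_in_diff[OF ch oT(1)] smooth_in_const
          smooth_in_bounded_linear[OF ch oT(1) cpr_bounded_linear] smooth_in_subset[OF smooth_in_chart[OF ch LP_chart(1)]])
        (simp add: T_def)
    obtain r M where r: "r \<in> sections P.LP" "aopen (base P.LP) M" "z0 \<in> M" "M \<subseteq> T" "\<And>y. y \<in> M \<Longrightarrow> ?\<tau> y (r y) = h (cpr (cc y))"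
      using P.P1.L1.local_section[OF LP_triv oT hs] by blast
    have hD: "(h has_derivative (\<lambda>x. e \<bullet> x)) (at (cpr (cc z0)))"
      unfolding h_def by (auto intro!: derivative_eq_intros)
    have D1: "section_deriv cd cc ?\<tau> r z0 = (\<lambda>x. e \<bullet> cpr x)"
    proof (rule P.P1.L1.section_rep_eqI[OF LPc r(2,3)])
      show "((\<lambda>y. h (cpr y)) has_derivative (\<lambda>x. e \<bullet> cpr x)) (at (cc z0))"
        by (rule has_derivative_compose[OF bounded_linear_imp_has_derivative[OF cpr_bounded_linear] hD])
    qed (rule r(5))
    have oM: "aopen (base LS) (points (base LS) \<inter> (\<lambda>x. x) -` M)"
      by (rule smooth_map_aopen_vimage[OF I.b_smooth I.L1.ch ch r(2)])
    have D2: "frechet_derivative ((\<lambda>y. ?\<tau> y (I.pull r y)) \<circ> inv_into (cd \<inter> S) (\<lambda>z. cpr (cc z))) (at (cpr (cc z0))) = (\<lambda>x. e \<bullet> x)"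
      by (rule I.L1.section_rep_eqI[OF LS_chart LS_triv oM _ hD])
        (use zS r(3,5) restriction_at[OF r(1)] in \<open>auto simp: G.SA_points\<close>)
    have hz: "?\<tau> z0 (r z0) = u" using r(5)[OF r(3)] by (simp add: h_def)
    have 1: "?\<tau> z0 (?a x k r) = e \<bullet> cpr x + k * u" for x k
      unfolding P.P1.L1.coord_der_triv[OF LPc r(1)] D1 hz ..
    have 2: "?\<tau> z0 (a' (I.pull r)) = e \<bullet> cpr v + c * u"
      unfolding a'_def I.L1.coord_der_triv[OF LS_chart LS_triv I.pull_section[OF r(1)]] D2 restriction_at[OF r(1) z0_points(2)] hz ..
    have f: "a r \<in> fibre P.LP z0" "a' (I.pull r) \<in> fibre P.LP z0"
      using P.P1.L1.derivationsD(1)[OF a r(1)] I.L1.derivationsD(1)[OF a' I.pull_section[OF r(1)]] by simp_all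
    have "?\<tau> z0 (d r) = 0"
      unfolding d_at[OF r(1)] P.P1.L1.triv_diff[OF LP_triv LP_triv_at f] 2 unfolding av 1 by simp
    then show ?thesis unfolding dv 1 .
  qed
  have "cpr v' = 0" "c' = 0" using key[of "cpr v'" 0] key[of 0 1] by simp_all
  then have v': "fst (fst v') = 0" "snd (fst (snd v')) = 0" and c': "c' = 0" by (simp_all add: cpr_def zero_prod_def)
  note cc_eq = cdom_def[of U1 W1 U2 W2] cchart_def[of U1 \<phi>1 \<tau>1 U2 \<phi>2 \<tau>2]
  let ?Dr = "\<lambda>r. section_deriv cd cc ?\<tau> r z0 v'"
  have d0: "d r = 0 \<longleftrightarrow> ?Dr r = 0" if r: "r \<in> sections P.LP" for r
    using P.P1.L1.coord_der_triv[OF LPc r, of v' c'] P.P1.L1.triv_zero[OF LP_triv LP_triv_at]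
    by (auto simp: dv c' P.P1.L1.coord_der_def r)
  define k where "k = \<tau>2 (b q) (Bext q (unit_vec Q1.JL (\<lambda>z. \<tau>1 (fst z)) (q, \<alpha>0)))"
  have k: "k \<noteq> 0" using P.fibre_iso_nonzero[OF c1(3,4) c2(3,4) C] by (simp add: k_def)
  have DP1: "?Dr (P.P1.pull u) = frechet_derivative ((\<lambda>z. \<tau>1 (fst z) (u z)) \<circ> inv_into (Q1.jdom U1 W1) (Q1.jchart U1 \<phi>1 \<tau>1))
      (at (Q1.jchart U1 \<phi>1 \<tau>1 (q, \<alpha>0))) (fst v')" if "u \<in> sections Q1.JL" for u
    unfolding cc_eq z0 P.P1_rep_derivative[OF c1 c2 C that] ..
  have DP2: "?Dr (P.P2.pull u) = frechet_derivative ((\<lambda>z. \<tau>2 (fst z) (u z)) \<circ> inv_into (Q2.jdom U2 W2) (Q2.jchart U2 \<phi>2 \<tau>2))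
      (at (Q2.jchart U2 \<phi>2 \<tau>2 (b q, \<beta>0))) (fst (snd v')) / k - \<tau>2 (b q) (u (b q, \<beta>0)) * snd (snd v') / (k * k)"
    if "u \<in> sections Q2.JL" for u
    unfolding cc_eq z0 P.P2_rep_derivative[OF c1 c2 C that] k_def fst_conv ..
  have d_pair: "d (pair_section u u') = d (P.P1.pull u) - d (P.P2.pull u')"
    if "u \<in> sections Q1.JL" "u' \<in> sections Q2.JL" for u u'
    unfolding pair_section_def
    by (rule P.P1.L1.derivations_minus(2)[OF d P.P1.pull_section[OF that(1)] P.P2.pull_section[OF that(2)]])
  have base1: "d (P.P1.pull (Q1.pi.pull t)) = 0" if t: "t \<in> sections L1" for t
    unfolding d0[OF P.P1.pull_section[OF Q1.pi.pull_section[OF t]]] DP1[OF Q1.pi.pull_section[OF t]]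
      Q1.base_rep_derivative[OF z0_points(3) U1 W1 t] v'(1)
    by (rule linear_0[OF Q1.section_rep_linear[OF U1 W1 t]])
  have base2: "d (P.P2.pull (Q2.pi.pull t)) = 0" if t: "t \<in> sections L2" for t
  proof -
    note g = gen1_sections[OF t]
    have "d (gen1 t) = 0"
      using gen1[OF t] restriction_zero[OF g(3) gen1_lift[OF _ _ t] a'] by (simp add: d_at[OF g(3)])
    then show ?thesis using d_pair[OF g(1,2)] base1[OF F.pull_section[OF t]] by (simp add: gen1_def)
  qed
  \<comment> \<open>A section with value 1 and vanishing differential isolates the term in the
    direction of the scale.\<close>
  have ssv: "snd (snd v') = 0"
  proof -
    obtain t where t: "t \<in> sections L2" "\<tau>2 (b q) (t (b q)) = 1"
      "\<And>v. section_deriv U2 \<phi>2 \<tau>2 t (b q) v = 0 \<bullet> v"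
      using Q2.section_with_jet[OF U2 W2, of 1 0] by metis
    note pt = Q2.pi.pull_section[OF t(1)]
    have "?Dr (P.P2.pull (Q2.pi.pull t)) = 0" using base2[OF t(1)] d0[OF P.P2.pull_section[OF pt]] by simp
    then show ?thesis
      unfolding DP2[OF pt] Q2.base_rep_derivative[OF z0_points(4) U2 W2 t(1)] Q2.base_section_at[OF z0_points(4) t(1)] t(2,3)
      using k by simp
  qed
  have frame2: "d (P.P2.pull (linear_section L2 (Q2.frame_field U2 \<phi>2 W2 \<tau>2 \<rho>2 w))) = 0" for w
    unfolding d0[OF P.P2.pull_section[OF Q2.frame_linear_section[OF U2 W2 \<rho>2]]] DP2[OF Q2.frame_linear_section[OF U2 W2 \<rho>2]]
      Q2.frame_rep_derivative[OF z0_points(4) U2 W2 \<rho>2] v'(2) ssv by simp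
  have ident2: "d (P.P2.pull (linear_section L2 Q2.ident_field)) = 0"
    unfolding d0[OF P.P2.pull_section[OF Q2.ident_linear_section]] DP2[OF Q2.ident_linear_section]
      Q2.ident_rep_derivative[OF z0_points(4) U2 W2] v'(2) ssv by simp
  have "P.P2.dmap z0 d \<in> derivations_at Q2.JL (b q, \<beta>0)"
    using P.P2.dmap_derivation[OF z0_points(1) d] by (simp add: lift_def)
  then have dm2: "P.P2.dmap z0 d = (\<lambda>_. 0)"
    by (rule Q2.jet_derivation_zero[OF z0_points(4) U2 W2 \<rho>2])
      (simp_all add: P.P2.dmap_at P.P2.B_0[OF z0_points(1)] base2 frame2 ident2 Q2.pi.pull_section
        Q2.frame_linear_section[OF U2 W2 \<rho>2] Q2.ident_linear_section)
  have d_P2: "d (P.P2.pull t) = 0" if t: "t \<in> sections Q2.JL" for t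
  proof -
    note pt = P.P2.pull_section[OF t]
    have "(\<lambda>(x1, x2, C) l. C l) z0 (d (P.P2.pull t)) = 0" using fun_cong[OF dm2, of t] by (simp only: P.P2.dmap_at[OF t])
    then show ?thesis
      using P.P2.B_inj[OF z0_points(1) P.P1.L1.derivationsD(1)[OF d pt] subspace_0[OF P.P1.L1.fibre_subspace[OF z0_points(1)]]]
        P.P2.B_0[OF z0_points(1)] by simp
  qed
  \<comment> \<open>As \<open>d\<close> kills all pullbacks from the second factor and all base
    sections of the first, a linear generator that it annihilates leaves only the linear section on
    the first factor.\<close>
  have lin1: "d (P.P1.pull (linear_section L1 X)) = 0" if XZ: "linear_pair X Z" and 0: "d (gen2 s X Z) = 0" for X Z
  proof -
    note g = gen2_sections[OF s XZ] and l = linear_pairD[OF XZ]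
    note Xs = Q1.derivations_fieldD(1)[OF l(1) F.pull_section[OF s]]
    have "d (P.P1.pull (Q1.vanishing_section (F.pull s) X)) = 0"
      using 0 d_pair[OF g(1,2)] d_P2[OF g(2)] by (simp add: gen2_def)
    then have "d (\<lambda>y. P.P1.pull (linear_section L1 X) y - P.P1.pull (Q1.pi.pull (X (F.pull s))) y) = 0"
      unfolding Q1.vanishing_section_def P.P1.pull_diff[OF l(2) Q1.pi.pull_section[OF Xs]] .
    then show ?thesis
      using P.P1.L1.derivations_minus(2)[OF d P.P1.pull_section[OF l(2)] P.P1.pull_section[OF Q1.pi.pull_section[OF Xs]]]
        base1[OF Xs] by simp
  qed
  have ident1: "d (P.P1.pull (linear_section L1 Q1.ident_field)) = 0"
    using unit restriction_zero[OF gen2_sections(3)[OF s linear_pair_ident] gen2_ident_lift[OF _ _ s] a']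
    by (intro lin1[OF linear_pair_ident]) (simp add: d_at[OF gen2_sections(3)[OF s linear_pair_ident]])
  have frame1: "d (P.P1.pull (linear_section L1 (Q1.frame_field U1 \<phi>1 W1 \<tau>1 \<rho>1 w))) = 0" for w
    using frame[of w] restricted_gen2_frame[OF a', of w]
    by (intro lin1[OF frame_pair[of w], unfolded frame1_def[of w]]) (simp add: d_at[OF gen2_sections(3)[OF s frame_pair]] frame1_def[symmetric])
  have "P.P1.dmap z0 d \<in> derivations_at Q1.JL (q, \<alpha>0)"
    using P.P1.dmap_derivation[OF z0_points(1) d] by (simp add: lift_def)
  then have dm1: "P.P1.dmap z0 d = (\<lambda>_. 0)"
    by (rule Q1.jet_derivation_zero[OF z0_points(3) U1 W1 \<rho>1])
      (simp_all add: P.P1.dmap_at base1 frame1 ident1 Q1.pi.pull_section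
        Q1.frame_linear_section[OF U1 W1 \<rho>1] Q1.ident_linear_section)
  have d_P1: "d (P.P1.pull t) = 0" if t: "t \<in> sections Q1.JL" for t
    using fun_cong[OF dm1, of t] by (simp only: P.P1.dmap_at[OF t])
  have "d = (\<lambda>_. 0)" by (rule P.product_derivation_zero[OF z0_points(1) d d_P1 d_P2])
  then have "a = I.dmap z0 a'" unfolding d_def by (auto simp: fun_eq_iff)
  then show ?thesis using a' by blast
qed

section \<open>Brackets of the generators at the point\<close>

lemma br_gen1_gen1:
  assumes t: "t \<in> sections L2" "t' \<in> sections L2" shows "br (gen1 t) (gen1 t') z0 = 0"
  unfolding gen1_def
  by (rule br_pair_lift_zero[OF q_points \<beta>0_jet gen1_sections(1)[OF t(1)] gen1_sections(1)[OF t(2)] gen1_sections(2)[OF t(1)] gen1_sections(2)[OF t(2)]])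
    (simp add: Q1.br_base_base F.pull_section t Q2.br_base_base F.B_0[OF q_points])

text \<open>On the first factor the bracket is minus \<open>X\<close> applied to the pullback of
  \<open>t\<close>, on the second minus \<open>Z\<close> applied to \<open>t\<close>. These
  correspond under \<open>B q\<close> because \<open>Z\<close> is the image of \<open>X\<close> at
  this point.\<close>

lemma br_gen1_gen2:
  assumes t: "t \<in> sections L2" and XZ: "linear_pair X Z" and rel: "(\<lambda>s. Z s (b q)) = F.dmap q (\<lambda>s. X s q)"
  shows "br (gen1 t) (gen2 s X Z) z0 = 0" "br (gen2 s X Z) (gen1 t) z0 = 0"
proof -
  note l = linear_pairD[OF XZ] and g1 = gen1_sections[OF t] and g2 = gen2_sections[OF s XZ]
  note Ft = F.pull_section[OF t]
  note Xt = Q1.derivations_fieldD(1)[OF l(1) Ft] and Zt = Q2.derivations_fieldD(1)[OF l(3) t]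
  have "B q (X (F.pull t) q) = Z t (b q)" using fun_cong[OF rel, of t] by (simp add: F.dmap_at[OF t])
  then have "B q (br1 (Q1.pi.pull (F.pull t)) (Q1.vanishing_section (F.pull s) X) (q, \<alpha>0)) =
      br2 (Q2.pi.pull t) (Q2.vanishing_section s Z) (b q, \<beta>0)"
    unfolding Q1.br_base_vanishing[OF F.pull_section[OF s] Ft l(1,2)] Q2.br_base_vanishing[OF s t l(3,4)]
      Q1.base_section_at[OF z0_points(3) Xt] Q2.base_section_at[OF z0_points(4) Zt]
    by (simp add: F.B_minus[OF q_points Q1.sectionsD(1)[OF Xt q_points]])
  then show "br (gen1 t) (gen2 s X Z) z0 = 0"
    unfolding gen1_def gen2_def by (rule br_pair_lift_zero[OF q_points \<beta>0_jet g1(1) g2(1) g1(2) g2(2)])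
  then show "br (gen2 s X Z) (gen1 t) z0 = 0" using J.br_antisym[OF g2(3) g1(3), of z0] by simp
qed

text \<open>Both jets at the point are jets of sections, the second of \<open>s\<close> and the
  first of its pullback, so \<open>br_vanishing\<close> applies on either factor.\<close>

lemma br_gen2_gen2:
  assumes XZ: "linear_pair X Z" and XZ': "linear_pair X' Z'"
  shows "br (gen2 s X Z) (gen2 s X' Z') z0 = 0"
proof -
  note l = linear_pairD[OF XZ] and l' = linear_pairD[OF XZ']
  have "br1 (Q1.vanishing_section (F.pull s) X) (Q1.vanishing_section (F.pull s) X') (q, \<alpha>0) = 0"
    unfolding \<alpha>0_eq by (rule Q1.br_vanishing[OF F.pull_section[OF s] l(1,2) l'(1,2) z0_points(3)[unfolded \<alpha>0_eq]])
  moreover have "br2 (Q2.vanishing_section s Z) (Q2.vanishing_section s Z') (b q, \<beta>0) = 0"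
    by (rule Q2.br_vanishing[OF s l(3,4) l'(3,4) z0_points(4)])
  ultimately show ?thesis
    unfolding gen2_def
    by (intro br_pair_lift_zero[OF q_points \<beta>0_jet gen2_sections(1)[OF s XZ] gen2_sections(1)[OF s XZ']
          gen2_sections(2)[OF s XZ] gen2_sections(2)[OF s XZ']]) (simp add: F.B_0[OF q_points])
qed

text \<open>It suffices to compare on pullbacks from the factors, and there
  \<open>unit_hamiltonian\<close> applies on either side.\<close>

lemma ham_der_unit: "ham_der P.LP br (gen2 s Q1.ident_field Q2.ident_field) z0 = eval_der P.LP z0"
proof -
  let ?V = "gen2 s Q1.ident_field Q2.ident_field"
  let ?v1 = "Q1.vanishing_section (F.pull s) Q1.ident_field" and ?v2 = "Q2.vanishing_section s Q2.ident_field"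
  note g = gen2_sections[OF s linear_pair_ident]
  let ?d = "\<lambda>r. ham_der P.LP br ?V z0 r - eval_der P.LP z0 r"
  have "?d = (\<lambda>_. 0)"
  proof (rule P.product_derivation_zero[OF z0_points(1)])
    show "?d \<in> derivations_at P.LP z0"
      by (rule P.P1.L1.derivations_at_diff[OF z0_points(1) J.ham_der_derivation[OF z0_points(1) g(3)] P.P1.L1.eval_der_derivation[OF z0_points(1)]])
    show "?d (P.P1.pull u) = 0" if u: "u \<in> sections Q1.JL" for u
    proof -
      have "br1 ?v1 u (q, \<alpha>0) = u (q, \<alpha>0)"
        using fun_cong[OF Q1.unit_hamiltonian[OF F.pull_section[OF s] z0_points(3)[unfolded \<alpha>0_eq]], of u] u
        by (simp add: \<alpha>0_eq ham_der_def eval_der_def)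
      then show ?thesis
        using br_pair_P1[OF g(1,2) u] P.P1.pull_section[OF u]
        by (simp add: J.ham_der_at eval_der_def gen2_def P1_pull_lift[OF q_points \<beta>0_jet] u Q1.J.br_section[OF g(1) u])
    qed
    show "?d (P.P2.pull u) = 0" if u: "u \<in> sections Q2.JL" for u
    proof -
      have "br2 ?v2 u (b q, \<beta>0) = u (b q, \<beta>0)"
        using fun_cong[OF Q2.unit_hamiltonian[OF s z0_points(4)], of u] u by (simp add: ham_der_def eval_der_def)
      then have "P.P2.pull (br2 ?v2 u) z0 = P.P2.pull u z0"
        unfolding P.P2.pull_at[OF z0_points(1)] by (simp add: lift_def)
      then show ?thesis
        using br_pair_P2[OF g(1,2) u] P.P2.pull_section[OF u] by (simp add: J.ham_der_at eval_der_def gen2_def)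
    qed
  qed
  then show ?thesis by (auto simp: fun_eq_iff)
qed

definition generators where "generators =
  gen1 ` sections L2 \<union> {gen2 s Q1.ident_field Q2.ident_field} \<union> range (\<lambda>w. gen2 s (frame1 w) (frame2 w))"

lemma generators_cases:
  assumes "V \<in> generators"
  obtains (base) t where "t \<in> sections L2" "V = gen1 t"
    | (linear) X Z where "linear_pair X Z" "(\<lambda>s. Z s (b q)) = F.dmap q (\<lambda>s. X s q)" "V = gen2 s X Z"
proof -
  have "(\<lambda>s. Q2.ident_field s (b q)) = F.dmap q (\<lambda>s. Q1.ident_field s q)"
    by (simp add: Q1.ident_field_at Q2.ident_field_at F.dmap_eval[OF q_points])
  then show thesis
    using assms base linear[OF linear_pair_ident] linear[OF frame_pair frame_related] unfolding generators_def by blast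
qed

lemma generators_section: "V \<in> generators \<Longrightarrow> V \<in> sections P.LP"
  by (erule generators_cases) (simp_all add: gen1_sections gen2_sections s)

lemma generators_br:
  assumes "V \<in> generators" "V' \<in> generators" shows "br V V' z0 = 0"
  using assms(1)
proof (cases V rule: generators_cases)
  case (base t)
  show ?thesis using assms(2) by (cases V' rule: generators_cases) (simp_all add: base br_gen1_gen1 br_gen1_gen2)
next
  case (linear X Z)
  show ?thesis using assms(2) by (cases V' rule: generators_cases) (simp_all add: linear br_gen1_gen2 br_gen2_gen2)
qed

lemma generators_restricted:
  assumes V: "V \<in> generators" and a: "a \<in> derivations_at LS z0" shows "a (I.pull V) = 0"
proof -
  note sec = generators_section[OF V]
  consider t where "t \<in> sections L2" "V = gen1 t" | "V = gen2 s Q1.ident_field Q2.ident_field" | w where "V = gen2 s (frame1 w) (frame2 w)"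
    using V unfolding generators_def by blast
  then show ?thesis
  proof cases
    case 1
    then show ?thesis using restriction_zero[OF sec _ a] gen1_lift by simp
  next
    case 2
    then show ?thesis using restriction_zero[OF sec _ a] gen2_ident_lift s by simp
  qed (simp add: restricted_gen2_frame[OF a])
qed

text \<open>Collects what the two final arguments use, in a form that no longer mentions charts,
  cut-off functions or the section \<open>s\<close>.\<close>

lemma generators_exist: "\<exists>\<V>. \<V> \<subseteq> sections P.LP \<and> (\<forall>V\<in>\<V>. \<forall>V'\<in>\<V>. br V V' z0 = 0) \<and>
  (\<forall>a\<in>derivations_at LS z0. \<forall>V\<in>\<V>. a (I.pull V) = 0) \<and>
  (\<forall>a\<in>derivations_at P.LP z0. (\<forall>V\<in>\<V>. a V = 0) \<longrightarrow> a \<in> I.dmap z0 ` derivations_at LS z0) \<and>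
  (\<exists>V\<in>\<V>. ham_der P.LP br V z0 = eval_der P.LP z0)"
proof (intro exI[of _ generators] conjI ballI impI)
  show "generators \<subseteq> sections P.LP" using generators_section by blast
  show "br V V' z0 = 0" if "V \<in> generators" "V' \<in> generators" for V V' by (rule generators_br[OF that])
  show "a (I.pull V) = 0" if "a \<in> derivations_at LS z0" "V \<in> generators" for a V by (rule generators_restricted[OF that(2,1)])
  show "a \<in> I.dmap z0 ` derivations_at LS z0" if "a \<in> derivations_at P.LP z0" "\<forall>V\<in>generators. a V = 0" for a
    by (rule gen_restricted[OF that(1)]) (use that(2) in \<open>auto simp: generators_def\<close>)
  show "\<exists>V\<in>generators. ham_der P.LP br V z0 = eval_der P.LP z0"
    using ham_der_unit by (auto simp: generators_def)
qed

end

text \<open>The jet \<beta> is realised by a section that is affine in the chosen coordinates, as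
  the construction of the generators requires.\<close>

lemma generatorsE:
  assumes z: "z \<in> S"
  obtains \<V> V0 where "\<V> \<subseteq> sections P.LP" "\<forall>V\<in>\<V>. \<forall>V'\<in>\<V>. br V V' z = 0"
    "\<forall>a\<in>derivations_at LS z. \<forall>V\<in>\<V>. a (I.pull V) = 0"
    "\<forall>a\<in>derivations_at P.LP z. (\<forall>V\<in>\<V>. a V = 0) \<longrightarrow> a \<in> I.dmap z ` derivations_at LS z"
    "V0 \<in> \<V>" "ham_der P.LP br V0 z = eval_der P.LP z"
proof -
  obtain q \<beta> where q: "q \<in> points (base L1)" "\<beta> \<in> jets_at L2 (b q)" "z = lift q \<beta>" using z S_iff by blast
  obtain U1 \<phi>1 where U1: "(U1, \<phi>1) \<in> base L1" "q \<in> U1" using pointsE[OF q(1)] .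
  obtain W1 \<tau>1 where W1: "(W1, \<tau>1) \<in> trivs L1" "q \<in> W1" using Q1.trivE[OF q(1)] .
  obtain U2 \<phi>2 where U2: "(U2, \<phi>2) \<in> base L2" "b q \<in> U2" using pointsE[OF F.b_points[OF q(1)]] .
  obtain W2 \<tau>2 where W2: "(W2, \<tau>2) \<in> trivs L2" "b q \<in> W2" using Q2.trivE[OF F.b_points[OF q(1)]] .
  obtain \<rho>1 where \<rho>1: "bump (base L1) q (U1 \<inter> W1) \<rho>1"
    using bump_exists[OF Q1.hmfd Q1.coord_open[OF U1 W1]] U1 W1 by blast
  obtain \<rho>2 where \<rho>2: "bump (base L2) (b q) (U2 \<inter> W2) \<rho>2"
    using bump_exists[OF Q2.hmfd Q2.coord_open[OF U2 W2]] U2 W2 by blast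
  let ?p = "Q2.momentum U2 \<phi>2 \<tau>2 (b q) \<beta>" and ?u = "\<tau>2 (b q) (\<beta> (eval_der L2 (b q)))"
  obtain s N where s: "s \<in> sections L2" and N: "aopen (base L2) N" "b q \<in> N" "N \<subseteq> U2 \<inter> W2"
    and aff: "\<And>y. y \<in> N \<Longrightarrow> \<tau>2 y (s y) = ?u + ?p \<bullet> (\<phi>2 y - \<phi>2 (b q))" and su: "\<tau>2 (b q) (s (b q)) = ?u"
    and sp: "\<And>v. section_deriv U2 \<phi>2 \<tau>2 s (b q) v = ?p \<bullet> v"
    using Q2.section_with_jet[OF U2 W2, where u = ?u and p = ?p] by blast
  note j = Q2.jet_of_section_coords[OF U2 W2 s] and js = Q2.jet_in_jets[OF F.b_points[OF q(1)] s]
  have "jet L2 s (b q) = \<beta>"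
    by (rule Q2.jet_eqI[OF U2 W2 js q(2) Q2.momentum_eqI[OF U2 W2 js]]) (simp_all add: j su sp)
  then have "z = lift q (jet L2 s (b q))" using q(3) by simp
  with generators_exist[OF U1 W1 U2 W2 \<rho>1 \<rho>2 s N aff] that show thesis by blast
qed

section \<open>Coisotropy and isotropy of the jet lift\<close>

lemma restricted_derivations: "restricted_derivations_at P.LP G.SA z = I.dmap z ` derivations_at LS z"
  by (simp add: restricted_derivations_at_def Let_def)

lemma S_points:
  assumes "z \<in> S" shows "z \<in> points (base P.LP)"
proof -
  obtain q \<beta> where q: "q \<in> points (base L1)" "\<beta> \<in> jets_at L2 (b q)" "z = lift q \<beta>" using assms S_iff by blast
  show ?thesis unfolding q(3) by (rule lift_points(1)[OF q(1,2)])
qed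

theorem coisotropic_jet_lift: "coisotropic P.LP br G.SA"
  unfolding coisotropic_def restricted_derivations G.SA_points
proof (intro ballI subsetI, elim imageE)
  fix z a \<eta> assume zS: "z \<in> S" and a: "a = Pi_sharp P.LP br z \<eta>"
    and \<eta>: "\<eta> \<in> {\<alpha> \<in> jets_at P.LP z. \<forall>a\<in>I.dmap z ` derivations_at LS z. \<alpha> a = 0}"
  note z = S_points[OF zS]
  obtain \<V> V0 where V: "\<V> \<subseteq> sections P.LP" "\<forall>V\<in>\<V>. \<forall>V'\<in>\<V>. br V V' z = 0"
    "\<forall>a\<in>derivations_at LS z. \<forall>V\<in>\<V>. a (I.pull V) = 0"
    "\<forall>a\<in>derivations_at P.LP z. (\<forall>V\<in>\<V>. a V = 0) \<longrightarrow> a \<in> I.dmap z ` derivations_at LS z"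
    "V0 \<in> \<V>" "ham_der P.LP br V0 z = eval_der P.LP z"
    using generatorsE[OF zS] .
  obtain r where r: "r \<in> sections P.LP" "jet P.LP r z = \<eta>" using P.P1.L1.jet_surj'[OF z] \<eta> by blast
  have ham: "a = ham_der P.LP br r z" using J.Pi_sharp_jet[OF z r(1)] a r(2) by simp
  have "a V = 0" if Vin: "V \<in> \<V>" for V
  proof -
    have Vs: "V \<in> sections P.LP" using V(1) Vin by blast
    note hV = J.ham_der_derivation[OF z Vs]
    have "ham_der P.LP br V z \<in> I.dmap z ` derivations_at LS z"
      using V(1,2,4) hV Vin by (auto simp: J.ham_der_at subset_iff)
    then have "\<eta> (ham_der P.LP br V z) = 0" using \<eta> by blast
    \<comment> \<open>As \<eta> is the jet of \<open>r\<close>, its value on the Hamiltonian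
      derivation of \<open>V\<close> is the bracket of \<open>V\<close> and \<open>r\<close> at
      \<open>z\<close>.\<close>
    then have "br V r z = 0" using hV r(1) unfolding r(2)[symmetric] by (simp add: jet_def J.ham_der_at)
    then show ?thesis using J.br_antisym[OF r(1) Vs, of z] by (simp add: ham J.ham_der_at[OF Vs])
  qed
  then show "a \<in> I.dmap z ` derivations_at LS z" using V(4) J.ham_der_derivation[OF z r(1)] ham by blast
qed

theorem isotropic_jet_lift: "isotropic P.LP br G.SA"
  unfolding isotropic_def G.SA_points
proof (intro ballI subsetI, elim imageE)
  fix z Y X assume zS: "z \<in> S" and Y: "Y = tangent_map G.SA (base P.LP) (\<lambda>x. x) X" and X: "X \<in> tangent_space G.SA z"
  note z = S_points[OF zS]
  have zLS: "z \<in> points (base LS)" using zS by (simp add: G.SA_points)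
  obtain \<V> V0 where V: "\<V> \<subseteq> sections P.LP" "\<forall>V\<in>\<V>. \<forall>V'\<in>\<V>. br V V' z = 0"
    "\<forall>a\<in>derivations_at LS z. \<forall>V\<in>\<V>. a (I.pull V) = 0"
    "\<forall>a\<in>derivations_at P.LP z. (\<forall>V\<in>\<V>. a V = 0) \<longrightarrow> a \<in> I.dmap z ` derivations_at LS z"
    "V0 \<in> \<V>" "ham_der P.LP br V0 z = eval_der P.LP z"
    using generatorsE[OF zS] .
  have V0: "V0 \<in> sections P.LP" using V(1,5) by blast
  \<comment> \<open>Isotropy concerns tangent vectors, whereas the generators are tested by
    derivations; so \<open>X\<close> is lifted to a derivation with symbol \<open>X\<close>.\<close>
  obtain a where a: "a \<in> derivations_at LS z" "I.L1.is_symbol z a X"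
    using I.L1.derivation_with_symbol[OF zLS] X by auto
  have "P.P1.L1.is_symbol z (I.dmap z a) Y" using I.dmap_symbol[OF zLS a(2,1)] by (simp add: Y)
  then have sym: "symbol P.LP z (I.dmap z a) = Y" by (rule P.P1.L1.symbol_eq[OF z])
  obtain r where r: "r \<in> sections P.LP" "I.dmap z a = ham_der P.LP br r z"
    using LP_full_hamiltonian z I.dmap_derivation[OF zLS a(1)] unfolding full_hamiltonian_def by blast
  have "br r V0 z = a (I.pull V0)"
    using fun_cong[OF r(2), of V0] by (simp add: J.ham_der_at[OF V0] I.dmap_at[OF V0])
  then have "br V0 r z = 0" using V(3,5) a(1) J.br_antisym[OF V0 r(1), of z] by simp
  then have "r z = 0" using fun_cong[OF V(6), of r] r(1) by (simp add: J.ham_der_at eval_der_def)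
  \<comment> \<open>\<open>Y\<close> is now the symbol of the Hamiltonian derivation of a section
    that vanishes at \<open>z\<close>.\<close>
  then show "Y \<in> contact_hyperplane P.LP br z"
    using J.contact_hyperplaneI[OF z r(1)] by (simp add: r(2)[symmetric] sym)
qed

theorem legendrian_jet_lift: "legendrian_submanifold P.LP br G.SA"
  unfolding legendrian_submanifold_def
  by (intro conjI J.nondegenerateI[OF LP_full_hamiltonian] embedded isotropic_jet_lift coisotropic_jet_lift)

end

theorem proposition4p3p3:
  fixes L1 :: "('q1, 'e1::finite_dim_inner, 'v1::real_vector) line_bundle"
    and L2 :: "('q2, 'e2::finite_dim_inner, 'v2::real_vector) line_bundle"
    and b :: "'q1 \<Rightarrow> 'q2" and B :: "'q1 \<Rightarrow> 'v1 \<Rightarrow> 'v2"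
  assumes "line_bundle L1" and "line_bundle L2"
    and "factor L1 L2 b B"
    and "canonical_jacobi_structure L1 br1"
    and "canonical_jacobi_structure L2 br2"
    and "product_jacobi_structure (jet_line_bundle L1) br1 (jet_line_bundle L2) (op_bracket br2) br"
  shows "\<exists>S :: (_, 'e1 \<times> 'e2 \<times> real) atlas.
    points S = jet_lift L1 L2 b B \<and>
    legendrian_submanifold (line_product (jet_line_bundle L1) (jet_line_bundle L2)) br S"
proof -
  have L: "hline_bundle L1" "hline_bundle L2" using assms(1,2) by (auto intro: line_bundle_imp_hline_bundle)
  have "second_countable (atlas_topology (base L1))" using assms(1) by (simp add: line_bundle_def manifold_def)
  then interpret jet_lift_setup L1 br1 L2 br2 b B br
    using L assms factor_imp_hfactor[OF L]
    by (intro jet_lift_setup.intro canonical_jacobi.intro jet_bundle.intro hbundle.intro canonical_jacobi_axioms.intro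
        bundle_factor.intro bundle_factor_axioms.intro jet_lift_setup_axioms.intro)
  show ?thesis using legendrian_jet_lift G.SA_points by blast
qed

end
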